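(* Let $k$ be a perfect field of characteristic zero. There do not exist Nisnevich sheaves of abelian groups $\mathcal{P}$ and $\mathcal{A}$ on $Sm_k$ which are strongly $\mathbb{A}^1$-invariant and whose evaluations on fields recover the functors $F\mapsto \mathcal{P}(F)$ (the pre-Bloch group) and $F\mapsto \mathcal{A}(F)=\wedge^2_{\mathbb{Z}}F^*$ on $\mathcal{F}_k$, together with maps of pointed sheaves $\mathbb{G}_m\to\mathcal{P}$ and $\mathbb{G}_m^{\wedge 2}\to\mathcal{A}$ (the targets being pointed by $0$) that restrict on fields $F\in\mathcal{F}_k$ to the canonical symbol maps $z\mapsto\{z\}$ for $z\neq 1$, $1\mapsto 0$, and $(x,y)\mapsto x\wedge y$, respectively.
   Context: $Sm_k$ is the category of smooth, separated schemes of finite type over $k$, with the Nisnevich topology. $\mathcal{F}_k$ is the category of field extensions of $k$ of finite transcendence degree. A sheaf $M$ on $Sm_k$ is evaluated on $F\in\mathcal{F}_k$ in the usual way: if $F$ is the function field of an irreducible $X\in Sm_k$, then $M(F)=\varinjlim_{U\subset X}M(U)$ over nonempty open subschemes $U$, and in general $M(F)$ is the filtered colimit of $M(F')$ over finitely generated subextensions $F'\subset F$. A Nisnevich sheaf of abelian groups $G$ on $Sm_k$ is strongly $\mathbb{A}^1$-invariant if for every $X\in Sm_k$ the projection $\mathbb{A}^1\times X\to X$ induces isomorphisms $H^i_{\mathrm{Nis}}(X;G)\to H^i_{\mathrm{Nis}}(\mathbb{A}^1\times X;G)$ for $i=0,1$. $\mathbb{G}_m^{\wedge n}$ is the Nisnevich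 sheaf of pointed sets on $Sm_k$ sending an irreducible $X$ to the $n$-fold smash product $(\mathcal{O}(X)^* )^{\wedge n}$ of the set $\mathcal{O}(X)^*$ pointed by $1$. For a field $F$, write $F^{**}=F^*\setminus\{1\}$. The pre-Bloch group $\mathcal{P}(F)$ is the quotient of the free abelian group $\mathbb{Z}[F^{**}]$ on symbols $\{x\}$, $x\in F^{**}$, by the subgroup generated by $$\{x\}-\{y\}+\Big\{\frac{y}{x}\Big\}+\Big\{\frac{1-x}{1-y}\Big\}-\Big\{\frac{y(1-x)}{x(1-y)}\Big\},\qquad x,y\in F^{**},\ x\neq y.$$ $\wedge^2_{\mathbb{Z}}F^*$ is the quotient of $F^*\otimes_{\mathbb{Z}}F^*$ by the subgroup generated by $x\otimes y+y\otimes x$ for $x,y\in F^*$; the class of $x\otimes y$ is $x\wedge y$. Both are functors from $\mathcal{F}_k$ to abelian groups in the evident way. *)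

theory Defs
  imports "HOL-Computational_Algebra.Primes" "HOL-Algebra.UnivPoly" "HOL-Algebra.Finite_Extensions"
    "HOL-Algebra.Generated_Fields" "HOL-Algebra.Generated_Rings" "HOL-Algebra.Free_Abelian_Groups"
    "HOL-Analysis.Abstract_Topology_2"
begin

(* the notation makes X unusable as a variable *)
no_notation var (\<open>X\<index>\<close>)

text \<open>
  One type \<open>'u\<close> serves as the universe: the base field, its extensions, the points of schemes and
  the sections of structure sheaves are all elements of \<open>'u\<close>.  The base field has characteristic
  zero, hence is infinite, and it has its carrier in \<open>'u\<close>; a scheme of finite type over \<open>k\<close> has at
  most \<open>card k\<close> points and at most \<open>card k\<close> sections over each open set, and an extension of finite
  transcendence degree has cardinality \<open>card k\<close>.  So every object of \<open>Sm\<^sub>k\<close> and of \<open>F\<^sub>k\<close>, as well as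
  the products and the test algebras used below, occurs in \<open>'u\<close> up to isomorphism.
\<close>

section \<open>Commutative algebra\<close>

definition char_zero :: "'u ring \<Rightarrow> bool" where
  "char_zero k \<longleftrightarrow> (\<forall>n::nat. n > 0 \<longrightarrow> add_pow k n \<one>\<^bsub>k\<^esub> \<noteq> \<zero>\<^bsub>k\<^esub>)"

definition perfect_field :: "'u ring \<Rightarrow> bool" where
  "perfect_field k \<longleftrightarrow> field k \<and>
     (\<forall>p::nat. normalization_semidom_class.prime p \<and> add_pow k p \<one>\<^bsub>k\<^esub> = \<zero>\<^bsub>k\<^esub> \<longrightarrow>
        (\<forall>x\<in>carrier k. \<exists>y\<in>carrier k. y [^]\<^bsub>k\<^esub> p = x))"

text \<open>The ring homomorphism \<open>\<phi>\<close> exhibits \<open>B\<close> as the localization of \<open>A\<close> at the powers of \<open>f\<close>.\<close>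

definition is_localization :: "'u ring \<Rightarrow> 'u \<Rightarrow> 'u ring \<Rightarrow> ('u \<Rightarrow> 'u) \<Rightarrow> bool" where
  "is_localization A f B \<phi> \<longleftrightarrow>
     \<phi> \<in> ring_hom A B \<and> \<phi> f \<in> Units B \<and>
     (\<forall>b\<in>carrier B. \<exists>a\<in>carrier A. \<exists>n::nat. b \<otimes>\<^bsub>B\<^esub> (\<phi> f [^]\<^bsub>B\<^esub> n) = \<phi> a) \<and>
     (\<forall>a\<in>carrier A. \<phi> a = \<zero>\<^bsub>B\<^esub> \<longrightarrow> (\<exists>n::nat. (f [^]\<^bsub>A\<^esub> n) \<otimes>\<^bsub>A\<^esub> a = \<zero>\<^bsub>A\<^esub>))"

definition finite_type_hom :: "'u ring \<Rightarrow> 'u ring \<Rightarrow> ('u \<Rightarrow> 'u) \<Rightarrow> bool" where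
  "finite_type_hom A B \<phi> \<longleftrightarrow>
     \<phi> \<in> ring_hom A B \<and>
     (\<exists>S. finite S \<and> S \<subseteq> carrier B \<and> generate_ring B (\<phi> ` carrier A \<union> S) = carrier B)"

text \<open>The \<open>A\<close>-algebra homomorphisms \<open>B \<rightarrow> C\<close> lifting \<open>h : B \<rightarrow> C/I\<close>, where \<open>C\<close> is an \<open>A\<close>-algebra
  via \<open>g\<close>.\<close>

definition lifts ::
  "'u ring \<Rightarrow> 'u ring \<Rightarrow> ('u \<Rightarrow> 'u) \<Rightarrow> 'u ring \<Rightarrow> 'u set \<Rightarrow> ('u \<Rightarrow> 'u) \<Rightarrow> ('u \<Rightarrow> 'u set) \<Rightarrow> ('u \<Rightarrow> 'u) set"
  where
  "lifts A B \<phi> C I g h =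
     {l \<in> ring_hom B C \<inter> extensional (carrier B).
        (\<forall>a\<in>carrier A. l (\<phi> a) = g a) \<and> (\<forall>b\<in>carrier B. I +>\<^bsub>C\<^esub> l b = h b)}"

definition square_zero_problem ::
  "'u ring \<Rightarrow> 'u ring \<Rightarrow> ('u \<Rightarrow> 'u) \<Rightarrow> 'u ring \<Rightarrow> 'u set \<Rightarrow> ('u \<Rightarrow> 'u) \<Rightarrow> ('u \<Rightarrow> 'u set) \<Rightarrow> bool" where
  "square_zero_problem A B \<phi> C I g h \<longleftrightarrow>
     cring C \<and> ideal I C \<and> (\<forall>a\<in>I. \<forall>b\<in>I. a \<otimes>\<^bsub>C\<^esub> b = \<zero>\<^bsub>C\<^esub>) \<and>
     g \<in> ring_hom A C \<and> h \<in> ring_hom B (C Quot I) \<and>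
     (\<forall>a\<in>carrier A. h (\<phi> a) = I +>\<^bsub>C\<^esub> g a)"

definition formally_smooth :: "'u ring \<Rightarrow> 'u ring \<Rightarrow> ('u \<Rightarrow> 'u) \<Rightarrow> bool" where
  "formally_smooth A B \<phi> \<longleftrightarrow>
     (\<forall>C I g h. square_zero_problem A B \<phi> C I g h \<longrightarrow> (\<exists>l. l \<in> lifts A B \<phi> C I g h))"

definition formally_etale :: "'u ring \<Rightarrow> 'u ring \<Rightarrow> ('u \<Rightarrow> 'u) \<Rightarrow> bool" where
  "formally_etale A B \<phi> \<longleftrightarrow>
     (\<forall>C I g h. square_zero_problem A B \<phi> C I g h \<longrightarrow> (\<exists>!l. l \<in> lifts A B \<phi> C I g h))"

definition spec_topology :: "'u ring \<Rightarrow> 'u set topology" where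
  "spec_topology A =
     topology_generated_by ((\<lambda>f. {p. primeideal p A \<and> f \<notin> p}) ` carrier A)"


section \<open>Schemes over a field\<close>

text \<open>
  A \<open>k\<close>-scheme is a scheme \<open>X\<close> with a ring homomorphism \<open>k \<rightarrow> \<Gamma>(X, O\<^sub>X)\<close>, which amounts to a
  morphism \<open>X \<rightarrow> Spec k\<close>.  For open sets \<open>V \<subseteq> U\<close>, \<open>res X U V\<close> is the restriction from \<open>U\<close> to \<open>V\<close>.
\<close>

record 'u sch =
  sp :: "'u topology"
  sec :: "'u set \<Rightarrow> 'u ring"
  res :: "'u set \<Rightarrow> 'u set \<Rightarrow> 'u \<Rightarrow> 'u"
  str :: "'u \<Rightarrow> 'u"

abbreviation pts :: "'u sch \<Rightarrow> 'u set" where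
  "pts X \<equiv> topspace (sp X)"

abbreviation opn :: "'u sch \<Rightarrow> 'u set \<Rightarrow> bool" where
  "opn X U \<equiv> openin (sp X) U"

abbreviation glob :: "'u sch \<Rightarrow> 'u ring" where
  "glob X \<equiv> sec X (pts X)"

definition ringed_space :: "'u sch \<Rightarrow> bool" where
  "ringed_space X \<longleftrightarrow>
     (\<forall>U. opn X U \<longrightarrow> cring (sec X U)) \<and>
     (\<forall>U V. opn X U \<and> opn X V \<and> V \<subseteq> U \<longrightarrow> res X U V \<in> ring_hom (sec X U) (sec X V)) \<and>
     (\<forall>U s. opn X U \<and> s \<in> carrier (sec X U) \<longrightarrow> res X U U s = s) \<and>
     (\<forall>U V W s. opn X U \<and> opn X V \<and> opn X W \<and> W \<subseteq> V \<and> V \<subseteq> U \<and> s \<in> carrier (sec X U) \<longrightarrow>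
        res X V W (res X U V s) = res X U W s) \<and>
     (\<forall>\<U> s. (\<forall>U\<in>\<U>. opn X U \<and> s U \<in> carrier (sec X U)) \<and>
        (\<forall>U\<in>\<U>. \<forall>V\<in>\<U>. res X U (U \<inter> V) (s U) = res X V (U \<inter> V) (s V)) \<longrightarrow>
        (\<exists>!t. t \<in> carrier (sec X (\<Union>\<U>)) \<and> (\<forall>U\<in>\<U>. res X (\<Union>\<U>) U t = s U)))"

definition open_sub :: "'u sch \<Rightarrow> 'u set \<Rightarrow> 'u sch" where
  "open_sub X U =
     \<lparr>sp = subtopology (sp X) U, sec = sec X, res = res X, str = (\<lambda>c. res X (pts X) U (str X c))\<rparr>"

text \<open>
  \<open>X\<close> is isomorphic to \<open>Spec A\<close> for \<open>A = \<Gamma>(X, O\<^sub>X)\<close>: the structure sheaf of \<open>Spec A\<close> is the sheaf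
  whose sections over the basic open set \<open>D(f)\<close> are the localization of \<open>A\<close> at the powers of \<open>f\<close>.
\<close>

definition affine :: "'u sch \<Rightarrow> bool" where
  "affine X \<longleftrightarrow> ringed_space X \<and>
     (\<exists>h. homeomorphic_map (sp X) (spec_topology (glob X)) h \<and>
        (\<forall>f\<in>carrier (glob X).
           is_localization (glob X) f (sec X {x\<in>pts X. f \<notin> h x}) (res X (pts X) {x\<in>pts X. f \<notin> h x})))"

definition affine_open :: "'u sch \<Rightarrow> 'u set \<Rightarrow> bool" where
  "affine_open X U \<longleftrightarrow> opn X U \<and> affine (open_sub X U)"

definition kscheme :: "'u ring \<Rightarrow> 'u sch \<Rightarrow> bool" where
  "kscheme k X \<longleftrightarrow> ringed_space X \<and> (\<forall>x\<in>pts X. \<exists>U. x \<in> U \<and> affine_open X U) \<and>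
     str X \<in> ring_hom k (glob X)"

text \<open>The germ at \<open>x\<close> of the section \<open>s\<close> over \<open>U\<close> lies in the maximal ideal of the local ring at \<open>x\<close>,
  that is, it is not a unit of the stalk.\<close>

definition vanishes :: "'u sch \<Rightarrow> 'u set \<Rightarrow> 'u \<Rightarrow> 'u \<Rightarrow> bool" where
  "vanishes X U s x \<longleftrightarrow> (\<forall>W. opn X W \<and> x \<in> W \<and> W \<subseteq> U \<longrightarrow> res X U W s \<notin> Units (sec X W))"


subsection \<open>Morphisms\<close>

text \<open>Both components of a morphism are normalized to be \<open>undefined\<close> outside their domains, so that
  equality of morphisms is equality of records.\<close>

record 'u mor =
  pt :: "'u \<Rightarrow> 'u"
  sh :: "'u set \<Rightarrow> 'u \<Rightarrow> 'u"

definition pre :: "'u sch \<Rightarrow> 'u mor \<Rightarrow> 'u set \<Rightarrow> 'u set" where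
  "pre X f V = {x \<in> pts X. pt f x \<in> V}"

definition is_mor :: "'u ring \<Rightarrow> 'u sch \<Rightarrow> 'u sch \<Rightarrow> 'u mor \<Rightarrow> bool" where
  "is_mor k X Y f \<longleftrightarrow>
     continuous_map (sp X) (sp Y) (pt f) \<and> pt f \<in> extensional (pts X) \<and>
     sh f \<in> extensional {V. opn Y V} \<and>
     (\<forall>V. opn Y V \<longrightarrow>
        sh f V \<in> ring_hom (sec Y V) (sec X (pre X f V)) \<inter> extensional (carrier (sec Y V))) \<and>
     (\<forall>V W s. opn Y V \<and> opn Y W \<and> W \<subseteq> V \<and> s \<in> carrier (sec Y V) \<longrightarrow>
        sh f W (res Y V W s) = res X (pre X f V) (pre X f W) (sh f V s)) \<and>
     (\<forall>c\<in>carrier k. sh f (pts Y) (str Y c) = str X c) \<and>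
     (\<forall>V s x. opn Y V \<and> s \<in> carrier (sec Y V) \<and> x \<in> pre X f V \<and> vanishes Y V s (pt f x) \<longrightarrow>
        vanishes X (pre X f V) (sh f V s) x)"

definition mor_id :: "'u sch \<Rightarrow> 'u mor" where
  "mor_id X = \<lparr>pt = (\<lambda>x\<in>pts X. x), sh = (\<lambda>U\<in>{U. opn X U}. \<lambda>s\<in>carrier (sec X U). s)\<rparr>"

text \<open>The composite of \<open>f : X \<rightarrow> Y\<close> and \<open>g : Y \<rightarrow> Z\<close>.\<close>

definition mor_comp :: "'u sch \<Rightarrow> 'u sch \<Rightarrow> 'u sch \<Rightarrow> 'u mor \<Rightarrow> 'u mor \<Rightarrow> 'u mor" where
  "mor_comp X Y Z g f =
     \<lparr>pt = (\<lambda>x\<in>pts X. pt g (pt f x)),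
      sh = (\<lambda>V\<in>{V. opn Z V}. \<lambda>s\<in>carrier (sec Z V). sh f (pre Y g V) (sh g V s))\<rparr>"

definition is_product ::
  "'u ring \<Rightarrow> 'u sch \<Rightarrow> 'u sch \<Rightarrow> 'u sch \<Rightarrow> 'u mor \<Rightarrow> 'u mor \<Rightarrow> bool" where
  "is_product k X Y Z p q \<longleftrightarrow>
     kscheme k Z \<and> is_mor k Z X p \<and> is_mor k Z Y q \<and>
     (\<forall>T a b. kscheme k T \<and> is_mor k T X a \<and> is_mor k T Y b \<longrightarrow>
        (\<exists>!m. is_mor k T Z m \<and> mor_comp T Z X p m = a \<and> mor_comp T Z Y q m = b))"

definition closed_immersion :: "'u ring \<Rightarrow> 'u sch \<Rightarrow> 'u sch \<Rightarrow> 'u mor \<Rightarrow> bool" where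
  "closed_immersion k X Y f \<longleftrightarrow>
     is_mor k X Y f \<and> embedding_map (sp X) (sp Y) (pt f) \<and> closedin (sp Y) (pt f ` pts X) \<and>
     (\<forall>V s x. opn Y V \<and> s \<in> carrier (sec X (pre X f V)) \<and> x \<in> pre X f V \<longrightarrow>
        (\<exists>W t. opn Y W \<and> W \<subseteq> V \<and> pt f x \<in> W \<and> t \<in> carrier (sec Y W) \<and>
           sh f W t = res X (pre X f V) (pre X f W) s))"


subsection \<open>The category of smooth schemes\<close>

text \<open>For \<open>X\<close> of finite type the product of \<open>X\<close> with itself exists; it is unique up to isomorphism, so
  the universal quantifier over its realizations makes no difference.\<close>

definition separated :: "'u ring \<Rightarrow> 'u sch \<Rightarrow> bool" where
  "separated k X \<longleftrightarrow>
     (\<forall>Z p q d. is_product k X X Z p q \<and> is_mor k X Z d \<and>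
        mor_comp X Z X p d = mor_id X \<and> mor_comp X Z X q d = mor_id X \<longrightarrow>
        closed_immersion k X Z d)"

definition finite_type :: "'u ring \<Rightarrow> 'u sch \<Rightarrow> bool" where
  "finite_type k X \<longleftrightarrow>
     (\<exists>\<U>. finite \<U> \<and> \<Union>\<U> = pts X \<and>
        (\<forall>U\<in>\<U>. affine_open X U \<and> finite_type_hom k (sec X U) (str (open_sub X U))))"

text \<open>Smooth means formally smooth and locally of finite presentation, and etale means formally etale
  and locally of finite presentation; over the Noetherian bases occurring here (a field, or a
  scheme of finite type over a field) finite presentation is the same as finite type.\<close>

definition smooth :: "'u ring \<Rightarrow> 'u sch \<Rightarrow> bool" where
  "smooth k X \<longleftrightarrow>
     (\<forall>x\<in>pts X. \<exists>U. x \<in> U \<and> affine_open X U \<and>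
        finite_type_hom k (sec X U) (str (open_sub X U)) \<and>
        formally_smooth k (sec X U) (str (open_sub X U)))"

definition Sm :: "'u ring \<Rightarrow> 'u sch \<Rightarrow> bool" where
  "Sm k X \<longleftrightarrow> kscheme k X \<and> separated k X \<and> finite_type k X \<and> smooth k X"

definition etale :: "'u ring \<Rightarrow> 'u sch \<Rightarrow> 'u sch \<Rightarrow> 'u mor \<Rightarrow> bool" where
  "etale k X Y f \<longleftrightarrow> is_mor k X Y f \<and>
     (\<forall>x\<in>pts X. \<exists>U V. x \<in> U \<and> affine_open X U \<and> affine_open Y V \<and> U \<subseteq> pre X f V \<and>
        finite_type_hom (sec Y V) (sec X U) (\<lambda>s. res X (pre X f V) U (sh f V s)) \<and>
        formally_etale (sec Y V) (sec X U) (\<lambda>s. res X (pre X f V) U (sh f V s)))"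

text \<open>The extension of residue fields \<open>\<kappa>(f x) \<rightarrow> \<kappa>(x)\<close> is an isomorphism.  It is injective in any case;
  surjectivity says that the germ at \<open>x\<close> of any section \<open>s\<close> agrees with the pullback of some germ at
  \<open>f x\<close> modulo the maximal ideal.\<close>

definition residue_iso :: "'u sch \<Rightarrow> 'u sch \<Rightarrow> 'u mor \<Rightarrow> 'u \<Rightarrow> bool" where
  "residue_iso X Y f x \<longleftrightarrow>
     (\<forall>W s. opn X W \<and> x \<in> W \<and> s \<in> carrier (sec X W) \<longrightarrow>
        (\<exists>V t. opn Y V \<and> pt f x \<in> V \<and> t \<in> carrier (sec Y V) \<and>
           vanishes X (W \<inter> pre X f V)
             (res X W (W \<inter> pre X f V) s \<ominus>\<^bsub>sec X (W \<inter> pre X f V)\<^esub>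
                res X (pre X f V) (W \<inter> pre X f V) (sh f V t)) x))"

definition nis_cover :: "'u ring \<Rightarrow> 'u sch \<Rightarrow> ('u sch \<times> 'u mor) set \<Rightarrow> bool" where
  "nis_cover k X C \<longleftrightarrow>
     (\<forall>(U, f)\<in>C. Sm k U \<and> etale k U X f) \<and>
     (\<forall>x\<in>pts X. \<exists>(U, f)\<in>C. \<exists>u\<in>pts U. pt f u = x \<and> residue_iso U X f u)"

definition is_affine_line :: "'u ring \<Rightarrow> 'u sch \<Rightarrow> bool" where
  "is_affine_line k L \<longleftrightarrow> kscheme k L \<and> affine L \<and>
     (\<exists>h. h \<in> ring_iso (UP k) (glob L) \<and> (\<forall>c\<in>carrier k. h (monom (UP k) c 0) = str L c))"


section \<open>Nisnevich sheaves\<close>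

text \<open>\<open>r X Y f : S X \<rightarrow> S Y\<close> is the pullback along \<open>f : Y \<rightarrow> X\<close>.\<close>

definition set_presheaf ::
  "'u ring \<Rightarrow> ('u sch \<Rightarrow> 'a set) \<Rightarrow> ('u sch \<Rightarrow> 'u sch \<Rightarrow> 'u mor \<Rightarrow> 'a \<Rightarrow> 'a) \<Rightarrow> bool" where
  "set_presheaf k S r \<longleftrightarrow>
     (\<forall>X Y f s. Sm k X \<and> Sm k Y \<and> is_mor k Y X f \<and> s \<in> S X \<longrightarrow> r X Y f s \<in> S Y) \<and>
     (\<forall>X s. Sm k X \<and> s \<in> S X \<longrightarrow> r X X (mor_id X) s = s) \<and>
     (\<forall>X Y Z f g s. Sm k X \<and> Sm k Y \<and> Sm k Z \<and> is_mor k Y X f \<and> is_mor k Z Y g \<and> s \<in> S X \<longrightarrow>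
        r X Z (mor_comp Z Y X f g) s = r Y Z g (r X Y f s))"

definition nis_sheaf ::
  "'u ring \<Rightarrow> ('u sch \<Rightarrow> 'a set) \<Rightarrow> ('u sch \<Rightarrow> 'u sch \<Rightarrow> 'u mor \<Rightarrow> 'a \<Rightarrow> 'a) \<Rightarrow> bool" where
  "nis_sheaf k S r \<longleftrightarrow> set_presheaf k S r \<and>
     (\<forall>X C s. Sm k X \<and> nis_cover k X C \<and> (\<forall>(U, f)\<in>C. s (U, f) \<in> S U) \<and>
        (\<forall>(U, f)\<in>C. \<forall>(V, g)\<in>C. \<forall>Y a b.
           Sm k Y \<and> is_mor k Y U a \<and> is_mor k Y V b \<and> mor_comp Y U X f a = mor_comp Y V X g b \<longrightarrow>
           r U Y a (s (U, f)) = r V Y b (s (V, g))) \<longrightarrow>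
        (\<exists>!t. t \<in> S X \<and> (\<forall>(U, f)\<in>C. r X U f t = s (U, f))))"

record ('u, 'a) ab_psh =
  grp :: "'u sch \<Rightarrow> 'a monoid"
  pull :: "'u sch \<Rightarrow> 'u sch \<Rightarrow> 'u mor \<Rightarrow> 'a \<Rightarrow> 'a"

definition ab_sheaf :: "'u ring \<Rightarrow> ('u, 'a) ab_psh \<Rightarrow> bool" where
  "ab_sheaf k M \<longleftrightarrow>
     (\<forall>X. Sm k X \<longrightarrow> comm_group (grp M X)) \<and>
     (\<forall>X Y f. Sm k X \<and> Sm k Y \<and> is_mor k Y X f \<longrightarrow> pull M X Y f \<in> hom (grp M X) (grp M Y)) \<and>
     nis_sheaf k (\<lambda>X. carrier (grp M X)) (pull M)"


subsection \<open>Torsors and strong invariance\<close>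

text \<open>
  A \<open>G\<close>-torsor over \<open>X\<close> is a sheaf of sets on \<open>Sm\<^sub>k/X\<close>.  For \<open>f : Y \<rightarrow> X\<close>, \<open>tsec T Y f\<close> is its set of
  sections over \<open>(Y, f)\<close>, \<open>tpull T Y Z g f : tsec T Y f \<rightarrow> tsec T Z (f \<circ> g)\<close> the pullback along
  \<open>g : Z \<rightarrow> Y\<close>, and \<open>tact T Y f\<close> the action of \<open>G(Y)\<close>.  A nonempty set of sections over \<open>(Y, f)\<close> is
  in bijection with \<open>G(Y)\<close>, so no generality is lost by letting torsors take values in the type of
  values of \<open>G\<close>.
\<close>

record ('u, 'a) tor =
  tsec :: "'u sch \<Rightarrow> 'u mor \<Rightarrow> 'a set"
  tpull :: "'u sch \<Rightarrow> 'u sch \<Rightarrow> 'u mor \<Rightarrow> 'u mor \<Rightarrow> 'a \<Rightarrow> 'a"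
  tact :: "'u sch \<Rightarrow> 'u mor \<Rightarrow> 'a \<Rightarrow> 'a \<Rightarrow> 'a"

definition over_sheaf :: "'u ring \<Rightarrow> 'u sch \<Rightarrow> ('u, 'a) tor \<Rightarrow> bool" where
  "over_sheaf k X T \<longleftrightarrow>
     (\<forall>Y Z f g t. Sm k Y \<and> Sm k Z \<and> is_mor k Y X f \<and> is_mor k Z Y g \<and> t \<in> tsec T Y f \<longrightarrow>
        tpull T Y Z g f t \<in> tsec T Z (mor_comp Z Y X f g)) \<and>
     (\<forall>Y f t. Sm k Y \<and> is_mor k Y X f \<and> t \<in> tsec T Y f \<longrightarrow> tpull T Y Y (mor_id Y) f t = t) \<and>
     (\<forall>Y Z W f g h t. Sm k Y \<and> Sm k Z \<and> Sm k W \<and>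
        is_mor k Y X f \<and> is_mor k Z Y g \<and> is_mor k W Z h \<and> t \<in> tsec T Y f \<longrightarrow>
        tpull T Y W (mor_comp W Z Y g h) f t =
          tpull T Z W h (mor_comp Z Y X f g) (tpull T Y Z g f t)) \<and>
     (\<forall>Y f C s. Sm k Y \<and> is_mor k Y X f \<and> nis_cover k Y C \<and>
        (\<forall>(U, g)\<in>C. s (U, g) \<in> tsec T U (mor_comp U Y X f g)) \<and>
        (\<forall>(U, g)\<in>C. \<forall>(V, h)\<in>C. \<forall>W a b.
           Sm k W \<and> is_mor k W U a \<and> is_mor k W V b \<and> mor_comp W U Y g a = mor_comp W V Y h b \<longrightarrow>
           tpull T U W a (mor_comp U Y X f g) (s (U, g)) =
             tpull T V W b (mor_comp V Y X f h) (s (V, h))) \<longrightarrow>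
        (\<exists>!t. t \<in> tsec T Y f \<and> (\<forall>(U, g)\<in>C. tpull T Y U g f t = s (U, g))))"

definition torsor :: "'u ring \<Rightarrow> ('u, 'a) ab_psh \<Rightarrow> 'u sch \<Rightarrow> ('u, 'a) tor \<Rightarrow> bool" where
  "torsor k G X T \<longleftrightarrow> over_sheaf k X T \<and>
     (\<forall>Y f. Sm k Y \<and> is_mor k Y X f \<longrightarrow>
        (\<forall>a\<in>carrier (grp G Y). \<forall>t\<in>tsec T Y f. tact T Y f a t \<in> tsec T Y f) \<and>
        (\<forall>t\<in>tsec T Y f. tact T Y f \<one>\<^bsub>grp G Y\<^esub> t = t) \<and>
        (\<forall>a\<in>carrier (grp G Y). \<forall>b\<in>carrier (grp G Y). \<forall>t\<in>tsec T Y f.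
           tact T Y f (a \<otimes>\<^bsub>grp G Y\<^esub> b) t = tact T Y f a (tact T Y f b t)) \<and>
        (\<forall>t\<in>tsec T Y f. \<forall>u\<in>tsec T Y f. \<exists>!a. a \<in> carrier (grp G Y) \<and> tact T Y f a t = u)) \<and>
     (\<forall>Y Z f g a t. Sm k Y \<and> Sm k Z \<and> is_mor k Y X f \<and> is_mor k Z Y g \<and>
        a \<in> carrier (grp G Y) \<and> t \<in> tsec T Y f \<longrightarrow>
        tpull T Y Z g f (tact T Y f a t) =
          tact T Z (mor_comp Z Y X f g) (pull G Y Z g a) (tpull T Y Z g f t)) \<and>
     (\<exists>C. nis_cover k X C \<and> (\<forall>(U, f)\<in>C. tsec T U f \<noteq> {}))"

definition tor_iso ::
  "'u ring \<Rightarrow> ('u, 'a) ab_psh \<Rightarrow> 'u sch \<Rightarrow> (('u, 'a) tor \<times> ('u, 'a) tor) set" where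
  "tor_iso k G X =
     {(T, T'). torsor k G X T \<and> torsor k G X T' \<and>
        (\<exists>\<eta>.
          (\<forall>Y f. Sm k Y \<and> is_mor k Y X f \<longrightarrow> bij_betw (\<eta> Y f) (tsec T Y f) (tsec T' Y f) \<and>
             (\<forall>a\<in>carrier (grp G Y). \<forall>t\<in>tsec T Y f. \<eta> Y f (tact T Y f a t) = tact T' Y f a (\<eta> Y f t))) \<and>
          (\<forall>Y Z f g t. Sm k Y \<and> Sm k Z \<and> is_mor k Y X f \<and> is_mor k Z Y g \<and> t \<in> tsec T Y f \<longrightarrow>
             \<eta> Z (mor_comp Z Y X f g) (tpull T Y Z g f t) = tpull T' Y Z g f (\<eta> Y f t)))}"

text \<open>\<open>H\<^sup>1\<close> as the set of isomorphism classes of torsors.\<close>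

definition H1 :: "'u ring \<Rightarrow> ('u, 'a) ab_psh \<Rightarrow> 'u sch \<Rightarrow> ('u, 'a) tor set set" where
  "H1 k G X = {T. torsor k G X T} // tor_iso k G X"

definition tor_restrict :: "'u sch \<Rightarrow> 'u sch \<Rightarrow> 'u mor \<Rightarrow> ('u, 'a) tor \<Rightarrow> ('u, 'a) tor" where
  "tor_restrict X Z q T =
     \<lparr>tsec = (\<lambda>Y f. tsec T Y (mor_comp Y Z X q f)),
      tpull = (\<lambda>Y W g f. tpull T Y W g (mor_comp Y Z X q f)),
      tact = (\<lambda>Y f. tact T Y (mor_comp Y Z X q f))\<rparr>"

definition H1_pull ::
  "'u ring \<Rightarrow> ('u, 'a) ab_psh \<Rightarrow> 'u sch \<Rightarrow> 'u sch \<Rightarrow> 'u mor \<Rightarrow> ('u, 'a) tor set \<Rightarrow> ('u, 'a) tor set" where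
  "H1_pull k G X Z q c = tor_iso k G Z `` (tor_restrict X Z q ` c)"

text \<open>The map on \<open>H\<^sup>1\<close> is a homomorphism for the sum of torsors, so it is an isomorphism of groups as
  soon as it is bijective.\<close>

definition strongly_A1_invariant :: "'u ring \<Rightarrow> ('u, 'a) ab_psh \<Rightarrow> bool" where
  "strongly_A1_invariant k G \<longleftrightarrow>
     (\<forall>X L Z p q. Sm k X \<and> is_affine_line k L \<and> is_product k L X Z p q \<longrightarrow>
        pull G X Z q \<in> iso (grp G X) (grp G Z) \<and>
        bij_betw (H1_pull k G X Z q) (H1 k G X) (H1 k G Z))"


subsection \<open>Powers of the multiplicative group\<close>

text \<open>The \<open>n\<close>-fold smash power of a set \<open>S\<close> pointed by \<open>b\<close>: \<open>None\<close> is the base point, the class of all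
  tuples having some entry \<open>b\<close>.\<close>

definition smash_class :: "'u \<Rightarrow> 'u list \<Rightarrow> 'u list option" where
  "smash_class b xs = (if b \<in> set xs then None else Some xs)"

definition smash :: "nat \<Rightarrow> 'u \<Rightarrow> 'u set \<Rightarrow> 'u list option set" where
  "smash n b S = insert None (smash_class b ` {xs. length xs = n \<and> set xs \<subseteq> S})"

fun smash_map :: "('u \<Rightarrow> 'u) \<Rightarrow> 'u \<Rightarrow> 'u list option \<Rightarrow> 'u list option" where
  "smash_map h b None = None"
| "smash_map h b (Some xs) = smash_class b (map h xs)"

record ('u, 'a) pt_psh =
  pset :: "'u sch \<Rightarrow> 'a set"
  pbase :: "'u sch \<Rightarrow> 'a"
  ppull :: "'u sch \<Rightarrow> 'u sch \<Rightarrow> 'u mor \<Rightarrow> 'a \<Rightarrow> 'a"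

definition Gm :: "('u, 'u) pt_psh" where
  "Gm = \<lparr>pset = (\<lambda>X. Units (glob X)), pbase = (\<lambda>X. \<one>\<^bsub>glob X\<^esub>), ppull = (\<lambda>X Y f. sh f (pts X))\<rparr>"

text \<open>The connected components of a smooth scheme are open and irreducible, so a sheaf with the
  prescribed values on irreducible schemes takes on \<open>X\<close> the product of the values on the components.\<close>

definition Gm_smash :: "nat \<Rightarrow> ('u, 'u set \<Rightarrow> 'u list option) pt_psh" where
  "Gm_smash n =
     \<lparr>pset = (\<lambda>X. \<Pi>\<^sub>E C\<in>connected_components_of (sp X). smash n \<one>\<^bsub>sec X C\<^esub> (Units (sec X C))),
      pbase = (\<lambda>X. \<lambda>C\<in>connected_components_of (sp X). None),
      ppull = (\<lambda>X Y f s. \<lambda>D\<in>connected_components_of (sp Y).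
        let C = (THE C. C \<in> connected_components_of (sp X) \<and> pt f ` D \<subseteq> C)
        in smash_map (\<lambda>u. res Y (pre Y f C) D (sh f C u)) \<one>\<^bsub>sec Y D\<^esub> (s C))\<rparr>"

definition smash_symbol :: "'u sch \<Rightarrow> 'u list \<Rightarrow> 'u set \<Rightarrow> 'u list option" where
  "smash_symbol X us =
     (\<lambda>C\<in>connected_components_of (sp X). smash_class \<one>\<^bsub>sec X C\<^esub> (map (res X (pts X) C) us))"

definition pointed_map ::
  "'u ring \<Rightarrow> ('u, 'b) pt_psh \<Rightarrow> ('u, 'a) ab_psh \<Rightarrow> ('u sch \<Rightarrow> 'b \<Rightarrow> 'a) \<Rightarrow> bool" where
  "pointed_map k S M \<sigma> \<longleftrightarrow>
     (\<forall>X. Sm k X \<longrightarrow> \<sigma> X \<in> pset S X \<rightarrow> carrier (grp M X) \<and> \<sigma> X (pbase S X) = \<one>\<^bsub>grp M X\<^esub>) \<and>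
     (\<forall>X Y f s. Sm k X \<and> Sm k Y \<and> is_mor k Y X f \<and> s \<in> pset S X \<longrightarrow>
        \<sigma> Y (ppull S X Y f s) = pull M X Y f (\<sigma> X s))"


section \<open>Evaluation on fields\<close>

definition fin_trdeg_ext :: "'u ring \<Rightarrow> 'u ring \<Rightarrow> ('u \<Rightarrow> 'u) \<Rightarrow> bool" where
  "fin_trdeg_ext k F i \<longleftrightarrow> field F \<and> i \<in> ring_hom k F \<and>
     (\<exists>S. finite S \<and> S \<subseteq> carrier F \<and>
        (\<forall>x\<in>carrier F. \<not> ring.transcendental F (generate_field F (i ` carrier k \<union> S)) x))"

definition ext_hom ::
  "'u ring \<Rightarrow> 'u ring \<Rightarrow> ('u \<Rightarrow> 'u) \<Rightarrow> 'u ring \<Rightarrow> ('u \<Rightarrow> 'u) \<Rightarrow> ('u \<Rightarrow> 'u) \<Rightarrow> bool" where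
  "ext_hom k F i F' i' j \<longleftrightarrow> j \<in> ring_hom F F' \<and> (\<forall>c\<in>carrier k. j (i c) = i' c)"

definition irreducible_sch :: "'u sch \<Rightarrow> bool" where
  "irreducible_sch X \<longleftrightarrow> pts X \<noteq> {} \<and>
     (\<forall>U V. opn X U \<and> opn X V \<and> U \<noteq> {} \<and> V \<noteq> {} \<longrightarrow> U \<inter> V \<noteq> {})"

text \<open>A \<open>k\<close>-homomorphism from the function field of \<open>X\<close>, the colimit of \<open>O(U)\<close> over the nonempty open
  \<open>U\<close>, to \<open>F\<close> is given as a compatible family \<open>\<epsilon> U : O(U) \<rightarrow> F\<close>.  It identifies the function field
  with a finitely generated subextension of \<open>F\<close>, so the pairs \<open>(X, \<epsilon>)\<close> are the smooth models of the
  finitely generated subextensions of \<open>F\<close>.\<close>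

definition field_model ::
  "'u ring \<Rightarrow> 'u ring \<Rightarrow> ('u \<Rightarrow> 'u) \<Rightarrow> 'u sch \<Rightarrow> ('u set \<Rightarrow> 'u \<Rightarrow> 'u) \<Rightarrow> bool" where
  "field_model k F i X \<epsilon> \<longleftrightarrow> Sm k X \<and> irreducible_sch X \<and>
     (\<forall>U. opn X U \<and> U \<noteq> {} \<longrightarrow> \<epsilon> U \<in> ring_hom (sec X U) F) \<and>
     (\<forall>U V s. opn X U \<and> opn X V \<and> V \<noteq> {} \<and> V \<subseteq> U \<and> s \<in> carrier (sec X U) \<longrightarrow>
        \<epsilon> V (res X U V s) = \<epsilon> U s) \<and>
     (\<forall>c\<in>carrier k. \<epsilon> (pts X) (str X c) = i c)"

definition model_mor ::
  "'u ring \<Rightarrow> 'u sch \<Rightarrow> ('u set \<Rightarrow> 'u \<Rightarrow> 'u) \<Rightarrow> 'u sch \<Rightarrow> ('u set \<Rightarrow> 'u \<Rightarrow> 'u) \<Rightarrow> 'u mor \<Rightarrow> bool" where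
  "model_mor k Z \<zeta> X \<epsilon> f \<longleftrightarrow> is_mor k Z X f \<and>
     (\<forall>U. opn X U \<and> U \<noteq> {} \<longrightarrow> pre Z f U \<noteq> {} \<and>
        (\<forall>s\<in>carrier (sec X U). \<zeta> (pre Z f U) (sh f U s) = \<epsilon> U s))"

type_synonym ('u, 'a) fsec = "'u sch \<times> ('u set \<Rightarrow> 'u \<Rightarrow> 'u) \<times> 'a"

definition fsecs :: "'u ring \<Rightarrow> ('u, 'a) ab_psh \<Rightarrow> 'u ring \<Rightarrow> ('u \<Rightarrow> 'u) \<Rightarrow> ('u, 'a) fsec set" where
  "fsecs k M F i = {(X, \<epsilon>, s). field_model k F i X \<epsilon> \<and> s \<in> carrier (grp M X)}"

definition fsec_rel ::
  "'u ring \<Rightarrow> ('u, 'a) ab_psh \<Rightarrow> 'u ring \<Rightarrow> ('u \<Rightarrow> 'u) \<Rightarrow> (('u, 'a) fsec \<times> ('u, 'a) fsec) set" where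
  "fsec_rel k M F i =
     {((X, \<epsilon>, s), (Y, \<delta>, t)). (X, \<epsilon>, s) \<in> fsecs k M F i \<and> (Y, \<delta>, t) \<in> fsecs k M F i \<and>
        (\<exists>Z \<zeta> f g. field_model k F i Z \<zeta> \<and> model_mor k Z \<zeta> X \<epsilon> f \<and> model_mor k Z \<zeta> Y \<delta> g \<and>
           pull M X Z f s = pull M Y Z g t)}"

text \<open>The group \<open>M(F)\<close>, as a filtered colimit over the models: elements are added after pulling them
  back to a common model.\<close>

definition eval_fld ::
  "'u ring \<Rightarrow> ('u, 'a) ab_psh \<Rightarrow> 'u ring \<Rightarrow> ('u \<Rightarrow> 'u) \<Rightarrow> ('u, 'a) fsec set monoid" where
  "eval_fld k M F i =
     \<lparr>carrier = fsecs k M F i // fsec_rel k M F i,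
      mult = (\<lambda>A B. fsec_rel k M F i ``
                {(Z, \<zeta>, s \<otimes>\<^bsub>grp M Z\<^esub> t) | Z \<zeta> s t. (Z, \<zeta>, s) \<in> A \<and> (Z, \<zeta>, t) \<in> B}),
      one = fsec_rel k M F i `` {(Z, \<zeta>, \<one>\<^bsub>grp M Z\<^esub>) | Z \<zeta>. field_model k F i Z \<zeta>}\<rparr>"

definition eval_class ::
  "'u ring \<Rightarrow> ('u, 'a) ab_psh \<Rightarrow> 'u ring \<Rightarrow> ('u \<Rightarrow> 'u) \<Rightarrow> 'u sch \<Rightarrow> ('u set \<Rightarrow> 'u \<Rightarrow> 'u) \<Rightarrow> 'a \<Rightarrow>
     ('u, 'a) fsec set" where
  "eval_class k M F i X \<epsilon> s = fsec_rel k M F i `` {(X, \<epsilon>, s)}"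

definition eval_map ::
  "'u ring \<Rightarrow> ('u, 'a) ab_psh \<Rightarrow> 'u ring \<Rightarrow> ('u \<Rightarrow> 'u) \<Rightarrow> ('u \<Rightarrow> 'u) \<Rightarrow>
     ('u, 'a) fsec set \<Rightarrow> ('u, 'a) fsec set" where
  "eval_map k M F' i' j A = fsec_rel k M F' i' `` {(X, \<lambda>U s. j (\<epsilon> U s), t) | X \<epsilon> t. (X, \<epsilon>, t) \<in> A}"

text \<open>A functor from fields to groups: values \<open>fobj F\<close> and maps \<open>fmap F F' j : fobj F \<rightarrow> fobj F'\<close> for
  \<open>j : F \<rightarrow> F'\<close>.  The family \<open>\<alpha>\<close> is a natural isomorphism from its restriction to \<open>F\<^sub>k\<close> to the
  evaluation of \<open>M\<close>.\<close>

record ('u, 'g) fld_functor =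
  fobj :: "'u ring \<Rightarrow> 'g monoid"
  fmap :: "'u ring \<Rightarrow> 'u ring \<Rightarrow> ('u \<Rightarrow> 'u) \<Rightarrow> 'g \<Rightarrow> 'g"

definition recovers ::
  "'u ring \<Rightarrow> ('u, 'a) ab_psh \<Rightarrow> ('u, 'g) fld_functor \<Rightarrow>
     ('u ring \<Rightarrow> ('u \<Rightarrow> 'u) \<Rightarrow> 'g \<Rightarrow> ('u, 'a) fsec set) \<Rightarrow> bool" where
  "recovers k M \<Phi> \<alpha> \<longleftrightarrow>
     (\<forall>F i. fin_trdeg_ext k F i \<longrightarrow> \<alpha> F i \<in> iso (fobj \<Phi> F) (eval_fld k M F i)) \<and>
     (\<forall>F i F' i' j. fin_trdeg_ext k F i \<and> fin_trdeg_ext k F' i' \<and> ext_hom k F i F' i' j \<longrightarrow>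
        (\<forall>a\<in>carrier (fobj \<Phi> F). \<alpha> F' i' (fmap \<Phi> F F' j a) = eval_map k M F' i' j (\<alpha> F i a)))"


section \<open>The pre-Bloch group and the second exterior power\<close>

definition quot_by :: "('g, 'm) monoid_scheme \<Rightarrow> 'g set \<Rightarrow> 'g set monoid" where
  "quot_by G R = G Mod generate G R"

definition quot_class :: "('g, 'm) monoid_scheme \<Rightarrow> 'g set \<Rightarrow> 'g \<Rightarrow> 'g set" where
  "quot_class G R a = generate G R #>\<^bsub>G\<^esub> a"

text \<open>The map of quotients induced by \<open>h : G \<rightarrow> G'\<close>; the argument \<open>A\<close> is a coset in \<open>G\<close>, and \<open>R'\<close> are
  the relations in \<open>G'\<close>.\<close>

definition quot_map :: "('g, 'm) monoid_scheme \<Rightarrow> 'g set \<Rightarrow> ('f \<Rightarrow> 'g) \<Rightarrow> 'f set \<Rightarrow> 'g set" where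
  "quot_map G' R' h A = generate G' R' <#>\<^bsub>G'\<^esub> (h ` A)"

definition free_map :: "('b \<Rightarrow> 'c) \<Rightarrow> ('b \<Rightarrow>\<^sub>0 int) \<Rightarrow> ('c \<Rightarrow>\<^sub>0 int)" where
  "free_map h = frag_extend (\<lambda>x. frag_of (h x))"

definition bloch_free :: "'u ring \<Rightarrow> ('u \<Rightarrow>\<^sub>0 int) monoid" where
  "bloch_free F = free_Abelian_group (Units F - {\<one>\<^bsub>F\<^esub>})"

definition bloch_rels :: "'u ring \<Rightarrow> ('u \<Rightarrow>\<^sub>0 int) set" where
  "bloch_rels F =
     {frag_of x - frag_of y + frag_of (y \<otimes>\<^bsub>F\<^esub> inv\<^bsub>F\<^esub> x)
        + frag_of ((\<one>\<^bsub>F\<^esub> \<ominus>\<^bsub>F\<^esub> x) \<otimes>\<^bsub>F\<^esub> inv\<^bsub>F\<^esub> (\<one>\<^bsub>F\<^esub> \<ominus>\<^bsub>F\<^esub> y))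
        - frag_of ((y \<otimes>\<^bsub>F\<^esub> (\<one>\<^bsub>F\<^esub> \<ominus>\<^bsub>F\<^esub> x)) \<otimes>\<^bsub>F\<^esub> inv\<^bsub>F\<^esub> (x \<otimes>\<^bsub>F\<^esub> (\<one>\<^bsub>F\<^esub> \<ominus>\<^bsub>F\<^esub> y))) | x y.
      x \<in> Units F - {\<one>\<^bsub>F\<^esub>} \<and> y \<in> Units F - {\<one>\<^bsub>F\<^esub>} \<and> x \<noteq> y}"

definition pre_bloch :: "('u, ('u \<Rightarrow>\<^sub>0 int) set) fld_functor" where
  "pre_bloch =
     \<lparr>fobj = (\<lambda>F. quot_by (bloch_free F) (bloch_rels F)),
      fmap = (\<lambda>F F' j. quot_map (bloch_free F') (bloch_rels F') (free_map j))\<rparr>"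

definition bloch_symbol :: "'u ring \<Rightarrow> 'u \<Rightarrow> ('u \<Rightarrow>\<^sub>0 int) set" where
  "bloch_symbol F z =
     (if z = \<one>\<^bsub>F\<^esub> then \<one>\<^bsub>fobj pre_bloch F\<^esub> else quot_class (bloch_free F) (bloch_rels F) (frag_of z))"

definition tensor_free :: "'u ring \<Rightarrow> (('u \<times> 'u) \<Rightarrow>\<^sub>0 int) monoid" where
  "tensor_free F = free_Abelian_group (Units F \<times> Units F)"

definition tensor_rels :: "'u ring \<Rightarrow> (('u \<times> 'u) \<Rightarrow>\<^sub>0 int) set" where
  "tensor_rels F =
     {frag_of (x \<otimes>\<^bsub>F\<^esub> y, z) - frag_of (x, z) - frag_of (y, z) | x y z.
        x \<in> Units F \<and> y \<in> Units F \<and> z \<in> Units F} \<union>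
     {frag_of (x, y \<otimes>\<^bsub>F\<^esub> z) - frag_of (x, y) - frag_of (x, z) | x y z.
        x \<in> Units F \<and> y \<in> Units F \<and> z \<in> Units F}"

definition tensor_units :: "'u ring \<Rightarrow> (('u \<times> 'u) \<Rightarrow>\<^sub>0 int) set monoid" where
  "tensor_units F = quot_by (tensor_free F) (tensor_rels F)"

definition tensor_class :: "'u ring \<Rightarrow> 'u \<Rightarrow> 'u \<Rightarrow> (('u \<times> 'u) \<Rightarrow>\<^sub>0 int) set" where
  "tensor_class F x y = quot_class (tensor_free F) (tensor_rels F) (frag_of (x, y))"

definition wedge_rels :: "'u ring \<Rightarrow> (('u \<times> 'u) \<Rightarrow>\<^sub>0 int) set set" where
  "wedge_rels F =
     {tensor_class F x y \<otimes>\<^bsub>tensor_units F\<^esub> tensor_class F y x | x y. x \<in> Units F \<and> y \<in> Units F}"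

definition wedge2 :: "('u, (('u \<times> 'u) \<Rightarrow>\<^sub>0 int) set set) fld_functor" where
  "wedge2 =
     \<lparr>fobj = (\<lambda>F. quot_by (tensor_units F) (wedge_rels F)),
      fmap = (\<lambda>F F' j. quot_map (tensor_units F') (wedge_rels F')
               (quot_map (tensor_free F') (tensor_rels F') (free_map (map_prod j j))))\<rparr>"

definition wedge_symbol :: "'u ring \<Rightarrow> 'u \<Rightarrow> 'u \<Rightarrow> (('u \<times> 'u) \<Rightarrow>\<^sub>0 int) set set" where
  "wedge_symbol F x y = quot_class (tensor_units F) (wedge_rels F) (tensor_class F x y)"

end

theory Submission
  imports Defs "HOL-Algebra.Weak_Morphisms"
begin

text \<open>
  Comparing the five-term relations of \<open>(x, y)\<close> and \<open>(1 - y, 1 - x)\<close> shows that \<open>{x} + {1 - x}\<close> does not depend on \<open>x\<close>; in particular \<open>{t} + {1 - t} = {2} + {-1}\<close>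
  in \<open>P(k(t))\<close>.  So on a small open subset of the line the section \<open>\<sigma>(t)\<close>, defined where \<open>t \<noteq> 0\<close>, agrees
  with \<open>\<sigma>(2) + \<sigma>(-1) - \<sigma>(1 - t)\<close>, which is defined near \<open>t = 0\<close>.  The two glue to a section over the affine
  line, which is constant by invariance and vanishes at \<open>t = 1\<close>, because \<open>\<sigma>(1) = 0\<close>.  Hence \<open>{t} = 0\<close>.  But
  \<open>{x} \<mapsto> v\<^sub>0(x) v\<^sub>1(1 - x) - v\<^sub>1(x) v\<^sub>0(1 - x)\<close>, where \<open>v\<^sub>0\<close> and \<open>v\<^sub>1\<close> are the orders at \<open>t = 0\<close> and \<open>t = 1\<close>,
  is a homomorphism on \<open>P(k(t))\<close> with value \<open>1\<close> at \<open>{t}\<close>.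

  A scheme consists of elements of one fixed type, so the line, its open subsets and the point are
  realized as explicit curves whose rings of sections lie in the function field.
\<close>

section \<open>Ringed spaces and affine charts\<close>

text \<open>Taking \<open>x = 2\<close> writes the constant \<open>{x} + {1 - x}\<close> in symbols
  of elements of \<open>k\<close>, and 2 is a unit in characteristic zero. Such symbols exist on
  every open set, and \<open>1 - t\<close> is a unit near \<open>t = 0\<close>; this carries
  \<sigma>(t) across a point at which \<open>t\<close> itself has no symbol. The value at
  \<open>k(t)\<close> is a colimit, so the relation holds only on some open set \<open>D\<close>
  that is not known. Hence the gluing is between the complement of 0 and \<open>D\<close> with 0
  added: these meet exactly in \<open>D\<close>, and they cover the line because every other point
  missing from \<open>D\<close> lies in the first set. Two obstacles shape the rest. Equality in the
  colimit involves arbitrary models of the function field, so every model must receive a morphism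
  from a small open subset of the line. And smooth schemes are separated, a condition on every
  product in the universe that provides no product to compute with; so the diagonal is tested by
  points with values in residue fields. Residue fields and the function field have to be realized in
  the universe, which is possible because it is infinite.\<close>

lemma ring_hom_Units:
  assumes "f \<in> ring_hom R S" "cring R" "cring S" "x \<in> Units R"
  shows "f x \<in> Units S"
proof -
  interpret R: cring R by fact
  interpret S: cring S by fact
  obtain y where y: "y \<in> carrier R" "x \<in> carrier R" "x \<otimes>\<^bsub>R\<^esub> y = \<one>\<^bsub>R\<^esub>" "y \<otimes>\<^bsub>R\<^esub> x = \<one>\<^bsub>R\<^esub>"
    using assms(4) unfolding Units_def by auto
  have "f x \<in> carrier S" "f y \<in> carrier S" "f x \<otimes>\<^bsub>S\<^esub> f y = \<one>\<^bsub>S\<^esub>" "f y \<otimes>\<^bsub>S\<^esub> f x = \<one>\<^bsub>S\<^esub>"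
    using y assms(1) by (metis ring_hom_closed ring_hom_mult ring_hom_one)+
  then show ?thesis unfolding Units_def by blast
qed

lemma ring_hom_pow:
  assumes "f \<in> ring_hom R S" "cring R" "cring S" "x \<in> carrier R"
  shows "f (x [^]\<^bsub>R\<^esub> (n::nat)) = f x [^]\<^bsub>S\<^esub> n"
proof -
  interpret ring_hom_cring R S f
    using assms by (simp add: ring_hom_cring_def ring_hom_cring_axioms_def)
  show ?thesis using assms(4) by simp
qed

lemma ring_hom_zero':
  assumes "f \<in> ring_hom R S" "cring R" "cring S"
  shows "f \<zero>\<^bsub>R\<^esub> = \<zero>\<^bsub>S\<^esub>"
  using assms ring_hom_zero[of f R S] by (simp add: cring_def)

text \<open>Values of homomorphisms on fractions are compared by cancelling the image of the
  denominator, hence the unit on the right.\<close>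

lemma Units_mult_cancel:
  assumes "cring R" "u \<in> Units R" "x \<in> carrier R" "y \<in> carrier R" "x \<otimes>\<^bsub>R\<^esub> u = y \<otimes>\<^bsub>R\<^esub> u"
  shows "x = y"
proof -
  interpret cring R by fact
  show ?thesis using assms(2-) by (metis Units_closed Units_l_cancel m_comm)
qed

lemma Units_multD:
  assumes "cring R" "x \<in> carrier R" "y \<in> carrier R" "x \<otimes>\<^bsub>R\<^esub> y \<in> Units R"
  shows "x \<in> Units R"
proof -
  interpret cring R by fact
  show ?thesis using assms(2-) by (meson divides_unit divides_prod_r dividesI)
qed

lemma Units_pow:
  assumes "cring R" "x \<in> Units R"
  shows "x [^]\<^bsub>R\<^esub> (n::nat) \<in> Units R"
proof -
  interpret cring R by fact
  show ?thesis using assms(2) by (simp add: Units_pow_closed)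
qed

locale ringed =
  fixes X :: "'u sch"
  assumes ringed: "ringed_space X"
begin

lemma sec_cring: "opn X U \<Longrightarrow> cring (sec X U)"
  using ringed[unfolded ringed_space_def, THEN conjunct1] by blast

lemma res_hom: "opn X U \<Longrightarrow> opn X V \<Longrightarrow> V \<subseteq> U \<Longrightarrow> res X U V \<in> ring_hom (sec X U) (sec X V)"
  using ringed[unfolded ringed_space_def, THEN conjunct2, THEN conjunct1] by blast

lemma res_closed:
  "opn X U \<Longrightarrow> opn X V \<Longrightarrow> V \<subseteq> U \<Longrightarrow> s \<in> carrier (sec X U) \<Longrightarrow> res X U V s \<in> carrier (sec X V)"
  using res_hom ring_hom_closed by metis

lemma res_id: "opn X U \<Longrightarrow> s \<in> carrier (sec X U) \<Longrightarrow> res X U U s = s"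
  using ringed[unfolded ringed_space_def, THEN conjunct2, THEN conjunct2, THEN conjunct1] by blast

lemma res_res:
  "opn X U \<Longrightarrow> opn X V \<Longrightarrow> opn X W \<Longrightarrow> W \<subseteq> V \<Longrightarrow> V \<subseteq> U \<Longrightarrow> s \<in> carrier (sec X U) \<Longrightarrow>
   res X V W (res X U V s) = res X U W s"
  using ringed[unfolded ringed_space_def, THEN conjunct2, THEN conjunct2, THEN conjunct2, THEN conjunct1] by blast

lemma sec_glue:
  assumes "\<forall>U\<in>\<U>. opn X U \<and> s U \<in> carrier (sec X U)"
    "\<forall>U\<in>\<U>. \<forall>V\<in>\<U>. res X U (U \<inter> V) (s U) = res X V (U \<inter> V) (s V)"
  shows "\<exists>!t. t \<in> carrier (sec X (\<Union>\<U>)) \<and> (\<forall>U\<in>\<U>. res X (\<Union>\<U>) U t = s U)"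
  using ringed[unfolded ringed_space_def, THEN conjunct2, THEN conjunct2, THEN conjunct2, THEN conjunct2] assms
  by (elim allE[of _ \<U>] allE[of _ s]) simp

lemma res_Units:
  "opn X U \<Longrightarrow> opn X V \<Longrightarrow> V \<subseteq> U \<Longrightarrow> s \<in> Units (sec X U) \<Longrightarrow> res X U V s \<in> Units (sec X V)"
  using ring_hom_Units res_hom sec_cring by metis

text \<open>Uniqueness in the sheaf axiom, applied to the family of restrictions of
  \<open>s\<close>: both \<open>s\<close> and \<open>t\<close> glue it.\<close>

lemma sec_eqI:
  assumes \<U>: "\<And>V. V \<in> \<U> \<Longrightarrow> opn X V" and U: "U = \<Union>\<U>"
    and s: "s \<in> carrier (sec X U)" and t: "t \<in> carrier (sec X U)"
    and eq: "\<And>V. V \<in> \<U> \<Longrightarrow> res X U V s = res X U V t"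
  shows "s = t"
proof -
  have oU: "opn X U" unfolding U using \<U> by blast
  define r where "r = (\<lambda>V. res X U V s)"
  have 1: "\<forall>V\<in>\<U>. opn X V \<and> r V \<in> carrier (sec X V)"
    using \<U> oU s U unfolding r_def by (auto intro: res_closed)
  have 2: "\<forall>V\<in>\<U>. \<forall>W\<in>\<U>. res X V (V \<inter> W) (r V) = res X W (V \<inter> W) (r W)"
  proof (intro ballI)
    fix V W assume VW: "V \<in> \<U>" "W \<in> \<U>"
    have o: "opn X V" "opn X W" "opn X (V \<inter> W)" "V \<subseteq> U" "W \<subseteq> U"
      using VW \<U> U by (auto simp: openin_Int)
    show "res X V (V \<inter> W) (r V) = res X W (V \<inter> W) (r W)"
      unfolding r_def using res_res[OF oU o(1) o(3) _ o(4) s] res_res[OF oU o(2) o(3) _ o(5) s] by simp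
  qed
  have "\<exists>!t. t \<in> carrier (sec X (\<Union>\<U>)) \<and> (\<forall>V\<in>\<U>. res X (\<Union>\<U>) V t = r V)"
    using sec_glue[OF 1 2] .
  then show ?thesis using s t eq U unfolding r_def by (metis (no_types, lifting))
qed

end

section \<open>Open subschemes\<close>

lemma pts_open_sub: "opn X U \<Longrightarrow> pts (open_sub X U) = U"
  unfolding open_sub_def by (simp add: inf.absorb2 openin_subset)

lemma opn_open_sub: "opn X U \<Longrightarrow> opn (open_sub X U) V \<longleftrightarrow> opn X V \<and> V \<subseteq> U"
  unfolding open_sub_def by (simp add: openin_open_subtopology)

lemma sec_open_sub [simp]: "sec (open_sub X U) = sec X" "res (open_sub X U) = res X"
  by (simp_all add: open_sub_def)

lemma ringed_space_open_sub:
  assumes "ringed_space X" "opn X U"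
  shows "ringed_space (open_sub X U)"
proof -
  interpret ringed X using assms(1) by unfold_locales
  have o: "\<And>V. opn (open_sub X U) V \<longleftrightarrow> opn X V \<and> V \<subseteq> U" by (rule opn_open_sub[OF assms(2)])
  show ?thesis
    unfolding ringed_space_def o sec_open_sub
  proof (intro conjI allI impI; elim conjE)
    fix \<U> s
    assume 1: "\<forall>V\<in>\<U>. (opn X V \<and> V \<subseteq> U) \<and> s V \<in> carrier (sec X V)"
      and 2: "\<forall>U\<in>\<U>. \<forall>V\<in>\<U>. res X U (U \<inter> V) (s U) = res X V (U \<inter> V) (s V)"
    show "\<exists>!t. t \<in> carrier (sec X (\<Union>\<U>)) \<and> (\<forall>V\<in>\<U>. res X (\<Union>\<U>) V t = s V)"
      by (rule sec_glue) (use 1 2 in blast)+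
  qed (simp_all add: sec_cring res_hom res_id res_res)
qed

text \<open>The affine open subsets, with the homeomorphism to the spectrum expressed by the base of basic open
  sets instead of the spectral topology.\<close>

definition chart :: "'u sch \<Rightarrow> 'u set \<Rightarrow> ('u \<Rightarrow> 'u set) \<Rightarrow> bool" where
  "chart Y U h \<longleftrightarrow> opn Y U \<and> bij_betw h U {p. primeideal p (sec Y U)} \<and>
     (\<forall>f\<in>carrier (sec Y U). opn Y {x\<in>U. f \<notin> h x} \<and>
        is_localization (sec Y U) f (sec Y {x\<in>U. f \<notin> h x}) (res Y U {x\<in>U. f \<notin> h x})) \<and>
     (\<forall>W x. opn Y W \<and> x \<in> W \<and> x \<in> U \<longrightarrow>
        (\<exists>f\<in>carrier (sec Y U). f \<notin> h x \<and> {y\<in>U. f \<notin> h y} \<subseteq> W))"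

section \<open>Affine open subsets and the base of basic open sets\<close>

lemma openin_spec_basic: "f \<in> carrier A \<Longrightarrow> openin (spec_topology A) {p. primeideal p A \<and> f \<notin> p}"
  unfolding spec_topology_def openin_topology_generated_by_iff
  by (rule generate_topology_on.Basis) blast

text \<open>A prime ideal is proper, so some ring element avoids it and the point lies in a basic
  open set.\<close>

lemma topspace_spec: "topspace (spec_topology A) = {p. primeideal p A}"
proof -
  have "\<exists>f\<in>carrier A. f \<notin> p" if "primeideal p A" for p
    using primeideal.I_notcarr[OF that] additive_subgroup.a_subset[OF ideal.axioms(1)[OF primeideal.axioms(1)[OF that]]]
    by blast
  then show ?thesis unfolding spec_topology_def topology_generated_by_topspace by blast
qed

text \<open>In the induction on the generated topology only intersections need an argument: a point
  of \<open>D(f)\<close> and \<open>D(g)\<close> lies in \<open>D(fg)\<close> by primality, and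
  \<open>D(fg)\<close> is contained in both.\<close>

lemma openin_spec_base:
  assumes "cring A" "openin (spec_topology A) W" "p \<in> W" "primeideal p A"
  shows "\<exists>f\<in>carrier A. f \<notin> p \<and> {q. primeideal q A \<and> f \<notin> q} \<subseteq> W"
proof -
  interpret cring A by fact
  interpret p: primeideal p A by fact
  have "generate_topology_on ((\<lambda>f. {p. primeideal p A \<and> f \<notin> p}) ` carrier A) W"
    using assms(2) unfolding spec_topology_def openin_topology_generated_by_iff .
  then show ?thesis using assms(3)
  proof (induction rule: generate_topology_on.induct)
    case (Int a b)
    then obtain f g where fg: "f \<in> carrier A" "f \<notin> p" "{q. primeideal q A \<and> f \<notin> q} \<subseteq> a"
      "g \<in> carrier A" "g \<notin> p" "{q. primeideal q A \<and> g \<notin> q} \<subseteq> b" by blast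
    have "f \<otimes>\<^bsub>A\<^esub> g \<notin> p" using fg p.I_prime by blast
    moreover have "{q. primeideal q A \<and> f \<otimes>\<^bsub>A\<^esub> g \<notin> q} \<subseteq> a \<inter> b"
    proof
      fix q assume "q \<in> {q. primeideal q A \<and> f \<otimes>\<^bsub>A\<^esub> g \<notin> q}"
      then have q: "primeideal q A" "f \<otimes>\<^bsub>A\<^esub> g \<notin> q" by auto
      interpret q: primeideal q A by fact
      have "f \<notin> q" "g \<notin> q" using q(2) fg q.I_r_closed q.I_l_closed by blast+
      then show "q \<in> a \<inter> b" using fg q by blast
    qed
    ultimately show ?case using fg by blast
  next
    case (UN K)
    then show ?case by blast
  next
    case (Basis s)
    then show ?case by blast
  qed simp
qed

text \<open>The homeomorphism is used in both directions. Continuity makes the basic sets open in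
  \<open>Y\<close>; openness carries a neighbourhood of \<open>x\<close> to the spectrum, where it
  contains a basic set, and injectivity brings this set back.\<close>

lemma affine_open_chart:
  assumes "affine_open Y U"
  obtains h where "chart Y U h"
proof -
  have oU: "opn Y U" using assms by (simp add: affine_open_def)
  have P: "pts (open_sub Y U) = U" by (rule pts_open_sub[OF oU])
  obtain h where "ringed_space (open_sub Y U)" and h: "homeomorphic_map (sp (open_sub Y U)) (spec_topology (sec Y U)) h"
    and loc: "\<And>f. f \<in> carrier (sec Y U) \<Longrightarrow> is_localization (sec Y U) f (sec Y {x\<in>U. f \<notin> h x}) (res Y U {x\<in>U. f \<notin> h x})"
    using assms P unfolding affine_open_def affine_def by auto
  then interpret S: ringed "open_sub Y U" by unfold_locales
  have B: "cring (sec Y U)" using S.sec_cring opn_open_sub[OF oU] oU by simp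
  have bij: "bij_betw h U {p. primeideal p (sec Y U)}"
    using homeomorphic_imp_injective_map[OF h] homeomorphic_imp_surjective_map[OF h] P topspace_spec
    unfolding bij_betw_def by metis
  have o: "opn Y {x\<in>U. f \<notin> h x}" if f: "f \<in> carrier (sec Y U)" for f
  proof -
    have "openin (sp (open_sub Y U)) {x \<in> pts (open_sub Y U). h x \<in> {p. primeideal p (sec Y U) \<and> f \<notin> p}}"
      using homeomorphic_imp_continuous_map[OF h] openin_spec_basic[OF f]
      by (rule openin_continuous_map_preimage)
    moreover have "{x \<in> pts (open_sub Y U). h x \<in> {p. primeideal p (sec Y U) \<and> f \<notin> p}} = {x\<in>U. f \<notin> h x}"
      using bij P unfolding bij_betw_def by auto
    ultimately show ?thesis using opn_open_sub[OF oU] by simp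
  qed
  have base: "\<exists>f\<in>carrier (sec Y U). f \<notin> h x \<and> {y\<in>U. f \<notin> h y} \<subseteq> W" if W: "opn Y W" "x \<in> W" "x \<in> U" for W x
  proof -
    have "openin (sp (open_sub Y U)) (W \<inter> U)" using W(1) oU opn_open_sub[OF oU] by (simp add: openin_Int)
    then have "openin (spec_topology (sec Y U)) (h ` (W \<inter> U))"
      using homeomorphic_imp_open_map[OF h] unfolding open_map_def by blast
    moreover have "h x \<in> h ` (W \<inter> U)" "primeideal (h x) (sec Y U)"
      using W bij unfolding bij_betw_def by blast+
    ultimately obtain f where f: "f \<in> carrier (sec Y U)" "f \<notin> h x"
      "{q. primeideal q (sec Y U) \<and> f \<notin> q} \<subseteq> h ` (W \<inter> U)"
      using openin_spec_base[OF B] by blast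
    have "y \<in> W" if "y \<in> U" "f \<notin> h y" for y
    proof -
      have "h y \<in> h ` (W \<inter> U)" using f(3) that bij unfolding bij_betw_def by blast
      then show ?thesis using that bij unfolding bij_betw_def by (metis IntE imageE inj_onD)
    qed
    then show ?thesis using f by blast
  qed
  show ?thesis using that oU bij o loc base unfolding chart_def by blast
qed

text \<open>A continuous open bijection is a homeomorphism. Continuity is checked on the generating
  basic sets, and images of open sets are open because the base condition of the chart makes them
  unions of basic sets.\<close>

lemma chart_affine_open:
  assumes "ringed_space Y" "chart Y U h"
  shows "affine_open Y U"
proof -
  have oU: "opn Y U" using assms by (simp add: chart_def)
  note P = pts_open_sub[OF oU] and O = opn_open_sub[OF oU]
  have bij: "bij_betw h U {p. primeideal p (sec Y U)}"
    and o: "\<And>f. f \<in> carrier (sec Y U) \<Longrightarrow> opn Y {x\<in>U. f \<notin> h x}"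
    and base: "\<And>W x. opn Y W \<Longrightarrow> x \<in> W \<Longrightarrow> x \<in> U \<Longrightarrow> \<exists>f\<in>carrier (sec Y U). f \<notin> h x \<and> {y\<in>U. f \<notin> h y} \<subseteq> W"
    using assms(2) unfolding chart_def by blast+
  have him: "h ` {x\<in>U. f \<notin> h x} = {p. primeideal p (sec Y U) \<and> f \<notin> p}" for f
    using bij unfolding bij_betw_def by blast
  have "homeomorphic_map (sp (open_sub Y U)) (spec_topology (sec Y U)) h"
  proof (rule bijective_open_imp_homeomorphic_map)
    show "continuous_map (sp (open_sub Y U)) (spec_topology (sec Y U)) h"
      unfolding spec_topology_def
    proof (rule continuous_on_generated_topo)
      fix W assume "W \<in> (\<lambda>f. {p. primeideal p (sec Y U) \<and> f \<notin> p}) ` carrier (sec Y U)"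
      then obtain f where f: "f \<in> carrier (sec Y U)" "W = {p. primeideal p (sec Y U) \<and> f \<notin> p}" by blast
      have "h -` W \<inter> pts (open_sub Y U) = {x\<in>U. f \<notin> h x}"
        using bij P f(2) unfolding bij_betw_def by auto
      then show "opn (open_sub Y U) (h -` W \<inter> pts (open_sub Y U))" using o[OF f(1)] O by auto
    next
      have "h ` U \<subseteq> topspace (spec_topology (sec Y U))" using bij topspace_spec unfolding bij_betw_def by blast
      then show "h ` pts (open_sub Y U) \<subseteq> \<Union> ((\<lambda>f. {p. primeideal p (sec Y U) \<and> f \<notin> p}) ` carrier (sec Y U))"
        unfolding P spec_topology_def topology_generated_by_topspace .
    qed
  next
    show "open_map (sp (open_sub Y U)) (spec_topology (sec Y U)) h"
      unfolding open_map_def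
    proof (intro allI impI)
      fix W assume "openin (sp (open_sub Y U)) W"
      then have W: "opn Y W" "W \<subseteq> U" using O by auto
      have "\<exists>T. openin (spec_topology (sec Y U)) T \<and> p \<in> T \<and> T \<subseteq> h ` W" if "p \<in> h ` W" for p
      proof -
        from that obtain x where x: "x \<in> W" "p = h x" by blast
        obtain f where f: "f \<in> carrier (sec Y U)" "f \<notin> h x" "{y\<in>U. f \<notin> h y} \<subseteq> W" using base[OF W(1) x(1)] x W by blast
        have "p \<in> h ` {y\<in>U. f \<notin> h y}" "h ` {y\<in>U. f \<notin> h y} \<subseteq> h ` W" using x f W by blast+
        then show ?thesis using openin_spec_basic[OF f(1)] him[of f] by metis
      qed
      then show "openin (spec_topology (sec Y U)) (h ` W)" using openin_subopen by metis
    qed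
  next
    show "h ` pts (open_sub Y U) = topspace (spec_topology (sec Y U))"
      using bij P topspace_spec unfolding bij_betw_def by metis
    show "inj_on h (pts (open_sub Y U))" using bij P unfolding bij_betw_def by metis
  qed
  moreover have "\<forall>f\<in>carrier (sec Y U). is_localization (sec Y U) f (sec Y {x\<in>U. f \<notin> h x}) (res Y U {x\<in>U. f \<notin> h x})"
    using assms(2) unfolding chart_def by blast
  ultimately show ?thesis
    using ringed_space_open_sub[OF assms(1) oU] oU unfolding affine_open_def affine_def by (auto simp: P)
qed

text \<open>Vanishing depends only on the germ at \<open>x\<close>: a neighbourhood \<open>W\<close>
  on which \<open>s\<close> becomes a unit may be shrunk to \<open>W \<inter> V\<close>.\<close>

lemma (in ringed) vanishes_res:
  assumes "opn X U" "opn X V" "V \<subseteq> U" "x \<in> V" "s \<in> carrier (sec X U)"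
  shows "vanishes X V (res X U V s) x \<longleftrightarrow> vanishes X U s x"
proof
  assume "vanishes X U s x"
  then show "vanishes X V (res X U V s) x"
    unfolding vanishes_def using assms res_res by (metis subset_trans)
next
  assume v: "vanishes X V (res X U V s) x"
  show "vanishes X U s x" unfolding vanishes_def
  proof (intro allI impI notI; elim conjE)
    fix W assume W: "opn X W" "x \<in> W" "W \<subseteq> U" "res X U W s \<in> Units (sec X W)"
    have o: "opn X (W \<inter> V)" using W assms by (simp add: openin_Int)
    have "res X W (W \<inter> V) (res X U W s) \<in> Units (sec X (W \<inter> V))" using res_Units[OF W(1) o _ W(4)] by simp
    then have "res X V (W \<inter> V) (res X U V s) \<in> Units (sec X (W \<inter> V))"
      using res_res[OF assms(1) W(1) o _ W(3) assms(5)] res_res[OF assms(1) assms(2) o _ assms(3) assms(5)] by simp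
    then show False using v W assms(4) o unfolding vanishes_def by blast
  qed
qed

lemma (in ringed) vanishes_unit_mult:
  assumes "opn X U" "x \<in> U" "s \<in> carrier (sec X U)" "u \<in> Units (sec X U)"
  shows "vanishes X U (u \<otimes>\<^bsub>sec X U\<^esub> s) x \<longleftrightarrow> vanishes X U s x"
proof -
  have "res X U W (u \<otimes>\<^bsub>sec X U\<^esub> s) \<in> Units (sec X W) \<longleftrightarrow> res X U W s \<in> Units (sec X W)"
    if W: "opn X W" "W \<subseteq> U" for W
  proof -
    interpret W: cring "sec X W" using W by (simp add: sec_cring)
    interpret U: cring "sec X U" using assms by (simp add: sec_cring)
    have u: "res X U W u \<in> Units (sec X W)" using res_Units assms W by blast
    have s: "res X U W s \<in> carrier (sec X W)" using res_closed assms W by blast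
    have "res X U W (u \<otimes>\<^bsub>sec X U\<^esub> s) = res X U W u \<otimes>\<^bsub>sec X W\<^esub> res X U W s"
      using res_hom[OF assms(1) W] assms by (simp add: ring_hom_mult U.Units_closed)
    then show ?thesis using u s W.Units_closed[OF u] W.Units_m_closed
      by (metis W.m_comm Units_multD W.is_cring)
  qed
  then show ?thesis unfolding vanishes_def by blast
qed

locale ringed_chart = ringed X for X :: "'u sch" +
  fixes U h
  assumes chart: "chart X U h"
begin

abbreviation "B \<equiv> sec X U"
definition D where "D f = {x\<in>U. f \<notin> h x}"

lemma opn_U: "opn X U" using chart by (simp add: chart_def)
lemma opn_D: "f \<in> carrier B \<Longrightarrow> opn X (D f)" using chart by (simp add: chart_def D_def)
lemma loc_D: "f \<in> carrier B \<Longrightarrow> is_localization B f (sec X (D f)) (res X U (D f))"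
  using chart by (simp add: chart_def D_def)
lemma D_sub: "D f \<subseteq> U" by (auto simp: D_def)
lemma h_inj: "inj_on h U" using chart by (simp add: chart_def bij_betw_def)
lemma h_prime: "x \<in> U \<Longrightarrow> primeideal (h x) B" using chart by (auto simp: chart_def bij_betw_def)
lemma h_surj: "primeideal p B \<Longrightarrow> \<exists>x\<in>U. h x = p"
proof -
  assume "primeideal p B"
  then have "p \<in> h ` U" using chart by (simp add: chart_def bij_betw_def)
  then show ?thesis by auto
qed
lemma base: "opn X W \<Longrightarrow> x \<in> W \<Longrightarrow> x \<in> U \<Longrightarrow> \<exists>f\<in>carrier B. x \<in> D f \<and> D f \<subseteq> W"
  using chart by (simp add: chart_def D_def)
lemma B_cring: "cring B" using sec_cring opn_U by blast

lemma h_sub: "x \<in> U \<Longrightarrow> h x \<subseteq> carrier B"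
  using h_prime additive_subgroup.a_subset ideal.axioms(1) primeideal.axioms(1) by metis

lemma D_mult: "f \<in> carrier B \<Longrightarrow> g \<in> carrier B \<Longrightarrow> D (f \<otimes>\<^bsub>B\<^esub> g) = D f \<inter> D g"
proof -
  assume fg: "f \<in> carrier B" "g \<in> carrier B"
  have "f \<otimes>\<^bsub>B\<^esub> g \<in> h x \<longleftrightarrow> f \<in> h x \<or> g \<in> h x" if "x \<in> U" for x
  proof -
    interpret p: primeideal "h x" B using h_prime[OF that] .
    show ?thesis using fg p.I_prime p.I_l_closed p.I_r_closed by blast
  qed
  then show ?thesis unfolding D_def by blast
qed

text \<open>The exponent is a successor because the power 0 would give all of
  \<open>U\<close>.\<close>

lemma D_pow:
  assumes "f \<in> carrier B"
  shows "D (f [^]\<^bsub>B\<^esub> Suc n) = D f"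
proof (induction n)
  interpret cring B by (rule B_cring)
  case 0
  then show ?case using assms by simp
next
  interpret cring B by (rule B_cring)
  case (Suc n)
  then show ?case using assms D_mult[of "f [^]\<^bsub>B\<^esub> Suc n" f] by simp
qed

lemma res_D_unit: "f \<in> carrier B \<Longrightarrow> res X U (D f) f \<in> Units (sec X (D f))"
  using loc_D unfolding is_localization_def by blast

lemma local_fraction:
  assumes f: "f \<in> carrier B" and s: "s \<in> carrier (sec X (D f))"
  obtains a b where "a \<in> carrier B" "b \<in> carrier B" "D b = D f"
    "res X U (D f) b \<in> Units (sec X (D f))"
    "s \<otimes>\<^bsub>sec X (D f)\<^esub> res X U (D f) b = res X U (D f) a"
    "\<And>x. x \<in> U \<Longrightarrow> f \<notin> h x \<Longrightarrow> b \<notin> h x"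
proof -
  interpret B: cring B by (rule B_cring)
  interpret R: cring "sec X (D f)" using sec_cring opn_D[OF f] by blast
  let ?r = "res X U (D f)"
  have rh: "?r \<in> ring_hom B (sec X (D f))" using res_hom opn_U opn_D[OF f] D_sub by blast
  obtain a n where a: "a \<in> carrier B" "s \<otimes>\<^bsub>sec X (D f)\<^esub> (?r f [^]\<^bsub>sec X (D f)\<^esub> (n::nat)) = ?r a"
    using loc_D[OF f] s unfolding is_localization_def by blast
  \<comment> \<open>The exponent is \<open>Suc n\<close> and not \<open>n\<close>: for
    \<open>n = 0\<close> the denominator would be 1, with basic set \<open>U\<close> instead of
    \<open>D f\<close>. The numerator is multiplied by \<open>f\<close> accordingly.\<close>
  define b where "b = f [^]\<^bsub>B\<^esub> Suc n"
  have rf: "?r f \<in> carrier (sec X (D f))" using rh f by (rule ring_hom_closed)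
  have b: "b \<in> carrier B" using f by (simp add: b_def)
  have rb: "?r b = (?r f [^]\<^bsub>sec X (D f)\<^esub> n) \<otimes>\<^bsub>sec X (D f)\<^esub> ?r f"
    unfolding b_def using ring_hom_pow[OF rh B_cring R.is_cring f, of "Suc n"] by simp
  have "s \<otimes>\<^bsub>sec X (D f)\<^esub> ?r b = ?r a \<otimes>\<^bsub>sec X (D f)\<^esub> ?r f"
    unfolding rb a(2)[symmetric] using s rf by (simp add: R.m_assoc)
  also have "\<dots> = ?r (a \<otimes>\<^bsub>B\<^esub> f)" using rh a f by (simp add: ring_hom_mult)
  finally have 1: "s \<otimes>\<^bsub>sec X (D f)\<^esub> ?r b = ?r (a \<otimes>\<^bsub>B\<^esub> f)" .
  have Db: "D b = D f" unfolding b_def using D_pow f by blast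
  then have 2: "?r b \<in> Units (sec X (D f))" using res_D_unit[OF b] by simp
  show ?thesis
    by (rule that[OF _ b Db 2 1]) (use a f Db in \<open>auto simp: D_def\<close>)
qed

text \<open>For the harder direction let \<open>s\<close> in \<open>h x\<close> become a unit near
  \<open>x\<close>, hence on some \<open>D f\<close> containing \<open>x\<close>. There its inverse
  is a fraction \<open>a/b\<close>, so \<open>a s = b\<close> up to a power of \<open>f\<close>. As
  \<open>f\<close> lies outside the prime \<open>h x\<close>, this puts \<open>b\<close> into
  \<open>h x\<close>, contradicting \<open>D b = D f\<close>.\<close>

lemma vanishes_iff:
  assumes x: "x \<in> U" and s: "s \<in> carrier B"
  shows "vanishes X U s x \<longleftrightarrow> s \<in> h x"
proof
  assume v: "vanishes X U s x"
  show "s \<in> h x"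
  proof (rule ccontr)
    assume "s \<notin> h x"
    then have "x \<in> D s" using x by (simp add: D_def)
    then show False using v res_D_unit[OF s] opn_D[OF s] D_sub unfolding vanishes_def by blast
  qed
next
  assume sh: "s \<in> h x"
  interpret B: cring B by (rule B_cring)
  interpret p: primeideal "h x" B using h_prime[OF x] .
  show "vanishes X U s x" unfolding vanishes_def
  proof (intro allI impI notI; elim conjE)
    fix W assume W: "opn X W" "x \<in> W" "W \<subseteq> U" "res X U W s \<in> Units (sec X W)"
    obtain f where f: "f \<in> carrier B" "x \<in> D f" "D f \<subseteq> W" using base[OF W(1,2) x] by blast
    let ?r = "res X U (D f)"
    interpret R: cring "sec X (D f)" using sec_cring opn_D[OF f(1)] by blast
    have "?r s \<in> Units (sec X (D f))"
      using res_Units[OF W(1) opn_D[OF f(1)] f(3) W(4)] res_res[OF opn_U W(1) opn_D[OF f(1)] f(3) W(3) s] by simp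
    then obtain t where t: "t \<in> carrier (sec X (D f))" "t \<otimes>\<^bsub>sec X (D f)\<^esub> ?r s = \<one>\<^bsub>sec X (D f)\<^esub>"
      unfolding Units_def by blast
    obtain a b where ab: "a \<in> carrier B" "b \<in> carrier B" "D b = D f" "t \<otimes>\<^bsub>sec X (D f)\<^esub> ?r b = ?r a"
      using local_fraction[OF f(1) t(1)] by metis
    have rh: "?r \<in> ring_hom B (sec X (D f))" using res_hom opn_U opn_D[OF f(1)] D_sub by blast
    have c: "?r a \<in> carrier (sec X (D f))" "?r b \<in> carrier (sec X (D f))" "?r s \<in> carrier (sec X (D f))"
      using rh ab s ring_hom_closed by metis+
    have "?r (a \<otimes>\<^bsub>B\<^esub> s) = ?r a \<otimes>\<^bsub>sec X (D f)\<^esub> ?r s" using rh ab s by (simp add: ring_hom_mult)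
    also have "\<dots> = (t \<otimes>\<^bsub>sec X (D f)\<^esub> ?r s) \<otimes>\<^bsub>sec X (D f)\<^esub> ?r b"
      unfolding ab(4)[symmetric] using t c by (metis R.m_assoc R.m_comm)
    also have "\<dots> = ?r b" using t c by simp
    finally have eq: "?r (a \<otimes>\<^bsub>B\<^esub> s) = ?r b" .
    let ?d = "a \<otimes>\<^bsub>B\<^esub> s \<ominus>\<^bsub>B\<^esub> b"
    have "ring_hom_ring B (sec X (D f)) ?r"
      by (rule ring_hom_ringI2[OF B.ring_axioms R.ring_axioms rh])
    then interpret H: ring_hom_ring B "sec X (D f)" ?r .
    have "?r ?d = \<zero>\<^bsub>sec X (D f)\<^esub>" using eq ab s c unfolding a_minus_def
      by (simp add: R.r_neg del: H.hom_mult)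
    then obtain n where n: "(f [^]\<^bsub>B\<^esub> (n::nat)) \<otimes>\<^bsub>B\<^esub> ?d = \<zero>\<^bsub>B\<^esub>"
      using loc_D[OF f(1)] ab s unfolding is_localization_def by (metis B.m_closed B.minus_closed)
    have fn: "f [^]\<^bsub>B\<^esub> n \<notin> h x"
    proof (induction n)
      case 0
      then show ?case using p.one_imp_carrier p.I_notcarr by auto
    next
      case (Suc n)
      then show ?case using p.I_prime[of "f [^]\<^bsub>B\<^esub> n" f] f(1,2) by (auto simp: D_def)
    qed
    have "(f [^]\<^bsub>B\<^esub> (n::nat)) \<otimes>\<^bsub>B\<^esub> ?d \<in> h x" unfolding n by simp
    then have "?d \<in> h x" using fn p.I_prime[of "f [^]\<^bsub>B\<^esub> n" ?d] ab(1,2) s f(1) by auto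
    moreover have "a \<otimes>\<^bsub>B\<^esub> s \<in> h x" using sh ab(1) p.I_l_closed by blast
    ultimately have "a \<otimes>\<^bsub>B\<^esub> s \<ominus>\<^bsub>B\<^esub> ?d \<in> h x" unfolding a_minus_def by (simp add: p.a_closed p.a_inv_closed)
    moreover have "a \<otimes>\<^bsub>B\<^esub> s \<ominus>\<^bsub>B\<^esub> ?d = b"
      unfolding a_minus_def using ab s by (simp add: B.minus_add B.r_neg2 B.a_assoc[symmetric] B.r_neg)
    ultimately have "b \<in> h x" by simp
    then show False using ab(3) f(2) unfolding D_def by blast
  qed
qed

end

section \<open>Morphisms\<close>

lemma morD:
  assumes "is_mor k X Y f"
  shows mor_cont: "continuous_map (sp X) (sp Y) (pt f)"
    and mor_pt_ext: "pt f \<in> extensional (pts X)"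
    and mor_sh_ext: "sh f \<in> extensional {V. opn Y V}"
    and mor_hom: "opn Y V \<Longrightarrow> sh f V \<in> ring_hom (sec Y V) (sec X (pre X f V))"
    and mor_sh_ext2: "opn Y V \<Longrightarrow> sh f V \<in> extensional (carrier (sec Y V))"
    and mor_res: "opn Y V \<Longrightarrow> opn Y W \<Longrightarrow> W \<subseteq> V \<Longrightarrow> s \<in> carrier (sec Y V) \<Longrightarrow>
        sh f W (res Y V W s) = res X (pre X f V) (pre X f W) (sh f V s)"
    and mor_str: "c \<in> carrier k \<Longrightarrow> sh f (pts Y) (str Y c) = str X c"
    and mor_local: "opn Y V \<Longrightarrow> s \<in> carrier (sec Y V) \<Longrightarrow> x \<in> pre X f V \<Longrightarrow>
        vanishes Y V s (pt f x) \<Longrightarrow> vanishes X (pre X f V) (sh f V s) x"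
  using assms unfolding is_mor_def by simp_all

lemma mor_pts: "is_mor k X Y f \<Longrightarrow> x \<in> pts X \<Longrightarrow> pt f x \<in> pts Y"
  using continuous_map_funspace[OF mor_cont, of k X Y f] by (auto simp: Pi_iff)

lemma mor_closed: "is_mor k X Y f \<Longrightarrow> opn Y V \<Longrightarrow> s \<in> carrier (sec Y V) \<Longrightarrow>
    sh f V s \<in> carrier (sec X (pre X f V))"
  using mor_hom ring_hom_closed by metis

lemma pre_opn: "is_mor k X Y f \<Longrightarrow> opn Y V \<Longrightarrow> opn X (pre X f V)"
  unfolding pre_def using mor_cont openin_continuous_map_preimage by metis

lemma pre_mono: "W \<subseteq> V \<Longrightarrow> pre X f W \<subseteq> pre X f V"
  unfolding pre_def by blast

lemma pre_pts: "is_mor k X Y f \<Longrightarrow> pre X f (pts Y) = pts X"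
  unfolding pre_def using mor_pts[of k X Y f] by auto

lemma mem_pre: "x \<in> pre X f V \<longleftrightarrow> x \<in> pts X \<and> pt f x \<in> V"
  unfolding pre_def by blast

lemma pt_comp: "x \<in> pts X \<Longrightarrow> pt (mor_comp X Y Z g f) x = pt g (pt f x)"
  by (simp add: mor_comp_def)

lemma sh_comp: "opn Z V \<Longrightarrow> s \<in> carrier (sec Z V) \<Longrightarrow>
    sh (mor_comp X Y Z g f) V s = sh f (pre Y g V) (sh g V s)"
  by (simp add: mor_comp_def)

lemma pre_comp: "is_mor k X Y f \<Longrightarrow> pre X (mor_comp X Y Z g f) V = pre X f (pre Y g V)"
  using mor_pts by (auto simp: mem_pre pt_comp)

lemma ring_hom_comp:
  assumes "f \<in> ring_hom R S" "g \<in> ring_hom S T"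
  shows "(\<lambda>x. g (f x)) \<in> ring_hom R T"
  using assms by (simp add: ring_hom_def Pi_def)

lemma ring_hom_cong:
  assumes "f \<in> ring_hom R S" "ring R" "\<And>x. x \<in> carrier R \<Longrightarrow> g x = f x"
  shows "g \<in> ring_hom R S"
proof -
  interpret ring R by fact
  show ?thesis using assms(1,3) by (simp add: ring_hom_def Pi_def)
qed

lemma mor_ext:
  assumes "is_mor k X Y f" "is_mor k X Y g"
    and "\<And>x. x \<in> pts X \<Longrightarrow> pt f x = pt g x"
    and "\<And>V s. opn Y V \<Longrightarrow> s \<in> carrier (sec Y V) \<Longrightarrow> sh f V s = sh g V s"
  shows "f = g"
proof -
  have "pt f = pt g"
    using mor_pt_ext[OF assms(1)] mor_pt_ext[OF assms(2)] assms(3) by (rule extensionalityI)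
  moreover have "sh f V = sh g V" if "opn Y V" for V
    using mor_sh_ext2[OF assms(1) that] mor_sh_ext2[OF assms(2) that] assms(4)[OF that]
    by (rule extensionalityI)
  then have "sh f = sh g"
    using mor_sh_ext[OF assms(1)] mor_sh_ext[OF assms(2)]
    by (intro extensionalityI[of _ "{V. opn Y V}"]) auto
  ultimately show ?thesis by (cases f, cases g) simp
qed

lemma is_mor_comp:
  assumes X: "ringed_space X" and Y: "ringed_space Y" and Z: "ringed_space Z"
    and f: "is_mor k X Y f" and g: "is_mor k Y Z g" and kZ: "str Z \<in> ring_hom k (glob Z)"
  shows "is_mor k X Z (mor_comp X Y Z g f)"
proof -
  interpret X: ringed X using X by unfold_locales
  interpret Y: ringed Y using Y by unfold_locales
  interpret Z: ringed Z using Z by unfold_locales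
  let ?m = "mor_comp X Y Z g f"
  note pre = pre_comp[OF f, of Z g]
  have 1: "continuous_map (sp X) (sp Z) (pt ?m)"
    using continuous_map_compose[OF mor_cont[OF f] mor_cont[OF g]]
    by (rule continuous_map_eq) (simp add: pt_comp)
  have 2: "sh ?m V \<in> ring_hom (sec Z V) (sec X (pre X ?m V))" if V: "opn Z V" for V
    unfolding pre
    by (rule ring_hom_cong[OF ring_hom_comp[OF mor_hom[OF g V] mor_hom[OF f pre_opn[OF g V]]]])
      (use Z.sec_cring[OF V] V in \<open>auto simp: sh_comp cring_def\<close>)
  have 3: "sh ?m W (res Z V W s) = res X (pre X ?m V) (pre X ?m W) (sh ?m V s)"
    if "opn Z V" "opn Z W" "W \<subseteq> V" "s \<in> carrier (sec Z V)" for V W s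
    using that Z.res_closed[OF that] mor_closed[OF g that(1,4)] mor_res[OF g that]
      mor_res[OF f pre_opn[OF g that(1)] pre_opn[OF g that(2)] pre_mono[OF that(3)]]
    by (simp add: sh_comp pre)
  have 4: "vanishes X (pre X ?m V) (sh ?m V s) x"
    if "opn Z V" "s \<in> carrier (sec Z V)" "x \<in> pre X ?m V" "vanishes Z V s (pt ?m x)" for V s x
  proof -
    have x: "x \<in> pre X f (pre Y g V)" using that(3) pre by simp
    then have y: "x \<in> pts X" "pt f x \<in> pre Y g V" by (auto simp: mem_pre)
    have "vanishes Y (pre Y g V) (sh g V s) (pt f x)"
      using mor_local[OF g that(1,2) y(2)] that(4) y(1) by (simp add: pt_comp)
    then show ?thesis
      using mor_local[OF f pre_opn[OF g that(1)] mor_closed[OF g that(1,2)] x] that by (simp add: sh_comp pre)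
  qed
  have 5: "sh ?m (pts Z) (str Z c) = str X c" if "c \<in> carrier k" for c
    using ring_hom_closed[OF kZ that] pre_pts[OF g] mor_str[OF f that] mor_str[OF g that]
    by (simp add: sh_comp)
  have 6: "pt ?m \<in> extensional (pts X)" "sh ?m \<in> extensional {V. opn Z V}"
    "opn Z V \<Longrightarrow> sh ?m V \<in> extensional (carrier (sec Z V))" for V
    by (simp_all add: mor_comp_def)
  show ?thesis unfolding is_mor_def using 1 2 3 4 5 6 by simp
qed

lemma mor_comp_assoc:
  assumes f: "is_mor k W X f" and g: "is_mor k X Y g" and h: "is_mor k Y Z h"
  shows "mor_comp W X Z (mor_comp X Y Z h g) f = mor_comp W Y Z h (mor_comp W X Y g f)"
proof -
  have "restrict (\<lambda>x. pt (mor_comp X Y Z h g) (pt f x)) (pts W) =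
      restrict (\<lambda>x. pt h (pt (mor_comp W X Y g f) x)) (pts W)"
    using mor_pts[OF f] by (auto simp: pt_comp)
  moreover have "sh f (pre X (mor_comp X Y Z h g) V) (sh (mor_comp X Y Z h g) V s) =
      sh (mor_comp W X Y g f) (pre Y h V) (sh h V s)"
    if "opn Z V" "s \<in> carrier (sec Z V)" for V s
    using that pre_opn[OF h that(1)] mor_closed[OF h that] by (simp add: sh_comp pre_comp[OF g])
  then have "(\<lambda>V\<in>{V. opn Z V}. \<lambda>s\<in>carrier (sec Z V). sh f (pre X (mor_comp X Y Z h g) V) (sh (mor_comp X Y Z h g) V s)) =
      (\<lambda>V\<in>{V. opn Z V}. \<lambda>s\<in>carrier (sec Z V). sh (mor_comp W X Y g f) (pre Y h V) (sh h V s))"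
    by (intro restrict_ext) auto
  ultimately show ?thesis unfolding mor_comp_def[of W X Z] mor_comp_def[of W Y Z] by simp
qed

lemma pre_id: "opn X V \<Longrightarrow> pre X (mor_id X) V = V"
  unfolding pre_def mor_id_def using openin_subset by auto

lemma is_mor_id:
  assumes "ringed_space X" "str X \<in> ring_hom k (glob X)"
  shows "is_mor k X X (mor_id X)"
proof -
  interpret X: ringed X using assms by unfold_locales
  have 1: "continuous_map (sp X) (sp X) (pt (mor_id X))"
    by (rule continuous_map_eq[OF continuous_map_id]) (simp add: mor_id_def)
  have sh: "sh (mor_id X) V s = s" if "opn X V" "s \<in> carrier (sec X V)" for V s
    using that by (simp add: mor_id_def)
  have 2: "sh (mor_id X) V \<in> ring_hom (sec X V) (sec X (pre X (mor_id X) V))" if V: "opn X V" for V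
    by (rule ring_hom_cong[of id]) (use sh V X.sec_cring in \<open>auto simp: pre_id cring_def ring_hom_def\<close>)
  have ext: "pt (mor_id X) \<in> extensional (pts X)" "sh (mor_id X) \<in> extensional {V. opn X V}"
    "opn X V \<Longrightarrow> sh (mor_id X) V \<in> extensional (carrier (sec X V))" for V
    by (simp_all add: mor_id_def)
  have pt: "x \<in> V \<Longrightarrow> opn X V \<Longrightarrow> pt (mor_id X) x = x" for x V
    using openin_subset[of "sp X" V] by (auto simp: mor_id_def)
  show ?thesis unfolding is_mor_def
    using 1 2 ext X.res_closed ring_hom_closed[OF assms(2)] by (auto simp: sh pre_id pt)
qed

lemma mor_comp_id_left:
  assumes "is_mor k X Y f"
  shows "mor_comp X Y Y (mor_id Y) f = f"
proof -
  have "pt (mor_comp X Y Y (mor_id Y) f) = pt f"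
    using mor_pt_ext[OF assms] mor_pts[OF assms]
    by (intro extensionalityI[of _ "pts X"]) (auto simp: mor_comp_def mor_id_def)
  moreover have "sh (mor_comp X Y Y (mor_id Y) f) V = sh f V" if V: "opn Y V" for V
    using mor_sh_ext2[OF assms V] V pre_id[OF V]
    by (intro extensionalityI[of _ "carrier (sec Y V)"]) (auto simp: sh_comp, auto simp: mor_comp_def mor_id_def)
  then have "sh (mor_comp X Y Y (mor_id Y) f) = sh f"
    using mor_sh_ext[OF assms] by (intro extensionalityI[of _ "{V. opn Y V}"]) (auto simp: mor_comp_def)
  ultimately show ?thesis by (cases f) (simp add: mor_comp_def)
qed

text \<open>One direction is the locality of morphisms. The other needs no locality: the pullback of
  a unit is a unit.\<close>

lemma vanishes_pull:
  assumes X: "ringed_space X" and Y: "ringed_space Y" and f: "is_mor k X Y f"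
    and V: "opn Y V" "s \<in> carrier (sec Y V)" "x \<in> pre X f V"
  shows "vanishes X (pre X f V) (sh f V s) x \<longleftrightarrow> vanishes Y V s (pt f x)"
proof
  interpret X: ringed X using X by unfold_locales
  interpret Y: ringed Y using Y by unfold_locales
  assume v: "vanishes X (pre X f V) (sh f V s) x"
  show "vanishes Y V s (pt f x)" unfolding vanishes_def
  proof (intro allI impI notI; elim conjE)
    fix W assume W: "opn Y W" "pt f x \<in> W" "W \<subseteq> V" "res Y V W s \<in> Units (sec Y W)"
    have "sh f W (res Y V W s) \<in> Units (sec X (pre X f W))"
      using ring_hom_Units[OF mor_hom[OF f W(1)] Y.sec_cring[OF W(1)] X.sec_cring[OF pre_opn[OF f W(1)]] W(4)] .
    then have "res X (pre X f V) (pre X f W) (sh f V s) \<in> Units (sec X (pre X f W))"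
      using mor_res[OF f V(1) W(1,3) V(2)] by simp
    then show False using v W V(3) pre_opn[OF f W(1)] pre_mono[OF W(3), of X f]
      unfolding vanishes_def by (auto simp: mem_pre)
  qed
qed (rule mor_local[OF f V])

text \<open>A morphism into a chart is determined by the pullback of the coordinate ring. On points,
  because the prime of the image of \<open>x\<close> consists of the functions whose pullback
  vanishes at \<open>x\<close>. On sections, because over a basic open set a section is a fraction,
  whose unit denominator cancels, and sections are determined locally.\<close>

lemma mor_eqI:
  assumes T: "ringed_space T" and Y: "ringed_chart Y U h"
    and m: "is_mor k T Y m" "is_mor k T Y m'"
    and U: "pre T m U = pts T" "pre T m' U = pts T"
    and eq: "\<And>b. b \<in> carrier (sec Y U) \<Longrightarrow> sh m U b = sh m' U b"
  shows "m = m'"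
proof (rule mor_ext[OF m])
  interpret T: ringed T using T by unfold_locales
  interpret Y: ringed_chart Y U h by fact
  have inU: "pt m x \<in> U" "pt m' x \<in> U" if "x \<in> pts T" for x
    using U that by (auto simp: mem_pre)
  show pt: "pt m x = pt m' x" if x: "x \<in> pts T" for x
  proof -
    have "b \<in> h (pt m x) \<longleftrightarrow> b \<in> h (pt m' x)" if b: "b \<in> carrier (sec Y U)" for b
      using vanishes_pull[OF T Y.ringed m(1) Y.opn_U b, of x] vanishes_pull[OF T Y.ringed m(2) Y.opn_U b, of x]
        U x eq[OF b] Y.vanishes_iff[OF inU(1)[OF x] b] Y.vanishes_iff[OF inU(2)[OF x] b] by simp
    then have "h (pt m x) = h (pt m' x)" using Y.h_sub[OF inU(1)[OF x]] Y.h_sub[OF inU(2)[OF x]] by blast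
    then show ?thesis using Y.h_inj inU[OF x] by (simp add: inj_on_def)
  qed
  fix V s assume V: "opn Y V" "s \<in> carrier (sec Y V)"
  have preeq: "pre T m' W = pre T m W" for W using pt by (auto simp: mem_pre)
  \<comment> \<open>The preimages of the basic open sets inside \<open>V\<close> cover the preimage
    of \<open>V\<close>, since all points are mapped into the chart.\<close>
  let ?\<U> = "{pre T m (Y.D b) | b. b \<in> carrier (sec Y U) \<and> Y.D b \<subseteq> V}"
  show "sh m V s = sh m' V s"
  proof (rule T.sec_eqI[of ?\<U>])
    show "opn T W" if "W \<in> ?\<U>" for W using that pre_opn[OF m(1)] Y.opn_D by blast
    show "pre T m V = \<Union>?\<U>"
    proof
      show "pre T m V \<subseteq> \<Union>?\<U>"
      proof
        fix x assume "x \<in> pre T m V"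
        then have x: "x \<in> pts T" "pt m x \<in> V" by (auto simp: mem_pre)
        obtain b where "b \<in> carrier (sec Y U)" "pt m x \<in> Y.D b" "Y.D b \<subseteq> V"
          using Y.base[OF V(1) x(2) inU(1)[OF x(1)]] by blast
        then show "x \<in> \<Union>?\<U>" using x(1) by (auto simp: mem_pre)
      qed
    qed (use pre_mono[of _ V T m] in blast)
    show "sh m V s \<in> carrier (sec T (pre T m V))" using mor_closed[OF m(1) V] .
    show "sh m' V s \<in> carrier (sec T (pre T m V))" using mor_closed[OF m(2) V] preeq by simp
    fix W assume "W \<in> ?\<U>"
    then obtain f where f: "f \<in> carrier (sec Y U)" "Y.D f \<subseteq> V" "W = pre T m (Y.D f)" by blast
    let ?D = "Y.D f"
    have o: "opn Y ?D" using Y.opn_D f by blast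
    define r where "r = res Y V ?D s"
    have rc: "r \<in> carrier (sec Y ?D)" using Y.res_closed[OF V(1) o f(2) V(2)] by (simp add: r_def)
    obtain a b where ab: "a \<in> carrier (sec Y U)" "b \<in> carrier (sec Y U)"
      "res Y U ?D b \<in> Units (sec Y ?D)" "r \<otimes>\<^bsub>sec Y ?D\<^esub> res Y U ?D b = res Y U ?D a"
      using Y.local_fraction[OF f(1) rc] by metis
    have same: "sh m ?D (res Y U ?D c) = sh m' ?D (res Y U ?D c)" if "c \<in> carrier (sec Y U)" for c
      using mor_res[OF m(1) Y.opn_U o Y.D_sub that] mor_res[OF m(2) Y.opn_U o Y.D_sub that] eq[OF that] preeq by simp
    have rb: "res Y U ?D b \<in> carrier (sec Y ?D)" using Y.res_closed[OF Y.opn_U o Y.D_sub ab(2)] .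
    have hm: "sh m ?D \<in> ring_hom (sec Y ?D) (sec T W)" "sh m' ?D \<in> ring_hom (sec Y ?D) (sec T W)"
      using mor_hom[OF m(1) o] mor_hom[OF m(2) o] preeq f(3) by auto
    have cT: "cring (sec T W)" using T.sec_cring pre_opn[OF m(1) o] f(3) by blast
    have "sh m ?D r = sh m' ?D r"
    proof (rule Units_mult_cancel[OF cT])
      show "sh m ?D (res Y U ?D b) \<in> Units (sec T W)"
        using ring_hom_Units[OF hm(1) Y.sec_cring[OF o] cT ab(3)] .
      show "sh m ?D r \<in> carrier (sec T W)" "sh m' ?D r \<in> carrier (sec T W)"
        using hm rc ring_hom_closed by metis+
      show "sh m ?D r \<otimes>\<^bsub>sec T W\<^esub> sh m ?D (res Y U ?D b) = sh m' ?D r \<otimes>\<^bsub>sec T W\<^esub> sh m ?D (res Y U ?D b)"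
        using ring_hom_mult[OF hm(1) rc rb] ring_hom_mult[OF hm(2) rc rb] ab same by simp
    qed
    then show "res T (pre T m V) W (sh m V s) = res T (pre T m V) W (sh m' V s)"
      using mor_res[OF m(1) V(1) o f(2) V(2)] mor_res[OF m(2) V(1) o f(2) V(2)] preeq f(3) by (simp add: r_def)
  qed
qed

subsection \<open>Open immersions\<close>

definition incl :: "'u sch \<Rightarrow> 'u set \<Rightarrow> 'u mor" where
  "incl X U = \<lparr>pt = (\<lambda>x\<in>U. x), sh = (\<lambda>V\<in>{V. opn X V}. \<lambda>s\<in>carrier (sec X V). res X V (U \<inter> V) s)\<rparr>"

lemma pre_incl: "opn X U \<Longrightarrow> pre (open_sub X U) (incl X U) V = U \<inter> V"
  unfolding pre_def pts_open_sub by (auto simp: incl_def)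

lemma sh_incl: "opn X V \<Longrightarrow> s \<in> carrier (sec X V) \<Longrightarrow> sh (incl X U) V s = res X V (U \<inter> V) s"
  by (simp add: incl_def)

lemma is_mor_incl:
  assumes X: "ringed_space X" and U: "opn X U" and k: "str X \<in> ring_hom k (glob X)"
  shows "is_mor k (open_sub X U) X (incl X U)"
proof -
  interpret X: ringed X using X by unfold_locales
  note P = pts_open_sub[OF U] and pre = pre_incl[OF U]
  have "continuous_map (sp (open_sub X U)) (sp X) (pt (incl X U))"
    by (rule continuous_map_eq[of _ _ "\<lambda>x. x"])
      (auto simp: open_sub_def incl_def continuous_map_from_subtopology)
  moreover have "sh (incl X U) V \<in> ring_hom (sec X V) (sec X (U \<inter> V))" if V: "opn X V" for V
    by (rule ring_hom_cong[OF X.res_hom[OF V openin_Int[OF U V]]])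
      (use V X.sec_cring[OF V] in \<open>auto simp: sh_incl cring_def\<close>)
  moreover have "res X W (U \<inter> W) (res X V W s) = res X (U \<inter> V) (U \<inter> W) (res X V (U \<inter> V) s)"
    if "opn X V" "opn X W" "W \<subseteq> V" "s \<in> carrier (sec X V)" for V W s
    using that(3) le_infI2[OF that(3), of U] X.res_res[OF that(1,2) openin_Int[OF U that(2)] _ that(3,4)]
      X.res_res[OF that(1) openin_Int[OF U that(1)] openin_Int[OF U that(2)] _ _ that(4)]
    by (simp add: Int_mono)
  moreover have "vanishes (open_sub X U) (U \<inter> V) (res X V (U \<inter> V) s) x"
    if "opn X V" "s \<in> carrier (sec X V)" "x \<in> U \<inter> V" "vanishes X V s x" for V s x
    using X.vanishes_res[OF that(1) openin_Int[OF U that(1)] _ that(3,2)] that(4)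
    unfolding vanishes_def by (auto simp: opn_open_sub[OF U])
  moreover have "U \<inter> pts X = U" using openin_subset[OF U] by blast
  ultimately show ?thesis
    unfolding is_mor_def P pre using X.res_closed ring_hom_closed[OF k]
    by (auto simp: sh_incl open_sub_def[of X U]) (auto simp: incl_def)
qed

text \<open>An open immersion is a monomorphism: over an open subset \<open>V\<close> of
  \<open>U\<close> its sheaf component is the restriction from \<open>V\<close> to itself, so the
  composite still shows all of \<open>a\<close>.\<close>

lemma incl_mono:
  assumes X: "ringed_space X" and U: "opn X U"
    and a: "is_mor k Y (open_sub X U) a" and b: "is_mor k Y (open_sub X U) b"
    and eq: "mor_comp Y (open_sub X U) X (incl X U) a = mor_comp Y (open_sub X U) X (incl X U) b"
  shows "a = b"
proof (rule mor_ext[OF a b])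
  interpret X: ringed X using X by unfold_locales
  note P = pts_open_sub[OF U] and O = opn_open_sub[OF U]
  show "pt a x = pt b x" if x: "x \<in> pts Y" for x
    using arg_cong[OF eq, of "\<lambda>m. pt m x"] mor_pts[OF a x] mor_pts[OF b x] x
    by (simp add: pt_comp P) (simp add: incl_def)
  fix V s assume V: "opn (open_sub X U) V" "s \<in> carrier (sec (open_sub X U) V)"
  then have V': "opn X V" "V \<subseteq> U" "s \<in> carrier (sec X V)" "U \<inter> V = V" using O by auto
  have "sh a V (res X V V s) = sh b V (res X V V s)"
    using arg_cong[OF eq, of "\<lambda>m. sh m V s"] V' by (simp add: sh_comp sh_incl pre_incl[OF U])
  then show "sh a V s = sh b V s" using X.res_id V' by simp
qed

text \<open>The factor keeps the point map and the sheaf maps of \<open>a\<close>, cut down to the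
  open subsets of \<open>U\<close> to meet the normalization of morphisms.\<close>

lemma corestrict:
  assumes Y: "ringed_space Y" and X: "ringed_space X" and U: "opn X U"
    and k: "str X \<in> ring_hom k (glob X)"
    and a: "is_mor k Y X a" and im: "pre Y a U = pts Y"
  obtains m where "is_mor k Y (open_sub X U) m" "mor_comp Y (open_sub X U) X (incl X U) m = a"
proof -
  interpret X: ringed X using X by unfold_locales
  interpret Y: ringed Y using Y by unfold_locales
  note P = pts_open_sub[OF U] and O = opn_open_sub[OF U]
  define m where "m = \<lparr>pt = pt a, sh = (\<lambda>V\<in>{V. opn X V \<and> V \<subseteq> U}. sh a V)\<rparr>"
  have pm: "pre Y m V = pre Y a V" for V by (simp add: pre_def m_def)
  have inU: "pt a x \<in> U" if "x \<in> pts Y" for x using im that by (auto simp: mem_pre)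
  have preU: "pre Y a (U \<inter> V) = pre Y a V" for V using inU by (auto simp: mem_pre)
  have sub: "U \<subseteq> pts X" using openin_subset[OF U] .
  have shm: "sh m V = sh a V" if "opn X V" "V \<subseteq> U" for V using that by (simp add: m_def)
  have "continuous_map (sp Y) (subtopology (sp X) U) (pt a)"
    using mor_cont[OF a] inU by (simp add: continuous_map_in_subtopology Pi_def image_subset_iff)
  then have c: "continuous_map (sp Y) (sp (open_sub X U)) (pt m)" by (simp add: open_sub_def m_def)
  have s: "sh m U (str (open_sub X U) c) = str Y c" if "c \<in> carrier k" for c
    using mor_res[OF a openin_topspace U sub ring_hom_closed[OF k that]] mor_str[OF a that]
      pre_pts[OF a] im Y.res_id[of "pts Y" "str Y c"] mor_closed[OF a openin_topspace ring_hom_closed[OF k that]]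
    by (simp add: shm[OF U] open_sub_def)
  have v: "vanishes Y (pre Y a V) (sh a V s) x"
    if "opn X V" "V \<subseteq> U" "s \<in> carrier (sec X V)" "x \<in> pre Y a V" "vanishes (open_sub X U) V s (pt a x)" for V s x
  proof -
    have "vanishes X V s (pt a x)" using that(5,2) unfolding vanishes_def by (auto simp: O)
    then show ?thesis using mor_local[OF a that(1,3,4)] by simp
  qed
  have e: "pt m \<in> extensional (pts Y)" "sh m \<in> extensional {V. opn X V \<and> V \<subseteq> U}"
    using mor_pt_ext[OF a] by (auto simp: m_def)
  have M: "is_mor k Y (open_sub X U) m"
    unfolding is_mor_def P O pm using c s v e mor_hom[OF a] mor_sh_ext2[OF a] mor_res[OF a]
    by (auto simp: shm) (auto simp: m_def)
  moreover have "mor_comp Y (open_sub X U) X (incl X U) m = a"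
  proof -
    have "restrict (\<lambda>x. pt (incl X U) (pt m x)) (pts Y) = pt a"
      using mor_pt_ext[OF a] inU by (intro extensionalityI[of _ "pts Y"]) (auto simp: m_def incl_def)
    moreover have "sh m (U \<inter> V) (res X V (U \<inter> V) s) = sh a V s" if "opn X V" "s \<in> carrier (sec X V)" for V s
      using that mor_res[OF a that(1) openin_Int[OF U that(1)] _ that(2)] shm[OF openin_Int[OF U that(1)]]
        Y.res_id[OF pre_opn[OF a that(1)] mor_closed[OF a that]] by (simp add: preU)
    then have *: "restrict (\<lambda>s. sh m (U \<inter> V) (res X V (U \<inter> V) s)) (carrier (sec X V)) = sh a V" if "opn X V" for V
      using mor_sh_ext2[OF a that] that by (intro extensionalityI[of _ "carrier (sec X V)"]) auto
    have **: "restrict (\<lambda>s. sh m (U \<inter> V) (sh (incl X U) V s)) (carrier (sec X V)) = sh a V" if "opn X V" for V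
      using *[OF that] by (subst *[OF that, symmetric]) (rule restrict_ext, simp add: sh_incl[OF that])
    have "restrict (\<lambda>V. \<lambda>s\<in>carrier (sec X V). sh m (pre (open_sub X U) (incl X U) V) (sh (incl X U) V s)) {V. opn X V} = sh a"
      using mor_sh_ext[OF a] mor_sh_ext2[OF a]
      by (intro extensionalityI[of _ "{V. opn X V}"]) (auto simp: pre_incl[OF U] **)
    ultimately show ?thesis unfolding mor_comp_def by simp
  qed
  ultimately show ?thesis using that by blast
qed

section \<open>Inclusions of affine open subsets are etale\<close>

lemma formally_etale_id:
  assumes "cring A" "\<And>a. a \<in> carrier A \<Longrightarrow> \<phi> a = a"
  shows "formally_etale A A \<phi>"
  unfolding formally_etale_def
proof (intro allI impI)
  interpret cring A by fact
  fix C I g h assume P: "square_zero_problem A A \<phi> C I g h"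
  have g: "g \<in> ring_hom A C" and h: "\<And>a. a \<in> carrier A \<Longrightarrow> h a = I +>\<^bsub>C\<^esub> g a"
    using P assms(2) unfolding square_zero_problem_def by auto
  show "\<exists>!l. l \<in> lifts A A \<phi> C I g h"
  proof (rule ex1I[of _ "restrict g (carrier A)"])
    have "restrict g (carrier A) \<in> ring_hom A C" by (rule ring_hom_cong[OF g]) (simp_all add: ring_axioms)
    then show "restrict g (carrier A) \<in> lifts A A \<phi> C I g h" using h assms(2) by (simp add: lifts_def)
    fix l assume "l \<in> lifts A A \<phi> C I g h"
    then show "l = restrict g (carrier A)" using assms(2)
      by (intro extensionalityI[of _ "carrier A"]) (auto simp: lifts_def)
  qed
qed

lemma finite_type_hom_id:
  assumes "cring A" "\<And>a. a \<in> carrier A \<Longrightarrow> \<phi> a = a"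
  shows "finite_type_hom A A \<phi>"
proof -
  interpret cring A by fact
  have "\<phi> \<in> ring_hom A A" using assms(2) by (auto simp: ring_hom_def)
  moreover have im: "\<phi> ` carrier A = carrier A" using assms(2) by force
  moreover have "generate_ring A (carrier A) = carrier A"
    by (intro subset_antisym subsetI generate_ring.incl) (rule generate_ring_in_carrier[of "carrier A"], simp_all)
  ultimately show ?thesis unfolding finite_type_hom_def by (intro conjI exI[of _ "{}"]) simp_all
qed

text \<open>With \<open>U\<close> as the chart on both sides the map of coordinate rings is the
  identity, which is formally etale and of finite type.\<close>

lemma etale_incl:
  assumes X: "ringed_space X" and U: "affine_open X U" "affine_open (open_sub X U) U"
    and k: "str X \<in> ring_hom k (glob X)"
  shows "etale k (open_sub X U) X (incl X U)"
proof -
  interpret X: ringed X using X by unfold_locales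
  have oU: "opn X U" using U by (simp add: affine_open_def)
  note P = pts_open_sub[OF oU]
  have id: "res X (U \<inter> U) U (sh (incl X U) U s) = s" if "s \<in> carrier (sec X U)" for s
    using that oU X.res_id by (simp add: sh_incl)
  have A: "cring (sec X U)" using X.sec_cring oU by blast
  show ?thesis
    unfolding etale_def P pre_incl[OF oU] sec_open_sub
    using is_mor_incl[OF X oU k] U formally_etale_id[OF A id] finite_type_hom_id[OF A id]
    by (intro conjI ballI exI[of _ U]) auto
qed

section \<open>Curves\<close>

text \<open>
  An affine smooth curve with trivial class group, given by its function field and the order
  functions of its closed points.  A closed point is named by a uniformizer without other zeros or
  poles, and the generic point by \<open>0\<close>; then all rings of sections are subrings of the function
  field, all restriction maps are inclusions, and open subsets inherit the structure.
\<close>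

definition reg :: "'u ring \<Rightarrow> ('u \<Rightarrow> 'u \<Rightarrow> int) \<Rightarrow> 'u set \<Rightarrow> 'u set" where
  "reg F ord U = {x \<in> carrier F. x = \<zero>\<^bsub>F\<^esub> \<or> (\<forall>p\<in>U - {\<zero>\<^bsub>F\<^esub>}. 0 \<le> ord p x)}"

text \<open>The sections over the empty set must form the zero ring, in which the unit is 0;
  otherwise gluing over the empty cover would not be unique.\<close>

definition reg_ring :: "'u ring \<Rightarrow> ('u \<Rightarrow> 'u \<Rightarrow> int) \<Rightarrow> 'u set \<Rightarrow> 'u ring" where
  "reg_ring F ord U =
     (if U = {} then F\<lparr>carrier := {\<zero>\<^bsub>F\<^esub>}, one := \<zero>\<^bsub>F\<^esub>\<rparr> else F\<lparr>carrier := reg F ord U\<rparr>)"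

text \<open>For the generic point \<open>p = 0\<close> this is the zero ideal, so that one formula
  covers all primes of the coordinate ring.\<close>

definition max_at :: "'u ring \<Rightarrow> ('u \<Rightarrow> 'u \<Rightarrow> int) \<Rightarrow> 'u set \<Rightarrow> 'u \<Rightarrow> 'u set" where
  "max_at F ord U p = {x \<in> reg F ord U. x = \<zero>\<^bsub>F\<^esub> \<or> (p \<noteq> \<zero>\<^bsub>F\<^esub> \<and> 0 < ord p x)}"

text \<open>Nonempty open sets contain the generic point and all but finitely many closed points,
  which is the Zariski topology of a curve. Restriction to the empty set is 0 because of the zero
  ring there.\<close>

definition curve_sch :: "'u ring \<Rightarrow> ('u \<Rightarrow> 'u \<Rightarrow> int) \<Rightarrow> ('u \<Rightarrow> 'u) \<Rightarrow> 'u set \<Rightarrow> 'u sch" where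
  "curve_sch F ord i Cl =
     \<lparr>sp = topology (\<lambda>U. U = {} \<or> (\<zero>\<^bsub>F\<^esub> \<in> U \<and> U \<subseteq> insert \<zero>\<^bsub>F\<^esub> Cl \<and> finite (Cl - U))),
      sec = reg_ring F ord, res = (\<lambda>U V x. if V = {} then \<zero>\<^bsub>F\<^esub> else x), str = i\<rparr>"

text \<open>\<open>ord_self\<close> makes the name of each closed point a global function with a
  simple zero there and no other zeros or poles among the closed points. \<open>ord_res\<close> says
  that residue rings are fields, an element of order 0 at \<open>p\<close> being invertible modulo
  the ideal of \<open>p\<close>; this is what excludes further prime ideals.\<close>

locale curve = field F for F :: "'u ring" (structure) +
  fixes Cl :: "'u set" and ord :: "'u \<Rightarrow> 'u \<Rightarrow> int"
  assumes Cl_sub: "Cl \<subseteq> carrier F - {\<zero>}"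
    and ord_mult: "p \<in> Cl \<Longrightarrow> x \<in> carrier F - {\<zero>} \<Longrightarrow> y \<in> carrier F - {\<zero>} \<Longrightarrow> ord p (x \<otimes> y) = ord p x + ord p y"
    and ord_add: "p \<in> Cl \<Longrightarrow> x \<in> carrier F - {\<zero>} \<Longrightarrow> y \<in> carrier F - {\<zero>} \<Longrightarrow> x \<oplus> y \<noteq> \<zero> \<Longrightarrow>
      n \<le> ord p x \<Longrightarrow> n \<le> ord p y \<Longrightarrow> n \<le> ord p (x \<oplus> y)"
    and ord_self: "p \<in> Cl \<Longrightarrow> q \<in> Cl \<Longrightarrow> ord p q = (if p = q then 1 else 0)"
    and ord_fin: "x \<in> carrier F - {\<zero>} \<Longrightarrow> finite {p\<in>Cl. ord p x \<noteq> 0}"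
    and ord_res: "p \<in> Cl \<Longrightarrow> x \<in> reg F ord Cl \<Longrightarrow> x \<noteq> \<zero> \<Longrightarrow> ord p x = 0 \<Longrightarrow>
      \<exists>y\<in>reg F ord Cl. \<one> \<ominus> x \<otimes> y \<in> max_at F ord Cl p"
begin

section \<open>Arithmetic of the order functions and of regular elements\<close>

lemma nz_mult: "x \<in> carrier F - {\<zero>} \<Longrightarrow> y \<in> carrier F - {\<zero>} \<Longrightarrow> x \<otimes> y \<in> carrier F - {\<zero>}"
  using integral by fastforce

lemma nz_one: "\<one> \<in> carrier F - {\<zero>}"
  by simp

lemma nz_inv: "x \<in> carrier F - {\<zero>} \<Longrightarrow> inv x \<in> carrier F - {\<zero>}"
  by (metis field_Units Units_inv_Units)

lemma nz_r_inv: "x \<in> carrier F - {\<zero>} \<Longrightarrow> x \<otimes> inv x = \<one>"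
  by (metis field_Units Units_r_inv)

lemma nz_pow: "x \<in> carrier F - {\<zero>} \<Longrightarrow> x [^] (n::nat) \<in> carrier F - {\<zero>}"
proof (induction n)
  case (Suc n)
  then show ?case using nz_mult by simp
qed simp

lemma nz_neg: "x \<in> carrier F - {\<zero>} \<Longrightarrow> \<ominus> x \<in> carrier F - {\<zero>}"
  by (auto dest: minus_minus)

lemma ord_one: "p \<in> Cl \<Longrightarrow> ord p \<one> = 0"
  using ord_mult[OF _ nz_one nz_one] by simp

lemma ord_inv: "p \<in> Cl \<Longrightarrow> x \<in> carrier F - {\<zero>} \<Longrightarrow> ord p (inv x) = - ord p x"
  using ord_mult[of p x "inv x"] nz_inv[of x] nz_r_inv[of x] ord_one by simp

lemma ord_pow: "p \<in> Cl \<Longrightarrow> x \<in> carrier F - {\<zero>} \<Longrightarrow> ord p (x [^] (n::nat)) = int n * ord p x"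
proof (induction n)
  case (Suc n)
  then show ?case using ord_mult[OF Suc(2) nz_pow[OF Suc(3)] Suc(3)] by (simp add: distrib_right)
qed (simp add: ord_one)

lemma ord_neg: "p \<in> Cl \<Longrightarrow> x \<in> carrier F - {\<zero>} \<Longrightarrow> ord p (\<ominus> x) = ord p x"
proof -
  assume p: "p \<in> Cl" and x: "x \<in> carrier F - {\<zero>}"
  have m: "\<ominus> \<one> \<in> carrier F - {\<zero>}" using nz_neg nz_one by blast
  \<comment> \<open>Orders are integers, so an element with square 1 has order 0.\<close>
  have "(\<ominus> \<one>) \<otimes> (\<ominus> \<one>) = \<one>" by (simp add: l_minus r_minus)
  then have "ord p (\<ominus> \<one>) = 0" using ord_mult[OF p m m] ord_one[OF p] by simp
  moreover have "(\<ominus> \<one>) \<otimes> x = \<ominus> x" using x by (simp add: l_minus)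
  ultimately show ?thesis using ord_mult[OF p m x] by simp
qed

lemma zero_notin_Cl: "\<zero> \<notin> Cl" using Cl_sub by blast

lemma reg_subset: "reg F ord U \<subseteq> carrier F" by (auto simp: reg_def)

lemma reg_mono: "V \<subseteq> U \<Longrightarrow> reg F ord U \<subseteq> reg F ord V" by (auto simp: reg_def)

lemma reg_insert_zero [simp]: "reg F ord (insert \<zero> U) = reg F ord U"
  by (simp add: reg_def)

lemma reg_Diff_zero [simp]: "reg F ord (U - {\<zero>}) = reg F ord U"
  by (simp add: reg_def)

lemma regI: "x \<in> carrier F \<Longrightarrow> (\<And>p. x \<noteq> \<zero> \<Longrightarrow> p \<in> U \<Longrightarrow> p \<noteq> \<zero> \<Longrightarrow> 0 \<le> ord p x) \<Longrightarrow> x \<in> reg F ord U"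
  by (auto simp: reg_def)

lemma regD: "x \<in> reg F ord U \<Longrightarrow> p \<in> U \<Longrightarrow> p \<noteq> \<zero> \<Longrightarrow> x \<noteq> \<zero> \<Longrightarrow> 0 \<le> ord p x"
  by (auto simp: reg_def)

lemma subring_reg:
  assumes "U \<subseteq> insert \<zero> Cl"
  shows "subring (reg F ord U) F"
proof (rule subringI)
  have U: "p \<in> U \<Longrightarrow> p \<noteq> \<zero> \<Longrightarrow> p \<in> Cl" for p using assms by blast
  show "reg F ord U \<subseteq> carrier F" by (rule reg_subset)
  show "\<one> \<in> reg F ord U" using ord_one U by (intro regI) auto
  fix x assume x: "x \<in> reg F ord U"
  then have xc: "x \<in> carrier F" using reg_subset by blast
  show "\<ominus> x \<in> reg F ord U"
  proof (rule regI)
    show "\<ominus> x \<in> carrier F" using xc by simp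
    fix p assume p: "\<ominus> x \<noteq> \<zero>" "p \<in> U" "p \<noteq> \<zero>"
    then have nz: "x \<in> carrier F - {\<zero>}" using xc by auto
    then show "0 \<le> ord p (\<ominus> x)" using ord_neg[OF U[OF p(2,3)] nz] regD[OF x p(2,3)] by simp
  qed
  fix y assume y: "y \<in> reg F ord U"
  then have yc: "y \<in> carrier F" using reg_subset by blast
  show "x \<otimes> y \<in> reg F ord U"
  proof (rule regI)
    show "x \<otimes> y \<in> carrier F" using xc yc by simp
    fix p assume p: "x \<otimes> y \<noteq> \<zero>" "p \<in> U" "p \<noteq> \<zero>"
    then have nz: "x \<in> carrier F - {\<zero>}" "y \<in> carrier F - {\<zero>}" using xc yc by auto
    then show "0 \<le> ord p (x \<otimes> y)" using ord_mult[OF U[OF p(2,3)] nz] regD[OF x p(2,3)] regD[OF y p(2,3)] by simp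
  qed
  show "x \<oplus> y \<in> reg F ord U"
  proof (cases "x = \<zero> \<or> y = \<zero>")
    case True
    then show ?thesis using x y xc yc by auto
  next
    case False
    then have nz: "x \<in> carrier F - {\<zero>}" "y \<in> carrier F - {\<zero>}" using xc yc by auto
    show ?thesis
    proof (rule regI)
      show "x \<oplus> y \<in> carrier F" using xc yc by simp
      fix p assume p: "x \<oplus> y \<noteq> \<zero>" "p \<in> U" "p \<noteq> \<zero>"
      show "0 \<le> ord p (x \<oplus> y)"
        by (rule ord_add[OF U[OF p(2,3)] nz p(1)]) (use regD[OF x p(2,3)] regD[OF y p(2,3)] False in simp_all)
    qed
  qed
qed

lemma zero_reg: "\<zero> \<in> reg F ord U" by (simp add: reg_def)

lemma zero_ring_cring: "cring (F\<lparr>carrier := {\<zero>}, one := \<zero>\<rparr>)"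
  by (rule cringI; (rule abelian_groupI | rule comm_monoidI)?) auto

lemma reg_ring_cring: "U \<subseteq> insert \<zero> Cl \<Longrightarrow> cring (reg_ring F ord U)"
  using zero_ring_cring domain.axioms(1)[OF subring_is_domain[OF subring_reg]] by (simp add: reg_ring_def)

lemma reg_ring_ne: "U \<noteq> {} \<Longrightarrow> reg_ring F ord U = F\<lparr>carrier := reg F ord U\<rparr>"
  by (simp add: reg_ring_def)

lemma carrier_reg_ring: "carrier (reg_ring F ord U) = (if U = {} then {\<zero>} else reg F ord U)"
  by (simp add: reg_ring_def)

lemma reg_ring_simps [simp]:
  "mult (reg_ring F ord U) = mult F" "add (reg_ring F ord U) = add F" "\<zero>\<^bsub>reg_ring F ord U\<^esub> = \<zero>"
  "one (reg_ring F ord U) = (if U = {} then \<zero> else \<one>)"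
  by (simp_all add: reg_ring_def)

text \<open>The orders of an element and of its inverse are nonnegative and add up to 0.\<close>

lemma Units_reg:
  assumes "U \<subseteq> insert \<zero> Cl" "U \<noteq> {}"
  shows "x \<in> Units (reg_ring F ord U) \<longleftrightarrow> x \<in> carrier F - {\<zero>} \<and> (\<forall>p\<in>U - {\<zero>}. ord p x = 0)"
proof
  assume "x \<in> Units (reg_ring F ord U)"
  then obtain y where xy: "x \<in> reg F ord U" "y \<in> reg F ord U" "x \<otimes> y = \<one>"
    using assms(2) by (auto simp: Units_def carrier_reg_ring)
  then have c: "x \<in> carrier F" "y \<in> carrier F" using reg_subset by auto
  have nz: "x \<in> carrier F - {\<zero>}" "y \<in> carrier F - {\<zero>}" using xy(3) c by auto
  have "ord p x = 0" if p: "p \<in> U - {\<zero>}" for p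
  proof -
    have "p \<in> Cl" using p assms by blast
    then have "ord p x + ord p y = 0" using ord_mult[OF _ nz] xy(3) ord_one by metis
    then show ?thesis using regD[OF xy(1), of p] regD[OF xy(2), of p] p nz by auto
  qed
  then show "x \<in> carrier F - {\<zero>} \<and> (\<forall>p\<in>U - {\<zero>}. ord p x = 0)" using nz by blast
next
  assume x: "x \<in> carrier F - {\<zero>} \<and> (\<forall>p\<in>U - {\<zero>}. ord p x = 0)"
  then have nz: "x \<in> carrier F - {\<zero>}" "inv x \<in> carrier F - {\<zero>}" using nz_inv by auto
  have "x \<in> reg F ord U" "inv x \<in> reg F ord U"
    using x nz ord_inv assms by (auto intro!: regI)
  moreover have "x \<otimes> inv x = \<one>" "inv x \<otimes> x = \<one>" using nz nz_r_inv m_comm by auto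
  ultimately show "x \<in> Units (reg_ring F ord U)" using assms(2) by (auto simp: Units_def carrier_reg_ring)
qed

text \<open>The witness is the product of the powers of the uniformizers \<open>q\<close> in
  \<open>S\<close>; they do not influence each other, so orders can be prescribed independently. The
  last clause holds because a prime containing a product of powers contains one of the
  bases.\<close>

lemma ex_ord:
  assumes "finite S" "S \<subseteq> Cl"
  shows "\<exists>b\<in>carrier F - {\<zero>}. (\<forall>q\<in>Cl. ord q b = (if q \<in> S then int (e q) else 0)) \<and>
    (\<forall>Q. primeideal Q (F\<lparr>carrier := reg F ord Cl\<rparr>) \<longrightarrow> b \<in> Q \<longrightarrow> (\<exists>q\<in>S. q \<in> Q))"
  using assms
proof (induction S rule: finite_induct)
  case empty
  show ?case
  proof (rule bexI[of _ \<one>], intro conjI ballI allI impI)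
    fix Q assume Q: "primeideal Q (F\<lparr>carrier := reg F ord Cl\<rparr>)" "\<one> \<in> Q"
    interpret Q: primeideal Q "F\<lparr>carrier := reg F ord Cl\<rparr>" by fact
    show "\<exists>q\<in>{}. q \<in> Q" using Q.one_imp_carrier Q.I_notcarr Q(2) by auto
  qed (auto simp: ord_one)
next
  case (insert p S)
  then obtain b where b: "b \<in> carrier F - {\<zero>}" "\<And>q. q \<in> Cl \<Longrightarrow> ord q b = (if q \<in> S then int (e q) else 0)"
    "\<And>Q. primeideal Q (F\<lparr>carrier := reg F ord Cl\<rparr>) \<Longrightarrow> b \<in> Q \<Longrightarrow> \<exists>q\<in>S. q \<in> Q" by auto
  have p: "p \<in> Cl" "p \<in> carrier F - {\<zero>}" using insert Cl_sub by auto
  have pr: "p \<in> reg F ord Cl" using p ord_self by (intro regI) auto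
  have br: "b \<in> reg F ord Cl" using b(1,2) by (intro regI) auto
  interpret R: "domain" "F\<lparr>carrier := reg F ord Cl\<rparr>" using subring_is_domain[OF subring_reg] by auto
  have pw: "p [^] n = p [^]\<^bsub>F\<lparr>carrier := reg F ord Cl\<rparr>\<^esub> n" for n :: nat by (rule nat_pow_consistent)
  have pwr: "p [^] n \<in> reg F ord Cl" for n :: nat using R.nat_pow_closed[of p n] pr pw by simp
  have inQ: "n > 0 \<and> p \<in> Q" if Q: "primeideal Q (F\<lparr>carrier := reg F ord Cl\<rparr>)" "p [^] n \<in> Q" for Q and n :: nat
  proof -
    interpret Q: primeideal Q "F\<lparr>carrier := reg F ord Cl\<rparr>" by fact
    show ?thesis using Q(2)
    proof (induction n)
      case 0
      then show ?case using Q.one_imp_carrier Q.I_notcarr by auto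
    next
      case (Suc n)
      then show ?case using Q.I_prime[of "p [^] n" p] pr pwr[of n] by auto
    qed
  qed
  show ?case
  proof (rule bexI[of _ "b \<otimes> p [^] e p"], intro conjI ballI allI impI)
    show "b \<otimes> p [^] e p \<in> carrier F - {\<zero>}" using b(1) p nz_pow nz_mult by blast
    fix q assume q: "q \<in> Cl"
    show "ord q (b \<otimes> p [^] e p) = (if q \<in> insert p S then int (e q) else 0)"
      using ord_mult[OF q b(1) nz_pow[OF p(2)]] ord_pow[OF q p(2)] ord_self[OF q p(1)] b(2)[OF q] insert(2) by auto
  next
    fix Q assume Q: "primeideal Q (F\<lparr>carrier := reg F ord Cl\<rparr>)" "b \<otimes> p [^] e p \<in> Q"
    interpret Q: primeideal Q "F\<lparr>carrier := reg F ord Cl\<rparr>" by fact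
    have "b \<in> Q \<or> p [^] e p \<in> Q" using Q.I_prime[of b "p [^] e p"] Q(2) br pwr by simp
    then show "\<exists>q\<in>insert p S. q \<in> Q" using b(3)[OF Q(1)] inQ[OF Q(1)] by blast
  qed
qed

text \<open>Only \<open>ord_res\<close> is not inherited directly, as \<open>x\<close> may have
  poles at the removed points. Multiplying by \<open>b\<close>, which has order 0 at
  \<open>p\<close>, makes it regular on all of \<open>Cl\<close>; if \<open>y\<close> inverts
  \<open>x b\<close> modulo the ideal of \<open>p\<close>, then \<open>b y\<close> inverts
  \<open>x\<close>.\<close>

lemma sub_curve:
  assumes "Cl' \<subseteq> Cl"
  shows "curve F Cl' ord"
proof
  show "Cl' \<subseteq> carrier F - {\<zero>}" using assms Cl_sub by blast
  show "finite {p\<in>Cl'. ord p x \<noteq> 0}" if "x \<in> carrier F - {\<zero>}" for x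
    by (rule finite_subset[OF _ ord_fin[OF that]]) (use assms in blast)
  fix p x assume p: "p \<in> Cl'" and x: "x \<in> reg F ord Cl'" "x \<noteq> \<zero>" "ord p x = 0"
  have xn: "x \<in> carrier F - {\<zero>}" using x reg_subset by auto
  define S where "S = {q\<in>Cl. ord q x \<noteq> 0} - Cl'"
  have S: "finite S" "S \<subseteq> Cl" using ord_fin[OF xn] by (auto simp: S_def)
  \<comment> \<open>The absolute value is enough to cancel a pole and does no harm at a
    zero.\<close>
  obtain b where b: "b \<in> carrier F - {\<zero>}" "\<And>q. q \<in> Cl \<Longrightarrow> ord q b = (if q \<in> S then int (nat \<bar>ord q x\<bar>) else 0)"
    using ex_ord[OF S, of "\<lambda>q. nat \<bar>ord q x\<bar>"] by metis
  have pS: "p \<notin> S" "p \<in> Cl" using p assms by (auto simp: S_def)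
  have n: "x \<otimes> b \<in> carrier F - {\<zero>}" using nz_mult xn b(1) by blast
  have o: "ord q (x \<otimes> b) = ord q x + (if q \<in> S then \<bar>ord q x\<bar> else 0)" if "q \<in> Cl" for q
    using ord_mult[OF that xn b(1)] b(2)[OF that] by simp
  have 1: "x \<otimes> b \<in> reg F ord Cl"
  proof (rule regI)
    fix q assume q: "q \<in> Cl" "q \<noteq> \<zero>"
    show "0 \<le> ord q (x \<otimes> b)"
    proof (cases "q \<in> Cl'")
      case True
      then show ?thesis using o[OF q(1)] regD[OF x(1) True q(2) x(2)] by simp
    next
      case False
      then show ?thesis using o[OF q(1)] q(1) by (auto simp: S_def)
    qed
  qed (use n in blast)
  have "ord p (x \<otimes> b) = 0" using o[OF pS(2)] pS(1) x(3) by simp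
  then obtain y where y: "y \<in> reg F ord Cl" "\<one> \<ominus> x \<otimes> b \<otimes> y \<in> max_at F ord Cl p"
    using ord_res[OF pS(2) 1] n by blast
  have yc: "y \<in> carrier F" using y(1) reg_subset by blast
  have br: "b \<in> reg F ord Cl" using b by (intro regI) auto
  have "b \<otimes> y \<in> reg F ord Cl" using subringE(6)[OF subring_reg br y(1)] by blast
  then have "b \<otimes> y \<in> reg F ord Cl'" using reg_mono[OF assms] by blast
  moreover have "x \<otimes> b \<otimes> y = x \<otimes> (b \<otimes> y)" using xn b(1) yc m_assoc by auto
  then have "\<one> \<ominus> x \<otimes> (b \<otimes> y) \<in> max_at F ord Cl' p"
    using y(2) reg_mono[OF assms] by (auto simp: max_at_def)
  ultimately show "\<exists>y\<in>reg F ord Cl'. \<one> \<ominus> x \<otimes> y \<in> max_at F ord Cl' p" by blast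
qed (use assms ord_mult ord_add ord_self in blast)+

abbreviation "pt_set \<equiv> insert \<zero> Cl"

section \<open>The scheme of a curve\<close>

lemma istop: "istopology (\<lambda>U. U = {} \<or> (\<zero> \<in> U \<and> U \<subseteq> pt_set \<and> finite (Cl - U)))"
  unfolding istopology_def
proof (intro conjI allI impI)
  fix S T assume "S = {} \<or> (\<zero> \<in> S \<and> S \<subseteq> pt_set \<and> finite (Cl - S))" "T = {} \<or> (\<zero> \<in> T \<and> T \<subseteq> pt_set \<and> finite (Cl - T))"
  then show "S \<inter> T = {} \<or> (\<zero> \<in> S \<inter> T \<and> S \<inter> T \<subseteq> pt_set \<and> finite (Cl - S \<inter> T))"
    by (auto simp: Diff_Int)
next
  fix K assume K: "\<forall>U\<in>K. U = {} \<or> (\<zero> \<in> U \<and> U \<subseteq> pt_set \<and> finite (Cl - U))"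
  show "\<Union>K = {} \<or> (\<zero> \<in> \<Union>K \<and> \<Union>K \<subseteq> pt_set \<and> finite (Cl - \<Union>K))"
  proof (cases "\<Union>K = {}")
    case False
    then obtain U where U: "U \<in> K" "U \<noteq> {}" by blast
    then have "finite (Cl - U)" "\<zero> \<in> U" using K by auto
    moreover have "Cl - \<Union>K \<subseteq> Cl - U" using U by blast
    ultimately show ?thesis using K U by (blast intro: finite_subset)
  qed simp
qed

abbreviation "C i \<equiv> curve_sch F ord i Cl"

lemma opn_curve: "opn (C i) U \<longleftrightarrow> U = {} \<or> (\<zero> \<in> U \<and> U \<subseteq> pt_set \<and> finite (Cl - U))"
  using topology_inverse'[OF istop] by (simp add: curve_sch_def)

lemma pts_curve [simp]: "pts (C i) = pt_set"
proof (rule antisym)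
  show "pts (C i) \<subseteq> pt_set" using openin_topspace[of "sp (C i)"] unfolding opn_curve by blast
  have "opn (C i) pt_set" unfolding opn_curve by auto
  then show "pt_set \<subseteq> pts (C i)" by (rule openin_subset)
qed

lemma sec_curve [simp]: "sec (C i) = reg_ring F ord" by (simp add: curve_sch_def)
lemma res_curve [simp]: "res (C i) U V x = (if V = {} then \<zero> else x)" by (simp add: curve_sch_def)
lemma str_curve [simp]: "str (C i) = i" by (simp add: curve_sch_def)

text \<open>Any two nonempty members of a cover meet in the generic point, so compatible sections
  over them are one and the same element of \<open>F\<close>, and its regularity is checked point by
  point. A cover with empty union is treated separately, since all its sections are 0.\<close>

lemma ringed_space_curve: "ringed_space (C i)"
proof -
  have sub: "U \<subseteq> pt_set" if "opn (C i) U" for U using that unfolding opn_curve by blast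
  have hom: "res (C i) U V \<in> ring_hom (reg_ring F ord U) (reg_ring F ord V)"
    if "opn (C i) U" "opn (C i) V" "V \<subseteq> U" for U V
  proof (cases "V = {}")
    case False
    then have "U \<noteq> {}" using that(3) by blast
    with False show ?thesis
      using reg_mono[OF that(3)] by (simp add: ring_hom_def carrier_reg_ring subset_iff)
  qed (simp add: ring_hom_def carrier_reg_ring)
  have glue: "\<exists>!t. t \<in> carrier (reg_ring F ord (\<Union>\<U>)) \<and> (\<forall>U\<in>\<U>. res (C i) (\<Union>\<U>) U t = s U)"
    if o: "\<forall>U\<in>\<U>. opn (C i) U \<and> s U \<in> carrier (reg_ring F ord U)"
      and c: "\<forall>U\<in>\<U>. \<forall>V\<in>\<U>. res (C i) U (U \<inter> V) (s U) = res (C i) V (U \<inter> V) (s V)" for \<U> s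
  proof (cases "\<Union>\<U> = {}")
    case True
    then have "U \<in> \<U> \<Longrightarrow> U = {}" for U by blast
    then show ?thesis using True o by (auto simp: carrier_reg_ring)
  next
    case False
    then obtain U where U: "U \<in> \<U>" "U \<noteq> {}" by blast
    have ne: "\<zero> \<in> V" if "V \<in> \<U>" "V \<noteq> {}" for V using o that unfolding opn_curve by blast
    have eq: "s V = s U" if V: "V \<in> \<U>" "V \<noteq> {}" for V
    proof -
      have "U \<inter> V \<noteq> {}" using ne[OF U] ne[OF V] by blast
      then show ?thesis using bspec[OF bspec[OF c U(1)] V(1)] by simp
    qed
    have "s U \<in> reg F ord (\<Union>\<U>)"
    proof (rule regI)
      have "s U \<in> reg F ord U" using bspec[OF o U(1)] U(2) by (simp add: carrier_reg_ring)
      then show "s U \<in> carrier F" using reg_subset by blast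
      fix p assume p: "s U \<noteq> \<zero>" "p \<in> \<Union>\<U>" "p \<noteq> \<zero>"
      then obtain V where V: "V \<in> \<U>" "p \<in> V" by blast
      then have "s U \<in> reg F ord V" using bspec[OF o V(1)] eq[of V] by (auto simp: carrier_reg_ring split: if_splits)
      then show "0 \<le> ord p (s U)" using regD V p by blast
    qed
    then have "s U \<in> carrier (reg_ring F ord (\<Union>\<U>)) \<and> (\<forall>V\<in>\<U>. res (C i) (\<Union>\<U>) V (s U) = s V)"
      using False o eq by (auto simp: carrier_reg_ring)
    moreover have "t = s U" if "\<forall>V\<in>\<U>. res (C i) (\<Union>\<U>) V t = s V" for t
      using bspec[OF that U(1)] U(2) by simp
    ultimately show ?thesis by (intro ex1I[of _ "s U"]) (simp_all del: res_curve)
  qed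
  have rr: "res (C i) V W (res (C i) U V s) = res (C i) U W s" if "W \<subseteq> V" for U V W s
    using that by auto
  have ri: "res (C i) U U s = s" if "s \<in> carrier (reg_ring F ord U)" for U s
    using that by (auto simp: carrier_reg_ring)
  show ?thesis unfolding ringed_space_def sec_curve
  proof (intro conjI allI impI; (elim conjE)?)
    fix \<U> s
    assume "\<forall>U\<in>\<U>. opn (C i) U \<and> s U \<in> carrier (reg_ring F ord U)"
      "\<forall>U\<in>\<U>. \<forall>V\<in>\<U>. res (C i) U (U \<inter> V) (s U) = res (C i) V (U \<inter> V) (s V)"
    then show "\<exists>!t. t \<in> carrier (reg_ring F ord (\<Union>\<U>)) \<and> (\<forall>U\<in>\<U>. res (C i) (\<Union>\<U>) U t = s U)"
      by (rule glue)
  qed (rule reg_ring_cring[OF sub] hom ri rr; assumption)+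
qed

text \<open>As \<open>Cl - U\<close> is finite, a subset of \<open>U\<close> is cofinite in
  \<open>Cl\<close> exactly if it is cofinite in the closed points of \<open>U\<close>. Thus
  nonempty open subschemes are curves again, and everything shown for curves applies to
  them.\<close>

lemma open_sub_curve:
  assumes "opn (C i) U" "U \<noteq> {}"
  shows "open_sub (C i) U = curve_sch F ord i (U - {\<zero>})"
proof -
  have U: "\<zero> \<in> U" "U \<subseteq> pt_set" "finite (Cl - U)" using assms unfolding opn_curve by auto
  interpret V: curve F "U - {\<zero>}" ord by (rule sub_curve) (use U in blast)
  have "subtopology (sp (C i)) U = sp (curve_sch F ord i (U - {\<zero>}))"
    unfolding topology_eq
  proof
    fix S
    have "Cl - S \<subseteq> (Cl - U) \<union> (U - {\<zero>} - S)" "S \<subseteq> U \<Longrightarrow> U - {\<zero>} - S \<subseteq> Cl - S"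
      using U(2) zero_notin_Cl by auto
    then have "S \<subseteq> U \<Longrightarrow> finite (Cl - S) \<longleftrightarrow> finite (U - {\<zero>} - S)"
      using U(3) by (metis finite_UnI finite_subset)
    then show "openin (subtopology (sp (C i)) U) S = opn (curve_sch F ord i (U - {\<zero>})) S"
      unfolding openin_open_subtopology[OF assms(1)] opn_curve V.opn_curve using U(1,2) zero_notin_Cl by auto
  qed
  then show ?thesis using assms(2) unfolding open_sub_def by (simp add: curve_sch_def)
qed

section \<open>Prime ideals of the coordinate ring\<close>

lemma idealI_reg:
  assumes "I \<subseteq> reg F ord Cl" "\<zero> \<in> I" "\<And>x y. x \<in> I \<Longrightarrow> y \<in> I \<Longrightarrow> x \<oplus> y \<in> I"
    "\<And>x y. x \<in> I \<Longrightarrow> y \<in> reg F ord Cl \<Longrightarrow> y \<otimes> x \<in> I"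
  shows "ideal I (F\<lparr>carrier := reg F ord Cl\<rparr>)"
proof -
  interpret R: "domain" "F\<lparr>carrier := reg F ord Cl\<rparr>" using subring_is_domain[OF subring_reg] by auto
  have Ic: "I \<subseteq> carrier F" using assms(1) reg_subset by blast
  show ?thesis
  proof (rule idealI)
    show "ring (F\<lparr>carrier := reg F ord Cl\<rparr>)" by (rule R.ring_axioms)
    show "subgroup I (add_monoid (F\<lparr>carrier := reg F ord Cl\<rparr>))"
    proof (rule R.add.subgroupI)
      fix x assume x: "x \<in> I"
      have "\<ominus>\<^bsub>F\<lparr>carrier := reg F ord Cl\<rparr>\<^esub> x = (\<ominus>\<^bsub>F\<lparr>carrier := reg F ord Cl\<rparr>\<^esub> \<one>) \<otimes> x"
        using R.l_minus[OF R.one_closed, of x] R.l_one[of x] x assms(1) by auto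
      also have "\<dots> \<in> I" using assms(4)[OF x] R.a_inv_closed[of \<one>] R.one_closed by simp
      finally show "\<ominus>\<^bsub>F\<lparr>carrier := reg F ord Cl\<rparr>\<^esub> x \<in> I" .
    qed (use assms in auto)
    fix a x assume a: "a \<in> I" "x \<in> carrier (F\<lparr>carrier := reg F ord Cl\<rparr>)"
    then have "a \<otimes> x = x \<otimes> a" using Ic reg_subset by (intro m_comm) auto
    then show "a \<otimes>\<^bsub>F\<lparr>carrier := reg F ord Cl\<rparr>\<^esub> x \<in> I" using assms(4) a by simp
  qed (use assms in auto)
qed

lemma max_at_zero: "max_at F ord U \<zero> = {\<zero>}"
  by (auto simp: max_at_def zero_reg)

lemma max_at_prime:
  assumes "p \<in> pt_set"
  shows "primeideal (max_at F ord Cl p) (F\<lparr>carrier := reg F ord Cl\<rparr>)"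
proof (rule primeidealI)
  interpret R: "domain" "F\<lparr>carrier := reg F ord Cl\<rparr>" using subring_is_domain[OF subring_reg] by auto
  note S = subringE[OF subring_reg[of Cl]]
  show "cring (F\<lparr>carrier := reg F ord Cl\<rparr>)" by (rule R.is_cring)
  have one: "\<one> \<in> reg F ord Cl" using R.one_closed by simp
  have "\<one> \<notin> max_at F ord Cl p" using assms ord_one by (auto simp: max_at_def)
  then show "carrier (F\<lparr>carrier := reg F ord Cl\<rparr>) \<noteq> max_at F ord Cl p" using one by auto
  show "ideal (max_at F ord Cl p) (F\<lparr>carrier := reg F ord Cl\<rparr>)"
  proof (rule idealI_reg)
    fix x y assume x: "x \<in> max_at F ord Cl p"
    then have xc: "x \<in> carrier F" "x \<in> reg F ord Cl" using reg_subset by (auto simp: max_at_def)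
    { assume y: "y \<in> max_at F ord Cl p"
      then have yc: "y \<in> carrier F" "y \<in> reg F ord Cl" using reg_subset by (auto simp: max_at_def)
      have r: "x \<oplus> y \<in> reg F ord Cl" using S(7) xc yc by blast
      show "x \<oplus> y \<in> max_at F ord Cl p"
      proof (cases "x = \<zero> \<or> y = \<zero> \<or> x \<oplus> y = \<zero>")
        case True
        then show ?thesis using x y r xc yc by (auto simp: max_at_def)
      next
        case False
        then have "p \<in> Cl" "1 \<le> ord p x" "1 \<le> ord p y" using x y assms by (auto simp: max_at_def)
        then have "1 \<le> ord p (x \<oplus> y)" using ord_add[of p x y 1] xc yc False by auto
        then show ?thesis using r \<open>p \<in> Cl\<close> zero_notin_Cl by (auto simp: max_at_def)
      qed }
    { assume y: "y \<in> reg F ord Cl"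
      then have yc: "y \<in> carrier F" using reg_subset by blast
      have r: "y \<otimes> x \<in> reg F ord Cl" using S(6) xc y by blast
      show "y \<otimes> x \<in> max_at F ord Cl p"
      proof (cases "x = \<zero> \<or> y = \<zero>")
        case True
        then show ?thesis using r xc yc by (auto simp: max_at_def)
      next
        case False
        then have p: "p \<in> Cl" "0 < ord p x" using x assms by (auto simp: max_at_def)
        then have "0 \<le> ord p y" using regD[OF y] False zero_notin_Cl by blast
        then have "0 < ord p (y \<otimes> x)" using ord_mult[of p y x] xc yc False p by auto
        then show ?thesis using r \<open>p \<in> Cl\<close> zero_notin_Cl by (auto simp: max_at_def)
      qed }
  qed (auto simp: max_at_def zero_reg)
  fix a b assume ab: "a \<in> carrier (F\<lparr>carrier := reg F ord Cl\<rparr>)" "b \<in> carrier (F\<lparr>carrier := reg F ord Cl\<rparr>)"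
    "a \<otimes>\<^bsub>F\<lparr>carrier := reg F ord Cl\<rparr>\<^esub> b \<in> max_at F ord Cl p"
  then have r: "a \<in> reg F ord Cl" "b \<in> reg F ord Cl" "a \<in> carrier F" "b \<in> carrier F" "a \<otimes> b \<in> max_at F ord Cl p"
    using reg_subset by auto
  show "a \<in> max_at F ord Cl p \<or> b \<in> max_at F ord Cl p"
  proof (cases "a = \<zero> \<or> b = \<zero>")
    case False
    then have "a \<otimes> b \<noteq> \<zero>" using integral r by blast
    then have "p \<in> Cl" "0 < ord p (a \<otimes> b)" using r(5) assms by (auto simp: max_at_def)
    then have "0 < ord p a \<or> 0 < ord p b" using ord_mult[of p a b] r False by auto
    then show ?thesis using r \<open>p \<in> Cl\<close> zero_notin_Cl by (auto simp: max_at_def)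
  qed (use r in \<open>auto simp: max_at_def\<close>)
qed

text \<open>A nonzero prime \<open>Q\<close> contains some nonzero \<open>x\<close>. Up to a
  function without zeros and poles \<open>x\<close> is a product of uniformizers at its zeros, so
  \<open>Q\<close> contains one of these uniformizers, \<open>p\<close>, and with it every function
  vanishing at \<open>p\<close>. A function in \<open>Q\<close> not vanishing at \<open>p\<close>
  would be invertible modulo the ideal of \<open>p\<close>, and 1 would lie in
  \<open>Q\<close>.\<close>

lemma prime_is_max_at:
  assumes "primeideal Q (F\<lparr>carrier := reg F ord Cl\<rparr>)"
  shows "\<exists>p\<in>pt_set. max_at F ord Cl p = Q"
proof (cases "Q = {\<zero>}")
  case True
  then show ?thesis using max_at_zero by blast
next
  case False
  interpret R: "domain" "F\<lparr>carrier := reg F ord Cl\<rparr>" using subring_is_domain[OF subring_reg] by auto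
  interpret Q: primeideal Q "F\<lparr>carrier := reg F ord Cl\<rparr>" by fact
  have Qr: "Q \<subseteq> reg F ord Cl" using Q.a_subset by simp
  have "\<zero> \<in> Q" using Q.zero_closed by simp
  then obtain x where x: "x \<in> Q" "x \<noteq> \<zero>" using False by blast
  have xr: "x \<in> reg F ord Cl" "x \<in> carrier F - {\<zero>}" using x Qr reg_subset by auto
  define S where "S = {q\<in>Cl. ord q x \<noteq> 0}"
  have S: "finite S" "S \<subseteq> Cl" using ord_fin[OF xr(2)] by (auto simp: S_def)
  obtain b where b: "b \<in> carrier F - {\<zero>}" "\<And>q. q \<in> Cl \<Longrightarrow> ord q b = (if q \<in> S then int (nat (ord q x)) else 0)"
    "b \<in> Q \<Longrightarrow> \<exists>q\<in>S. q \<in> Q"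
    using ex_ord[OF S, of "\<lambda>q. nat (ord q x)"] assms by metis
  have ob: "ord q b = ord q x" if "q \<in> Cl" for q
    using b(2)[OF that] regD[OF xr(1) that] xr that zero_notin_Cl by (auto simp: S_def)
  \<comment> \<open>\<open>u\<close> has order 0 at all closed points, hence is regular, and
    \<open>b = u x\<close> lies in \<open>Q\<close>.\<close>
  define u where "u = b \<otimes> inv x"
  have "u \<in> carrier F - {\<zero>}" unfolding u_def using b(1) xr nz_inv nz_mult by blast
  moreover have "ord q u = 0" if "q \<in> Cl" for q
    using ord_mult[OF that b(1) nz_inv[OF xr(2)]] ord_inv[OF that xr(2)] ob[OF that] by (simp add: u_def)
  ultimately have "u \<in> reg F ord Cl" by (intro regI) auto
  moreover have "b = u \<otimes> x" unfolding u_def using b(1) xr nz_inv[OF xr(2)] nz_r_inv[OF xr(2)] m_comm m_assoc by auto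
  ultimately have "b \<in> Q" using Q.I_l_closed[OF x(1), of u] by simp
  then obtain p where p: "p \<in> Cl" "p \<in> Q" using b(3) S(2) by blast
  have pn: "p \<in> carrier F - {\<zero>}" using p Cl_sub by blast
  have "max_at F ord Cl p \<subseteq> Q"
  proof
    fix y assume y: "y \<in> max_at F ord Cl p"
    show "y \<in> Q"
    proof (cases "y = \<zero>")
      case True
      then show ?thesis using \<open>\<zero> \<in> Q\<close> by simp
    next
      case False
      then have yr: "y \<in> reg F ord Cl" "y \<in> carrier F - {\<zero>}" "0 < ord p y" using y reg_subset by (auto simp: max_at_def)
      have "y \<otimes> inv p \<in> reg F ord Cl"
      proof (rule regI)
        show "y \<otimes> inv p \<in> carrier F" using nz_inv[OF pn] yr by auto
        fix q assume q: "q \<in> Cl" "q \<noteq> \<zero>"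
        show "0 \<le> ord q (y \<otimes> inv p)"
          using ord_mult[OF q(1) yr(2) nz_inv[OF pn]] ord_inv[OF q(1) pn] ord_self[OF q(1) p(1)] regD[OF yr(1) q False] yr(3)
          by auto
      qed
      moreover have "y = y \<otimes> inv p \<otimes> p"
        using yr pn nz_inv[OF pn] nz_r_inv[OF pn] m_assoc[of y "inv p" p] m_comm[of "inv p" p] by auto
      ultimately show ?thesis using Q.I_l_closed[OF p(2), of "y \<otimes> inv p"] by simp
    qed
  qed
  moreover have "Q \<subseteq> max_at F ord Cl p"
  proof
    fix y assume y: "y \<in> Q"
    then have yr: "y \<in> reg F ord Cl" using Qr by blast
    show "y \<in> max_at F ord Cl p"
    proof (rule ccontr)
      assume n: "y \<notin> max_at F ord Cl p"
      then have "y \<noteq> \<zero>" "ord p y = 0" using yr regD[OF yr p(1)] p(1) zero_notin_Cl by (force simp: max_at_def)+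
      then obtain z where z: "z \<in> reg F ord Cl" "\<one> \<ominus> y \<otimes> z \<in> max_at F ord Cl p" using ord_res[OF p(1) yr] by blast
      then have "\<one> \<ominus> y \<otimes> z \<in> Q" using calculation by blast
      moreover have "y \<otimes> z \<in> Q" using Q.I_r_closed[OF y, of z] z by simp
      moreover have "\<one> = (\<one> \<ominus> y \<otimes> z) \<oplus> y \<otimes> z" using yr z reg_subset
        by (metis a_minus_def add.inv_solve_right m_closed minus_closed one_closed subset_iff)
      ultimately have "\<one> \<in> Q" using Q.a_closed[of "\<one> \<ominus> y \<otimes> z" "y \<otimes> z"] by simp
      then show False using Q.one_imp_carrier Q.I_notcarr by simp
    qed
  qed
  ultimately show ?thesis using p(1) by blast
qed

lemma basic_curve:
  assumes "f \<in> reg F ord Cl"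
  shows "{x\<in>pt_set. f \<notin> max_at F ord Cl x} = (if f = \<zero> then {} else insert \<zero> {p\<in>Cl. ord p f = 0})"
proof (cases "f = \<zero>")
  case True
  then show ?thesis by (auto simp: max_at_def zero_reg)
next
  case False
  have "f \<in> max_at F ord Cl p \<longleftrightarrow> ord p f \<noteq> 0" if "p \<in> Cl" for p
    using regD[OF assms that _ False] that zero_notin_Cl assms False by (force simp: max_at_def)
  then show ?thesis using False by (auto simp: max_at_zero)
qed

text \<open>A function regular off the zeros of \<open>f\<close> has only finitely many poles on the
  curve, all of them at zeros of \<open>f\<close>; a high power of \<open>f\<close> cancels
  them.\<close>

lemma localization_curve:
  assumes f: "f \<in> reg F ord Cl"
  shows "is_localization (F\<lparr>carrier := reg F ord Cl\<rparr>) f (reg_ring F ord {x\<in>pt_set. f \<notin> max_at F ord Cl x})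
    (\<lambda>x. if {x\<in>pt_set. f \<notin> max_at F ord Cl x} = {} then \<zero> else x)"
proof (cases "f = \<zero>")
  case True
  \<comment> \<open>For \<open>f = 0\<close> the basic open set is empty and the localization is the
    zero ring. The exponent must be positive here, since the power 0 of \<open>f\<close> is
    1.\<close>
  have "\<exists>n::nat. f [^]\<^bsub>F\<lparr>carrier := reg F ord Cl\<rparr>\<^esub> n \<otimes> a = \<zero>" if "a \<in> carrier F" for a
    using that True by (intro exI[of _ 1]) (simp add: nat_pow_consistent[symmetric])
  moreover have "\<exists>n::nat. \<zero> \<otimes> \<zero> [^]\<^bsub>reg_ring F ord {}\<^esub> n = \<zero>"
    by (intro exI[of _ 0]) simp
  ultimately show ?thesis
    unfolding is_localization_def basic_curve[OF f] using True zero_reg reg_subset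
    by (auto simp: ring_hom_def carrier_reg_ring Units_def)
next
  case False
  define D where "D = insert \<zero> {p\<in>Cl. ord p f = 0}"
  have D: "{x\<in>pt_set. f \<notin> max_at F ord Cl x} = D" "D \<noteq> {}" "D \<subseteq> pt_set"
    using basic_curve[OF f] False by (auto simp: D_def)
  have fn: "f \<in> carrier F - {\<zero>}" using f False reg_subset by auto
  have sub: "reg F ord Cl \<subseteq> reg F ord D" using reg_mono[OF D(3)] by simp
  have "f \<in> Units (reg_ring F ord D)" using Units_reg[OF D(3,2)] fn by (auto simp: D_def)
  moreover have "\<exists>a\<in>reg F ord Cl. \<exists>n::nat. b \<otimes> f [^] n = a" if b: "b \<in> reg F ord D" for b
  proof (cases "b = \<zero>")
    case True
    then show ?thesis using zero_reg fn nz_pow by (intro bexI[of _ \<zero>] exI[of _ "0::nat"]) auto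
  next
    case bn: False
    have bc: "b \<in> carrier F - {\<zero>}" using b bn reg_subset by auto
    \<comment> \<open>A common bound for the pole orders of \<open>b\<close>; at a zero of
      \<open>f\<close> the \<open>n\<close>-th power of \<open>f\<close> has order at least
      \<open>n\<close>.\<close>
    obtain n where n: "\<And>q. q \<in> {p\<in>Cl. ord p b \<noteq> 0} \<Longrightarrow> nat (- ord q b) \<le> n"
      using finite_nat_set_iff_bounded_le[of "(\<lambda>q. nat (- ord q b)) ` {p\<in>Cl. ord p b \<noteq> 0}"] ord_fin[OF bc] by auto
    have "b \<otimes> f [^] n \<in> reg F ord Cl"
    proof (rule regI)
      show "b \<otimes> f [^] n \<in> carrier F" using bc fn by simp
      fix q assume q: "q \<in> Cl" "q \<noteq> \<zero>"
      have o: "ord q (b \<otimes> f [^] n) = ord q b + int n * ord q f"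
        using ord_mult[OF q(1) bc nz_pow[OF fn]] ord_pow[OF q(1) fn] by simp
      show "0 \<le> ord q (b \<otimes> f [^] n)"
      proof (cases "ord q f = 0")
        case True
        then have "0 \<le> ord q b" using regD[OF b _ q(2) bn] q by (auto simp: D_def)
        then show ?thesis using o True by simp
      next
        case False
        then have "1 \<le> ord q f" using regD[OF f q] fn by force
        then have "int n \<le> int n * ord q f" by (simp add: mult_le_cancel_left1)
        moreover have "- ord q b \<le> int n" using n[of q] q by (cases "ord q b = 0") auto
        ultimately show ?thesis using o by linarith
      qed
    qed
    then show ?thesis by blast
  qed
  moreover have "\<exists>n::nat. f [^]\<^bsub>F\<lparr>carrier := reg F ord Cl\<rparr>\<^esub> n \<otimes> a = \<zero>" if "a \<in> carrier F" "a = \<zero>" for a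
    using that fn nz_pow[OF fn] by (intro exI[of _ 0]) simp
  ultimately show ?thesis
    unfolding is_localization_def D(1) using D(2) sub reg_subset
    by (auto simp: ring_hom_def carrier_reg_ring reg_ring_ne nat_pow_consistent[symmetric])
qed

text \<open>The point map is injective because a uniformizer vanishes at its own closed point and at
  no other point.\<close>

lemma chart_curve: "chart (C i) pt_set (max_at F ord Cl)"
  unfolding chart_def
proof (intro conjI ballI allI impI)
  show o: "opn (C i) pt_set" unfolding opn_curve by auto
  have B: "sec (C i) pt_set = F\<lparr>carrier := reg F ord Cl\<rparr>" by (simp add: reg_ring_ne)
  show "bij_betw (max_at F ord Cl) pt_set {p. primeideal p (sec (C i) pt_set)}"
    unfolding bij_betw_def B
  proof
    have "p = q" if "p \<in> pt_set" "q \<in> pt_set" "max_at F ord Cl p = max_at F ord Cl q" for p q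
    proof (rule ccontr)
      have self: "p \<in> max_at F ord Cl p" if "p \<in> Cl" for p
        using that Cl_sub ord_self[OF _ that] by (auto simp: max_at_def intro!: regI)
      have other: "p \<notin> max_at F ord Cl q" if "p \<in> Cl" "q \<in> pt_set" "p \<noteq> q" for p q
        using that zero_notin_Cl ord_self[OF _ that(1)] by (auto simp: max_at_def)
      assume "p \<noteq> q"
      then have "p \<in> Cl \<or> q \<in> Cl" using that by blast
      then show False using self other that \<open>p \<noteq> q\<close> by blast
    qed
    then show "inj_on (max_at F ord Cl) pt_set" by (rule inj_onI)
    show "max_at F ord Cl ` pt_set = {p. primeideal p (F\<lparr>carrier := reg F ord Cl\<rparr>)}"
      using max_at_prime prime_is_max_at by (auto simp: image_iff)
  qed
  fix f assume "f \<in> carrier (sec (C i) pt_set)"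
  then have f: "f \<in> reg F ord Cl" unfolding B by simp
  show "opn (C i) {x\<in>pt_set. f \<notin> max_at F ord Cl x}"
  proof (cases "f = \<zero>")
    case False
    then have "finite {p\<in>Cl. ord p f \<noteq> 0}" using ord_fin f reg_subset by blast
    moreover have "Cl - insert \<zero> {p\<in>Cl. ord p f = 0} \<subseteq> {p\<in>Cl. ord p f \<noteq> 0}" by blast
    ultimately show ?thesis unfolding opn_curve basic_curve[OF f] using False by (auto intro: finite_subset)
  qed (unfold opn_curve basic_curve[OF f], simp)
  show "is_localization (sec (C i) pt_set) f (sec (C i) {x\<in>pt_set. f \<notin> max_at F ord Cl x})
      (res (C i) pt_set {x\<in>pt_set. f \<notin> max_at F ord Cl x})"
    using localization_curve[OF f] B unfolding sec_curve by (simp add: curve_sch_def)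
next
  fix W x assume W: "opn (C i) W \<and> x \<in> W \<and> x \<in> pt_set"
  then have fin: "finite (Cl - W)" "\<zero> \<in> W" unfolding opn_curve by auto
  \<comment> \<open>A function with simple zeros exactly at the finitely many closed points outside
    \<open>W\<close>, so that its basic open set is \<open>W\<close>.\<close>
  obtain b where b: "b \<in> carrier F - {\<zero>}" "\<And>q. q \<in> Cl \<Longrightarrow> ord q b = (if q \<in> Cl - W then int 1 else 0)"
    using ex_ord[OF fin(1), of "\<lambda>_. 1"] by (metis Diff_subset)
  have br: "b \<in> reg F ord Cl" using b by (intro regI) auto
  have "{x\<in>pt_set. b \<notin> max_at F ord Cl x} = insert \<zero> (W \<inter> Cl)"
    unfolding basic_curve[OF br] using b by (auto split: if_splits)
  then show "\<exists>f\<in>carrier (sec (C i) pt_set). f \<notin> max_at F ord Cl x \<and> {y\<in>pt_set. f \<notin> max_at F ord Cl y} \<subseteq> W"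
    using br W fin(2) by (intro bexI[of _ b]) (auto simp: reg_ring_ne)
qed

lemma open_sub_self: "open_sub (C i) pt_set = C i"
  using open_sub_curve[of i pt_set] zero_notin_Cl by (simp add: opn_curve)

lemma affine_curve: "affine (C i)"
  using chart_affine_open[OF ringed_space_curve chart_curve] open_sub_self by (simp add: affine_open_def)

lemma affine_open_curve: "opn (C i) U \<Longrightarrow> U \<noteq> {} \<Longrightarrow> affine_open (C i) U"
proof -
  assume U: "opn (C i) U" "U \<noteq> {}"
  then interpret V: curve F "U - {\<zero>}" ord by (intro sub_curve) (auto simp: opn_curve)
  show ?thesis using V.affine_curve open_sub_curve[OF U] U by (simp add: affine_open_def)
qed

lemma kscheme_curve:
  assumes "i \<in> ring_hom k (F\<lparr>carrier := reg F ord Cl\<rparr>)"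
  shows "kscheme k (C i)"
  unfolding kscheme_def using ringed_space_curve affine_open_curve[of i pt_set] assms
  by (auto simp: opn_curve reg_ring_ne)

end

section \<open>Morphisms from a curve into an affine chart\<close>

lemma (in ringed_chart) eq_on_D:
  assumes f: "f \<in> carrier B" and xy: "x \<in> carrier B" "y \<in> carrier B"
    and eq: "res X U (D f) x = res X U (D f) y"
  shows "\<exists>n::nat. f [^]\<^bsub>B\<^esub> n \<otimes>\<^bsub>B\<^esub> x = f [^]\<^bsub>B\<^esub> n \<otimes>\<^bsub>B\<^esub> y"
proof -
  interpret B: cring B by (rule B_cring)
  interpret R: cring "sec X (D f)" using sec_cring opn_D[OF f] by blast
  have "ring_hom_ring B (sec X (D f)) (res X U (D f))"
    by (rule ring_hom_ringI2[OF B.ring_axioms R.ring_axioms res_hom[OF opn_U opn_D[OF f] D_sub]])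
  then interpret H: ring_hom_ring B "sec X (D f)" "res X U (D f)" .
  have "res X U (D f) (x \<ominus>\<^bsub>B\<^esub> y) = \<zero>\<^bsub>sec X (D f)\<^esub>"
    using eq xy H.hom_closed[OF xy(2)] unfolding a_minus_def by (simp add: R.r_neg)
  then obtain n where n: "f [^]\<^bsub>B\<^esub> (n::nat) \<otimes>\<^bsub>B\<^esub> (x \<ominus>\<^bsub>B\<^esub> y) = \<zero>\<^bsub>B\<^esub>"
    using loc_D[OF f] xy unfolding is_localization_def by (metis B.minus_closed)
  have "f [^]\<^bsub>B\<^esub> n \<otimes>\<^bsub>B\<^esub> x \<ominus>\<^bsub>B\<^esub> f [^]\<^bsub>B\<^esub> n \<otimes>\<^bsub>B\<^esub> y = \<zero>\<^bsub>B\<^esub>"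
    using n f xy unfolding a_minus_def by (simp add: B.r_distr B.r_minus)
  then show ?thesis using f xy by (intro exI[of _ n]) (simp add: B.r_right_minus_eq)
qed

lemma (in ringed_chart) D_one: "D \<one>\<^bsub>B\<^esub> = U"
proof -
  have "\<one>\<^bsub>B\<^esub> \<notin> h x" if "x \<in> U" for x
  proof -
    interpret p: primeideal "h x" B using h_prime[OF that] .
    show ?thesis using p.one_imp_carrier p.I_notcarr by blast
  qed
  then show ?thesis unfolding D_def by blast
qed

text \<open>
  The morphism to \<open>Y\<close> induced by \<open>\<phi>\<close>: since sections of the curve are elements of its function field,
  the image of a section is found by writing it as a fraction somewhere on \<open>U\<close>.
\<close>

locale ring_to_mor = curve F Cl ord + Y: ringed_chart Y U h
  for F :: "'u ring" (structure) and Cl ord and Y :: "'u sch" and U h +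
  fixes k :: "'u ring" and i \<phi> :: "'u \<Rightarrow> 'u"
  assumes \<phi>: "\<phi> \<in> ring_hom (sec Y U) (F\<lparr>carrier := reg F ord Cl\<rparr>)"
    and kY: "str Y \<in> ring_hom k (glob Y)"
    and \<phi>_str: "c \<in> carrier k \<Longrightarrow> \<phi> (res Y (pts Y) U (str Y c)) = i c"
begin

lemma \<phi>_hom: "\<phi> \<in> ring_hom (sec Y U) F"
  using \<phi> reg_subset by (auto simp: ring_hom_def Pi_def)

lemma \<phi>_reg: "b \<in> carrier Y.B \<Longrightarrow> \<phi> b \<in> reg F ord Cl"
  using ring_hom_closed[OF \<phi>] by simp

lemma \<phi>_carrier: "b \<in> carrier Y.B \<Longrightarrow> \<phi> b \<in> carrier F"
  using ring_hom_closed[OF \<phi>_hom] .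

text \<open>Primes contract to primes and the chart is bijective onto primes, so the choice is
  unique. Outside the curve the value is \<open>undefined\<close>, as the normalization of morphisms
  demands.\<close>

definition pm where "pm x = (if x \<in> pt_set then (SOME y. y \<in> U \<and> h y = {b \<in> carrier Y.B. \<phi> b \<in> max_at F ord Cl x}) else undefined)"

lemma pm:
  assumes "x \<in> pt_set"
  shows "pm x \<in> U" "h (pm x) = {b \<in> carrier Y.B. \<phi> b \<in> max_at F ord Cl x}"
proof -
  interpret R: "domain" "F\<lparr>carrier := reg F ord Cl\<rparr>" using subring_is_domain[OF subring_reg] by auto
  interpret B: cring Y.B by (rule Y.B_cring)
  interpret H: ring_hom_ring Y.B "F\<lparr>carrier := reg F ord Cl\<rparr>" \<phi>
    by (rule ring_hom_ringI2[OF B.ring_axioms R.ring_axioms \<phi>])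
  have "primeideal {b \<in> carrier Y.B. \<phi> b \<in> max_at F ord Cl x} Y.B"
    by (rule H.primeideal_vimage[OF B.is_cring max_at_prime[OF assms]])
  then have "\<exists>y. y \<in> U \<and> h y = {b \<in> carrier Y.B. \<phi> b \<in> max_at F ord Cl x}" using Y.h_surj by blast
  from someI_ex[OF this] show "pm x \<in> U" "h (pm x) = {b \<in> carrier Y.B. \<phi> b \<in> max_at F ord Cl x}"
    using assms by (simp_all add: pm_def)
qed

definition PV where "PV V = {x \<in> pt_set. pm x \<in> V}"

definition frac where "frac V E s a b \<longleftrightarrow> res Y U E a = res Y V E s \<otimes>\<^bsub>sec Y E\<^esub> res Y U E b"

text \<open>\<open>r\<close> is the value of \<open>s\<close> at the generic point: \<open>s\<close>
  is the fraction \<open>a/b\<close> on \<open>Y.D b\<close>, and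
  \<open>\<phi> b \<noteq> \<zero>\<close> says that this set contains the image of the generic
  point. The open set \<open>V\<close> need not lie in the chart.\<close>

definition REL where "REL V s r \<longleftrightarrow> r \<in> carrier F \<and> (\<exists>a b. a \<in> carrier Y.B \<and> b \<in> carrier Y.B \<and>
   Y.D b \<subseteq> V \<and> \<phi> b \<noteq> \<zero> \<and> frac V (Y.D b) s a b \<and> r \<otimes> \<phi> b = \<phi> a)"

lemma frac_mono:
  assumes "opn Y V" "opn Y E" "opn Y E'" "E' \<subseteq> E" "E \<subseteq> V" "E \<subseteq> U"
    "s \<in> carrier (sec Y V)" "a \<in> carrier Y.B" "b \<in> carrier Y.B" "frac V E s a b"
  shows "frac V E' s a b"
proof -
  have "res Y E E' (res Y U E a) = res Y E E' (res Y V E s) \<otimes>\<^bsub>sec Y E'\<^esub> res Y E E' (res Y U E b)"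
    using assms(10) Y.res_closed[OF assms(1,2,5,7)] Y.res_closed[OF Y.opn_U assms(2,6,9)]
      ring_hom_mult[OF Y.res_hom[OF assms(2,3,4)]] unfolding frac_def by simp
  then show ?thesis unfolding frac_def
    using Y.res_res[OF Y.opn_U assms(2,3,4,6)] Y.res_res[OF assms(1-3,4,5,7)] assms(8,9) by simp
qed

text \<open>The local fraction at the image of \<open>x\<close> has a denominator not vanishing at
  \<open>x\<close>, so its value has nonnegative order there. Once values are known to be unique,
  the fractions at all points yield the same \<open>r\<close>, which is therefore regular on the
  preimage of \<open>V\<close>.\<close>

lemma key:
  assumes V: "opn Y V" and s: "s \<in> carrier (sec Y V)" and x: "x \<in> PV V"
  obtains r a b where "r \<in> carrier F" "a \<in> carrier Y.B" "b \<in> carrier Y.B" "Y.D b \<subseteq> V" "pm x \<in> Y.D b"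
    "\<phi> b \<noteq> \<zero>" "frac V (Y.D b) s a b" "r \<otimes> \<phi> b = \<phi> a" "\<phi> b \<notin> max_at F ord Cl x" "REL V s r"
    "r \<noteq> \<zero> \<Longrightarrow> x \<noteq> \<zero> \<Longrightarrow> 0 \<le> ord x r"
proof -
  have x': "x \<in> pt_set" "pm x \<in> V" using x by (auto simp: PV_def)
  note p = pm[OF x'(1)]
  obtain f where f: "f \<in> carrier Y.B" "pm x \<in> Y.D f" "Y.D f \<subseteq> V" using Y.base[OF V x'(2) p(1)] by blast
  obtain a b where ab: "a \<in> carrier Y.B" "b \<in> carrier Y.B" "Y.D b = Y.D f"
    "res Y V (Y.D f) s \<otimes>\<^bsub>sec Y (Y.D f)\<^esub> res Y U (Y.D f) b = res Y U (Y.D f) a"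
    using Y.local_fraction[OF f(1) Y.res_closed[OF V Y.opn_D[OF f(1)] f(3) s]] by metis
  have "b \<notin> h (pm x)" using f(2) ab(3) unfolding Y.D_def by blast
  then have nb: "\<phi> b \<notin> max_at F ord Cl x" using p ab by blast
  then have b0: "\<phi> b \<noteq> \<zero>" by (auto simp: max_at_def zero_reg)
  have bn: "\<phi> b \<in> carrier F - {\<zero>}" using b0 \<phi>_carrier[OF ab(2)] by blast
  have ac: "\<phi> a \<in> carrier F" using \<phi>_carrier[OF ab(1)] .
  define r where "r = \<phi> a \<otimes> inv (\<phi> b)"
  have rc: "r \<in> carrier F" unfolding r_def using ac nz_inv[OF bn] by blast
  have "inv (\<phi> b) \<otimes> \<phi> b = \<one>" using nz_r_inv[OF bn] m_comm bn nz_inv[OF bn] by auto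
  then have rb: "r \<otimes> \<phi> b = \<phi> a" unfolding r_def using ac bn nz_inv[OF bn] m_assoc[of "\<phi> a" "inv (\<phi> b)" "\<phi> b"] by auto
  have fr: "frac V (Y.D b) s a b" using ab unfolding frac_def by simp
  have REL: "REL V s r" unfolding REL_def using rc ab b0 fr rb f(3) by blast
  have "0 \<le> ord x r" if "r \<noteq> \<zero>" "x \<noteq> \<zero>"
  proof -
    have xC: "x \<in> Cl" using x'(1) that by blast
    have "ord x (\<phi> b) = 0" using nb \<phi>_reg[OF ab(2)] that xC regD[OF \<phi>_reg[OF ab(2)] xC _ b0] by (auto simp: max_at_def)
    moreover have "\<phi> a \<noteq> \<zero>" using rb integral[of r "\<phi> b"] rc bn that by auto
    then have "0 \<le> ord x (\<phi> a)" using regD[OF \<phi>_reg[OF ab(1)] xC] that by blast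
    ultimately show ?thesis using ord_mult[OF xC _ bn, of r] rc that rb by auto
  qed
  then show ?thesis using that[OF rc ab(1,2) _ _ b0 fr rb nb REL] ab(3) f by simp
qed

text \<open>Two values are compared on the basic set of the product of the denominators; it still
  contains the image of the generic point, because a product of nonzero elements of \<open>F\<close>
  is not 0.\<close>

lemma REL_combine:
  assumes V: "opn Y V" and s: "s \<in> carrier (sec Y V)" "s' \<in> carrier (sec Y V)" and r: "REL V s r" "REL V s' r'"
  obtains a b a' b' c where "a \<in> carrier Y.B" "b \<in> carrier Y.B" "a' \<in> carrier Y.B" "b' \<in> carrier Y.B"
    "c = b \<otimes>\<^bsub>Y.B\<^esub> b'" "Y.D c \<subseteq> V" "\<phi> c \<noteq> \<zero>" "\<phi> b \<noteq> \<zero>" "\<phi> b' \<noteq> \<zero>" "frac V (Y.D c) s a b" "frac V (Y.D c) s' a' b'"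
    "r \<otimes> \<phi> b = \<phi> a" "r' \<otimes> \<phi> b' = \<phi> a'" "r \<in> carrier F" "r' \<in> carrier F"
proof -
  interpret B: cring Y.B by (rule Y.B_cring)
  obtain a b where ab: "r \<in> carrier F" "a \<in> carrier Y.B" "b \<in> carrier Y.B" "Y.D b \<subseteq> V" "\<phi> b \<noteq> \<zero>"
    "frac V (Y.D b) s a b" "r \<otimes> \<phi> b = \<phi> a" using r(1) unfolding REL_def by blast
  obtain a' b' where ab': "r' \<in> carrier F" "a' \<in> carrier Y.B" "b' \<in> carrier Y.B" "Y.D b' \<subseteq> V" "\<phi> b' \<noteq> \<zero>"
    "frac V (Y.D b') s' a' b'" "r' \<otimes> \<phi> b' = \<phi> a'" using r(2) unfolding REL_def by blast
  let ?c = "b \<otimes>\<^bsub>Y.B\<^esub> b'"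
  have c: "?c \<in> carrier Y.B" using ab ab' by simp
  have D: "Y.D ?c = Y.D b \<inter> Y.D b'" using Y.D_mult ab ab' by blast
  have "\<phi> ?c = \<phi> b \<otimes> \<phi> b'" using ring_hom_mult[OF \<phi>_hom ab(3) ab'(3)] .
  then have "\<phi> ?c \<noteq> \<zero>" using integral[of "\<phi> b" "\<phi> b'"] \<phi>_carrier ab ab' by auto
  moreover have "frac V (Y.D ?c) s a b"
    using frac_mono[OF V Y.opn_D[OF ab(3)] Y.opn_D[OF c] _ ab(4) Y.D_sub s(1) ab(2,3,6)] D by blast
  moreover have "frac V (Y.D ?c) s' a' b'"
    using frac_mono[OF V Y.opn_D[OF ab'(3)] Y.opn_D[OF c] _ ab'(4) Y.D_sub s(2) ab'(2,3,6)] D by blast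
  ultimately show ?thesis using that[of a b a' b' ?c] ab ab' D by blast
qed

text \<open>Cross multiplication holds on the common basic set, hence in the coordinate ring after
  multiplying by a power of \<open>c\<close>. Under \<open>\<phi>\<close> that power becomes a
  nonzero element of the field and cancels.\<close>

lemma REL_unique:
  assumes V: "opn Y V" and s: "s \<in> carrier (sec Y V)" and r: "REL V s r" "REL V s r'"
  shows "r = r'"
proof -
  interpret B: cring Y.B by (rule Y.B_cring)
  obtain a b a' b' c where ab: "a \<in> carrier Y.B" "b \<in> carrier Y.B" "a' \<in> carrier Y.B" "b' \<in> carrier Y.B"
    "c = b \<otimes>\<^bsub>Y.B\<^esub> b'" "Y.D c \<subseteq> V" "\<phi> c \<noteq> \<zero>" "\<phi> b \<noteq> \<zero>" "\<phi> b' \<noteq> \<zero>" "frac V (Y.D c) s a b" "frac V (Y.D c) s a' b'"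
    "r \<otimes> \<phi> b = \<phi> a" "r' \<otimes> \<phi> b' = \<phi> a'" "r \<in> carrier F" "r' \<in> carrier F"
    using REL_combine[OF V s s r] .
  have c: "c \<in> carrier Y.B" using ab by simp
  let ?E = "Y.D c" and ?r = "res Y U (Y.D c)"
  interpret R: cring "sec Y ?E" using Y.sec_cring Y.opn_D[OF c] by blast
  have rh: "?r \<in> ring_hom Y.B (sec Y ?E)" using Y.res_hom Y.opn_U Y.opn_D[OF c] Y.D_sub by blast
  note cl = ring_hom_closed[OF rh]
  have sc: "res Y V ?E s \<in> carrier (sec Y ?E)" using Y.res_closed[OF V Y.opn_D[OF c] ab(6) s] .
  have "?r (a \<otimes>\<^bsub>Y.B\<^esub> b') = ?r a \<otimes>\<^bsub>sec Y ?E\<^esub> ?r b'" using ring_hom_mult[OF rh] ab by simp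
  also have "\<dots> = ?r a' \<otimes>\<^bsub>sec Y ?E\<^esub> ?r b"
    using ab(10,11) cl ab(1-4) sc unfolding frac_def by (simp add: R.m_assoc R.m_comm[of "?r b'" "?r b"])
  also have "\<dots> = ?r (a' \<otimes>\<^bsub>Y.B\<^esub> b)" using ring_hom_mult[OF rh] ab by simp
  finally obtain n where n: "c [^]\<^bsub>Y.B\<^esub> (n::nat) \<otimes>\<^bsub>Y.B\<^esub> (a \<otimes>\<^bsub>Y.B\<^esub> b') = c [^]\<^bsub>Y.B\<^esub> n \<otimes>\<^bsub>Y.B\<^esub> (a' \<otimes>\<^bsub>Y.B\<^esub> b)"
    using Y.eq_on_D[OF c, of "a \<otimes>\<^bsub>Y.B\<^esub> b'" "a' \<otimes>\<^bsub>Y.B\<^esub> b"] ab by auto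
  note fc = \<phi>_carrier
  have "\<phi> c [^] n \<otimes> (\<phi> a \<otimes> \<phi> b') = \<phi> (c [^]\<^bsub>Y.B\<^esub> n \<otimes>\<^bsub>Y.B\<^esub> (a \<otimes>\<^bsub>Y.B\<^esub> b'))"
    using ring_hom_mult[OF \<phi>_hom] ring_hom_pow[OF \<phi>_hom B.is_cring is_cring c] ab c by simp
  also have "\<dots> = \<phi> c [^] n \<otimes> (\<phi> a' \<otimes> \<phi> b)"
    unfolding n using ring_hom_mult[OF \<phi>_hom] ring_hom_pow[OF \<phi>_hom B.is_cring is_cring c] ab c by simp
  finally have "\<phi> a \<otimes> \<phi> b' = \<phi> a' \<otimes> \<phi> b"
    using m_lcancel[of "\<phi> c [^] n"] nz_pow[of "\<phi> c" n] ab fc c by auto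
  then have "r \<otimes> (\<phi> b \<otimes> \<phi> b') = r' \<otimes> (\<phi> b \<otimes> \<phi> b')"
    using ab(12-15) fc ab(1-4) by (metis m_assoc m_comm)
  moreover have "\<phi> b \<otimes> \<phi> b' \<noteq> \<zero>" using integral[of "\<phi> b" "\<phi> b'"] fc ab by auto
  ultimately show ?thesis using m_rcancel[of "\<phi> b \<otimes> \<phi> b'" r r'] fc ab by auto
qed

lemma REL_add_mult:
  assumes V: "opn Y V" and s: "s \<in> carrier (sec Y V)" "s' \<in> carrier (sec Y V)" and r: "REL V s r" "REL V s' r'"
  shows "REL V (s \<oplus>\<^bsub>sec Y V\<^esub> s') (r \<oplus> r')" "REL V (s \<otimes>\<^bsub>sec Y V\<^esub> s') (r \<otimes> r')"
proof -
  interpret B: cring Y.B by (rule Y.B_cring)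
  obtain a b a' b' c where ab: "a \<in> carrier Y.B" "b \<in> carrier Y.B" "a' \<in> carrier Y.B" "b' \<in> carrier Y.B"
    "c = b \<otimes>\<^bsub>Y.B\<^esub> b'" "Y.D c \<subseteq> V" "\<phi> c \<noteq> \<zero>" "\<phi> b \<noteq> \<zero>" "\<phi> b' \<noteq> \<zero>" "frac V (Y.D c) s a b" "frac V (Y.D c) s' a' b'"
    "r \<otimes> \<phi> b = \<phi> a" "r' \<otimes> \<phi> b' = \<phi> a'" "r \<in> carrier F" "r' \<in> carrier F"
    using REL_combine[OF V s r] .
  have c: "c \<in> carrier Y.B" using ab by simp
  let ?E = "Y.D c" and ?r = "res Y U (Y.D c)"
  interpret R: cring "sec Y ?E" using Y.sec_cring Y.opn_D[OF c] by blast
  interpret V: cring "sec Y V" using Y.sec_cring V by blast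
  have rh: "?r \<in> ring_hom Y.B (sec Y ?E)" using Y.res_hom Y.opn_U Y.opn_D[OF c] Y.D_sub by blast
  have vh: "res Y V ?E \<in> ring_hom (sec Y V) (sec Y ?E)" using Y.res_hom[OF V Y.opn_D[OF c] ab(6)] .
  note cl = ring_hom_closed[OF rh] ring_hom_closed[OF vh] and fc = \<phi>_carrier
  have rc: "?r c = ?r b \<otimes>\<^bsub>sec Y ?E\<^esub> ?r b'" unfolding ab(5) using ring_hom_mult[OF rh ab(2,4)] ab(5) by simp
  define S where "S = res Y V ?E s"
  define S' where "S' = res Y V ?E s'"
  have Sc: "S \<in> carrier (sec Y ?E)" "S' \<in> carrier (sec Y ?E)" using cl s by (auto simp: S_def S'_def)
  have f: "?r a = S \<otimes>\<^bsub>sec Y ?E\<^esub> ?r b" "?r a' = S' \<otimes>\<^bsub>sec Y ?E\<^esub> ?r b'" using ab(10,11) by (auto simp: frac_def S_def S'_def)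
  have "?r (a \<otimes>\<^bsub>Y.B\<^esub> b' \<oplus>\<^bsub>Y.B\<^esub> a' \<otimes>\<^bsub>Y.B\<^esub> b) = (S \<oplus>\<^bsub>sec Y ?E\<^esub> S') \<otimes>\<^bsub>sec Y ?E\<^esub> ?r c"
    using ring_hom_mult[OF rh] ring_hom_add[OF rh] ab(1-4) f Sc cl rc
    by (simp add: R.l_distr R.m_assoc R.m_comm[of "?r b'" "?r b"])
  then have "frac V ?E (s \<oplus>\<^bsub>sec Y V\<^esub> s') (a \<otimes>\<^bsub>Y.B\<^esub> b' \<oplus>\<^bsub>Y.B\<^esub> a' \<otimes>\<^bsub>Y.B\<^esub> b) c"
    using ring_hom_add[OF vh s] by (simp add: frac_def S_def S'_def)
  moreover have "(r \<oplus> r') \<otimes> \<phi> c = \<phi> (a \<otimes>\<^bsub>Y.B\<^esub> b' \<oplus>\<^bsub>Y.B\<^esub> a' \<otimes>\<^bsub>Y.B\<^esub> b)"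
    using ring_hom_mult[OF \<phi>_hom] ring_hom_add[OF \<phi>_hom] ab(1-5) fc ab(12,13)[symmetric] ab(14,15)
    by (simp add: l_distr m_assoc m_comm[of "\<phi> b'" "\<phi> b"])
  ultimately show "REL V (s \<oplus>\<^bsub>sec Y V\<^esub> s') (r \<oplus> r')"
    unfolding REL_def using ab c by (intro conjI exI[of _ "a \<otimes>\<^bsub>Y.B\<^esub> b' \<oplus>\<^bsub>Y.B\<^esub> a' \<otimes>\<^bsub>Y.B\<^esub> b"] exI[of _ c]) auto
  have "?r (a \<otimes>\<^bsub>Y.B\<^esub> a') = (S \<otimes>\<^bsub>sec Y ?E\<^esub> S') \<otimes>\<^bsub>sec Y ?E\<^esub> ?r c"
    using ring_hom_mult[OF rh] ab(1-4) f Sc cl rc by (simp add: R.m_ac)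
  then have "frac V ?E (s \<otimes>\<^bsub>sec Y V\<^esub> s') (a \<otimes>\<^bsub>Y.B\<^esub> a') c"
    using ring_hom_mult[OF vh s] by (simp add: frac_def S_def S'_def)
  moreover have "(r \<otimes> r') \<otimes> \<phi> c = \<phi> (a \<otimes>\<^bsub>Y.B\<^esub> a')"
    using ring_hom_mult[OF \<phi>_hom] ab(1-5) fc ab(12-13)[symmetric] ab(14,15) by (simp add: m_ac)
  ultimately show "REL V (s \<otimes>\<^bsub>sec Y V\<^esub> s') (r \<otimes> r')"
    unfolding REL_def using ab c by (intro conjI exI[of _ "a \<otimes>\<^bsub>Y.B\<^esub> a'"] exI[of _ c]) auto
qed

lemma REL_one:
  assumes V: "opn Y V" and x: "x \<in> PV V"
  shows "REL V \<one>\<^bsub>sec Y V\<^esub> \<one>"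
proof -
  interpret V: cring "sec Y V" using Y.sec_cring V by blast
  obtain b where b: "b \<in> carrier Y.B" "Y.D b \<subseteq> V" "\<phi> b \<noteq> \<zero>" using key[OF V V.one_closed x] by metis
  interpret R: cring "sec Y (Y.D b)" using Y.sec_cring Y.opn_D[OF b(1)] by blast
  have "frac V (Y.D b) \<one>\<^bsub>sec Y V\<^esub> b b"
    unfolding frac_def using ring_hom_one[OF Y.res_hom[OF V Y.opn_D[OF b(1)] b(2)]]
      Y.res_closed[OF Y.opn_U Y.opn_D[OF b(1)] Y.D_sub b(1)] by simp
  then show ?thesis unfolding REL_def using b \<phi>_carrier[OF b(1)] by (intro conjI exI[of _ b]) auto
qed

lemma REL_res:
  assumes VW: "opn Y V" "opn Y W" "W \<subseteq> V" "s \<in> carrier (sec Y V)" and r: "REL W (res Y V W s) r"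
  shows "REL V s r"
proof -
  obtain a b where ab: "r \<in> carrier F" "a \<in> carrier Y.B" "b \<in> carrier Y.B" "Y.D b \<subseteq> W" "\<phi> b \<noteq> \<zero>"
    "frac W (Y.D b) (res Y V W s) a b" "r \<otimes> \<phi> b = \<phi> a" using r unfolding REL_def by blast
  have "frac V (Y.D b) s a b"
    using ab(6) Y.res_res[OF VW(1,2) Y.opn_D[OF ab(3)] ab(4) VW(3,4)] by (simp add: frac_def)
  then show ?thesis unfolding REL_def using ab VW(3) by blast
qed

text \<open>Over an empty preimage the only section is 0.\<close>

definition smap where "smap V s = (if PV V = {} then \<zero> else (THE r. REL V s r))"

lemma smap_eq: "opn Y V \<Longrightarrow> s \<in> carrier (sec Y V) \<Longrightarrow> PV V \<noteq> {} \<Longrightarrow> REL V s r \<Longrightarrow> smap V s = r"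
  unfolding smap_def using REL_unique by (auto intro!: the_equality)

lemma smap_REL:
  assumes "opn Y V" "s \<in> carrier (sec Y V)" "PV V \<noteq> {}"
  shows "REL V s (smap V s)"
proof -
  obtain x where "x \<in> PV V" using assms by blast
  then obtain r where "REL V s r" using key[OF assms(1,2)] by metis
  then show ?thesis using smap_eq[OF assms] by simp
qed

lemma smap_closed:
  assumes "opn Y V" "s \<in> carrier (sec Y V)"
  shows "smap V s \<in> carrier (reg_ring F ord (PV V))"
proof (cases "PV V = {}")
  case False
  have "smap V s \<in> reg F ord (PV V)"
  proof (rule regI)
    show "smap V s \<in> carrier F" using smap_REL[OF assms False] by (simp add: REL_def)
    fix p assume p: "smap V s \<noteq> \<zero>" "p \<in> PV V" "p \<noteq> \<zero>"
    obtain r where "REL V s r" "r \<noteq> \<zero> \<Longrightarrow> p \<noteq> \<zero> \<Longrightarrow> 0 \<le> ord p r" using key[OF assms p(2)] by metis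
    then show "0 \<le> ord p (smap V s)" using smap_eq[OF assms False] p by auto
  qed
  then show ?thesis using False by (simp add: carrier_reg_ring)
qed (simp add: smap_def carrier_reg_ring)

lemma PV_opn:
  assumes V: "opn Y V"
  shows "opn (C i) (PV V)"
proof (subst openin_subopen, intro ballI)
  fix x assume "x \<in> PV V"
  then have x: "x \<in> pt_set" "pm x \<in> V" by (auto simp: PV_def)
  obtain f where f: "f \<in> carrier Y.B" "pm x \<in> Y.D f" "Y.D f \<subseteq> V" using Y.base[OF V x(2) pm(1)[OF x(1)]] by blast
  let ?T = "{y\<in>pt_set. \<phi> f \<notin> max_at F ord Cl y}"
  have "opn (C i) ?T" using chart_curve[of i] \<phi>_reg[OF f(1)] unfolding chart_def by (simp add: reg_ring_ne)
  moreover have "x \<in> ?T" using f x pm(2)[OF x(1)] by (auto simp: Y.D_def)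
  moreover have "y \<in> PV V" if "y \<in> ?T" for y
    using that f pm[of y] unfolding PV_def Y.D_def by blast
  ultimately show "\<exists>T. opn (C i) T \<and> x \<in> T \<and> T \<subseteq> PV V" by blast
qed

definition induced where
  "induced = \<lparr>pt = pm, sh = (\<lambda>V\<in>{V. opn Y V}. \<lambda>s\<in>carrier (sec Y V). smap V s)\<rparr>"

lemma pre_induced: "pre (C i) induced V = PV V"
  by (simp add: pre_def PV_def induced_def)

lemma smap_hom:
  assumes V: "opn Y V"
  shows "smap V \<in> ring_hom (sec Y V) (reg_ring F ord (PV V))"
proof (cases "PV V = {}")
  case True
  then show ?thesis by (auto simp: ring_hom_def smap_def carrier_reg_ring)
next
  case False
  then obtain x where x: "x \<in> PV V" by blast
  interpret V: cring "sec Y V" using Y.sec_cring V by blast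
  show ?thesis
  proof (rule ring_hom_memI)
    fix s s' assume s: "s \<in> carrier (sec Y V)"
    show "smap V s \<in> carrier (reg_ring F ord (PV V))" using smap_closed[OF V s] .
    assume s': "s' \<in> carrier (sec Y V)"
    note R = REL_add_mult[OF V s s' smap_REL[OF V s False] smap_REL[OF V s' False]]
    show "smap V (s \<otimes>\<^bsub>sec Y V\<^esub> s') = smap V s \<otimes>\<^bsub>reg_ring F ord (PV V)\<^esub> smap V s'"
      using smap_eq[OF V _ False R(2)] s s' by simp
    show "smap V (s \<oplus>\<^bsub>sec Y V\<^esub> s') = smap V s \<oplus>\<^bsub>reg_ring F ord (PV V)\<^esub> smap V s'"
      using smap_eq[OF V _ False R(1)] s s' by simp
  next
    show "smap V \<one>\<^bsub>sec Y V\<^esub> = \<one>\<^bsub>reg_ring F ord (PV V)\<^esub>"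
      using smap_eq[OF V V.one_closed False REL_one[OF V x]] False by simp
  qed
qed

lemma REL_U:
  assumes "opn Y V" "U \<subseteq> V" "s \<in> carrier (sec Y V)"
  shows "REL V s (\<phi> (res Y V U s))"
proof -
  interpret B: cring Y.B by (rule Y.B_cring)
  have b: "res Y V U s \<in> carrier Y.B" using Y.res_closed[OF assms(1) Y.opn_U assms(2,3)] .
  have "\<phi> \<one>\<^bsub>Y.B\<^esub> = \<one>" using ring_hom_one[OF \<phi>_hom] .
  moreover have "frac V (Y.D \<one>\<^bsub>Y.B\<^esub>) s (res Y V U s) \<one>\<^bsub>Y.B\<^esub>"
    unfolding frac_def Y.D_one using b Y.res_id[OF Y.opn_U] by simp
  ultimately show ?thesis
    unfolding REL_def using b \<phi>_carrier[OF b] Y.D_one assms(2)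
    by (intro conjI exI[of _ "res Y V U s"] exI[of _ "\<one>\<^bsub>Y.B\<^esub>"]) auto
qed

lemma PV_U: "U \<subseteq> V \<Longrightarrow> PV V = pt_set"
  using pm(1) by (auto simp: PV_def)

text \<open>Let the value of \<open>s\<close> be a unit near \<open>x\<close>. It is nonzero, and
  \<open>a = s b\<close> vanishes at the image of \<open>x\<close>, so \<open>\<phi> a\<close> is a
  nonzero element vanishing at \<open>x\<close>. This forces \<open>x\<close> to be closed; as the
  value of \<open>s\<close> has order 0 there, \<open>\<phi> b\<close> would vanish at
  \<open>x\<close>, against the choice of \<open>b\<close>.\<close>

lemma local_induced:
  assumes V: "opn Y V" and s: "s \<in> carrier (sec Y V)" and x: "x \<in> PV V" and v: "vanishes Y V s (pm x)"
  shows "vanishes (C i) (PV V) (smap V s) x"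
  unfolding vanishes_def
proof (intro allI impI notI; elim conjE)
  fix W assume W: "opn (C i) W" "x \<in> W" "W \<subseteq> PV V"
    "res (C i) (PV V) W (smap V s) \<in> Units (sec (C i) W)"
  have x': "x \<in> pt_set" "pm x \<in> V" using x by (auto simp: PV_def)
  have Wn: "W \<noteq> {}" "W \<subseteq> pt_set" using W openin_subset[OF W(1)] by auto
  define r where "r = smap V s"
  have r: "r \<in> carrier F - {\<zero>}" "\<And>p. p \<in> W \<Longrightarrow> p \<noteq> \<zero> \<Longrightarrow> ord p r = 0"
    using W(4) Wn Units_reg[OF Wn(2,1)] by (auto simp: r_def)
  obtain r' a b where ab: "a \<in> carrier Y.B" "b \<in> carrier Y.B" "Y.D b \<subseteq> V" "pm x \<in> Y.D b"
    "\<phi> b \<noteq> \<zero>" "frac V (Y.D b) s a b" "r' \<otimes> \<phi> b = \<phi> a" "\<phi> b \<notin> max_at F ord Cl x" "REL V s r'"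
    using key[OF V s x] by metis
  have "r' = r" using smap_eq[OF V s _ ab(9)] x by (auto simp: r_def)
  have o: "opn Y (Y.D b)" using Y.opn_D[OF ab(2)] .
  interpret R: cring "sec Y (Y.D b)" using Y.sec_cring o by blast
  have sD: "res Y V (Y.D b) s \<in> carrier (sec Y (Y.D b))" using Y.res_closed[OF V o ab(3) s] .
  have "vanishes Y (Y.D b) (res Y V (Y.D b) s) (pm x)" using Y.vanishes_res[OF V o ab(3,4) s] v by blast
  then have "vanishes Y (Y.D b) (res Y U (Y.D b) b \<otimes>\<^bsub>sec Y (Y.D b)\<^esub> res Y V (Y.D b) s) (pm x)"
    using Y.vanishes_unit_mult[OF o ab(4) sD Y.res_D_unit[OF ab(2)]] by blast
  moreover have "res Y U (Y.D b) b \<otimes>\<^bsub>sec Y (Y.D b)\<^esub> res Y V (Y.D b) s = res Y U (Y.D b) a"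
    using ab(6) sD R.m_comm Y.res_closed[OF Y.opn_U o Y.D_sub ab(2)] by (simp add: frac_def)
  ultimately have "vanishes Y U a (pm x)" using Y.vanishes_res[OF Y.opn_U o Y.D_sub ab(4,1)] by simp
  then have "a \<in> h (pm x)" using Y.vanishes_iff pm(1)[OF x'(1)] ab(1) by blast
  then have am: "\<phi> a \<in> max_at F ord Cl x" using pm(2)[OF x'(1)] by blast
  have bn: "\<phi> b \<in> carrier F - {\<zero>}" using ab \<phi>_carrier by blast
  have an: "\<phi> a \<noteq> \<zero>" using nz_mult[OF r(1) bn] ab(7) \<open>r' = r\<close> by auto
  then have xC: "x \<in> Cl" "x \<noteq> \<zero>" "0 < ord x (\<phi> a)" using am x'(1) by (auto simp: max_at_def)
  then have "0 < ord x (\<phi> b)" using ord_mult[OF xC(1) r(1) bn] r(2)[OF W(2) xC(2)] ab(7) \<open>r' = r\<close> by simp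
  then show False using ab(8) \<phi>_reg[OF ab(2)] xC by (auto simp: max_at_def)
qed

lemma is_mor_induced: "is_mor k (C i) Y induced"
proof -
  have sh: "sh induced V s = smap V s" if "opn Y V" "s \<in> carrier (sec Y V)" for V s
    using that by (simp add: induced_def)
  have pt: "pt induced = pm" by (simp add: induced_def)
  have U: "U \<subseteq> pts Y" using openin_subset[OF Y.opn_U] .
  have "continuous_map (sp (C i)) (sp Y) pm"
    unfolding continuous_map_def pts_curve
    using pm(1) U PV_opn[unfolded PV_def] by auto
  moreover have "pm \<in> extensional (pts (C i))" by (simp add: pm_def extensional_def)
  moreover have "sh induced V \<in> ring_hom (sec Y V) (reg_ring F ord (PV V))" if "opn Y V" for V
    by (rule ring_hom_cong[OF smap_hom[OF that]]) (use sh[OF that] Y.sec_cring[OF that] in \<open>auto simp: cring_def\<close>)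
  moreover have "smap W (res Y V W s) = (if PV W = {} then \<zero> else smap V s)"
    if "opn Y V" "opn Y W" "W \<subseteq> V" "s \<in> carrier (sec Y V)" for V W s
  proof (cases "PV W = {}")
    case False
    moreover have "PV V \<noteq> {}" using False that(3) by (auto simp: PV_def)
    ultimately show ?thesis
      using smap_eq[OF that(1,4) _ REL_res[OF that smap_REL[OF that(2) Y.res_closed[OF that]]]] by simp
  qed (simp add: smap_def)
  moreover have "smap (pts Y) (str Y c) = i c" if c: "c \<in> carrier k" for c
    using smap_eq[OF openin_topspace ring_hom_closed[OF kY c] _ REL_U[OF openin_topspace U ring_hom_closed[OF kY c]]]
      PV_U[OF U] \<phi>_str[OF c] by simp
  ultimately show ?thesis
    unfolding is_mor_def pre_induced pt
    using local_induced Y.res_closed ring_hom_closed[OF kY] by (auto simp: sh) (auto simp: induced_def)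
qed

lemma sh_induced: "b \<in> carrier Y.B \<Longrightarrow> sh induced U b = \<phi> b"
  using smap_eq[OF Y.opn_U _ _ REL_U[OF Y.opn_U subset_refl]] PV_U[of U] Y.res_id[OF Y.opn_U] Y.opn_U
  by (simp add: induced_def)

end

text \<open>The existence half of the correspondence between morphisms to an affine scheme and ring
  homomorphisms. The last clause identifies the image of the generic point by the kernel of
  \<open>\<phi>\<close>.\<close>

lemma (in curve) ex_mor:
  assumes "ringed_chart Y U h" "\<phi> \<in> ring_hom (sec Y U) (F\<lparr>carrier := reg F ord Cl\<rparr>)"
    "str Y \<in> ring_hom k (glob Y)" "\<And>c. c \<in> carrier k \<Longrightarrow> \<phi> (res Y (pts Y) U (str Y c)) = i c"
  obtains m where "is_mor k (C i) Y m" "pre (C i) m U = pt_set"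
    "\<And>b. b \<in> carrier (sec Y U) \<Longrightarrow> sh m U b = \<phi> b"
    "h (pt m \<zero>) = {b \<in> carrier (sec Y U). \<phi> b = \<zero>}"
proof -
  interpret Y: ringed_chart Y U h by fact
  interpret ring_to_mor F Cl ord Y U h k i \<phi> using assms(2-) by unfold_locales
  have "h (pt induced \<zero>) = {b \<in> carrier (sec Y U). \<phi> b = \<zero>}"
    using pm(2)[of \<zero>] by (simp add: induced_def max_at_zero)
  then show ?thesis using that[OF is_mor_induced _ sh_induced] pre_induced[of U] PV_U[of U] by simp
qed

section \<open>Localizations and fields of fractions\<close>

text \<open>Every element of the localization comes from \<open>A\<close> after multiplication by a
  unit, a power of \<open>\<phi> f\<close>, so homomorphisms are determined on
  \<open>A\<close>.\<close>

lemma localization_epi: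
  assumes L: "is_localization A f B \<phi>" and cr: "cring A" "cring B" "cring C"
    and fg: "\<psi> \<in> ring_hom B C" "\<psi>' \<in> ring_hom B C" and f: "f \<in> carrier A"
    and eq: "\<And>a. a \<in> carrier A \<Longrightarrow> \<psi> (\<phi> a) = \<psi>' (\<phi> a)" and b: "b \<in> carrier B"
  shows "\<psi> b = \<psi>' b"
proof -
  interpret B: cring B by fact
  interpret C: cring C by fact
  have u: "\<phi> f \<in> Units B" using L by (simp add: is_localization_def)
  obtain a n where a: "a \<in> carrier A" "b \<otimes>\<^bsub>B\<^esub> (\<phi> f [^]\<^bsub>B\<^esub> (n::nat)) = \<phi> a"
    using L b by (auto simp: is_localization_def)
  have un: "\<phi> f [^]\<^bsub>B\<^esub> n \<in> Units B" using Units_pow[OF cr(2) u] .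
  have same: "\<psi> (\<phi> f [^]\<^bsub>B\<^esub> n) = \<psi>' (\<phi> f [^]\<^bsub>B\<^esub> n)"
    using ring_hom_pow[OF fg(1) cr(2,3)] ring_hom_pow[OF fg(2) cr(2,3)] B.Units_closed[OF u] eq[OF f] by simp
  show ?thesis
  proof (rule Units_mult_cancel[OF cr(3)])
    show "\<psi> (\<phi> f [^]\<^bsub>B\<^esub> n) \<in> Units C" using ring_hom_Units[OF fg(1) cr(2,3) un] .
    show "\<psi> b \<in> carrier C" "\<psi>' b \<in> carrier C" using fg b ring_hom_closed by metis+
    show "\<psi> b \<otimes>\<^bsub>C\<^esub> \<psi> (\<phi> f [^]\<^bsub>B\<^esub> n) = \<psi>' b \<otimes>\<^bsub>C\<^esub> \<psi> (\<phi> f [^]\<^bsub>B\<^esub> n)"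
      using ring_hom_mult[OF fg(1) b B.Units_closed[OF un]] ring_hom_mult[OF fg(2) b B.Units_closed[OF un]]
        same eq[OF a(1)] a(2) by simp
  qed
qed

text \<open>A fraction \<open>a/s\<close> goes to \<open>\<psi> a\<close> divided by
  \<open>\<psi> s\<close>. As the localization is known only by its characterization, the map is set
  up as a relation. Independence of the fraction holds because cross products with equal image in
  \<open>B\<close> differ by an element killed by a power of \<open>f\<close>, and
  \<open>\<psi>\<close> turns that power into a unit.\<close>

lemma localization_extend:
  assumes L: "is_localization A f B \<phi>" and cr: "cring A" "cring B" "cring C"
    and \<psi>: "\<psi> \<in> ring_hom A C" and f: "f \<in> carrier A" and u: "\<psi> f \<in> Units C"
  obtains \<psi>' where "\<psi>' \<in> ring_hom B C" "\<And>a. a \<in> carrier A \<Longrightarrow> \<psi>' (\<phi> a) = \<psi> a"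
proof -
  interpret A: cring A by fact
  interpret B: cring B by fact
  interpret C: cring C by fact
  have \<phi>: "\<phi> \<in> ring_hom A B" and uf: "\<phi> f \<in> Units B"
    and fr: "\<And>b. b \<in> carrier B \<Longrightarrow> \<exists>a\<in>carrier A. \<exists>n::nat. b \<otimes>\<^bsub>B\<^esub> (\<phi> f [^]\<^bsub>B\<^esub> n) = \<phi> a"
    and ker: "\<And>a. a \<in> carrier A \<Longrightarrow> \<phi> a = \<zero>\<^bsub>B\<^esub> \<Longrightarrow> \<exists>n::nat. (f [^]\<^bsub>A\<^esub> n) \<otimes>\<^bsub>A\<^esub> a = \<zero>\<^bsub>A\<^esub>"
    using L unfolding is_localization_def by auto
  interpret H: ring_hom_ring A B \<phi> by (rule ring_hom_ringI2[OF A.ring_axioms B.ring_axioms \<phi>])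
  interpret K: ring_hom_ring A C \<psi> by (rule ring_hom_ringI2[OF A.ring_axioms C.ring_axioms \<psi>])
  define P where "P = {s \<in> carrier A. \<exists>n::nat. s = f [^]\<^bsub>A\<^esub> n}"
  have P: "s \<in> carrier A" "\<phi> s \<in> Units B" "\<psi> s \<in> Units C" if "s \<in> P" for s
    using that Units_pow[OF cr(2) uf] Units_pow[OF cr(3) u] f
      ring_hom_pow[OF \<phi> cr(1,2) f] ring_hom_pow[OF \<psi> cr(1,3) f] by (auto simp: P_def)
  have Pm: "s \<otimes>\<^bsub>A\<^esub> s' \<in> P" if "s \<in> P" "s' \<in> P" for s s'
  proof -
    obtain n n' where "s = f [^]\<^bsub>A\<^esub> (n::nat)" "s' = f [^]\<^bsub>A\<^esub> (n'::nat)" using \<open>s \<in> P\<close> \<open>s' \<in> P\<close> by (auto simp: P_def)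
    then have "s \<otimes>\<^bsub>A\<^esub> s' = f [^]\<^bsub>A\<^esub> (n + n')" using f by (simp add: A.nat_pow_mult)
    then show ?thesis using f by (auto simp: P_def)
  qed
  have P1: "\<one>\<^bsub>A\<^esub> \<in> P" by (auto simp: P_def intro: exI[of _ 0])
  define rel where "rel b c \<longleftrightarrow> c \<in> carrier C \<and> (\<exists>a\<in>carrier A. \<exists>s\<in>P. b \<otimes>\<^bsub>B\<^esub> \<phi> s = \<phi> a \<and> c \<otimes>\<^bsub>C\<^esub> \<psi> s = \<psi> a)" for b c
  have ex: "\<exists>c. rel b c" if b: "b \<in> carrier B" for b
  proof -
    obtain a n where a: "a \<in> carrier A" "b \<otimes>\<^bsub>B\<^esub> (\<phi> f [^]\<^bsub>B\<^esub> (n::nat)) = \<phi> a" using fr[OF b] by blast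
    let ?s = "f [^]\<^bsub>A\<^esub> n"
    have s: "?s \<in> P" using f by (auto simp: P_def)
    have "\<psi> a \<otimes>\<^bsub>C\<^esub> inv\<^bsub>C\<^esub> (\<psi> ?s) \<otimes>\<^bsub>C\<^esub> \<psi> ?s = \<psi> a"
      using P(3)[OF s] a by (simp add: C.m_assoc C.Units_closed)
    moreover have "\<psi> a \<otimes>\<^bsub>C\<^esub> inv\<^bsub>C\<^esub> (\<psi> ?s) \<in> carrier C" using P(3)[OF s] a by simp
    moreover have "b \<otimes>\<^bsub>B\<^esub> \<phi> ?s = \<phi> a" using a(2) ring_hom_pow[OF \<phi> cr(1,2) f] by simp
    ultimately show ?thesis unfolding rel_def using a(1) s by blast
  qed
  have un: "c = c'" if b: "b \<in> carrier B" and c: "rel b c" "rel b c'" for b c c'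
  proof -
    obtain a s where a: "c \<in> carrier C" "a \<in> carrier A" "s \<in> P" "b \<otimes>\<^bsub>B\<^esub> \<phi> s = \<phi> a" "c \<otimes>\<^bsub>C\<^esub> \<psi> s = \<psi> a"
      using c(1) unfolding rel_def by blast
    obtain a' s' where a': "c' \<in> carrier C" "a' \<in> carrier A" "s' \<in> P" "b \<otimes>\<^bsub>B\<^esub> \<phi> s' = \<phi> a'" "c' \<otimes>\<^bsub>C\<^esub> \<psi> s' = \<psi> a'"
      using c(2) unfolding rel_def by blast
    note sc = P[OF a(3)] P[OF a'(3)]
    have "\<phi> (a \<otimes>\<^bsub>A\<^esub> s') = \<phi> (a' \<otimes>\<^bsub>A\<^esub> s)"
      using a(1-3) a'(1-3) sc b by (simp add: a(4)[symmetric] a'(4)[symmetric] B.m_assoc B.m_comm[of "\<phi> s'" "\<phi> s"])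
    then have "\<phi> (a \<otimes>\<^bsub>A\<^esub> s' \<ominus>\<^bsub>A\<^esub> a' \<otimes>\<^bsub>A\<^esub> s) = \<zero>\<^bsub>B\<^esub>"
      using a a' sc unfolding a_minus_def by (simp add: B.r_neg del: H.hom_mult)
    then obtain n where n: "f [^]\<^bsub>A\<^esub> (n::nat) \<otimes>\<^bsub>A\<^esub> (a \<otimes>\<^bsub>A\<^esub> s' \<ominus>\<^bsub>A\<^esub> a' \<otimes>\<^bsub>A\<^esub> s) = \<zero>\<^bsub>A\<^esub>"
      using ker a a' sc by (meson A.minus_closed A.m_closed)
    have "f [^]\<^bsub>A\<^esub> n \<in> P" using f by (auto simp: P_def)
    then have uu: "\<psi> (f [^]\<^bsub>A\<^esub> n) \<in> Units C" using P by blast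
    have "\<psi> (f [^]\<^bsub>A\<^esub> n) \<otimes>\<^bsub>C\<^esub> \<psi> (a \<otimes>\<^bsub>A\<^esub> s' \<ominus>\<^bsub>A\<^esub> a' \<otimes>\<^bsub>A\<^esub> s) = \<zero>\<^bsub>C\<^esub>"
      using arg_cong[OF n, of \<psi>] a a' sc f K.hom_mult[of "f [^]\<^bsub>A\<^esub> n" "a \<otimes>\<^bsub>A\<^esub> s' \<ominus>\<^bsub>A\<^esub> a' \<otimes>\<^bsub>A\<^esub> s"] by simp
    then have "\<psi> (a \<otimes>\<^bsub>A\<^esub> s' \<ominus>\<^bsub>A\<^esub> a' \<otimes>\<^bsub>A\<^esub> s) = \<zero>\<^bsub>C\<^esub>"
      using uu a a' sc by (metis A.m_closed A.minus_closed C.Units_l_cancel C.Units_closed C.r_null C.zero_closed K.hom_closed)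
    then have "\<psi> a \<otimes>\<^bsub>C\<^esub> \<psi> s' \<ominus>\<^bsub>C\<^esub> \<psi> a' \<otimes>\<^bsub>C\<^esub> \<psi> s = \<zero>\<^bsub>C\<^esub>"
      using a a' sc unfolding a_minus_def by simp
    then have "\<psi> a \<otimes>\<^bsub>C\<^esub> \<psi> s' = \<psi> a' \<otimes>\<^bsub>C\<^esub> \<psi> s" using a a' sc by (simp add: C.r_right_minus_eq)
    then have "c \<otimes>\<^bsub>C\<^esub> (\<psi> s \<otimes>\<^bsub>C\<^esub> \<psi> s') = c' \<otimes>\<^bsub>C\<^esub> (\<psi> s \<otimes>\<^bsub>C\<^esub> \<psi> s')"
      using a(1-3) a'(1-3) sc by (simp add: a(5)[symmetric] a'(5)[symmetric] C.m_assoc C.m_comm[of "\<psi> s'" "\<psi> s"])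
    then show ?thesis using Units_mult_cancel[OF cr(3) C.Units_m_closed[OF sc(3,6)] a(1) a'(1)] by simp
  qed
  define \<psi>' where "\<psi>' b = (THE c. rel b c)" for b
  have \<psi>'_eq: "\<psi>' b = c" if "b \<in> carrier B" "rel b c" for b c
    unfolding \<psi>'_def by (rule the_equality) (use un that in auto)
  have r\<psi>: "rel b (\<psi>' b)" if "b \<in> carrier B" for b using ex[OF that] \<psi>'_eq[OF that] by auto
  have "\<psi>' \<in> ring_hom B C"
  proof (rule ring_hom_memI)
    fix b b' assume b: "b \<in> carrier B"
    show "\<psi>' b \<in> carrier C" using r\<psi>[OF b] by (simp add: rel_def)
    assume b': "b' \<in> carrier B"
    obtain a s where a: "\<psi>' b \<in> carrier C" "a \<in> carrier A" "s \<in> P" "b \<otimes>\<^bsub>B\<^esub> \<phi> s = \<phi> a" "\<psi>' b \<otimes>\<^bsub>C\<^esub> \<psi> s = \<psi> a"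
      using r\<psi>[OF b] unfolding rel_def by blast
    obtain a' s' where a': "\<psi>' b' \<in> carrier C" "a' \<in> carrier A" "s' \<in> P" "b' \<otimes>\<^bsub>B\<^esub> \<phi> s' = \<phi> a'" "\<psi>' b' \<otimes>\<^bsub>C\<^esub> \<psi> s' = \<psi> a'"
      using r\<psi>[OF b'] unfolding rel_def by blast
    note sc = P[OF a(3)] P[OF a'(3)]
    note cl = H.hom_closed[OF sc(1)] H.hom_closed[OF sc(4)] K.hom_closed[OF sc(1)] K.hom_closed[OF sc(4)]
    show "\<psi>' (b \<otimes>\<^bsub>B\<^esub> b') = \<psi>' b \<otimes>\<^bsub>C\<^esub> \<psi>' b'"
    proof (rule \<psi>'_eq)
      have "(b \<otimes>\<^bsub>B\<^esub> b') \<otimes>\<^bsub>B\<^esub> \<phi> (s \<otimes>\<^bsub>A\<^esub> s') = \<phi> (a \<otimes>\<^bsub>A\<^esub> a')"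
        using a(2) a'(2) sc b b' cl by (simp add: a(4)[symmetric] a'(4)[symmetric] B.m_ac)
      moreover have "(\<psi>' b \<otimes>\<^bsub>C\<^esub> \<psi>' b') \<otimes>\<^bsub>C\<^esub> \<psi> (s \<otimes>\<^bsub>A\<^esub> s') = \<psi> (a \<otimes>\<^bsub>A\<^esub> a')"
        using a(1,2) a'(1,2) sc cl by (simp add: a(5)[symmetric] a'(5)[symmetric] C.m_ac)
      ultimately show "rel (b \<otimes>\<^bsub>B\<^esub> b') (\<psi>' b \<otimes>\<^bsub>C\<^esub> \<psi>' b')"
        unfolding rel_def using Pm[OF a(3) a'(3)] a(1,2) a'(1,2) by (intro conjI bexI[of _ "a \<otimes>\<^bsub>A\<^esub> a'"] bexI[of _ "s \<otimes>\<^bsub>A\<^esub> s'"]) auto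
    qed (use b b' in simp)
    show "\<psi>' (b \<oplus>\<^bsub>B\<^esub> b') = \<psi>' b \<oplus>\<^bsub>C\<^esub> \<psi>' b'"
    proof (rule \<psi>'_eq)
      have "(b \<oplus>\<^bsub>B\<^esub> b') \<otimes>\<^bsub>B\<^esub> \<phi> (s \<otimes>\<^bsub>A\<^esub> s') = \<phi> (a \<otimes>\<^bsub>A\<^esub> s' \<oplus>\<^bsub>A\<^esub> a' \<otimes>\<^bsub>A\<^esub> s)"
        using a(2) a'(2) sc b b' cl
        by (simp add: a(4)[symmetric] a'(4)[symmetric] B.l_distr B.m_assoc B.m_comm[of "\<phi> s'" "\<phi> s"])
      moreover have "(\<psi>' b \<oplus>\<^bsub>C\<^esub> \<psi>' b') \<otimes>\<^bsub>C\<^esub> \<psi> (s \<otimes>\<^bsub>A\<^esub> s') = \<psi> (a \<otimes>\<^bsub>A\<^esub> s' \<oplus>\<^bsub>A\<^esub> a' \<otimes>\<^bsub>A\<^esub> s)"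
        using a(1,2) a'(1,2) sc cl
        by (simp add: a(5)[symmetric] a'(5)[symmetric] C.l_distr C.m_assoc C.m_comm[of "\<psi> s'" "\<psi> s"])
      ultimately show "rel (b \<oplus>\<^bsub>B\<^esub> b') (\<psi>' b \<oplus>\<^bsub>C\<^esub> \<psi>' b')"
        unfolding rel_def using Pm[OF a(3) a'(3)] a(1,2) a'(1,2) sc
        by (intro conjI bexI[of _ "a \<otimes>\<^bsub>A\<^esub> s' \<oplus>\<^bsub>A\<^esub> a' \<otimes>\<^bsub>A\<^esub> s"] bexI[of _ "s \<otimes>\<^bsub>A\<^esub> s'"]) auto
    qed (use b b' in simp)
  next
    show "\<psi>' \<one>\<^bsub>B\<^esub> = \<one>\<^bsub>C\<^esub>"
      by (rule \<psi>'_eq) (auto simp: rel_def intro!: bexI[of _ "\<one>\<^bsub>A\<^esub>"] P1)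
  qed
  moreover have "\<psi>' (\<phi> a) = \<psi> a" if "a \<in> carrier A" for a
  proof (rule \<psi>'_eq)
    show "rel (\<phi> a) (\<psi> a)" unfolding rel_def
      by (intro conjI, simp add: that, rule bexI[of _ a], rule bexI[of _ "\<one>\<^bsub>A\<^esub>"]) (use that P1 in auto)
  qed (use that in simp)
  ultimately show ?thesis using that by blast
qed

section \<open>The field of fractions of a domain\<close>

lemma Union_const:
  assumes eq: "\<And>a b c d. (a, b) \<in> x \<Longrightarrow> (c, d) \<in> y \<Longrightarrow> f a b c d = T"
    and m: "(a0, b0) \<in> x" "(c0, d0) \<in> y"
  shows "\<Union>{f a b c d | a b c d. (a, b) \<in> x \<and> (c, d) \<in> y} = T"
proof -
  let ?S = "{f a b c d | a b c d. (a, b) \<in> x \<and> (c, d) \<in> y}"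
  have all: "\<forall>s\<in>?S. s = T" using eq by auto
  have mem: "T \<in> ?S" using m eq[OF m] by (intro CollectI exI[of _ a0] exI[of _ b0] exI[of _ c0] exI[of _ d0]) simp
  show ?thesis by (rule antisym[OF Union_least Union_upper[OF mem]]) (use all in simp)
qed

context "domain"
begin

definition fr :: "'a \<Rightarrow> 'a \<Rightarrow> ('a \<times> 'a) set" where
  "fr a b = {(c, d). c \<in> carrier R \<and> d \<in> carrier R - {\<zero>} \<and> a \<otimes> d = c \<otimes> b}"

text \<open>The operations are unions over all pairs of representatives. All members of such a union
  are the same class, so the union is that class.\<close>

definition Frac :: "('a \<times> 'a) set ring" where
  "Frac = \<lparr>carrier = {fr a b | a b. a \<in> carrier R \<and> b \<in> carrier R - {\<zero>}},
     mult = (\<lambda>x y. \<Union>{fr (a \<otimes> c) (b \<otimes> d) | a b c d. (a, b) \<in> x \<and> (c, d) \<in> y}),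
     one = fr \<one> \<one>, ring.zero = fr \<zero> \<one>,
     add = (\<lambda>x y. \<Union>{fr (a \<otimes> d \<oplus> c \<otimes> b) (b \<otimes> d) | a b c d. (a, b) \<in> x \<and> (c, d) \<in> y})\<rparr>"

lemma fr_mem: "a \<in> carrier R \<Longrightarrow> b \<in> carrier R - {\<zero>} \<Longrightarrow> (a, b) \<in> fr a b"
  by (simp add: fr_def)

lemma fr_eqI:
  assumes "a \<in> carrier R" "b \<in> carrier R - {\<zero>}" "a' \<in> carrier R" "b' \<in> carrier R - {\<zero>}" "a \<otimes> b' = a' \<otimes> b"
  shows "fr a b = fr a' b'"
proof -
  have "a \<otimes> d = c \<otimes> b \<longleftrightarrow> a' \<otimes> d = c \<otimes> b'" if cd: "c \<in> carrier R" "d \<in> carrier R - {\<zero>}" for c d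
  proof -
    have "a \<otimes> d = c \<otimes> b \<longleftrightarrow> (a \<otimes> d) \<otimes> b' = (c \<otimes> b) \<otimes> b'" using m_rcancel[of b'] assms cd by auto
    also have "(a \<otimes> d) \<otimes> b' = (a' \<otimes> d) \<otimes> b"
      using assms cd by (metis DiffD1 m_assoc m_comm)
    also have "(c \<otimes> b) \<otimes> b' = (c \<otimes> b') \<otimes> b" using assms cd by (metis DiffD1 m_assoc m_comm)
    also have "(a' \<otimes> d) \<otimes> b = (c \<otimes> b') \<otimes> b \<longleftrightarrow> a' \<otimes> d = c \<otimes> b'" using m_rcancel[of b] assms cd by auto
    finally show ?thesis .
  qed
  then show ?thesis unfolding fr_def by auto
qed

lemma nz_prod: "b \<in> carrier R - {\<zero>} \<Longrightarrow> d \<in> carrier R - {\<zero>} \<Longrightarrow> b \<otimes> d \<in> carrier R - {\<zero>}"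
  using integral by fastforce

lemma Frac_mult:
  assumes "a \<in> carrier R" "b \<in> carrier R - {\<zero>}" "c \<in> carrier R" "d \<in> carrier R - {\<zero>}"
  shows "fr a b \<otimes>\<^bsub>Frac\<^esub> fr c d = fr (a \<otimes> c) (b \<otimes> d)"
proof -
  have "fr (a' \<otimes> c') (b' \<otimes> d') = fr (a \<otimes> c) (b \<otimes> d)" if "(a', b') \<in> fr a b" "(c', d') \<in> fr c d" for a' b' c' d'
  proof -
    have h: "a' \<in> carrier R" "b' \<in> carrier R - {\<zero>}" "a \<otimes> b' = a' \<otimes> b"
      "c' \<in> carrier R" "d' \<in> carrier R - {\<zero>}" "c \<otimes> d' = c' \<otimes> d" using that by (auto simp: fr_def)
    have "(a' \<otimes> c') \<otimes> (b \<otimes> d) = (a' \<otimes> b) \<otimes> (c' \<otimes> d)" using h assms by (simp add: m_ac)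
    also have "\<dots> = (a \<otimes> b') \<otimes> (c \<otimes> d')" using h by simp
    also have "\<dots> = (a \<otimes> c) \<otimes> (b' \<otimes> d')" using h(1,2,4,5) assms by (simp add: m_ac)
    finally show ?thesis using h assms nz_prod by (intro fr_eqI) auto
  qed
  from Union_const[of "fr a b" "fr c d", OF this fr_mem[OF assms(1,2)] fr_mem[OF assms(3,4)]]
  show ?thesis by (simp add: Frac_def)
qed

lemma Frac_add:
  assumes "a \<in> carrier R" "b \<in> carrier R - {\<zero>}" "c \<in> carrier R" "d \<in> carrier R - {\<zero>}"
  shows "fr a b \<oplus>\<^bsub>Frac\<^esub> fr c d = fr (a \<otimes> d \<oplus> c \<otimes> b) (b \<otimes> d)"
proof -
  have "fr (a' \<otimes> d' \<oplus> c' \<otimes> b') (b' \<otimes> d') = fr (a \<otimes> d \<oplus> c \<otimes> b) (b \<otimes> d)"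
    if "(a', b') \<in> fr a b" "(c', d') \<in> fr c d" for a' b' c' d'
  proof -
    have h: "a' \<in> carrier R" "b' \<in> carrier R - {\<zero>}" "a \<otimes> b' = a' \<otimes> b"
      "c' \<in> carrier R" "d' \<in> carrier R - {\<zero>}" "c \<otimes> d' = c' \<otimes> d" using that by (auto simp: fr_def)
    have "(a' \<otimes> d' \<oplus> c' \<otimes> b') \<otimes> (b \<otimes> d) = (a' \<otimes> b) \<otimes> (d' \<otimes> d) \<oplus> (c' \<otimes> d) \<otimes> (b' \<otimes> b)"
      using h(1,2,4,5) assms by (simp add: l_distr r_distr m_ac)
    also have "\<dots> = (a \<otimes> b') \<otimes> (d' \<otimes> d) \<oplus> (c \<otimes> d') \<otimes> (b' \<otimes> b)" using h by simp
    also have "\<dots> = (a \<otimes> d \<oplus> c \<otimes> b) \<otimes> (b' \<otimes> d')" using h(1,2,4,5) assms by (simp add: l_distr r_distr m_ac)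
    finally show ?thesis using h assms nz_prod by (intro fr_eqI) auto
  qed
  from Union_const[of "fr a b" "fr c d", OF this fr_mem[OF assms(1,2)] fr_mem[OF assms(3,4)]]
  show ?thesis by (simp add: Frac_def)
qed

lemma Frac_carrierE:
  assumes "x \<in> carrier Frac"
  obtains a b where "x = fr a b" "a \<in> carrier R" "b \<in> carrier R - {\<zero>}"
  using assms by (auto simp: Frac_def)

lemma Frac_carrierI: "a \<in> carrier R \<Longrightarrow> b \<in> carrier R - {\<zero>} \<Longrightarrow> fr a b \<in> carrier Frac"
  by (auto simp: Frac_def)

lemma Frac_one: "\<one>\<^bsub>Frac\<^esub> = fr \<one> \<one>" and Frac_zero: "\<zero>\<^bsub>Frac\<^esub> = fr \<zero> \<one>"
  by (simp_all add: Frac_def)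

lemma fr_eqD:
  assumes "a \<in> carrier R" "b \<in> carrier R - {\<zero>}" "a' \<in> carrier R" "b' \<in> carrier R - {\<zero>}" "fr a b = fr a' b'"
  shows "a \<otimes> b' = a' \<otimes> b"
  using fr_mem[OF assms(3,4)] assms(5) by (auto simp: fr_def)

lemma field_Frac: "field Frac"
proof (rule cring.cring_fieldI2)
  have o: "\<one> \<in> carrier R - {\<zero>}" by simp
  show "cring Frac"
  proof (rule cringI)
    show "abelian_group Frac"
    proof (rule abelian_groupI)
      fix x y z assume "x \<in> carrier Frac"
      then obtain a b where x: "x = fr a b" "a \<in> carrier R" "b \<in> carrier R - {\<zero>}" by (rule Frac_carrierE)
      show "\<zero>\<^bsub>Frac\<^esub> \<oplus>\<^bsub>Frac\<^esub> x = x" using x o by (simp add: Frac_zero Frac_add)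
      have "fr (\<ominus> a) b \<oplus>\<^bsub>Frac\<^esub> x = fr (\<ominus> a \<otimes> b \<oplus> a \<otimes> b) (b \<otimes> b)" using x by (simp add: Frac_add)
      also have "\<dots> = \<zero>\<^bsub>Frac\<^esub>" unfolding Frac_zero using x nz_prod[of b b] by (intro fr_eqI) (auto simp: l_minus l_neg)
      finally show "\<exists>y\<in>carrier Frac. y \<oplus>\<^bsub>Frac\<^esub> x = \<zero>\<^bsub>Frac\<^esub>" using x Frac_carrierI[of "\<ominus> a" b] by auto
      assume "y \<in> carrier Frac"
      then obtain c d where y: "y = fr c d" "c \<in> carrier R" "d \<in> carrier R - {\<zero>}" by (rule Frac_carrierE)
      show "x \<oplus>\<^bsub>Frac\<^esub> y \<in> carrier Frac" using x y nz_prod[of b d] by (auto simp: Frac_add intro!: Frac_carrierI)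
      show "x \<oplus>\<^bsub>Frac\<^esub> y = y \<oplus>\<^bsub>Frac\<^esub> x" using x y by (simp add: Frac_add a_comm m_comm[of b d])
      assume "z \<in> carrier Frac"
      then obtain e f where z: "z = fr e f" "e \<in> carrier R" "f \<in> carrier R - {\<zero>}" by (rule Frac_carrierE)
      show "x \<oplus>\<^bsub>Frac\<^esub> y \<oplus>\<^bsub>Frac\<^esub> z = x \<oplus>\<^bsub>Frac\<^esub> (y \<oplus>\<^bsub>Frac\<^esub> z)"
        using x y z nz_prod[of b d] nz_prod[of d f] by (simp add: Frac_add l_distr r_distr m_ac a_ac)
    qed (use o in \<open>auto simp: Frac_zero intro!: Frac_carrierI\<close>)
    show "comm_monoid Frac"
    proof (rule comm_monoidI)
      fix x y z assume "x \<in> carrier Frac"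
      then obtain a b where x: "x = fr a b" "a \<in> carrier R" "b \<in> carrier R - {\<zero>}" by (rule Frac_carrierE)
      show "\<one>\<^bsub>Frac\<^esub> \<otimes>\<^bsub>Frac\<^esub> x = x" using x o by (simp add: Frac_one Frac_mult)
      assume "y \<in> carrier Frac"
      then obtain c d where y: "y = fr c d" "c \<in> carrier R" "d \<in> carrier R - {\<zero>}" by (rule Frac_carrierE)
      show "x \<otimes>\<^bsub>Frac\<^esub> y \<in> carrier Frac" using x y nz_prod[of b d] by (auto simp: Frac_mult intro!: Frac_carrierI)
      show "x \<otimes>\<^bsub>Frac\<^esub> y = y \<otimes>\<^bsub>Frac\<^esub> x" using x y by (simp add: Frac_mult m_comm[of b d] m_comm[of a c])
      assume "z \<in> carrier Frac"
      then obtain e f where z: "z = fr e f" "e \<in> carrier R" "f \<in> carrier R - {\<zero>}" by (rule Frac_carrierE)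
      show "x \<otimes>\<^bsub>Frac\<^esub> y \<otimes>\<^bsub>Frac\<^esub> z = x \<otimes>\<^bsub>Frac\<^esub> (y \<otimes>\<^bsub>Frac\<^esub> z)"
        using x y z nz_prod[of b d] nz_prod[of d f] by (simp add: Frac_mult m_ac)
    qed (use o in \<open>auto simp: Frac_one intro!: Frac_carrierI\<close>)
  next
    fix x y z assume "x \<in> carrier Frac" "y \<in> carrier Frac" "z \<in> carrier Frac"
    then obtain a b c d e f where xyz: "x = fr a b" "a \<in> carrier R" "b \<in> carrier R - {\<zero>}"
      "y = fr c d" "c \<in> carrier R" "d \<in> carrier R - {\<zero>}" "z = fr e f" "e \<in> carrier R" "f \<in> carrier R - {\<zero>}"
      by (metis Frac_carrierE)
    note n = nz_prod[OF xyz(3,6)] nz_prod[OF xyz(3,9)] nz_prod[OF xyz(6,9)]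
    have "fr ((a \<otimes> d \<oplus> c \<otimes> b) \<otimes> e) (b \<otimes> d \<otimes> f) =
        fr (a \<otimes> e \<otimes> (d \<otimes> f) \<oplus> c \<otimes> e \<otimes> (b \<otimes> f)) (b \<otimes> f \<otimes> (d \<otimes> f))"
      using xyz n nz_prod[OF n(1) xyz(9)] nz_prod[OF n(2,3)]
      by (intro fr_eqI) (auto simp: l_distr r_distr m_ac)
    then show "(x \<oplus>\<^bsub>Frac\<^esub> y) \<otimes>\<^bsub>Frac\<^esub> z = x \<otimes>\<^bsub>Frac\<^esub> z \<oplus>\<^bsub>Frac\<^esub> y \<otimes>\<^bsub>Frac\<^esub> z"
      using xyz n by (simp add: Frac_add Frac_mult)
  qed
  show "\<zero>\<^bsub>Frac\<^esub> \<noteq> \<one>\<^bsub>Frac\<^esub>" unfolding Frac_one Frac_zero using fr_eqD[of \<zero> \<one> \<one> \<one>] by auto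
  fix x assume x: "x \<in> carrier Frac" "x \<noteq> \<zero>\<^bsub>Frac\<^esub>"
  then obtain a b where ab: "x = fr a b" "a \<in> carrier R" "b \<in> carrier R - {\<zero>}" by (metis Frac_carrierE)
  have "a \<noteq> \<zero>" using x(2) ab fr_eqI[of \<zero> b \<zero> \<one>] unfolding Frac_zero by auto
  then have "x \<otimes>\<^bsub>Frac\<^esub> fr b a = \<one>\<^bsub>Frac\<^esub>"
    unfolding Frac_one using ab nz_prod[of b a] by (simp add: Frac_mult) (intro fr_eqI, auto simp: m_comm)
  then show "\<exists>y\<in>carrier Frac. x \<otimes>\<^bsub>Frac\<^esub> y = \<one>\<^bsub>Frac\<^esub>"
    using Frac_carrierI[of b a] ab \<open>a \<noteq> \<zero>\<close> by auto
qed

lemma fr_hom: "(\<lambda>a. fr a \<one>) \<in> ring_hom R Frac"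
  by (rule ring_hom_memI) (auto simp: Frac_one Frac_mult Frac_add intro!: Frac_carrierI)

lemma fr_inj: "inj_on (\<lambda>a. fr a \<one>) (carrier R)"
proof (rule inj_onI)
  fix x y assume "x \<in> carrier R" "y \<in> carrier R" "fr x \<one> = fr y \<one>"
  then show "x = y" using fr_eqD[of x \<one> y \<one>] by simp
qed

lemma fr_div: "a \<in> carrier R \<Longrightarrow> b \<in> carrier R - {\<zero>} \<Longrightarrow> fr a b \<otimes>\<^bsub>Frac\<^esub> fr b \<one> = fr a \<one>"
  using nz_prod[of b \<one>] by (simp add: Frac_mult) (intro fr_eqI, auto)

end

section \<open>Fields of fractions inside an infinite universe\<close>

lemma ex_inj_pair:
  assumes "infinite (UNIV :: 'u set)"
  shows "\<exists>J :: 'u \<times> 'u \<Rightarrow> 'u. inj J"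
proof -
  have "\<exists>f :: 'u \<times> 'u \<Rightarrow> 'u. bij_betw f (UNIV \<times> UNIV) UNIV"
    using card_of_Times_same_infinite[OF assms] card_of_ordIso by blast
  then show ?thesis by (auto simp: bij_betw_def)
qed

text \<open>A fraction is a set of pairs and not an element of \<open>'u\<close>. Choosing one pair
  for each fraction and coding it by \<open>g\<close> and an injection of pairs into the infinite
  type embeds the field of fractions into \<open>'u\<close>, where its image takes over the
  structure.\<close>

lemma ex_fraction_field:
  fixes g :: "'a \<Rightarrow> 'u"
  assumes D: "domain D" and g: "inj_on g (carrier D)" and inf: "infinite (UNIV :: 'u set)"
  obtains F :: "'u ring" and e where "field F" "e \<in> ring_hom D F" "inj_on e (carrier D)"
    "\<And>x. x \<in> carrier F \<Longrightarrow> \<exists>a\<in>carrier D. \<exists>b\<in>carrier D - {\<zero>\<^bsub>D\<^esub>}. x \<otimes>\<^bsub>F\<^esub> e b = e a"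
proof -
  interpret D: "domain" D by fact
  interpret Q: field D.Frac by (rule D.field_Frac)
  obtain J :: "'u \<times> 'u \<Rightarrow> 'u" where J: "inj J" using ex_inj_pair[OF inf] by blast
  define r where "r x = (SOME p. fst p \<in> carrier D \<and> snd p \<in> carrier D \<and> x = D.fr (fst p) (snd p))" for x
  have r: "fst (r x) \<in> carrier D" "snd (r x) \<in> carrier D" "x = D.fr (fst (r x)) (snd (r x))" if "x \<in> carrier D.Frac" for x
  proof -
    from that obtain a b where "x = D.fr a b" "a \<in> carrier D" "b \<in> carrier D - {\<zero>\<^bsub>D\<^esub>}"
      by (rule D.Frac_carrierE)
    then have "\<exists>p. fst p \<in> carrier D \<and> snd p \<in> carrier D \<and> x = D.fr (fst p) (snd p)"
      by (intro exI[of _ "(a, b)"]) simp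
    from someI_ex[OF this] show "fst (r x) \<in> carrier D" "snd (r x) \<in> carrier D" "x = D.fr (fst (r x)) (snd (r x))"
      unfolding r_def[symmetric] by auto
  qed
  define \<psi> where "\<psi> x = J (g (fst (r x)), g (snd (r x)))" for x
  have inj: "inj_on \<psi> (carrier D.Frac)"
  proof (rule inj_onI)
    fix x y assume xy: "x \<in> carrier D.Frac" "y \<in> carrier D.Frac" "\<psi> x = \<psi> y"
    have "g (fst (r x)) = g (fst (r y))" "g (snd (r x)) = g (snd (r y))"
      using injD[OF J xy(3)[unfolded \<psi>_def]] by simp_all
    then have eq: "fst (r x) = fst (r y)" "snd (r x) = snd (r y)"
      using inj_onD[OF g] r(1,2)[OF xy(1)] r(1,2)[OF xy(2)] by blast+
    have "x = D.fr (fst (r x)) (snd (r x))" by (rule r(3)[OF xy(1)])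
    also have "\<dots> = D.fr (fst (r y)) (snd (r y))" by (simp only: eq)
    also have "\<dots> = y" by (rule r(3)[OF xy(2), symmetric])
    finally show "x = y" .
  qed
  define K where "K = image_ring \<psi> D.Frac"
  have F: "field K" unfolding K_def using Q.inj_imp_image_ring_is_field[OF inj] .
  have hom: "\<psi> \<in> ring_hom D.Frac K" unfolding K_def using inj_imp_image_ring_iso[OF inj] by (simp add: ring_iso_def)
  let ?e = "\<lambda>a. \<psi> (D.fr a \<one>\<^bsub>D\<^esub>)"
  have e: "?e \<in> ring_hom D K" using ring_hom_comp[OF D.fr_hom hom] .
  have ei: "inj_on ?e (carrier D)"
    using comp_inj_on[OF D.fr_inj, of \<psi>] inj ring_hom_closed[OF D.fr_hom]
    by (auto simp: comp_def inj_on_def)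
  have "\<exists>a\<in>carrier D. \<exists>b\<in>carrier D - {\<zero>\<^bsub>D\<^esub>}. x \<otimes>\<^bsub>K\<^esub> ?e b = ?e a" if "x \<in> carrier K" for x
  proof -
    from that obtain y where y: "y \<in> carrier D.Frac" "x = \<psi> y" by (auto simp: K_def image_ring_carrier)
    from y(1) obtain a b where ab: "y = D.fr a b" "a \<in> carrier D" "b \<in> carrier D - {\<zero>\<^bsub>D\<^esub>}"
      by (rule D.Frac_carrierE)
    have "D.fr b \<one>\<^bsub>D\<^esub> \<in> carrier D.Frac" using ab by (intro D.Frac_carrierI) auto
    then have "x \<otimes>\<^bsub>K\<^esub> ?e b = ?e a"
      using ring_hom_mult[OF hom y(1), of "D.fr b \<one>\<^bsub>D\<^esub>"] D.fr_div[OF ab(2,3)] y ab by simp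
    then show ?thesis using ab by blast
  qed
  then show ?thesis using that F e ei by blast
qed

text \<open>The residue field is the field of fractions of \<open>B/P\<close>; coding each coset by
  a chosen member brings it into the universe.\<close>

lemma ex_residue_field:
  fixes B :: "'u ring"
  assumes "cring B" "primeideal P B" "infinite (UNIV :: 'u set)"
  obtains \<kappa> :: "'u ring" and \<phi> where "field \<kappa>" "\<phi> \<in> ring_hom B \<kappa>" "\<And>b. b \<in> carrier B \<Longrightarrow> \<phi> b = \<zero>\<^bsub>\<kappa>\<^esub> \<longleftrightarrow> b \<in> P"
proof -
  interpret B: cring B by fact
  interpret P: primeideal P B by fact
  interpret Q: "domain" "B Quot P" by (rule P.quotient_is_domain)
  define g where "g c = (SOME b. b \<in> carrier B \<and> c = P +>\<^bsub>B\<^esub> b)" for c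
  have g: "c = P +>\<^bsub>B\<^esub> g c" if "c \<in> carrier (B Quot P)" for c
  proof -
    have "\<exists>b. b \<in> carrier B \<and> c = P +>\<^bsub>B\<^esub> b" using that by (auto simp: FactRing_def A_RCOSETS_def')
    from someI_ex[OF this] show ?thesis by (simp add: g_def)
  qed
  have "inj_on g (carrier (B Quot P))" by (rule inj_onI) (metis g)
  then obtain \<kappa> :: "'u ring" and e where e: "field \<kappa>" "e \<in> ring_hom (B Quot P) \<kappa>" "inj_on e (carrier (B Quot P))"
    using ex_fraction_field[OF Q.domain_axioms _ assms(3)] by metis
  interpret K: field \<kappa> by (rule e(1))
  have p: "(\<lambda>b. P +>\<^bsub>B\<^esub> b) \<in> ring_hom B (B Quot P)" by (rule P.rcos_ring_hom)
  have ker: "e (P +>\<^bsub>B\<^esub> b) = \<zero>\<^bsub>\<kappa>\<^esub> \<longleftrightarrow> b \<in> P" if b: "b \<in> carrier B" for b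
  proof -
    have "e \<zero>\<^bsub>B Quot P\<^esub> = \<zero>\<^bsub>\<kappa>\<^esub>" using ring_hom_zero'[OF e(2) Q.is_cring K.is_cring] .
    then have "e (P +>\<^bsub>B\<^esub> b) = \<zero>\<^bsub>\<kappa>\<^esub> \<longleftrightarrow> P +>\<^bsub>B\<^esub> b = \<zero>\<^bsub>B Quot P\<^esub>"
      using e(3) ring_hom_closed[OF p b] Q.zero_closed by (metis inj_onD)
    also have "\<dots> \<longleftrightarrow> b \<in> P" using P.rcos_const_imp_mem[OF b] P.a_rcos_const by (auto simp: FactRing_def)
    finally show ?thesis .
  qed
  show ?thesis by (rule that[OF e(1) ring_hom_comp[OF p e(2)] ker])
qed

section \<open>Smoothness and separatedness of curves\<close>

text \<open>An inverse modulo \<open>I\<close> gives \<open>x y = 1 + z\<close> with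
  \<open>z\<close> in \<open>I\<close>, and \<open>1 - z\<close> inverts \<open>1 + z\<close>
  because the square of \<open>z\<close> is 0.\<close>

lemma square_zero_unit_lift:
  assumes "cring C" "ideal I C" and sq: "\<forall>a\<in>I. \<forall>b\<in>I. a \<otimes>\<^bsub>C\<^esub> b = \<zero>\<^bsub>C\<^esub>"
    and x: "x \<in> carrier C" and u: "I +>\<^bsub>C\<^esub> x \<in> Units (C Quot I)"
  shows "x \<in> Units C"
proof -
  interpret C: cring C by fact
  interpret I: ideal I C by fact
  have p: "(\<lambda>b. I +>\<^bsub>C\<^esub> b) \<in> ring_hom C (C Quot I)" by (rule I.rcos_ring_hom)
  obtain y' where y': "y' \<in> carrier (C Quot I)" "(I +>\<^bsub>C\<^esub> x) \<otimes>\<^bsub>C Quot I\<^esub> y' = \<one>\<^bsub>C Quot I\<^esub>"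
    using u by (auto simp: Units_def)
  then obtain y where y: "y \<in> carrier C" "y' = I +>\<^bsub>C\<^esub> y" by (auto simp: FactRing_def A_RCOSETS_def')
  have "I +>\<^bsub>C\<^esub> (x \<otimes>\<^bsub>C\<^esub> y) = I +>\<^bsub>C\<^esub> \<one>\<^bsub>C\<^esub>"
    using ring_hom_mult[OF p x y(1)] y'(2) y(2) ring_hom_one[OF p] by simp
  then have "x \<otimes>\<^bsub>C\<^esub> y \<ominus>\<^bsub>C\<^esub> \<one>\<^bsub>C\<^esub> \<in> I"
    using C.quotient_eq_iff_same_a_r_cos[OF I.ideal_axioms, of "x \<otimes>\<^bsub>C\<^esub> y" "\<one>\<^bsub>C\<^esub>"] x y by simp
  moreover define z where "z = x \<otimes>\<^bsub>C\<^esub> y \<ominus>\<^bsub>C\<^esub> \<one>\<^bsub>C\<^esub>"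
  ultimately have z: "z \<in> I" "z \<in> carrier C" "z \<otimes>\<^bsub>C\<^esub> z = \<zero>\<^bsub>C\<^esub>" using sq I.a_subset by auto
  have xy: "x \<otimes>\<^bsub>C\<^esub> y = \<one>\<^bsub>C\<^esub> \<oplus>\<^bsub>C\<^esub> z"
    unfolding z_def a_minus_def using x y(1) by (simp add: C.a_lcomm[of "\<one>\<^bsub>C\<^esub>"] C.r_neg)
  have "x \<otimes>\<^bsub>C\<^esub> (y \<otimes>\<^bsub>C\<^esub> (\<one>\<^bsub>C\<^esub> \<ominus>\<^bsub>C\<^esub> z)) = (\<one>\<^bsub>C\<^esub> \<oplus>\<^bsub>C\<^esub> z) \<otimes>\<^bsub>C\<^esub> (\<one>\<^bsub>C\<^esub> \<ominus>\<^bsub>C\<^esub> z)"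
    using x y(1) z(2) xy by (simp add: C.m_assoc[symmetric])
  also have "\<dots> = (\<one>\<^bsub>C\<^esub> \<ominus>\<^bsub>C\<^esub> z) \<oplus>\<^bsub>C\<^esub> z \<otimes>\<^bsub>C\<^esub> (\<one>\<^bsub>C\<^esub> \<ominus>\<^bsub>C\<^esub> z)"
    using z(2) by (simp add: C.l_distr)
  also have "z \<otimes>\<^bsub>C\<^esub> (\<one>\<^bsub>C\<^esub> \<ominus>\<^bsub>C\<^esub> z) = z"
    using z(2,3) unfolding a_minus_def by (simp add: C.r_distr C.r_minus)
  also have "(\<one>\<^bsub>C\<^esub> \<ominus>\<^bsub>C\<^esub> z) \<oplus>\<^bsub>C\<^esub> z = \<one>\<^bsub>C\<^esub>"
    using z(2) unfolding a_minus_def by (simp add: C.a_assoc C.l_neg)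
  finally have "x \<otimes>\<^bsub>C\<^esub> (y \<otimes>\<^bsub>C\<^esub> (\<one>\<^bsub>C\<^esub> \<ominus>\<^bsub>C\<^esub> z)) \<in> Units C" by simp
  then show ?thesis by (rule Units_multD[OF C.is_cring x, rotated]) (use y(1) z(2) in simp)
qed

text \<open>Lift over \<open>A\<close> first. The image of \<open>f\<close> is a unit modulo
  \<open>I\<close>, hence a unit, so the lift extends to the localization. The extension still lifts
  \<open>h\<close>, because both maps to the quotient agree on \<open>A\<close>.\<close>

lemma formally_smooth_localization:
  assumes A: "cring A" and B: "cring B" and i: "i \<in> ring_hom k A" and fs: "formally_smooth k A i"
    and L: "is_localization A f B \<phi>" and f: "f \<in> carrier A"
  shows "formally_smooth k B (\<lambda>c. \<phi> (i c))"
  unfolding formally_smooth_def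
proof (intro allI impI)
  fix C I g h assume P: "square_zero_problem k B (\<lambda>c. \<phi> (i c)) C I g h"
  have C: "cring C" and I: "ideal I C" and sq: "\<forall>a\<in>I. \<forall>b\<in>I. a \<otimes>\<^bsub>C\<^esub> b = \<zero>\<^bsub>C\<^esub>"
    and g: "g \<in> ring_hom k C" and h: "h \<in> ring_hom B (C Quot I)"
    and hg: "\<And>a. a \<in> carrier k \<Longrightarrow> h (\<phi> (i a)) = I +>\<^bsub>C\<^esub> g a"
    using P by (simp_all add: square_zero_problem_def)
  have \<phi>: "\<phi> \<in> ring_hom A B" and uf: "\<phi> f \<in> Units B" using L by (simp_all add: is_localization_def)
  interpret I: ideal I C by fact
  interpret Cr: cring C by fact
  have Q: "cring (C Quot I)" by (rule I.quotient_is_cring[OF C])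
  have "square_zero_problem k A i C I g (\<lambda>a. h (\<phi> a))"
    using C I sq g ring_hom_comp[OF \<phi> h] hg by (simp add: square_zero_problem_def)
  then obtain l where "l \<in> lifts k A i C I g (\<lambda>a. h (\<phi> a))" using fs unfolding formally_smooth_def by meson
  then have l: "l \<in> ring_hom A C" and li: "\<And>a. a \<in> carrier k \<Longrightarrow> l (i a) = g a"
    and lh: "\<And>a. a \<in> carrier A \<Longrightarrow> I +>\<^bsub>C\<^esub> l a = h (\<phi> a)" by (simp_all add: lifts_def)
  have "h (\<phi> f) \<in> Units (C Quot I)" using ring_hom_Units[OF h B Q uf] .
  then have "l f \<in> Units C"
    using square_zero_unit_lift[OF C I sq ring_hom_closed[OF l f]] lh[OF f] by simp
  then obtain \<psi> where \<psi>: "\<psi> \<in> ring_hom B C" "\<And>a. a \<in> carrier A \<Longrightarrow> \<psi> (\<phi> a) = l a"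
    using localization_extend[OF L A B C l f] by metis
  let ?l = "restrict \<psi> (carrier B)"
  have "?l \<in> ring_hom B C" by (rule ring_hom_cong[OF \<psi>(1)]) (use B in \<open>simp_all add: cring_def\<close>)
  moreover have "I +>\<^bsub>C\<^esub> \<psi> b = h b" if b: "b \<in> carrier B" for b
    by (rule localization_epi[OF L A B Q ring_hom_comp[OF \<psi>(1) I.rcos_ring_hom] h f _ b]) (simp add: \<psi>(2) lh)
  moreover have "\<phi> (i a) \<in> carrier B" "\<psi> (\<phi> (i a)) = g a" if "a \<in> carrier k" for a
    using ring_hom_closed[OF i that] ring_hom_closed[OF \<phi>] \<psi>(2) li that by auto
  ultimately show "\<exists>l. l \<in> lifts k B (\<lambda>c. \<phi> (i c)) C I g h"
    by (intro exI[of _ ?l]) (simp add: lifts_def)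
qed

lemma (in ring) a_inv_subring:
  assumes "subring H R" "x \<in> H"
  shows "\<ominus>\<^bsub>R\<lparr>carrier := H\<rparr>\<^esub> x = \<ominus> x"
proof -
  interpret S: ring "R\<lparr>carrier := H\<rparr>" using subring_is_ring[OF assms(1)] .
  have H: "H \<subseteq> carrier R" using subringE(1)[OF assms(1)] .
  have "\<ominus>\<^bsub>R\<lparr>carrier := H\<rparr>\<^esub> x \<in> H" "\<ominus>\<^bsub>R\<lparr>carrier := H\<rparr>\<^esub> x \<oplus> x = \<zero>"
    using S.a_inv_closed[of x] S.l_neg[of x] assms(2) by simp_all
  then show ?thesis using minus_equality H assms(2) by (metis subsetD)
qed

text \<open>The step for negatives needs an argument, since negation is computed in the record and
  could depend on its carrier.\<close>

lemma (in ring) generate_ring_subring_mono: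
  assumes "subring H R" "subring H' R" "H \<subseteq> H'" "X \<subseteq> H" "X \<subseteq> X'" "X' \<subseteq> H'"
  shows "generate_ring (R\<lparr>carrier := H\<rparr>) X \<subseteq> generate_ring (R\<lparr>carrier := H'\<rparr>) X'"
proof
  interpret S: ring "R\<lparr>carrier := H\<rparr>" using subring_is_ring[OF assms(1)] .
  fix x assume "x \<in> generate_ring (R\<lparr>carrier := H\<rparr>) X"
  then show "x \<in> generate_ring (R\<lparr>carrier := H'\<rparr>) X'"
  proof (induction rule: generate_ring.induct)
    case one
    then show ?case using generate_ring.one[of "R\<lparr>carrier := H'\<rparr>"] by simp
  next
    case (incl h)
    then show ?case using assms(5) by (auto intro: generate_ring.incl)
  next
    case (a_inv h)
    have "h \<in> H" using S.generate_ring_in_carrier[of X] a_inv(1) assms(4) by simp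
    then have "\<ominus>\<^bsub>R\<lparr>carrier := H\<rparr>\<^esub> h = \<ominus>\<^bsub>R\<lparr>carrier := H'\<rparr>\<^esub> h"
      using a_inv_subring assms(1-3) by (simp add: subset_iff)
    then show ?case using generate_ring.a_inv[OF a_inv(2)] by simp
  next
    case (eng_add h1 h2)
    then show ?case using generate_ring.eng_add[of h1 "R\<lparr>carrier := H'\<rparr>" X' h2] by simp
  next
    case (eng_mult h1 h2)
    then show ?case using generate_ring.eng_mult[of h1 "R\<lparr>carrier := H'\<rparr>" X' h2] by simp
  qed
qed

text \<open>This says that the map from \<open>k[t]\<close> to \<open>B\<close> is an epimorphism,
  as far as target rings in the universe can tell. Unlike generation by \<open>t\<close> this passes
  to localizations, and it is what allows the diagonal to be cut out by a single equation.\<close>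

definition coordinate :: "'u ring \<Rightarrow> 'u ring \<Rightarrow> ('u \<Rightarrow> 'u) \<Rightarrow> 'u \<Rightarrow> bool" where
  "coordinate k B i t \<longleftrightarrow> t \<in> carrier B \<and>
     (\<forall>(\<kappa> :: 'u ring) f g b. cring \<kappa> \<and> f \<in> ring_hom B \<kappa> \<and> g \<in> ring_hom B \<kappa> \<and>
        (\<forall>c\<in>carrier k. f (i c) = g (i c)) \<and> f t = g t \<and> b \<in> carrier B \<longrightarrow> f b = g b)"

lemma coordinateD:
  fixes B \<kappa> :: "'u ring"
  assumes "coordinate k B i t" "cring \<kappa>" "f \<in> ring_hom B \<kappa>" "g \<in> ring_hom B \<kappa>"
    "\<And>c. c \<in> carrier k \<Longrightarrow> f (i c) = g (i c)" "f t = g t" "b \<in> carrier B"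
  shows "f b = g b"
proof -
  have "\<forall>(\<kappa> :: 'u ring) f g b. cring \<kappa> \<and> f \<in> ring_hom B \<kappa> \<and> g \<in> ring_hom B \<kappa> \<and>
        (\<forall>c\<in>carrier k. f (i c) = g (i c)) \<and> f t = g t \<and> b \<in> carrier B \<longrightarrow> f b = g b"
    using assms(1) unfolding coordinate_def by (rule conjunct2)
  from this[THEN spec[of _ \<kappa>], THEN spec[of _ f], THEN spec[of _ g], THEN spec[of _ b], THEN mp]
  show ?thesis using assms(2-) by simp
qed

text \<open>The properties from which membership in \<open>Sm k\<close> is derived, in a form that
  passes to nonempty open subsets.\<close>

locale kcurve = curve +
  fixes k :: "'a ring" and i :: "'a \<Rightarrow> 'a"
  assumes k_field: "field k"
    and i_hom: "i \<in> ring_hom k (F\<lparr>carrier := reg F ord Cl\<rparr>)"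
    and ft: "finite_type_hom k (F\<lparr>carrier := reg F ord Cl\<rparr>) i"
    and fs: "formally_smooth k (F\<lparr>carrier := reg F ord Cl\<rparr>) i"
    and coord: "\<exists>t. coordinate k (F\<lparr>carrier := reg F ord Cl\<rparr>) i t"
    and inf: "infinite (UNIV :: 'a set)"

lemma (in curve) reg_domain: "domain (F\<lparr>carrier := reg F ord Cl\<rparr>)"
  using subring_is_domain[OF subring_reg] by auto

text \<open>Every closed point has a global uniformizer, so one function cuts out the finitely many
  missing points.\<close>

lemma (in curve) open_is_basic:
  assumes "opn (C i) U" "U \<noteq> {}"
  obtains f where "f \<in> reg F ord Cl" "f \<in> carrier F - {\<zero>}"
    "is_localization (F\<lparr>carrier := reg F ord Cl\<rparr>) f (F\<lparr>carrier := reg F ord U\<rparr>) (\<lambda>x. x)"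
proof -
  have U: "\<zero> \<in> U" "U \<subseteq> pt_set" "finite (Cl - U)" using assms unfolding opn_curve by auto
  obtain b where b: "b \<in> carrier F - {\<zero>}" "\<And>q. q \<in> Cl \<Longrightarrow> ord q b = (if q \<in> Cl - U then int 1 else 0)"
    using ex_ord[OF U(3), of "\<lambda>_. 1"] by (metis Diff_subset)
  have br: "b \<in> reg F ord Cl" using b by (intro regI) auto
  have D: "{x\<in>pt_set. b \<notin> max_at F ord Cl x} = U"
  proof -
    have "ord p b = 0 \<longleftrightarrow> p \<in> U" if "p \<in> Cl" for p using b(2)[OF that] that by simp
    then have "insert \<zero> {p\<in>Cl. ord p b = 0} = U" using U(1,2) by auto
    then show ?thesis unfolding basic_curve[OF br] using b(1) by simp
  qed
  have "is_localization (F\<lparr>carrier := reg F ord Cl\<rparr>) b (F\<lparr>carrier := reg F ord U\<rparr>) (\<lambda>x. x)"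
    using localization_curve[OF br] unfolding D reg_ring_ne[OF assms(2)] if_not_P[OF assms(2)] .
  then show ?thesis by (rule that[OF br b(1)])
qed

context kcurve
begin

abbreviation "X \<equiv> curve_sch F ord i Cl"

lemma kscheme_X: "kscheme k X"
  by (rule kscheme_curve[OF i_hom])

lemma str_X: "str X \<in> ring_hom k (glob X)"
  using i_hom by (simp add: reg_ring_ne)

text \<open>The ring of \<open>U\<close> arises from the coordinate ring by inverting one element
  \<open>f\<close>. This costs one more generator, and formal smoothness and the coordinate are
  inherited by localizations.\<close>

lemma open_kcurve:
  assumes U: "opn X U" "U \<noteq> {}"
  shows "kcurve F (U - {\<zero>}) ord k i"
proof -
  have U': "U \<subseteq> pt_set" using U by (simp add: opn_curve)
  interpret V: curve F "U - {\<zero>}" ord by (rule sub_curve) (use U' in blast)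
  obtain f where f: "f \<in> reg F ord Cl" "f \<in> carrier F - {\<zero>}"
    "is_localization (F\<lparr>carrier := reg F ord Cl\<rparr>) f (F\<lparr>carrier := reg F ord U\<rparr>) (\<lambda>x. x)"
    using open_is_basic[OF U] .
  let ?A = "F\<lparr>carrier := reg F ord Cl\<rparr>" and ?B = "F\<lparr>carrier := reg F ord U\<rparr>"
  interpret A: "domain" ?A by (rule reg_domain)
  interpret B: "domain" ?B using V.reg_domain by simp
  have sub: "reg F ord Cl \<subseteq> reg F ord U" using reg_mono[OF U'] by simp
  have iB: "i \<in> ring_hom k ?B" using i_hom sub by (auto simp: ring_hom_def)
  have rA: "subring (reg F ord Cl) F" using subring_reg by blast
  have rB: "subring (reg F ord U) F" using subring_reg[OF U'] .
  have fu: "f \<in> Units ?B" using f(3) by (simp add: is_localization_def)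
  have finv: "inv f \<in> reg F ord U"
  proof -
    obtain y where y: "y \<in> reg F ord U" "f \<otimes> y = \<one>" using fu by (auto simp: Units_def)
    then have "inv f = y" using f(2) reg_subset comm_inv_char by blast
    then show ?thesis using y by simp
  qed
  obtain S where S: "finite S" "S \<subseteq> reg F ord Cl" "generate_ring ?A (i ` carrier k \<union> S) = reg F ord Cl"
    using ft by (auto simp: finite_type_hom_def)
  let ?G = "i ` carrier k \<union> insert (inv f) S"
  have ik: "i ` carrier k \<subseteq> reg F ord Cl" using ring_hom_closed[OF i_hom] by auto
  have GB: "?G \<subseteq> reg F ord U" using ik S(2) sub finv by blast
  have gA: "reg F ord Cl \<subseteq> generate_ring ?B ?G"
    using generate_ring_subring_mono[OF rA rB sub _ _ GB, of "i ` carrier k \<union> S"] S ik by auto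
  have gm: "x \<in> generate_ring ?B ?G \<Longrightarrow> y \<in> generate_ring ?B ?G \<Longrightarrow> x \<otimes> y \<in> generate_ring ?B ?G" for x y
    using generate_ring.eng_mult[of x ?B ?G y] by simp
  have gi: "inv f [^] n \<in> generate_ring ?B ?G" for n :: nat
  proof (induction n)
    case 0
    then show ?case using generate_ring.one[of ?B ?G] by simp
  next
    case (Suc n)
    then show ?case using gm generate_ring.incl[of "inv f" ?G ?B] by simp
  qed
  have "b \<in> generate_ring ?B ?G" if b: "b \<in> reg F ord U" for b
  proof -
    obtain a n where a: "a \<in> reg F ord Cl" "b \<otimes> (f [^]\<^bsub>?B\<^esub> (n::nat)) = a"
      using f(3) b by (auto simp: is_localization_def)
    have a': "b \<otimes> f [^] n = a" using a(2) nat_pow_consistent[of f n "reg F ord U"] by simp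
    have bc: "b \<in> carrier F" using b reg_subset by blast
    have inv1: "inv f \<in> carrier F" "f \<otimes> inv f = \<one>" using nz_inv[OF f(2)] nz_r_inv[OF f(2)] by auto
    have "f [^] n \<otimes> inv f [^] n = \<one>"
      using nat_pow_distrib[of f "inv f" n] inv1 f(2) by simp
    then have "b = a \<otimes> inv f [^] n"
      unfolding a'[symmetric] using bc inv1 f(2) by (simp add: m_assoc)
    then show ?thesis using gm gi gA a(1) by auto
  qed
  then have gB: "generate_ring ?B ?G = reg F ord U"
    using B.generate_ring_incl[of ?G] GB by auto
  have ftB: "finite_type_hom k ?B i"
    unfolding finite_type_hom_def using iB gB GB S(1) by (intro conjI exI[of _ "insert (inv f) S"]) auto
  have fsB: "formally_smooth k ?B i"
    using formally_smooth_localization[OF A.is_cring B.is_cring i_hom fs f(3)] f(1) by simp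
  obtain t where t: "coordinate k ?A i t" using coord by blast
  have tA: "t \<in> reg F ord Cl" using t by (simp add: coordinate_def)
  have coordB: "coordinate k ?B i t"
    unfolding coordinate_def
  proof (intro conjI allI impI; (elim conjE)?)
    show "t \<in> carrier ?B" using tA sub by auto
    fix \<kappa> :: "'a ring" and p q b
    assume h: "cring \<kappa>" "p \<in> ring_hom ?B \<kappa>" "q \<in> ring_hom ?B \<kappa>"
      "\<forall>c\<in>carrier k. p (i c) = q (i c)" "p t = q t" and b: "b \<in> carrier ?B"
    have pq: "p \<in> ring_hom ?A \<kappa>" "q \<in> ring_hom ?A \<kappa>" using h(2,3) sub by (simp_all add: ring_hom_def Pi_iff subset_iff)
    have "p a = q a" if "a \<in> carrier ?A" for a
      using coordinateD[OF t h(1) pq _ h(5) that] h(4) by simp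
    then show "p b = q b"
      using localization_epi[OF f(3) A.is_cring B.is_cring h(1-3) _ _ b] f(1) by simp
  qed
  show ?thesis
  proof (intro kcurve.intro kcurve_axioms.intro V.curve_axioms)
    show "\<exists>t. coordinate k (F\<lparr>carrier := reg F ord (U - {\<zero>})\<rparr>) i t" using coordB by auto
  qed (use iB ftB fsB k_field inf in simp_all)
qed

lemma finite_type_X: "finite_type k X"
proof -
  have "affine_open X pt_set" using affine_open_curve[of i pt_set] by (simp add: opn_curve)
  then show ?thesis unfolding finite_type_def
    using ft open_sub_self[of i] by (intro exI[of _ "{pt_set}"]) (simp add: reg_ring_ne)
qed

lemma smooth_X: "smooth k X"
proof -
  have "affine_open X pt_set" using affine_open_curve[of i pt_set] by (simp add: opn_curve)
  then show ?thesis unfolding smooth_def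
    using ft fs open_sub_self[of i] by (intro ballI exI[of _ pt_set]) (simp add: reg_ring_ne)
qed

lemma ringed_chart_X: "ringed_chart X pt_set (max_at F ord Cl)"
  by (simp add: ringed_chart_def ringed_def ringed_chart_axioms_def ringed_space_curve chart_curve)

text \<open>
  The diagonal is the locus where the two pullbacks of the coordinate \<open>t\<close> agree: at a point \<open>z\<close> of
  that locus the two projections agree on the spectrum of the residue field of \<open>z\<close>, so that by the
  universal property \<open>z\<close> factors through the diagonal.
\<close>

lemma diagonal_closed:
  assumes P: "is_product k X X Z p q" and d: "is_mor k X Z d"
    and pd: "mor_comp X Z X p d = mor_id X" and qd: "mor_comp X Z X q d = mor_id X"
  shows "closedin (sp Z) (pt d ` pts X)"
proof -
  have kZ: "kscheme k Z" and p: "is_mor k Z X p" and q: "is_mor k Z X q"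
    and uni: "\<And>T a b. kscheme k T \<Longrightarrow> is_mor k T X a \<Longrightarrow> is_mor k T X b \<Longrightarrow>
        (\<exists>!m. is_mor k T Z m \<and> mor_comp T Z X p m = a \<and> mor_comp T Z X q m = b)"
    using P unfolding is_product_def by simp_all
  have rZ: "ringed_space Z" and sZ: "str Z \<in> ring_hom k (glob Z)"
    and aff: "\<And>z. z \<in> pts Z \<Longrightarrow> \<exists>U. z \<in> U \<and> affine_open Z U" using kZ by (simp_all add: kscheme_def)
  interpret Z: ringed Z using rZ by unfold_locales
  have rX: "ringed_space X" by (rule ringed_space_curve)
  interpret X: ringed X using rX by unfold_locales
  obtain t where tc: "coordinate k (F\<lparr>carrier := reg F ord Cl\<rparr>) i t" using coord by blast
  have t: "t \<in> reg F ord Cl" using tc by (simp add: coordinate_def)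
  have tg: "t \<in> carrier (glob X)" using t by (simp add: carrier_reg_ring)
  note oX = openin_topspace[of "sp X"] and oZ = openin_topspace[of "sp Z"]
  interpret GZ: cring "glob Z" by (rule Z.sec_cring[OF oZ])
  interpret GX: cring "glob X" by (rule X.sec_cring[OF oX])
  define a where "a = sh p (pts X) t"
  define b where "b = sh q (pts X) t"
  have ab: "a \<in> carrier (glob Z)" "b \<in> carrier (glob Z)"
    using mor_closed[OF p oX tg] mor_closed[OF q oX tg] pre_pts[OF p] pre_pts[OF q] by (simp_all add: a_def b_def)
  define f where "f = a \<ominus>\<^bsub>glob Z\<^esub> b"
  have fc: "f \<in> carrier (glob Z)" using ab by (simp add: f_def)
  have diff: "\<psi> f = \<zero>\<^bsub>R\<^esub> \<longleftrightarrow> \<psi> a = \<psi> b" if "cring R" "\<psi> \<in> ring_hom (glob Z) R" for \<psi> and R :: "'a ring"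
  proof -
    interpret R: cring R by fact
    interpret H: ring_hom_ring "glob Z" R \<psi> by (rule ring_hom_ringI2[OF GZ.ring_axioms R.ring_axioms that(2)])
    have "\<psi> f = \<psi> a \<ominus>\<^bsub>R\<^esub> \<psi> b" unfolding f_def a_minus_def using ab by simp
    then show ?thesis using R.r_right_minus_eq ab by simp
  qed
  have img: "pt d ` pts X = {z\<in>pts Z. vanishes Z (pts Z) f z}"
  proof (intro equalityI subsetI)
    fix z assume "z \<in> pt d ` pts X"
    then obtain x where x: "x \<in> pts X" "z = pt d x" by blast
    have dh: "sh d (pts Z) \<in> ring_hom (glob Z) (glob X)" using mor_hom[OF d oZ] pre_pts[OF d] by simp
    have "sh d (pts Z) a = t"
      using arg_cong[OF pd, of "\<lambda>m. sh m (pts X) t"] sh_comp[OF oX tg, of X Z p d] tg oX pre_pts[OF p]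
      by (simp add: a_def mor_id_def)
    moreover have "sh d (pts Z) b = t"
      using arg_cong[OF qd, of "\<lambda>m. sh m (pts X) t"] sh_comp[OF oX tg, of X Z q d] tg oX pre_pts[OF q]
      by (simp add: b_def mor_id_def)
    ultimately have "sh d (pts Z) f = \<zero>\<^bsub>glob X\<^esub>" using diff[OF GX.is_cring dh] by simp
    moreover have "vanishes X (pts X) \<zero>\<^bsub>glob X\<^esub> x"
      unfolding vanishes_def
    proof (intro allI impI notI; elim conjE)
      fix W assume W: "opn X W" "x \<in> W" "res X (pts X) W \<zero>\<^bsub>glob X\<^esub> \<in> Units (sec X W)"
      then have "W \<subseteq> pt_set" "W \<noteq> {}" by (auto simp: opn_curve)
      then show False using W(3) Units_reg by simp
    qed
    ultimately show "z \<in> {z\<in>pts Z. vanishes Z (pts Z) f z}"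
      using vanishes_pull[OF rX rZ d oZ fc, of x] pre_pts[OF d] x mor_pts[OF d] by simp
  next
    fix z assume "z \<in> {z\<in>pts Z. vanishes Z (pts Z) f z}"
    then have z: "z \<in> pts Z" "vanishes Z (pts Z) f z" by auto
    obtain U where U: "z \<in> U" "affine_open Z U" using aff[OF z(1)] by blast
    obtain h where h: "chart Z U h" using affine_open_chart[OF U(2)] .
    interpret Zc: ringed_chart Z U h using h by unfold_locales
    have oU: "opn Z U" "U \<subseteq> pts Z" using Zc.opn_U openin_subset by auto
    have "res Z (pts Z) U f \<in> h z"
      using Z.vanishes_res[OF oZ oU U(1) fc] z(2) Zc.vanishes_iff[OF U(1) Z.res_closed[OF oZ oU fc]] by simp
    moreover obtain \<kappa> :: "'a ring" and \<phi> where K: "field \<kappa>" "\<phi> \<in> ring_hom (sec Z U) \<kappa>"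
      "\<And>b. b \<in> carrier (sec Z U) \<Longrightarrow> \<phi> b = \<zero>\<^bsub>\<kappa>\<^esub> \<longleftrightarrow> b \<in> h z"
      by (rule ex_residue_field[OF Zc.B_cring Zc.h_prime[OF U(1)] inf]) (rule that)
    ultimately have \<phi>f: "\<phi> (res Z (pts Z) U f) = \<zero>\<^bsub>\<kappa>\<^esub>" using Z.res_closed[OF oZ oU fc] by simp
    \<comment> \<open>The spectrum of the residue field is realized as the curve with function field
      \<open>\<kappa>\<close> and without closed points. The kernel of \<open>\<phi>\<close> is the
      prime of \<open>z\<close>, so the induced morphism hits \<open>z\<close>.\<close>
    let ?o = "\<lambda>_ _. 0 :: int" and ?i = "\<lambda>c. \<phi> (res Z (pts Z) U (str Z c))"
    interpret K: field \<kappa> by (rule K(1))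
    interpret K: curve \<kappa> "{}" ?o by unfold_locales auto
    have regK: "\<kappa>\<lparr>carrier := reg \<kappa> ?o {}\<rparr> = \<kappa>" by (simp add: reg_def)
    let ?T = "curve_sch \<kappa> ?o ?i {}"
    have "?i \<in> ring_hom k \<kappa>"
      using ring_hom_comp[OF ring_hom_comp[OF sZ Z.res_hom[OF oZ oU]] K(2)] by simp
    then have kT: "kscheme k ?T" using K.kscheme_curve regK by simp
    have rT: "ringed_space ?T" by (rule K.ringed_space_curve)
    obtain m where m: "is_mor k ?T Z m" "pre ?T m U = {\<zero>\<^bsub>\<kappa>\<^esub>}"
      "\<And>b. b \<in> carrier (sec Z U) \<Longrightarrow> sh m U b = \<phi> b" "h (pt m \<zero>\<^bsub>\<kappa>\<^esub>) = {b \<in> carrier (sec Z U). \<phi> b = \<zero>\<^bsub>\<kappa>\<^esub>}"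
      using K.ex_mor[OF Zc.ringed_chart_axioms, of \<phi> k ?i] K(2) regK sZ by auto
    have ptT: "pts ?T = {\<zero>\<^bsub>\<kappa>\<^esub>}" by simp
    have mU: "pt m \<zero>\<^bsub>\<kappa>\<^esub> \<in> U" using m(2) by (auto simp: pre_def)
    have "h (pt m \<zero>\<^bsub>\<kappa>\<^esub>) = h z" using m(4) K(3) Zc.h_sub[OF U(1)] by auto
    then have mz: "pt m \<zero>\<^bsub>\<kappa>\<^esub> = z" using Zc.h_inj mU U(1) by (simp add: inj_on_def)
    have glT: "sec ?T {\<zero>\<^bsub>\<kappa>\<^esub>} = \<kappa>" by (simp add: K.reg_ring_ne regK)
    have mh: "sh m (pts Z) \<in> ring_hom (glob Z) \<kappa>" using mor_hom[OF m(1) oZ] pre_pts[OF m(1)] glT ptT by simp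
    have "sh m (pts Z) f = \<zero>\<^bsub>\<kappa>\<^esub>"
      using mor_res[OF m(1) oZ oU fc] m(3)[OF Z.res_closed[OF oZ oU fc]] \<phi>f pre_pts[OF m(1)] m(2) by simp
    then have mab: "sh m (pts Z) a = sh m (pts Z) b" using diff[OF K.is_cring mh] by simp
    let ?pm = "mor_comp ?T Z X p m" and ?qm = "mor_comp ?T Z X q m"
    have pm: "is_mor k ?T X ?pm" by (rule is_mor_comp[OF rT rZ rX m(1) p str_X])
    have qm: "is_mor k ?T X ?qm" by (rule is_mor_comp[OF rT rZ rX m(1) q str_X])
    have hpm: "sh ?pm (pts X) \<in> ring_hom (F\<lparr>carrier := reg F ord Cl\<rparr>) \<kappa>"
      using mor_hom[OF pm oX] pre_pts[OF pm] glT ptT by (simp add: reg_ring_ne)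
    have hqm: "sh ?qm (pts X) \<in> ring_hom (F\<lparr>carrier := reg F ord Cl\<rparr>) \<kappa>"
      using mor_hom[OF qm oX] pre_pts[OF qm] glT ptT by (simp add: reg_ring_ne)
    have "sh ?pm (pts X) b = sh ?qm (pts X) b" if "b \<in> reg F ord Cl" for b
    proof (rule coordinateD[OF tc K.is_cring hpm hqm])
      show "sh ?pm (pts X) (i c) = sh ?qm (pts X) (i c)" if "c \<in> carrier k" for c
        using mor_str[OF pm that] mor_str[OF qm that] by simp
      show "sh ?pm (pts X) t = sh ?qm (pts X) t"
        using sh_comp[OF oX tg, of ?T Z p m] sh_comp[OF oX tg, of ?T Z q m] mab pre_pts[OF p] pre_pts[OF q]
        by (simp add: a_def b_def)
    qed (use that in simp)
    then have "?pm = ?qm"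
      by (intro mor_eqI[OF rT ringed_chart_X pm qm])
        (use pre_pts[OF pm] pre_pts[OF qm] in \<open>simp_all add: carrier_reg_ring\<close>)
    define n where "n = mor_comp ?T X Z d ?pm"
    have n: "is_mor k ?T Z n" unfolding n_def by (rule is_mor_comp[OF rT rX rZ pm d sZ])
    have "mor_comp ?T Z X p n = ?pm" "mor_comp ?T Z X q n = ?pm"
      unfolding n_def using mor_comp_assoc[OF pm d p] mor_comp_assoc[OF pm d q] pd qd mor_comp_id_left[OF pm] by simp_all
    then have "m = n"
      using uni[OF kT pm pm] m(1) n \<open>?pm = ?qm\<close> by (metis (no_types, lifting))
    then have "z = pt d (pt ?pm \<zero>\<^bsub>\<kappa>\<^esub>)" using mz pt_comp[of "\<zero>\<^bsub>\<kappa>\<^esub>" ?T X Z d ?pm] by (simp add: n_def)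
    then show "z \<in> pt d ` pts X" using mor_pts[OF pm, of "\<zero>\<^bsub>\<kappa>\<^esub>"] ptT by blast
  qed
  have "opn Z (pts Z - pt d ` pts X)"
  proof (subst openin_subopen, intro ballI)
    fix z assume "z \<in> pts Z - pt d ` pts X"
    then have "z \<in> pts Z" "\<not> vanishes Z (pts Z) f z" using img by auto
    then obtain W where W: "opn Z W" "z \<in> W" "W \<subseteq> pts Z" "res Z (pts Z) W f \<in> Units (sec Z W)"
      by (auto simp: vanishes_def)
    then have "W \<subseteq> pts Z - pt d ` pts X" unfolding img vanishes_def by auto
    then show "\<exists>T. opn Z T \<and> z \<in> T \<and> T \<subseteq> pts Z - pt d ` pts X" using W by blast
  qed
  moreover have "pt d ` pts X \<subseteq> pts Z" using img by blast
  ultimately show ?thesis by (simp add: closedin_def)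
qed

text \<open>The projection \<open>p\<close> is a left inverse of \<open>d\<close>. So the diagonal
  is an embedding, and sections on it extend by pullback along \<open>p\<close>; only closedness
  depends on the curve.\<close>

lemma separated_X: "separated k X"
  unfolding separated_def
proof (intro allI impI; elim conjE)
  fix Z p q d assume P: "is_product k X X Z p q" and d: "is_mor k X Z d"
    and pd: "mor_comp X Z X p d = mor_id X" and qd: "mor_comp X Z X q d = mor_id X"
  have kZ: "kscheme k Z" and p: "is_mor k Z X p" using P unfolding is_product_def by simp_all
  have rZ: "ringed_space Z" using kZ by (simp add: kscheme_def)
  interpret Z: ringed Z using rZ by unfold_locales
  interpret X: ringed X using ringed_space_curve by unfold_locales
  have ptpd: "pt p (pt d x) = x" if "x \<in> pts X" for x
    using arg_cong[OF pd, of "\<lambda>m. pt m x"] that by (simp add: pt_comp mor_id_def del: pts_curve)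
  have shpd: "sh d (pre Z p V) (sh p V s) = s" if "opn X V" "s \<in> carrier (sec X V)" for V s
    using arg_cong[OF pd, of "\<lambda>m. sh m V s"] that sh_comp[OF that, of X Z p d] by (simp add: mor_id_def)
  have emb: "embedding_map (sp X) (sp Z) (pt d)"
    by (rule section_imp_embedding_map)
      (auto simp: section_map_def retraction_maps_def intro!: exI[of _ "pt p"] mor_cont[OF p] mor_cont[OF d] ptpd)
  have surj: "\<exists>W t. opn Z W \<and> W \<subseteq> V \<and> pt d x \<in> W \<and> t \<in> carrier (sec Z W) \<and>
      sh d W t = res X (pre X d V) (pre X d W) s"
    if V: "opn Z V" and s: "s \<in> carrier (sec X (pre X d V))" and x: "x \<in> pre X d V" for V s x
  proof -
    let ?U = "pre X d V"
    have U: "opn X ?U" using pre_opn[OF d V] .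
    have o: "opn Z (pre Z p ?U)" using pre_opn[OF p U] .
    \<comment> \<open>Cutting with \<open>V\<close> keeps \<open>W\<close> in the given open set,
      while its preimage under \<open>d\<close> remains the whole preimage of
      \<open>V\<close>.\<close>
    define W where "W = pre Z p ?U \<inter> V"
    have W: "opn Z W" "W \<subseteq> V" "W \<subseteq> pre Z p ?U" using o V by (auto simp: W_def)
    have preW: "pre X d W = ?U" using ptpd mor_pts[OF d] by (auto simp: W_def mem_pre)
    have preP: "pre X d (pre Z p ?U) = ?U" using ptpd mor_pts[OF d] by (auto simp: mem_pre)
    have ps: "sh p ?U s \<in> carrier (sec Z (pre Z p ?U))" using mor_closed[OF p U s] .
    define t where "t = res Z (pre Z p ?U) W (sh p ?U s)"
    have "sh d W t = res X ?U ?U (sh d (pre Z p ?U) (sh p ?U s))"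
      unfolding t_def using mor_res[OF d o W(1,3) ps] preW preP by simp
    then have "sh d W t = res X ?U (pre X d W) s" using shpd[OF U s] preW by simp
    moreover have "t \<in> carrier (sec Z W)" unfolding t_def using Z.res_closed[OF o W(1,3) ps] .
    moreover have "pt d x \<in> W" using x preW by (auto simp: mem_pre W_def)
    ultimately show ?thesis using W by blast
  qed
  show "closed_immersion k X Z d"
    unfolding closed_immersion_def using d emb diagonal_closed[OF P d pd qd] surj by simp
qed

lemma Sm_X: "Sm k X"
  unfolding Sm_def using kscheme_X separated_X finite_type_X smooth_X by simp

end

section \<open>Orders on a field of fractions\<close>

text \<open>\<open>\<delta>\<close> abstracts the degree of polynomials. It is the induction measure
  for splitting off primes: primes are not units and so have positive \<open>\<delta>\<close>, which
  makes cofactors smaller.\<close>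

locale graded_pid = principal_domain R for R (structure) +
  fixes \<delta> :: "'a \<Rightarrow> nat"
  assumes \<delta>_mult: "a \<in> carrier R - {\<zero>} \<Longrightarrow> b \<in> carrier R - {\<zero>} \<Longrightarrow> \<delta> (a \<otimes> b) = \<delta> a + \<delta> b"
    and \<delta>_unit: "a \<in> carrier R - {\<zero>} \<Longrightarrow> \<delta> a = 0 \<Longrightarrow> a \<in> Units R"
begin

text \<open>Closed points have to correspond to prime ideals and not to prime elements, so one
  generator is selected for each principal ideal.\<close>

definition rp where "rp p = (SOME q. q \<in> carrier R \<and> PIdl q = PIdl p)"
definition Pr where "Pr = {p \<in> carrier R - {\<zero>}. primeideal (PIdl p) R \<and> rp p = p}"

lemma rp:
  assumes "p \<in> carrier R"
  shows "rp p \<in> carrier R" "PIdl (rp p) = PIdl p" "rp (rp p) = rp p"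
proof -
  have "\<exists>q. q \<in> carrier R \<and> PIdl q = PIdl p" using assms by blast
  from someI_ex[OF this] show *: "rp p \<in> carrier R" "PIdl (rp p) = PIdl p" by (simp_all add: rp_def)
  have "rp q = rp p" if "PIdl q = PIdl p" for q using that by (simp add: rp_def)
  then show "rp (rp p) = rp p" using *(2) by blast
qed

lemma mem_PIdl: "p \<in> carrier R \<Longrightarrow> a \<in> PIdl p \<longleftrightarrow> p divides a"
  unfolding cgenideal_def factor_def using m_comm by auto

lemma rp_Pr:
  assumes "p \<in> carrier R - {\<zero>}" "primeideal (PIdl p) R"
  shows "rp p \<in> Pr"
proof -
  have "rp p \<noteq> \<zero>"
  proof
    assume "rp p = \<zero>"
    then have "p \<in> PIdl \<zero>" using rp(2)[of p] cgenideal_self[of p] assms by auto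
    then show False using assms mem_PIdl[of \<zero> p] zero_divides by auto
  qed
  then show ?thesis unfolding Pr_def using rp[of p] assms by auto
qed

lemma Pr_carrier: "p \<in> Pr \<Longrightarrow> p \<in> carrier R - {\<zero>}" by (simp add: Pr_def)

lemma Pr_prime:
  assumes "p \<in> Pr" "a \<in> carrier R" "b \<in> carrier R" "p divides (a \<otimes> b)"
  shows "p divides a \<or> p divides b"
proof -
  have p: "p \<in> carrier R" "primeideal (PIdl p) R" using assms by (auto simp: Pr_def)
  then show ?thesis using primeideal.I_prime[OF p(2) assms(2,3)] assms(4) mem_PIdl[OF p(1)] by blast
qed

lemma Pr_not_one: "p \<in> Pr \<Longrightarrow> \<not> p divides \<one>"
proof
  assume p: "p \<in> Pr" "p divides \<one>"
  interpret I: primeideal "PIdl p" R using p by (simp add: Pr_def)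
  have "\<one> \<in> PIdl p" using mem_PIdl[of p \<one>] Pr_carrier[OF p(1)] p(2) by blast
  then show False using I.one_imp_carrier I.I_notcarr by blast
qed

lemma Pr_\<delta>: "p \<in> Pr \<Longrightarrow> 0 < \<delta> p"
  using \<delta>_unit[of p] Pr_not_one[of p] Pr_carrier[of p] divides_one[of p] by auto

lemma nz_prod': "a \<in> carrier R - {\<zero>} \<Longrightarrow> b \<in> carrier R - {\<zero>} \<Longrightarrow> a \<otimes> b \<in> carrier R - {\<zero>}"
  using integral by fastforce

lemma nz_pow': "a \<in> carrier R - {\<zero>} \<Longrightarrow> a [^] (n::nat) \<in> carrier R - {\<zero>}"
proof (induction n)
  case (Suc n)
  then show ?case using nz_prod' by simp
qed simp

lemma dividesE_nz:
  assumes "p \<in> carrier R" "a \<in> carrier R - {\<zero>}" "p divides a"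
  obtains c where "c \<in> carrier R - {\<zero>}" "a = p \<otimes> c"
proof -
  obtain c where c: "c \<in> carrier R" "a = p \<otimes> c" using assms(3) unfolding factor_def by blast
  have "c \<noteq> \<zero>" using assms(1,2) c by auto
  then show ?thesis using that[of c] c by simp
qed

section \<open>Valuations on a principal ideal domain\<close>

lemma decomp_ex:
  assumes p: "p \<in> Pr" and a: "a \<in> carrier R - {\<zero>}"
  shows "\<exists>n a'. a' \<in> carrier R - {\<zero>} \<and> a = p [^] (n::nat) \<otimes> a' \<and> \<not> p divides a'"
  using a
proof (induction "\<delta> a" arbitrary: a rule: less_induct)
  case less
  have pc: "p \<in> carrier R - {\<zero>}" using Pr_carrier[OF p] .
  show ?case
  proof (cases "p divides a")
    case True
    obtain c where c: "c \<in> carrier R - {\<zero>}" "a = p \<otimes> c" by (rule dividesE_nz[of p a]) (use pc less(2) True in auto)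
    then have "\<delta> c < \<delta> a" using \<delta>_mult[OF pc c(1)] Pr_\<delta>[OF p] by simp
    then obtain n a' where n: "a' \<in> carrier R - {\<zero>}" "c = p [^] (n::nat) \<otimes> a'" "\<not> p divides a'"
      using less(1)[OF _ c(1)] by blast
    have "a = p [^] Suc n \<otimes> a'" unfolding c(2) n(2) using pc n(1) by (simp add: m_ac)
    then show ?thesis using n by blast
  next
    case False
    then show ?thesis using less(2) by (intro exI[of _ "0::nat"] exI[of _ a]) auto
  qed
qed

lemma decomp_le:
  assumes p: "p \<in> Pr" and a: "a \<in> carrier R - {\<zero>}" and b: "b \<in> carrier R - {\<zero>}" "\<not> p divides a"
    and eq: "p [^] (n::nat) \<otimes> a = p [^] (m::nat) \<otimes> b"
  shows "m \<le> n"
proof (rule ccontr)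
  assume "\<not> m \<le> n"
  then obtain j where j: "m = n + Suc j" by (metis add_Suc_right less_imp_Suc_add not_le)
  have pc: "p \<in> carrier R - {\<zero>}" using Pr_carrier[OF p] .
  have "p [^] m \<otimes> b = p [^] n \<otimes> (p [^] Suc j \<otimes> b)"
    unfolding j using pc b(1) by (simp add: nat_pow_mult[symmetric] m_assoc del: nat_pow_Suc)
  then have "a = p [^] Suc j \<otimes> b"
    using eq m_lcancel[of "p [^] n" a "p [^] Suc j \<otimes> b"] nz_pow'[OF pc] pc a b(1) by auto
  then have "a = p \<otimes> (p [^] j \<otimes> b)" using pc b(1) by (simp add: m_ac)
  then have "p divides a" using pc b(1) by (intro dividesI[where G = R and c = "p [^] j \<otimes> b"]) auto
  then show False using b(2) by blast
qed

definition v where "v p a = (THE n. \<exists>a'. a' \<in> carrier R - {\<zero>} \<and> a = p [^] (n::nat) \<otimes> a' \<and> \<not> p divides a')"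

lemma v_eq:
  assumes "p \<in> Pr" "a \<in> carrier R - {\<zero>}" "\<not> p divides a"
  shows "v p (p [^] n \<otimes> a) = n"
  unfolding v_def
proof (rule the_equality)
  show "\<exists>a'. a' \<in> carrier R - {\<zero>} \<and> p [^] n \<otimes> a = p [^] n \<otimes> a' \<and> \<not> p divides a'" using assms by blast
  fix m assume "\<exists>a'. a' \<in> carrier R - {\<zero>} \<and> p [^] n \<otimes> a = p [^] (m::nat) \<otimes> a' \<and> \<not> p divides a'"
  then obtain b where b: "b \<in> carrier R - {\<zero>}" "p [^] n \<otimes> a = p [^] m \<otimes> b" "\<not> p divides b" by blast
  show "m = n"
    using decomp_le[OF assms(1,2) b(1) assms(3) b(2)] decomp_le[OF assms(1) b(1) assms(2) b(3) b(2)[symmetric]] by simp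
qed

lemma v_decomp:
  assumes "p \<in> Pr" "a \<in> carrier R - {\<zero>}"
  obtains a' where "a' \<in> carrier R - {\<zero>}" "a = p [^] v p a \<otimes> a'" "\<not> p divides a'"
proof -
  obtain n a' where n: "a' \<in> carrier R - {\<zero>}" "a = p [^] (n::nat) \<otimes> a'" "\<not> p divides a'"
    using decomp_ex[OF assms] by blast
  have vn: "v p a = n" using v_eq[OF assms(1) n(1,3), of n] n(2) by simp
  have "a = p [^] v p a \<otimes> a'" unfolding vn by (rule n(2))
  then show ?thesis by (rule that[OF n(1) _ n(3)])
qed

lemma v_mult:
  assumes p: "p \<in> Pr" and a: "a \<in> carrier R - {\<zero>}" and b: "b \<in> carrier R - {\<zero>}"
  shows "v p (a \<otimes> b) = v p a + v p b"
proof -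
  obtain a' where a': "a' \<in> carrier R - {\<zero>}" "a = p [^] v p a \<otimes> a'" "\<not> p divides a'" using v_decomp[OF p a] .
  obtain b' where b': "b' \<in> carrier R - {\<zero>}" "b = p [^] v p b \<otimes> b'" "\<not> p divides b'" using v_decomp[OF p b] .
  have pc: "p \<in> carrier R" using Pr_carrier[OF p] by blast
  have "(p [^] v p a \<otimes> a') \<otimes> (p [^] v p b \<otimes> b') = p [^] (v p a + v p b) \<otimes> (a' \<otimes> b')"
    using a'(1) b'(1) pc by (simp add: nat_pow_mult[symmetric] m_ac)
  then have "a \<otimes> b = p [^] (v p a + v p b) \<otimes> (a' \<otimes> b')" using a'(2) b'(2) by simp
  moreover have "\<not> p divides (a' \<otimes> b')" using Pr_prime[OF p] a' b' by blast
  ultimately show ?thesis using v_eq[OF p nz_prod'[OF a'(1) b'(1)]] by simp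
qed

lemma v_pow_mult:
  assumes "p \<in> Pr" "a \<in> carrier R - {\<zero>}"
  shows "n \<le> v p (p [^] n \<otimes> a)"
proof -
  have pc: "p \<in> carrier R - {\<zero>}" using Pr_carrier[OF assms(1)] .
  have "v p (p [^] n) = n" using v_eq[OF assms(1), of \<one> n] Pr_not_one[OF assms(1)] pc by simp
  then show ?thesis using v_mult[OF assms(1) nz_pow'[OF pc] assms(2)] by simp
qed

lemma v_add:
  assumes p: "p \<in> Pr" and a: "a \<in> carrier R - {\<zero>}" and b: "b \<in> carrier R - {\<zero>}" and ab: "a \<oplus> b \<noteq> \<zero>"
    and n: "n \<le> v p a" "n \<le> v p b"
  shows "n \<le> v p (a \<oplus> b)"
proof -
  have pc: "p \<in> carrier R - {\<zero>}" using Pr_carrier[OF p] .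
  have ex: "\<exists>c\<in>carrier R. x = p [^] n \<otimes> c" if x: "x \<in> carrier R - {\<zero>}" "n \<le> v p x" for x
  proof -
    obtain x' where x': "x' \<in> carrier R - {\<zero>}" "x = p [^] v p x \<otimes> x'" using v_decomp[OF p x(1)] by blast
    have "p [^] v p x \<otimes> x' = p [^] n \<otimes> (p [^] (v p x - n) \<otimes> x')"
      using x(2) x'(1) pc by (simp add: m_assoc[symmetric] nat_pow_mult)
    then show ?thesis using x'(1,2) pc by (intro bexI[of _ "p [^] (v p x - n) \<otimes> x'"]) auto
  qed
  obtain c where c: "c \<in> carrier R" "a = p [^] n \<otimes> c" using ex[OF a n(1)] by blast
  obtain d where d: "d \<in> carrier R" "b = p [^] n \<otimes> d" using ex[OF b n(2)] by blast
  have eq: "a \<oplus> b = p [^] n \<otimes> (c \<oplus> d)" unfolding c(2) d(2) using c(1) d(1) pc by (simp add: r_distr)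
  then have "c \<oplus> d \<in> carrier R - {\<zero>}" using ab c(1) d(1) pc by auto
  then show ?thesis unfolding eq using v_pow_mult[OF p] by blast
qed

lemma v_pos:
  assumes "p \<in> Pr" "a \<in> carrier R - {\<zero>}"
  shows "0 < v p a \<longleftrightarrow> p divides a"
proof
  have pc: "p \<in> carrier R - {\<zero>}" using Pr_carrier[OF assms(1)] .
  { assume v: "0 < v p a"
    obtain a' where a': "a' \<in> carrier R - {\<zero>}" "a = p [^] v p a \<otimes> a'" using v_decomp[OF assms] by blast
    obtain n where "v p a = Suc n" using v gr0_implies_Suc by blast
    then have "a = p \<otimes> (p [^] n \<otimes> a')" using a' pc by (simp add: m_ac)
    then show "p divides a" using a'(1) pc by (intro dividesI[where G = R and c = "p [^] n \<otimes> a'"]) auto }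
  { assume pa: "p divides a"
    obtain c where "c \<in> carrier R - {\<zero>}" "a = p \<otimes> c" by (rule dividesE_nz[of p a]) (use pc assms(2) pa in auto)
    then show "0 < v p a" using v_pow_mult[OF assms(1), of c 1] pc by simp }
qed

lemma v_self: "p \<in> Pr \<Longrightarrow> v p p = 1"
  using v_eq[of p \<one> 1] Pr_not_one[of p] Pr_carrier[of p] by simp

text \<open>From \<open>q = p c\<close> the prime \<open>q\<close> divides \<open>p\<close> or
  \<open>c\<close>. The latter would make \<open>p\<close> a unit, so both generate the same ideal,
  of which each is the selected generator.\<close>

lemma Pr_divides_eq:
  assumes "p \<in> Pr" "q \<in> Pr" "p divides q"
  shows "p = q"
proof -
  have pq: "p \<in> carrier R - {\<zero>}" "q \<in> carrier R - {\<zero>}" using assms Pr_carrier by auto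
  obtain c where c: "c \<in> carrier R - {\<zero>}" "q = p \<otimes> c" by (rule dividesE_nz[of p q]) (use pq assms(3) in auto)
  have "q divides (p \<otimes> c)" by (subst c(2)[symmetric], rule divides_refl) (use pq in blast)
  then have "q divides p \<or> q divides c" using Pr_prime[OF assms(2), of p c] pq c(1) by blast
  moreover have "\<not> q divides c"
  proof
    assume "q divides c"
    then obtain d where d: "d \<in> carrier R" "c = q \<otimes> d" unfolding factor_def by blast
    have "q \<otimes> \<one> = q" using pq by simp
    also have "\<dots> = p \<otimes> (q \<otimes> d)" using c(2) unfolding d(2) .
    also have "\<dots> = q \<otimes> (p \<otimes> d)" using pq d(1) by (simp add: m_lcomm)
    finally have "q \<otimes> \<one> = q \<otimes> (p \<otimes> d)" .
    then have "\<one> = p \<otimes> d" using m_lcancel[of q \<one> "p \<otimes> d"] pq d by auto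
    then show False using Pr_not_one[OF assms(1)] d(1) unfolding factor_def by blast
  qed
  ultimately have "q divides p" by blast
  then have "PIdl q \<subseteq> PIdl p" "PIdl p \<subseteq> PIdl q"
    using assms(3) to_contain_is_to_divide[of p q] to_contain_is_to_divide[of q p] pq by blast+
  then have "PIdl p = PIdl q" by (rule equalityI[rotated])
  then have 1: "rp p = rp q" unfolding rp_def by (simp only:)
  have "rp p = p" "rp q = q" using assms(1,2) unfolding Pr_def by blast+
  then show ?thesis using 1 by metis
qed

lemma v_other: "p \<in> Pr \<Longrightarrow> q \<in> Pr \<Longrightarrow> p \<noteq> q \<Longrightarrow> v p q = 0"
  using v_pos[of p q] Pr_divides_eq[of p q] Pr_carrier[of q] by auto

lemma finite_divisors:
  assumes "a \<in> carrier R - {\<zero>}"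
  shows "finite {p\<in>Pr. p divides a}"
  using assms
proof (induction "\<delta> a" arbitrary: a rule: less_induct)
  case less
  show ?case
  proof (cases "{p\<in>Pr. p divides a} = {}")
    case False
    then obtain p where p: "p \<in> Pr" "p divides a" by blast
    obtain c where c: "c \<in> carrier R - {\<zero>}" "a = p \<otimes> c"
      by (rule dividesE_nz[of p a]) (use less(2) p Pr_carrier[OF p(1)] in auto)
    have "\<delta> c < \<delta> a" using \<delta>_mult[OF Pr_carrier[OF p(1)] c(1)] Pr_\<delta>[OF p(1)] c(2) by simp
    then have "finite {p\<in>Pr. p divides c}" using less(1) c(1) by blast
    moreover have "{p\<in>Pr. p divides a} \<subseteq> insert p {p\<in>Pr. p divides c}"
      using Pr_prime[of _ p c] Pr_divides_eq[of _ p] p(1) Pr_carrier[OF p(1)] c by auto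
    ultimately show ?thesis by (simp add: finite_subset)
  qed (simp only: finite.emptyI)
qed

lemma ex_Pr_divisor:
  assumes "a \<in> carrier R - {\<zero>}" "a \<notin> Units R"
  shows "\<exists>p\<in>Pr. p divides a"
proof -
  obtain q where q: "q \<in> carrier R" "ring_irreducible q" "q divides a"
    using exists_irreducible_divisor[OF assms] .
  have q0: "q \<noteq> \<zero>" using q(2) by (simp add: ring_irreducible_def)
  then have "primeideal (PIdl q) R" using primeness_condition[OF q(1)] primeideal_iff_prime[of q] q by auto
  then have "rp q \<in> Pr" using rp_Pr q(1) q0 by blast
  moreover have "rp q divides a" using rp[OF q(1)] q(3) mem_PIdl[OF q(1), of a] mem_PIdl[of "rp q" a] by simp
  ultimately show ?thesis by blast
qed

text \<open>A prime factor of \<open>b\<close> divides \<open>a\<close> too, by the inequality of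
  valuations. Cancelling it from both reduces \<open>\<delta> b\<close> and preserves the
  inequalities.\<close>

lemma divides_of_v:
  assumes "a \<in> carrier R - {\<zero>}" "b \<in> carrier R - {\<zero>}" "\<And>p. p \<in> Pr \<Longrightarrow> v p b \<le> v p a"
  shows "b divides a"
  using assms
proof (induction "\<delta> b" arbitrary: a b rule: less_induct)
  case less
  show ?case
  proof (cases "b \<in> Units R")
    case True
    then show ?thesis using less(2) by (intro unit_divides) auto
  next
    case False
    then obtain p where p: "p \<in> Pr" "p divides b" using ex_Pr_divisor less(3) by blast
    have pc: "p \<in> carrier R - {\<zero>}" using Pr_carrier[OF p(1)] .
    have pa: "p divides a" using less(4)[OF p(1)] v_pos[OF p(1) less(3)] v_pos[OF p(1) less(2)] p(2) by simp
    obtain c where c: "c \<in> carrier R - {\<zero>}" "a = p \<otimes> c" by (rule dividesE_nz[of p a]) (use less(2) pc pa in auto)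
    obtain d where d: "d \<in> carrier R - {\<zero>}" "b = p \<otimes> d" by (rule dividesE_nz[of p b]) (use less(3) pc p(2) in auto)
    have "\<delta> d < \<delta> b" using \<delta>_mult[OF pc d(1)] Pr_\<delta>[OF p(1)] d(2) by simp
    moreover have "v q d \<le> v q c" if "q \<in> Pr" for q
      using less(4)[OF that] v_mult[OF that pc c(1)] v_mult[OF that pc d(1)] c(2) d(2) by simp
    ultimately have "d divides c" using less(1) c(1) d(1) by blast
    then show ?thesis unfolding c(2) d(2) using divides_mult[of d p c] d(1) pc by auto
  qed
qed

text \<open>The nonzero prime ideal of \<open>p\<close> is maximal, so together with
  \<open>a\<close> it generates the unit ideal. This becomes \<open>ord_res\<close> for the
  curve.\<close>

lemma Pr_bezout:
  assumes p: "p \<in> Pr" and a: "a \<in> carrier R" "\<not> p divides a"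
  shows "\<exists>y\<in>carrier R. \<exists>z\<in>carrier R. \<one> = p \<otimes> z \<oplus> a \<otimes> y"
proof -
  have pc: "p \<in> carrier R - {\<zero>}" using Pr_carrier[OF p] .
  have "ring_irreducible p" using primeness_condition[of p] primeideal_iff_prime[OF pc] p pc by (auto simp: Pr_def)
  then interpret M: maximalideal "PIdl p" R using irreducible_imp_maximalideal pc by blast
  let ?J = "PIdl p <+>\<^bsub>R\<^esub> PIdl a"
  have J: "ideal ?J R" using add_ideals cgenideal_ideal pc a(1) by blast
  then have Jc: "?J \<subseteq> carrier R" using additive_subgroup.a_subset ideal.axioms(1) by blast
  have 0: "\<zero> \<in> PIdl p" "\<zero> \<in> PIdl a"
    using additive_subgroup.zero_closed ideal.axioms(1) cgenideal_ideal pc a(1) by blast+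
  have "x \<in> ?J" if x: "x \<in> PIdl p" for x
  proof -
    have "x = x \<oplus> \<zero>" using x M.a_subset by auto
    then show ?thesis using x 0(2) unfolding set_add_def' by blast
  qed
  moreover have "a \<in> ?J"
  proof -
    have "a = \<zero> \<oplus> a" using a by simp
    then show ?thesis using 0(1) cgenideal_self[OF a(1)] unfolding set_add_def' by blast
  qed
  moreover have "a \<notin> PIdl p" using mem_PIdl a(2) pc by blast
  ultimately have "?J = carrier R" using M.I_maximal[OF J _ Jc] by blast
  then have "\<one> \<in> ?J" by simp
  then obtain z y where "z \<in> PIdl p" "y \<in> PIdl a" "\<one> = z \<oplus> y" unfolding set_add_def' by auto
  moreover then obtain z' where "z' \<in> carrier R" "z = p \<otimes> z'" using mem_PIdl pc by (auto simp: factor_def)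
  moreover obtain y' where "y' \<in> carrier R" "y = a \<otimes> y'" using \<open>y \<in> PIdl a\<close> mem_PIdl[OF a(1)] by (auto simp: factor_def)
  ultimately show ?thesis by blast
qed

end

section \<open>Orders on the field of fractions\<close>

locale fraction_curve = graded_pid R \<delta> + F: field F
  for R :: "('a, 'b) ring_scheme" (structure) and \<delta> and F :: "'u ring" +
  fixes e :: "'a \<Rightarrow> 'u"
  assumes e_hom: "e \<in> ring_hom R F"
    and e_inj: "inj_on e (carrier R)"
    and e_frac: "x \<in> carrier F \<Longrightarrow> \<exists>a\<in>carrier R. \<exists>b\<in>carrier R - {\<zero>}. x \<otimes>\<^bsub>F\<^esub> e b = e a"
begin

lemma e_zero: "e \<zero> = \<zero>\<^bsub>F\<^esub>" using ring_hom_zero'[OF e_hom is_cring F.is_cring] .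

lemma e_closed: "a \<in> carrier R \<Longrightarrow> e a \<in> carrier F" using ring_hom_closed[OF e_hom] .

lemma e_nz: "a \<in> carrier R - {\<zero>} \<Longrightarrow> e a \<in> carrier F - {\<zero>\<^bsub>F\<^esub>}"
  using e_closed e_zero e_inj by (metis Diff_iff inj_onD singleton_iff zero_closed)

lemma e_frac_nz:
  assumes "x \<in> carrier F - {\<zero>\<^bsub>F\<^esub>}"
  obtains a b where "a \<in> carrier R - {\<zero>}" "b \<in> carrier R - {\<zero>}" "x \<otimes>\<^bsub>F\<^esub> e b = e a"
proof -
  obtain a b where ab: "a \<in> carrier R" "b \<in> carrier R - {\<zero>}" "x \<otimes>\<^bsub>F\<^esub> e b = e a" using e_frac assms by blast
  have "x \<otimes>\<^bsub>F\<^esub> e b \<noteq> \<zero>\<^bsub>F\<^esub>" using F.integral[of x "e b"] e_nz[OF ab(2)] assms by auto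
  then have "a \<in> carrier R - {\<zero>}" using ab(1,3) e_zero by auto
  then show ?thesis by (rule that[OF _ ab(2,3)])
qed

definition Cl where "Cl = e ` Pr"

text \<open>The valuation extended to fractions \<open>a/b\<close>. A point is named in
  \<open>F\<close> by \<open>e p\<close>, and \<open>p\<close> is recovered from the name by
  injectivity of \<open>e\<close>.\<close>

definition ord where "ord q x = (THE n. \<exists>p a b. p \<in> Pr \<and> q = e p \<and> a \<in> carrier R - {\<zero>} \<and> b \<in> carrier R - {\<zero>} \<and>
  x \<otimes>\<^bsub>F\<^esub> e b = e a \<and> n = int (v p a) - int (v p b))"

lemma ord_eq:
  assumes "p \<in> Pr" "a \<in> carrier R - {\<zero>}" "b \<in> carrier R - {\<zero>}" "x \<in> carrier F" "x \<otimes>\<^bsub>F\<^esub> e b = e a"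
  shows "ord (e p) x = int (v p a) - int (v p b)"
  unfolding ord_def
proof (rule the_equality)
  show "\<exists>p' a' b'. p' \<in> Pr \<and> e p = e p' \<and> a' \<in> carrier R - {\<zero>} \<and> b' \<in> carrier R - {\<zero>} \<and>
      x \<otimes>\<^bsub>F\<^esub> e b' = e a' \<and> int (v p a) - int (v p b) = int (v p' a') - int (v p' b')" using assms by blast
  fix n assume "\<exists>p' a' b'. p' \<in> Pr \<and> e p = e p' \<and> a' \<in> carrier R - {\<zero>} \<and> b' \<in> carrier R - {\<zero>} \<and>
      x \<otimes>\<^bsub>F\<^esub> e b' = e a' \<and> n = int (v p' a') - int (v p' b')"
  then obtain p' a' b' where h: "p' \<in> Pr" "e p = e p'" "a' \<in> carrier R - {\<zero>}" "b' \<in> carrier R - {\<zero>}"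
      "x \<otimes>\<^bsub>F\<^esub> e b' = e a'" "n = int (v p' a') - int (v p' b')" by blast
  have pp: "p' = p" using inj_onD[OF e_inj h(2)] Pr_carrier[OF h(1)] Pr_carrier[OF assms(1)] by auto
  have c: "e a \<in> carrier F" "e b \<in> carrier F" "e a' \<in> carrier F" "e b' \<in> carrier F"
    using assms h e_closed by auto
  have "e (a \<otimes> b') = e a \<otimes>\<^bsub>F\<^esub> e b'" using ring_hom_mult[OF e_hom] assms h by simp
  also have "\<dots> = e a' \<otimes>\<^bsub>F\<^esub> e b"
    unfolding assms(5)[symmetric] h(5)[symmetric] using c assms(4) by (simp add: F.m_assoc F.m_comm[of "e b'" "e b"])
  also have "\<dots> = e (a' \<otimes> b)" using ring_hom_mult[OF e_hom] assms h by simp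
  finally have "a \<otimes> b' = a' \<otimes> b" using inj_onD[OF e_inj] assms h by auto
  then have "v p a + v p b' = v p a' + v p b"
    using v_mult[OF assms(1,2) h(4)] v_mult[OF assms(1) h(3) assms(3)] by simp
  then show "n = int (v p a) - int (v p b)" using h(6) pp by simp
qed

lemma ord_e: "p \<in> Pr \<Longrightarrow> a \<in> carrier R - {\<zero>} \<Longrightarrow> ord (e p) (e a) = int (v p a)"
proof -
  assume p: "p \<in> Pr" and a: "a \<in> carrier R - {\<zero>}"
  have 1: "\<one> \<in> carrier R - {\<zero>}" by simp
  have "v p \<one> = 0" using v_pos[OF p 1] Pr_not_one[OF p] by simp
  moreover have "e a \<otimes>\<^bsub>F\<^esub> e \<one> = e a" using ring_hom_one[OF e_hom] e_closed a by simp
  ultimately show ?thesis using ord_eq[OF p a 1 e_closed] a by simp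
qed

text \<open>For a fraction \<open>a/b\<close> of nonnegative orders every prime occurs in
  \<open>a\<close> at least as often as in \<open>b\<close>, so \<open>b\<close> divides
  \<open>a\<close>: the domain is the intersection of its valuation rings.\<close>

lemma reg_eq: "reg F ord Cl = e ` carrier R"
proof (intro equalityI subsetI)
  have Cl0: "Cl - {\<zero>\<^bsub>F\<^esub>} = Cl" using e_nz Pr_carrier by (auto simp: Cl_def)
  { fix x assume x: "x \<in> reg F ord Cl"
    show "x \<in> e ` carrier R"
    proof (cases "x = \<zero>\<^bsub>F\<^esub>")
      case True
      then show ?thesis using e_zero by (metis image_eqI zero_closed)
    next
      case False
      then have xc: "x \<in> carrier F - {\<zero>\<^bsub>F\<^esub>}" and xo: "\<And>q. q \<in> Cl \<Longrightarrow> 0 \<le> ord q x"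
        using x Cl0 by (auto simp: reg_def)
      obtain a b where ab: "a \<in> carrier R - {\<zero>}" "b \<in> carrier R - {\<zero>}" "x \<otimes>\<^bsub>F\<^esub> e b = e a" using e_frac_nz[OF xc] .
      have "v p b \<le> v p a" if "p \<in> Pr" for p
        using ord_eq[OF that ab(1,2) _ ab(3)] xo[of "e p"] xc that by (auto simp: Cl_def)
      then have "b divides a" using divides_of_v[OF ab(1,2)] by blast
      then obtain c where c: "c \<in> carrier R" "a = b \<otimes> c" unfolding factor_def by blast
      have "e b \<otimes>\<^bsub>F\<^esub> x = e b \<otimes>\<^bsub>F\<^esub> e c"
        using ab ring_hom_mult[OF e_hom, of b c] c xc e_closed F.m_comm[of x "e b"] by auto
      then have "x = e c" using F.m_lcancel[of "e b" x "e c"] e_nz[OF ab(2)] xc e_closed[OF c(1)] by auto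
      then show ?thesis using c by blast
    qed }
  { fix x assume "x \<in> e ` carrier R"
    then obtain a where a: "a \<in> carrier R" "x = e a" by blast
    have "0 \<le> ord q x" if "x \<noteq> \<zero>\<^bsub>F\<^esub>" "q \<in> Cl" for q
    proof -
      have "a \<noteq> \<zero>" using that a e_zero by auto
      then show ?thesis using ord_e a that by (auto simp: Cl_def)
    qed
    then show "x \<in> reg F ord Cl" using a e_closed by (auto simp: reg_def) }
qed

lemma max_at_e:
  assumes "p \<in> Pr" "c \<in> carrier R"
  shows "e (p \<otimes> c) \<in> max_at F ord Cl (e p)"
proof -
  have pc: "p \<in> carrier R - {\<zero>}" using Pr_carrier[OF assms(1)] .
  have "0 < ord (e p) (e (p \<otimes> c))" if "c \<noteq> \<zero>"
  proof -
    have "c \<in> carrier R - {\<zero>}" using that assms by blast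
    then show ?thesis
      using ord_e[OF assms(1), of "p \<otimes> c"] v_mult[OF assms(1) pc] v_self[OF assms(1)] nz_prod'[OF pc] by simp
  qed
  moreover have "e (p \<otimes> c) \<in> reg F ord Cl" unfolding reg_eq using assms pc by blast
  ultimately show ?thesis using e_zero e_nz[OF pc] pc by (cases "c = \<zero>") (auto simp: max_at_def)
qed

sublocale curve F Cl ord
proof
  show "Cl \<subseteq> carrier F - {\<zero>\<^bsub>F\<^esub>}" using e_nz Pr_carrier by (auto simp: Cl_def)
  fix q assume "q \<in> Cl"
  then obtain p where p: "p \<in> Pr" "q = e p" by (auto simp: Cl_def)
  { fix q' assume "q' \<in> Cl"
    then obtain p' where p': "p' \<in> Pr" "q' = e p'" by (auto simp: Cl_def)
    have "e p = e p' \<longleftrightarrow> p = p'"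
      using inj_onD[OF e_inj, of p p'] Pr_carrier[OF p(1)] Pr_carrier[OF p'(1)] by auto
    then show "ord q q' = (if q = q' then 1 else 0)"
      using ord_e[OF p(1) Pr_carrier[OF p'(1)]] v_self[OF p(1)] v_other[OF p(1) p'(1)] p p' by auto }
  fix x assume x: "x \<in> carrier F - {\<zero>\<^bsub>F\<^esub>}"
  obtain a b where ab: "a \<in> carrier R - {\<zero>}" "b \<in> carrier R - {\<zero>}" "x \<otimes>\<^bsub>F\<^esub> e b = e a" using e_frac_nz[OF x] .
  fix y assume y: "y \<in> carrier F - {\<zero>\<^bsub>F\<^esub>}"
  obtain c d where cd: "c \<in> carrier R - {\<zero>}" "d \<in> carrier R - {\<zero>}" "y \<otimes>\<^bsub>F\<^esub> e d = e c" using e_frac_nz[OF y] .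
  note E = e_closed[of a] e_closed[of b] e_closed[of c] e_closed[of d]
  have ox: "ord q x = int (v p a) - int (v p b)" and oy: "ord q y = int (v p c) - int (v p d)"
    using ord_eq[OF p(1) ab(1,2) _ ab(3)] ord_eq[OF p(1) cd(1,2) _ cd(3)] x y p by auto
  have "(x \<otimes>\<^bsub>F\<^esub> y) \<otimes>\<^bsub>F\<^esub> e (b \<otimes> d) = (x \<otimes>\<^bsub>F\<^esub> e b) \<otimes>\<^bsub>F\<^esub> (y \<otimes>\<^bsub>F\<^esub> e d)"
    using ring_hom_mult[OF e_hom, of b d] x y E ab(2) cd(2) by (simp add: F.m_ac)
  also have "\<dots> = e (a \<otimes> c)" using ring_hom_mult[OF e_hom, of a c] ab cd by simp
  finally have "ord (e p) (x \<otimes>\<^bsub>F\<^esub> y) = int (v p (a \<otimes> c)) - int (v p (b \<otimes> d))"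
    using x y by (intro ord_eq[OF p(1) nz_prod'[OF ab(1) cd(1)] nz_prod'[OF ab(2) cd(2)]]) auto
  then show "ord q (x \<otimes>\<^bsub>F\<^esub> y) = ord q x + ord q y"
    unfolding ox oy using v_mult[OF p(1) ab(1) cd(1)] v_mult[OF p(1) ab(2) cd(2)] p(2) by simp
  fix n assume xy: "x \<oplus>\<^bsub>F\<^esub> y \<noteq> \<zero>\<^bsub>F\<^esub>" and n: "n \<le> ord q x" "n \<le> ord q y"
  let ?s = "a \<otimes> d \<oplus> c \<otimes> b"
  have "(x \<oplus>\<^bsub>F\<^esub> y) \<otimes>\<^bsub>F\<^esub> e (b \<otimes> d) = (x \<otimes>\<^bsub>F\<^esub> e b) \<otimes>\<^bsub>F\<^esub> e d \<oplus>\<^bsub>F\<^esub> (y \<otimes>\<^bsub>F\<^esub> e d) \<otimes>\<^bsub>F\<^esub> e b"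
    using ring_hom_mult[OF e_hom, of b d] x y E ab(2) cd(2) by (simp add: F.l_distr F.r_distr F.m_ac)
  also have "\<dots> = e ?s"
    using ring_hom_mult[OF e_hom, of a d] ring_hom_mult[OF e_hom, of c b] ring_hom_add[OF e_hom, of "a \<otimes> d" "c \<otimes> b"] ab cd
    by simp
  finally have eq: "(x \<oplus>\<^bsub>F\<^esub> y) \<otimes>\<^bsub>F\<^esub> e (b \<otimes> d) = e ?s" .
  have "?s \<noteq> \<zero>"
  proof
    assume "?s = \<zero>"
    then have "(x \<oplus>\<^bsub>F\<^esub> y) \<otimes>\<^bsub>F\<^esub> e (b \<otimes> d) = \<zero>\<^bsub>F\<^esub>" using eq e_zero by simp
    then show False using F.integral xy e_nz[OF nz_prod'[OF ab(2) cd(2)]] x y by auto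
  qed
  then have s: "?s \<in> carrier R - {\<zero>}" using ab cd by auto
  have os: "ord q (x \<oplus>\<^bsub>F\<^esub> y) = int (v p ?s) - int (v p (b \<otimes> d))"
    unfolding p(2) using x y by (intro ord_eq[OF p(1) s nz_prod'[OF ab(2) cd(2)] _ eq]) auto
  \<comment> \<open>\<open>n\<close> is an integer while \<open>v\<close> has natural values, so the
    bound is shifted by the orders of the denominators before \<open>v_add\<close> applies.\<close>
  have "nat (n + int (v p b) + int (v p d)) \<le> v p ?s"
    by (rule v_add[OF p(1) nz_prod'[OF ab(1) cd(2)] nz_prod'[OF cd(1) ab(2)] \<open>?s \<noteq> \<zero>\<close>])
      (use n ox oy v_mult[OF p(1) ab(1) cd(2)] v_mult[OF p(1) cd(1) ab(2)] in auto)
  then show "n \<le> ord q (x \<oplus>\<^bsub>F\<^esub> y)" unfolding os using v_mult[OF p(1) ab(2) cd(2)] by linarith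
next
  fix x assume x: "x \<in> carrier F - {\<zero>\<^bsub>F\<^esub>}"
  obtain a b where ab: "a \<in> carrier R - {\<zero>}" "b \<in> carrier R - {\<zero>}" "x \<otimes>\<^bsub>F\<^esub> e b = e a" using e_frac_nz[OF x] .
  have "{q\<in>Cl. ord q x \<noteq> 0} \<subseteq> e ` ({p\<in>Pr. p divides a} \<union> {p\<in>Pr. p divides b})"
  proof
    fix q assume "q \<in> {q\<in>Cl. ord q x \<noteq> 0}"
    then obtain p where p: "p \<in> Pr" "q = e p" "ord (e p) x \<noteq> 0" by (auto simp: Cl_def)
    then have "v p a \<noteq> 0 \<or> v p b \<noteq> 0" using ord_eq[OF p(1) ab(1,2) _ ab(3)] x by auto
    then show "q \<in> e ` ({p\<in>Pr. p divides a} \<union> {p\<in>Pr. p divides b})"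
      using v_pos[OF p(1) ab(1)] v_pos[OF p(1) ab(2)] p by auto
  qed
  then show "finite {q\<in>Cl. ord q x \<noteq> 0}"
    using finite_divisors[OF ab(1)] finite_divisors[OF ab(2)] by (meson finite_Un finite_imageI finite_subset)
next
  fix q x assume q: "q \<in> Cl" and x: "x \<in> reg F ord Cl" "x \<noteq> \<zero>\<^bsub>F\<^esub>" "ord q x = 0"
  obtain p where p: "p \<in> Pr" "q = e p" using q by (auto simp: Cl_def)
  obtain a where a: "a \<in> carrier R" "x = e a" using x(1) reg_eq by auto
  then have an: "a \<in> carrier R - {\<zero>}" using x(2) e_zero by auto
  have "\<not> p divides a" using x(3) ord_e[OF p(1) an] v_pos[OF p(1) an] p a by simp
  then obtain y z where yz: "y \<in> carrier R" "z \<in> carrier R" "\<one> = p \<otimes> z \<oplus> a \<otimes> y" using Pr_bezout[OF p(1) a(1)] by blast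
  have pc: "p \<in> carrier R" using Pr_carrier[OF p(1)] by blast
  have "\<one>\<^bsub>F\<^esub> = e (p \<otimes> z) \<oplus>\<^bsub>F\<^esub> e a \<otimes>\<^bsub>F\<^esub> e y"
    using arg_cong[OF yz(3), of e] ring_hom_one[OF e_hom] ring_hom_add[OF e_hom, of "p \<otimes> z" "a \<otimes> y"]
      ring_hom_mult[OF e_hom, of a y] yz a pc by simp
  then have "\<one>\<^bsub>F\<^esub> \<ominus>\<^bsub>F\<^esub> x \<otimes>\<^bsub>F\<^esub> e y = e (p \<otimes> z)"
    using a yz pc e_closed[of "p \<otimes> z"] e_closed[of a] e_closed[of y]
    by (simp add: a_minus_def F.a_assoc F.r_neg)
  then have "\<one>\<^bsub>F\<^esub> \<ominus>\<^bsub>F\<^esub> x \<otimes>\<^bsub>F\<^esub> e y \<in> max_at F ord Cl q"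
    using max_at_e[OF p(1) yz(2)] p(2) by simp
  then show "\<exists>y\<in>reg F ord Cl. \<one>\<^bsub>F\<^esub> \<ominus>\<^bsub>F\<^esub> x \<otimes>\<^bsub>F\<^esub> y \<in> max_at F ord Cl q"
    using yz(1) reg_eq by (intro bexI[of _ "e y"]) auto
qed

end

section \<open>The affine line and the point\<close>

text \<open>Division with remainder makes polynomials over a field a Euclidean domain, hence a
  principal ideal domain, and a nonzero polynomial of degree 0 is an invertible constant.\<close>

lemma graded_pid_UP:
  assumes "field k"
  shows "graded_pid (UP k) (deg k)"
proof -
  interpret k: field k by fact
  interpret P: UP_domain k "UP k" by unfold_locales simp
  have "euclidean_domain (UP k) (deg k)"
  proof (rule P.euclidean_domainI)
    fix a b assume a: "a \<in> carrier (UP k) - {\<zero>\<^bsub>UP k\<^esub>}" and b: "b \<in> carrier (UP k) - {\<zero>\<^bsub>UP k\<^esub>}"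
    obtain q r and j :: nat where q: "q \<in> carrier (UP k)" "r \<in> carrier (UP k)"
      "(P.lcoeff b [^]\<^bsub>k\<^esub> j) \<odot>\<^bsub>UP k\<^esub> a = b \<otimes>\<^bsub>UP k\<^esub> q \<oplus>\<^bsub>UP k\<^esub> r" "r = \<zero>\<^bsub>UP k\<^esub> \<or> deg k r < deg k b"
      using P.long_div_theorem[of b a] a b by auto
    \<comment> \<open>The division theorem for general rings divides only a multiple of
      \<open>a\<close> by a power of the leading coefficient of \<open>b\<close>. Over a field this
      power is a unit, and quotient and remainder are rescaled by its inverse.\<close>
    define u where "u = P.lcoeff b [^]\<^bsub>k\<^esub> j"
    have lc: "P.lcoeff b \<in> Units k" using P.lcoeff_nonzero2[of b] b k.field_Units by auto
    then have u: "u \<in> Units k" unfolding u_def using Units_pow[OF k.is_cring] by blast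
    define w where "w = inv\<^bsub>k\<^esub> u"
    have w: "w \<in> carrier k" "w \<otimes>\<^bsub>k\<^esub> u = \<one>\<^bsub>k\<^esub>" "u \<in> carrier k" "w \<noteq> \<zero>\<^bsub>k\<^esub>"
      using u k.Units_inv_Units[OF u] k.field_Units by (auto simp: w_def)
    have "a = (w \<otimes>\<^bsub>k\<^esub> u) \<odot>\<^bsub>UP k\<^esub> a" using w a by simp
    also have "\<dots> = w \<odot>\<^bsub>UP k\<^esub> (b \<otimes>\<^bsub>UP k\<^esub> q \<oplus>\<^bsub>UP k\<^esub> r)"
      using w(1,3) a q(3) P.UP_smult_assoc1[of w u a] by (simp add: u_def)
    also have "\<dots> = b \<otimes>\<^bsub>UP k\<^esub> (w \<odot>\<^bsub>UP k\<^esub> q) \<oplus>\<^bsub>UP k\<^esub> w \<odot>\<^bsub>UP k\<^esub> r"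
      using w(1) b q(1,2) P.UP_smult_r_distr P.UP_smult_assoc2
      by (simp add: P.P.m_comm[of b])
    finally have "a = b \<otimes>\<^bsub>UP k\<^esub> (w \<odot>\<^bsub>UP k\<^esub> q) \<oplus>\<^bsub>UP k\<^esub> w \<odot>\<^bsub>UP k\<^esub> r" .
    moreover have "w \<odot>\<^bsub>UP k\<^esub> r = \<zero>\<^bsub>UP k\<^esub> \<or> deg k (w \<odot>\<^bsub>UP k\<^esub> r) < deg k b"
      using q(2,4) w P.deg_smult[of w r] by auto
    ultimately show "\<exists>q r. q \<in> carrier (UP k) \<and> r \<in> carrier (UP k) \<and> a = b \<otimes>\<^bsub>UP k\<^esub> q \<oplus>\<^bsub>UP k\<^esub> r \<and>
        (r = \<zero>\<^bsub>UP k\<^esub> \<or> deg k r < deg k b)"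
      using w(1) q(1,2) by (intro exI[of _ "w \<odot>\<^bsub>UP k\<^esub> q"] exI[of _ "w \<odot>\<^bsub>UP k\<^esub> r"]) simp
  qed
  then interpret E: euclidean_domain "UP k" "deg k" .
  show ?thesis
  proof (intro graded_pid.intro graded_pid_axioms.intro E.principal_domain_axioms)
    fix a assume a: "a \<in> carrier (UP k) - {\<zero>\<^bsub>UP k\<^esub>}"
    { fix b assume "b \<in> carrier (UP k) - {\<zero>\<^bsub>UP k\<^esub>}"
      then show "deg k (a \<otimes>\<^bsub>UP k\<^esub> b) = deg k a + deg k b" using a P.deg_mult by auto }
    assume d: "deg k a = 0"
    define c where "c = up_ring.coeff (UP k) a 0"
    have c: "c \<in> carrier k" "c \<noteq> \<zero>\<^bsub>k\<^esub>" using P.lcoeff_nonzero2[of a] a d P.coeff_closed by (auto simp: c_def)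
    have am: "a = up_ring.monom (UP k) c 0"
      using a d P.deg_aboveD[of a] c(1) by (intro P.up_eqI) (auto simp: c_def)
    have cu: "c \<in> Units k" using c k.field_Units by blast
    have "up_ring.monom (UP k) c 0 \<otimes>\<^bsub>UP k\<^esub> up_ring.monom (UP k) (inv\<^bsub>k\<^esub> c) 0 = up_ring.monom (UP k) (c \<otimes>\<^bsub>k\<^esub> inv\<^bsub>k\<^esub> c) (0 + 0)"
      using c cu by (intro P.monom_mult[symmetric]) auto
    then have "a \<otimes>\<^bsub>UP k\<^esub> up_ring.monom (UP k) (inv\<^bsub>k\<^esub> c) 0 = \<one>\<^bsub>UP k\<^esub>" using cu am by (simp add: P.monom_one)
    then have "a \<otimes>\<^bsub>UP k\<^esub> up_ring.monom (UP k) (inv\<^bsub>k\<^esub> c) 0 \<in> Units (UP k)" by simp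
    then show "a \<in> Units (UP k)" by (rule Units_multD[OF P.P.is_cring, rotated 2]) (use a cu in auto)
  qed
qed

lemma (in graded_pid) \<delta>_Unit: "u \<in> Units R \<Longrightarrow> \<delta> u = 0"
proof -
  assume u: "u \<in> Units R"
  have 1: "\<one> \<in> carrier R - {\<zero>}" by simp
  obtain w where w: "w \<in> carrier R" "u \<in> carrier R" "u \<otimes> w = \<one>" using u by (auto simp: Units_def)
  then have nz: "u \<in> carrier R - {\<zero>}" "w \<in> carrier R - {\<zero>}" by auto
  have "\<delta> \<one> = 0" using \<delta>_mult[OF 1 1] by simp
  then show ?thesis using \<delta>_mult[OF nz] w(3) by simp
qed

text \<open>The degrees of two factors add up to 1, so one of them has degree 0 and is a
  unit.\<close>

lemma (in graded_pid) degree_one_prime: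
  assumes p: "p \<in> carrier R - {\<zero>}" and d: "\<delta> p = 1"
  shows "primeideal (PIdl p) R"
proof -
  have "ring_irreducible p"
  proof (rule ring_irreducibleI)
    show "p \<in> carrier R - {\<zero>}" by (rule p)
    show "p \<notin> Units R" using \<delta>_Unit d by force
    fix a b assume ab: "a \<in> carrier R" "b \<in> carrier R" "p = a \<otimes> b"
    then have nz: "a \<in> carrier R - {\<zero>}" "b \<in> carrier R - {\<zero>}" using p by auto
    then have "\<delta> a = 0 \<or> \<delta> b = 0" using \<delta>_mult[OF nz] ab(3) d by auto
    then show "a \<in> Units R \<or> b \<in> Units R" using \<delta>_unit nz by blast
  qed
  then show ?thesis using primeness_condition[of p] primeideal_iff_prime[OF p] p by blast
qed

lemma (in graded_pid) v_Unit: "q \<in> Pr \<Longrightarrow> u \<in> Units R \<Longrightarrow> v q u = 0"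
proof -
  assume q: "q \<in> Pr" and u: "u \<in> Units R"
  obtain w where w: "w \<in> carrier R" "u \<in> carrier R" "u \<otimes> w = \<one>" using u by (auto simp: Units_def)
  then have nz: "u \<in> carrier R - {\<zero>}" "w \<in> carrier R - {\<zero>}" by auto
  have "\<one> \<in> carrier R - {\<zero>}" by simp
  then have "v q \<one> = 0" using v_pos[OF q] Pr_not_one[OF q] by blast
  then show "v q u = 0" using v_mult[OF q nz] w(3) by simp
qed

text \<open>\<open>p\<close> need not be the selected generator of its ideal, but differs from it by
  a unit, on which all valuations are 0.\<close>

lemma (in graded_pid) v_prime:
  assumes p: "p \<in> carrier R - {\<zero>}" "primeideal (PIdl p) R" and q: "q \<in> Pr"
  shows "v q p = (if q = rp p then 1 else 0)"
proof -
  have r: "rp p \<in> Pr" by (rule rp_Pr[OF p])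
  have rc: "rp p \<in> carrier R - {\<zero>}" by (rule Pr_carrier[OF r])
  have "PIdl (rp p) = PIdl p" using rp(2)[of p] p by blast
  then have "p \<in> PIdl (rp p)" "rp p \<in> PIdl p" using cgenideal_self[of p] cgenideal_self[of "rp p"] p rc by auto
  then have d: "rp p divides p" "p divides rp p" using mem_PIdl[of "rp p" p] mem_PIdl[of p "rp p"] p rc by blast+
  obtain c where c: "c \<in> carrier R" "p = rp p \<otimes> c" using d(1) unfolding factor_def by blast
  obtain d where d: "d \<in> carrier R" "rp p = p \<otimes> d" using d(2) unfolding factor_def by blast
  have "p \<otimes> \<one> = p" using p by simp
  also have "p = rp p \<otimes> c" by (rule c(2))
  also have "\<dots> = p \<otimes> d \<otimes> c" using arg_cong[OF d(2), of "\<lambda>x. x \<otimes> c"] .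
  also have "\<dots> = p \<otimes> (c \<otimes> d)" using p c(1) d(1) by (simp add: m_ac)
  finally have one: "\<one> = c \<otimes> d" using m_lcancel[of p \<one> "c \<otimes> d"] p c(1) d(1) by auto
  have "c \<otimes> d \<in> Units R" unfolding one[symmetric] by simp
  then have u: "c \<in> Units R" by (rule Units_multD[OF is_cring c(1) d(1)])
  have "c \<noteq> \<zero>"
  proof
    assume "c = \<zero>"
    then have "rp p \<otimes> c = \<zero>" using rc by simp
    then have "p = \<zero>" by (rule trans[OF c(2)])
    then show False using p by simp
  qed
  then have "c \<in> carrier R - {\<zero>}" using c(1) by blast
  then have "v q (rp p \<otimes> c) = v q (rp p)" using v_mult[OF q rc] v_Unit[OF q u] by simp
  then have "v q p = v q (rp p)" using arg_cong[OF c(2), of "v q"] by (rule trans[rotated])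
  then show ?thesis using v_self[OF r] v_other[OF q r] by auto
qed

text \<open>Folding with an injection of pairs separates only lists of equal length, so the length
  is coded as well.\<close>

lemma ex_inj_lists:
  assumes inf: "infinite (UNIV :: 'u set)"
  shows "\<exists>g :: 'u list \<Rightarrow> 'u. inj g"
proof -
  obtain J :: "'u \<times> 'u \<Rightarrow> 'u" where J: "inj J" using ex_inj_pair[OF inf] by blast
  obtain N :: "nat \<Rightarrow> 'u" where N: "inj N" using infinite_countable_subset[OF inf] by blast
  define c where "c = foldr (\<lambda>x a. J (x, a))"
  have c: "c xs a = c ys a \<Longrightarrow> xs = ys" if "length xs = length ys" for xs ys a
    using that
  proof (induction xs ys rule: list_induct2)
    case (Cons x xs y ys)
    from Cons.prems have "J (x, c xs a) = J (y, c ys a)" by (simp add: c_def)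
    then have "(x, c xs a) = (y, c ys a)" by (rule injD[OF J])
    then show ?case using Cons.IH by simp
  qed simp
  have "inj (\<lambda>xs. J (N (length xs), c xs (N 0)))"
  proof (rule injI)
    fix xs ys :: "'u list" assume "J (N (length xs), c xs (N 0)) = J (N (length ys), c ys (N 0))"
    then have "N (length xs) = N (length ys)" "c xs (N 0) = c ys (N 0)" using injD[OF J] by blast+
    then show "xs = ys" using c injD[OF N] by blast
  qed
  then show ?thesis by blast
qed

text \<open>A polynomial is coded by its coefficients up to the degree; the length of this list
  recovers the degree, beyond which all coefficients vanish.\<close>

lemma ex_inj_UP:
  fixes k :: "'u ring"
  assumes "field k" and inf: "infinite (UNIV :: 'u set)"
  shows "\<exists>g :: (nat \<Rightarrow> 'u) \<Rightarrow> 'u. inj_on g (carrier (UP k))"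
proof -
  interpret k: field k by fact
  interpret P: UP_domain k "UP k" by unfold_locales simp
  obtain h :: "'u list \<Rightarrow> 'u" where h: "inj h" using ex_inj_lists[OF inf] by blast
  define l where "l p = map (up_ring.coeff (UP k) p) [0..<Suc (deg k p)]" for p
  have "inj_on (\<lambda>p. h (l p)) (carrier (UP k))"
  proof (rule inj_onI)
    fix p q assume p: "p \<in> carrier (UP k)" and q: "q \<in> carrier (UP k)" and "h (l p) = h (l q)"
    then have eq: "l p = l q" using injD[OF h] by blast
    then have "length (l p) = length (l q)" by simp
    then have d: "deg k p = deg k q" by (simp add: l_def)
    show "p = q"
    proof (rule P.up_eqI[OF _ p q])
      fix n
      show "up_ring.coeff (UP k) p n = up_ring.coeff (UP k) q n"
      proof (cases "n \<le> deg k p")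
        case True
        then have "l p ! n = up_ring.coeff (UP k) p n" "l q ! n = up_ring.coeff (UP k) q n"
          using d by (auto simp: l_def simp del: upt_Suc)
        then show ?thesis using eq by simp
      next
        case False
        then show ?thesis using P.deg_aboveD[OF _ p, of n] P.deg_aboveD[OF _ q, of n] d by simp
      qed
    qed
  qed
  then show ?thesis by blast
qed

locale affine_line = K: field k + fraction_curve "UP k" "deg k" F e
  for k :: "'u ring" and F :: "'u ring" and e :: "(nat \<Rightarrow> 'u) \<Rightarrow> 'u" +
  assumes inf: "infinite (UNIV :: 'u set)"

lemma ex_affine_line:
  fixes k :: "'u ring"
  assumes "field k" and inf: "infinite (UNIV :: 'u set)"
  obtains F e where "affine_line k F e"
proof -
  interpret G: graded_pid "UP k" "deg k" by (rule graded_pid_UP[OF assms(1)])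
  obtain g :: "(nat \<Rightarrow> 'u) \<Rightarrow> 'u" where g: "inj_on g (carrier (UP k))" using ex_inj_UP[OF assms] by blast
  obtain F :: "'u ring" and e where F: "field F" "e \<in> ring_hom (UP k) F" "inj_on e (carrier (UP k))"
    "\<And>x. x \<in> carrier F \<Longrightarrow> \<exists>a\<in>carrier (UP k). \<exists>b\<in>carrier (UP k) - {\<zero>\<^bsub>UP k\<^esub>}. x \<otimes>\<^bsub>F\<^esub> e b = e a"
    by (rule ex_fraction_field[OF G.domain_axioms g inf]) (rule that)
  have "fraction_curve (UP k) (deg k) F e"
    by (intro fraction_curve.intro fraction_curve_axioms.intro G.graded_pid_axioms F)
  then have "affine_line k F e" by (intro affine_line.intro assms(1)) (simp_all add: affine_line_axioms_def inf)
  then show ?thesis by (rule that)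
qed

context affine_line
begin

sublocale P: UP_domain k "UP k" by unfold_locales simp

abbreviation "T \<equiv> up_ring.monom (UP k) \<one>\<^bsub>k\<^esub> 1"
definition i where "i c = e (up_ring.monom (UP k) c 0)"
definition t where "t = e T"

lemma T_closed: "T \<in> carrier (UP k)" by simp

lemma e_hom_reg: "e \<in> ring_hom (UP k) (F\<lparr>carrier := reg F ord Cl\<rparr>)"
  using e_hom unfolding reg_eq by (auto simp: ring_hom_def)

lemma monom_hom: "(\<lambda>c. up_ring.monom (UP k) c 0) \<in> ring_hom k (UP k)"
proof (rule ring_hom_memI)
  fix a b assume "a \<in> carrier k" "b \<in> carrier k"
  then show "up_ring.monom (UP k) (a \<otimes>\<^bsub>k\<^esub> b) 0 = up_ring.monom (UP k) a 0 \<otimes>\<^bsub>UP k\<^esub> up_ring.monom (UP k) b 0"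
    using P.monom_mult[of a b 0 0] by simp
qed (simp_all add: P.monom_one)

lemma i_hom: "i \<in> ring_hom k (F\<lparr>carrier := reg F ord Cl\<rparr>)"
  using ring_hom_comp[OF monom_hom e_hom_reg] by (simp add: i_def[abs_def])

lemma e_iso: "e \<in> ring_iso (UP k) (F\<lparr>carrier := reg F ord Cl\<rparr>)"
  unfolding ring_iso_def bij_betw_def using e_hom_reg e_inj reg_eq by simp

lemma hom_UP_eqI:
  assumes "cring S" "p \<in> ring_hom (UP k) S" "q \<in> ring_hom (UP k) S"
    and "\<And>c. c \<in> carrier k \<Longrightarrow> p (up_ring.monom (UP k) c 0) = q (up_ring.monom (UP k) c 0)" "p T = q T" "x \<in> carrier (UP k)"
  shows "p x = q x"
proof -
  interpret S: cring S by fact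
  have "(\<lambda>c. q (up_ring.monom (UP k) c 0)) \<in> ring_hom k S" using ring_hom_comp[OF monom_hom assms(3)] .
  then interpret H: UP_pre_univ_prop k S "\<lambda>c. q (up_ring.monom (UP k) c 0)" "UP k"
    by unfold_locales simp_all
  have h: "ring_hom_cring (UP k) S p" "ring_hom_cring (UP k) S q"
    using assms(2,3) is_cring S.is_cring by (simp_all add: ring_hom_cring_def ring_hom_cring_axioms_def)
  have "p (up_ring.monom (UP k) \<one>\<^bsub>k\<^esub> (Suc 0)) = q T" "q (up_ring.monom (UP k) \<one>\<^bsub>k\<^esub> (Suc 0)) = q T"
    using assms(5) by simp_all
  from H.UP_hom_unique[OF h(1) this(1) assms(4) h(2) this(2) refl assms(6) ring_hom_closed[OF assms(3) T_closed]]
  show ?thesis .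
qed

lemma coordinate_t: "coordinate k (F\<lparr>carrier := reg F ord Cl\<rparr>) i t"
  unfolding coordinate_def
proof (intro conjI allI impI; (elim conjE)?)
  show "t \<in> carrier (F\<lparr>carrier := reg F ord Cl\<rparr>)" by (simp add: t_def reg_eq)
  fix \<kappa> :: "'u ring" and f g b
  assume h: "cring \<kappa>" "f \<in> ring_hom (F\<lparr>carrier := reg F ord Cl\<rparr>) \<kappa>" "g \<in> ring_hom (F\<lparr>carrier := reg F ord Cl\<rparr>) \<kappa>"
    "\<forall>c\<in>carrier k. f (i c) = g (i c)" "f t = g t" "b \<in> carrier (F\<lparr>carrier := reg F ord Cl\<rparr>)"
  obtain x where x: "x \<in> carrier (UP k)" "b = e x" using h(6) reg_eq by auto
  have "f (e x) = g (e x)"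
    by (rule hom_UP_eqI[OF h(1) ring_hom_comp[OF e_hom_reg h(2)] ring_hom_comp[OF e_hom_reg h(3)] _ _ x(1)])
      (use h(4,5) in \<open>simp_all add: i_def t_def\<close>)
  then show "f b = g b" using x(2) by simp
qed

text \<open>Evaluation of polynomials at \<open>s\<close>, transported to the coordinate ring of the
  line along the isomorphism \<open>e\<close>.\<close>

lemma eval_hom:
  assumes "cring S" "g \<in> ring_hom k S" "s \<in> carrier S"
  obtains \<psi> where "\<psi> \<in> ring_hom (F\<lparr>carrier := reg F ord Cl\<rparr>) S" "\<And>c. c \<in> carrier k \<Longrightarrow> \<psi> (i c) = g c" "\<psi> t = s"
proof -
  interpret S: cring S by fact
  interpret H: UP_pre_univ_prop k S g "UP k"
    using assms(2) by unfold_locales simp_all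
  define \<psi> where "\<psi> x = UnivPoly.eval k S g s (the_inv_into (carrier (UP k)) e x)" for x
  have \<psi>: "\<psi> (e p) = UnivPoly.eval k S g s p" if "p \<in> carrier (UP k)" for p
    using the_inv_into_f_f[OF e_inj that] by (simp add: \<psi>_def)
  have eh: "UnivPoly.eval k S g s \<in> ring_hom (UP k) S" using H.eval_ring_hom[OF assms(3)] .
  have "\<psi> \<in> ring_hom (F\<lparr>carrier := reg F ord Cl\<rparr>) S"
  proof (rule ring_hom_memI)
    fix x y assume "x \<in> carrier (F\<lparr>carrier := reg F ord Cl\<rparr>)"
    then obtain p where p: "p \<in> carrier (UP k)" "x = e p" by (auto simp: reg_eq)
    show "\<psi> x \<in> carrier S" using \<psi>[OF p(1)] ring_hom_closed[OF eh p(1)] p(2) by simp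
    assume "y \<in> carrier (F\<lparr>carrier := reg F ord Cl\<rparr>)"
    then obtain q where q: "q \<in> carrier (UP k)" "y = e q" by (auto simp: reg_eq)
    show "\<psi> (x \<otimes>\<^bsub>F\<lparr>carrier := reg F ord Cl\<rparr>\<^esub> y) = \<psi> x \<otimes>\<^bsub>S\<^esub> \<psi> y"
      using \<psi>[OF p(1)] \<psi>[OF q(1)] \<psi>[OF m_closed[OF p(1) q(1)]] ring_hom_mult[OF eh p(1) q(1)]
        ring_hom_mult[OF e_hom p(1) q(1)] p(2) q(2) by simp
    show "\<psi> (x \<oplus>\<^bsub>F\<lparr>carrier := reg F ord Cl\<rparr>\<^esub> y) = \<psi> x \<oplus>\<^bsub>S\<^esub> \<psi> y"
      using \<psi>[OF p(1)] \<psi>[OF q(1)] \<psi>[OF a_closed[OF p(1) q(1)]] ring_hom_add[OF eh p(1) q(1)]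
        ring_hom_add[OF e_hom p(1) q(1)] p(2) q(2) by simp
  next
    show "\<psi> \<one>\<^bsub>F\<lparr>carrier := reg F ord Cl\<rparr>\<^esub> = \<one>\<^bsub>S\<^esub>"
      using \<psi>[OF one_closed] ring_hom_one[OF eh] ring_hom_one[OF e_hom] by simp
  qed
  moreover have "\<psi> (i c) = g c" if "c \<in> carrier k" for c
    using \<psi>[of "up_ring.monom (UP k) c 0"] H.eval_const[OF assms(3) that] that by (simp add: i_def)
  moreover have "\<psi> t = s" using \<psi>[OF T_closed] H.eval_monom1[OF assms(3)] by (simp add: t_def)
  ultimately show ?thesis by (rule that)
qed

text \<open>The coordinate ring is free on \<open>t\<close>: choose any preimage in \<open>C\<close>
  of the image of \<open>t\<close> and evaluate there. Agreement with \<open>h\<close> is then a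
  matter of constants and \<open>t\<close>.\<close>

lemma formally_smooth_line: "formally_smooth k (F\<lparr>carrier := reg F ord Cl\<rparr>) i"
  unfolding formally_smooth_def
proof (intro allI impI)
  let ?B = "F\<lparr>carrier := reg F ord Cl\<rparr>"
  fix C :: "'u ring" and I g h assume Pr: "square_zero_problem k ?B i C I g h"
  have C: "cring C" and I: "ideal I C" and g: "g \<in> ring_hom k C" and h: "h \<in> ring_hom ?B (C Quot I)"
    and hg: "\<And>a. a \<in> carrier k \<Longrightarrow> h (i a) = I +>\<^bsub>C\<^esub> g a"
    using Pr by (simp_all add: square_zero_problem_def)
  interpret I: ideal I C by fact
  have tB: "t \<in> carrier ?B" by (simp add: t_def reg_eq)
  then have "h t \<in> carrier (C Quot I)" using ring_hom_closed[OF h] by blast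
  then obtain s where s: "s \<in> carrier C" "h t = I +>\<^bsub>C\<^esub> s" by (auto simp: FactRing_def A_RCOSETS_def')
  obtain \<psi> where \<psi>: "\<psi> \<in> ring_hom ?B C" "\<And>c. c \<in> carrier k \<Longrightarrow> \<psi> (i c) = g c" "\<psi> t = s"
    by (rule eval_hom[OF C g s(1)]) (rule that)
  have p: "(\<lambda>b. I +>\<^bsub>C\<^esub> \<psi> b) \<in> ring_hom ?B (C Quot I)" using ring_hom_comp[OF \<psi>(1) I.rcos_ring_hom] .
  have lift: "I +>\<^bsub>C\<^esub> \<psi> b = h b" if "b \<in> carrier ?B" for b
  proof -
    from that obtain x where x: "x \<in> carrier (UP k)" "b = e x" using reg_eq by auto
    have "I +>\<^bsub>C\<^esub> \<psi> (e x) = h (e x)"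
      by (rule hom_UP_eqI[OF I.quotient_is_cring[OF C] ring_hom_comp[OF e_hom_reg p] ring_hom_comp[OF e_hom_reg h] _ _ x(1)])
        (use hg \<psi>(2,3) s(2) in \<open>simp_all add: i_def t_def\<close>)
    then show ?thesis using x(2) by simp
  qed
  let ?l = "restrict \<psi> (carrier ?B)"
  have "?l \<in> ring_hom ?B C"
    by (rule ring_hom_cong[OF \<psi>(1)]) (use reg_domain in \<open>simp_all add: domain_def cring_def\<close>)
  moreover have "\<psi> (i a) = g a" "i a \<in> carrier ?B" if "a \<in> carrier k" for a
    using \<psi>(2)[OF that] ring_hom_closed[OF i_hom that] by auto
  ultimately show "\<exists>l. l \<in> lifts k ?B i C I g h"
    using lift by (intro exI[of _ ?l]) (simp add: lifts_def)
qed

text \<open>Monomials are built by multiplying with \<open>t\<close>, and a polynomial is the finite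
  sum of its monomials.\<close>

lemma generate_line:
  "generate_ring (F\<lparr>carrier := reg F ord Cl\<rparr>) (i ` carrier k \<union> {t}) = carrier (F\<lparr>carrier := reg F ord Cl\<rparr>)"
proof -
  let ?B = "F\<lparr>carrier := reg F ord Cl\<rparr>" and ?G = "generate_ring (F\<lparr>carrier := reg F ord Cl\<rparr>) (i ` carrier k \<union> {t})"
  interpret B: "domain" ?B by (rule reg_domain)
  have tB: "t \<in> carrier ?B" by (simp add: t_def reg_eq)
  have sub: "i ` carrier k \<union> {t} \<subseteq> carrier ?B" using ring_hom_closed[OF i_hom] tB by auto
  have add: "e (p \<oplus>\<^bsub>UP k\<^esub> q) \<in> ?G" if "p \<in> carrier (UP k)" "q \<in> carrier (UP k)" "e p \<in> ?G" "e q \<in> ?G" for p q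
    using generate_ring.eng_add[OF that(3,4)] ring_hom_add[OF e_hom that(1,2)] by simp
  have mult: "e (p \<otimes>\<^bsub>UP k\<^esub> q) \<in> ?G" if "p \<in> carrier (UP k)" "q \<in> carrier (UP k)" "e p \<in> ?G" "e q \<in> ?G" for p q
    using generate_ring.eng_mult[OF that(3,4)] ring_hom_mult[OF e_hom that(1,2)] by simp
  have c0: "e (up_ring.monom (UP k) c 0) \<in> ?G" if "c \<in> carrier k" for c
    using that by (intro generate_ring.incl) (auto simp: i_def)
  have T: "e T \<in> ?G" by (intro generate_ring.incl) (auto simp: t_def)
  have mon: "e (up_ring.monom (UP k) c n) \<in> ?G" if c: "c \<in> carrier k" for c n
  proof (induction n)
    case (Suc n)
    have "up_ring.monom (UP k) c (Suc n) = up_ring.monom (UP k) c n \<otimes>\<^bsub>UP k\<^esub> T" using P.monom_mult[of c "\<one>\<^bsub>k\<^esub>" n 1] c by simp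
    then show ?case using mult[OF _ T_closed Suc T] c by simp
  qed (rule c0[OF c])
  have sum: "e (\<Oplus>\<^bsub>UP k\<^esub>j\<in>{..n}. up_ring.monom (UP k) (up_ring.coeff (UP k) p j) j) \<in> ?G" if p: "p \<in> carrier (UP k)" for p and n :: nat
  proof (induction n)
    case 0
    then show ?case using mon P.coeff_closed[OF p] by simp
  next
    case (Suc n)
    have "(\<Oplus>\<^bsub>UP k\<^esub>j\<in>{..Suc n}. up_ring.monom (UP k) (up_ring.coeff (UP k) p j) j) =
        up_ring.monom (UP k) (up_ring.coeff (UP k) p (Suc n)) (Suc n) \<oplus>\<^bsub>UP k\<^esub> (\<Oplus>\<^bsub>UP k\<^esub>j\<in>{..n}. up_ring.monom (UP k) (up_ring.coeff (UP k) p j) j)"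
      using P.coeff_closed[OF p] by (intro finsum_Suc) auto
    then show ?case using add[OF _ _ mon Suc] P.coeff_closed[OF p] by (simp add: finsum_closed Pi_def)
  qed
  have "b \<in> ?G" if b: "b \<in> carrier ?B" for b
  proof -
    obtain p where p: "p \<in> carrier (UP k)" "b = e p" using b reg_eq by auto
    then show ?thesis using sum[OF p(1), of "deg k p"] P.up_repr[OF p(1)] by simp
  qed
  then show "?G = carrier ?B" using B.generate_ring_incl[OF sub] by blast
qed

lemma finite_type_line: "finite_type_hom k (F\<lparr>carrier := reg F ord Cl\<rparr>) i"
proof -
  have "t \<in> carrier (F\<lparr>carrier := reg F ord Cl\<rparr>)" by (simp add: t_def reg_eq)
  then show ?thesis unfolding finite_type_hom_def
    using i_hom generate_line by (intro conjI exI[of _ "{t}"]) auto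
qed

sublocale kcurve F Cl ord k i
  by (intro kcurve.intro kcurve_axioms.intro curve_axioms K.field_axioms i_hom finite_type_line
      formally_smooth_line exI[of _ t] coordinate_t inf)

lemma is_affine_line_X: "is_affine_line k X"
  unfolding is_affine_line_def
proof (intro conjI exI[of _ e] ballI)
  show "kscheme k X" by (rule kscheme_X)
  show "affine X" by (rule affine_curve)
  show "e \<in> ring_iso (UP k) (glob X)" using e_iso by (simp add: reg_ring_ne)
  show "e (up_ring.monom (UP k) c 0) = str X c" for c by (simp add: i_def)
qed

end

lemma formally_etale_smooth:
  assumes "formally_etale A B \<phi>"
  shows "formally_smooth A B \<phi>"
  unfolding formally_smooth_def
proof (intro allI impI)
  fix C I g h assume "square_zero_problem A B \<phi> C I g h"
  then have "\<exists>!l. l \<in> lifts A B \<phi> C I g h" using assms unfolding formally_etale_def by simp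
  then show "\<exists>l. l \<in> lifts A B \<phi> C I g h" by (rule ex1_implies_ex)
qed

text \<open>\<open>Spec k\<close> is the curve with function field \<open>k\<close> and no closed
  points. Any element serves as a coordinate, since homomorphisms that agree on \<open>k\<close> are
  already equal.\<close>

lemma kcurve_point:
  fixes k :: "'u ring"
  assumes "field k" "infinite (UNIV :: 'u set)"
  shows "kcurve k {} (\<lambda>_ _. 0) k (\<lambda>c. c)"
proof -
  interpret K: field k by fact
  interpret K: curve k "{}" "\<lambda>_ _. 0" by unfold_locales auto
  have reg: "k\<lparr>carrier := reg k (\<lambda>_ _. 0) {}\<rparr> = k" by (simp add: reg_def)
  have id: "(\<lambda>c. c) \<in> ring_hom k k" by (simp add: ring_hom_def)
  have "formally_smooth k k (\<lambda>c. c)"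
    by (rule formally_etale_smooth[OF formally_etale_id[OF K.is_cring]]) simp
  moreover have "coordinate k k (\<lambda>c. c) \<one>\<^bsub>k\<^esub>" unfolding coordinate_def by simp
  ultimately show ?thesis
    by (intro kcurve.intro kcurve_axioms.intro K.curve_axioms)
      (use id assms finite_type_hom_id[OF K.is_cring] in \<open>auto simp: reg\<close>)
qed

section \<open>Models of the function field\<close>

lemma field_modelD:
  assumes "field_model k F i Z \<zeta>"
  shows "Sm k Z" "kscheme k Z" "ringed_space Z" "str Z \<in> ring_hom k (glob Z)" "pts Z \<noteq> {}"
    "\<And>U V. opn Z U \<Longrightarrow> opn Z V \<Longrightarrow> U \<noteq> {} \<Longrightarrow> V \<noteq> {} \<Longrightarrow> U \<inter> V \<noteq> {}"
    "\<And>U. opn Z U \<Longrightarrow> U \<noteq> {} \<Longrightarrow> \<zeta> U \<in> ring_hom (sec Z U) F"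
    "\<And>U V s. opn Z U \<Longrightarrow> opn Z V \<Longrightarrow> V \<noteq> {} \<Longrightarrow> V \<subseteq> U \<Longrightarrow> s \<in> carrier (sec Z U) \<Longrightarrow> \<zeta> V (res Z U V s) = \<zeta> U s"
    "\<And>c. c \<in> carrier k \<Longrightarrow> \<zeta> (pts Z) (str Z c) = i c"
    "\<exists>V. opn Z V \<and> V \<noteq> {} \<and> affine_open Z V \<and> finite_type_hom k (sec Z V) (str (open_sub Z V))"
proof -
  show S: "Sm k Z" and "pts Z \<noteq> {}"
    and "\<And>U V. opn Z U \<Longrightarrow> opn Z V \<Longrightarrow> U \<noteq> {} \<Longrightarrow> V \<noteq> {} \<Longrightarrow> U \<inter> V \<noteq> {}"
    and "\<And>U. opn Z U \<Longrightarrow> U \<noteq> {} \<Longrightarrow> \<zeta> U \<in> ring_hom (sec Z U) F"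
    and "\<And>U V s. opn Z U \<Longrightarrow> opn Z V \<Longrightarrow> V \<noteq> {} \<Longrightarrow> V \<subseteq> U \<Longrightarrow> s \<in> carrier (sec Z U) \<Longrightarrow> \<zeta> V (res Z U V s) = \<zeta> U s"
    and "\<And>c. c \<in> carrier k \<Longrightarrow> \<zeta> (pts Z) (str Z c) = i c"
    using assms by (simp_all add: field_model_def irreducible_sch_def)
  show "kscheme k Z" "ringed_space Z" "str Z \<in> ring_hom k (glob Z)" using S by (simp_all add: Sm_def kscheme_def)
  obtain z where z: "z \<in> pts Z" using \<open>pts Z \<noteq> {}\<close> by blast
  obtain \<U> where U: "\<Union>\<U> = pts Z"
    "\<forall>V\<in>\<U>. affine_open Z V \<and> finite_type_hom k (sec Z V) (str (open_sub Z V))"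
    using S by (auto simp: Sm_def finite_type_def)
  then obtain V where "V \<in> \<U>" "z \<in> V" using z by blast
  then show "\<exists>V. opn Z V \<and> V \<noteq> {} \<and> affine_open Z V \<and> finite_type_hom k (sec Z V) (str (open_sub Z V))"
    using U(2) by (intro exI[of _ V]) (auto simp: affine_open_def)
qed

lemma SmD:
  assumes "Sm k X"
  shows "ringed_space X" "str X \<in> ring_hom k (glob X)"
  using assms by (simp_all add: Sm_def kscheme_def)

lemma model_mor_comp:
  assumes W: "Sm k W" and Z: "Sm k Z" and Y: "Sm k Y"
    and g: "model_mor k Z \<zeta> Y \<delta> g" and m: "model_mor k W \<omega> Z \<zeta> m"
  shows "model_mor k W \<omega> Y \<delta> (mor_comp W Z Y g m)"
proof -
  have gm: "is_mor k Z Y g" "is_mor k W Z m" using g m by (simp_all add: model_mor_def)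
  have "is_mor k W Y (mor_comp W Z Y g m)"
    by (rule is_mor_comp[OF SmD(1)[OF W] SmD(1)[OF Z] SmD(1)[OF Y] gm(2,1) SmD(2)[OF Y]])
  moreover have "pre W (mor_comp W Z Y g m) U \<noteq> {} \<and>
      (\<forall>s\<in>carrier (sec Y U). \<omega> (pre W (mor_comp W Z Y g m) U) (sh (mor_comp W Z Y g m) U s) = \<delta> U s)"
    if U: "opn Y U" "U \<noteq> {}" for U
  proof -
    have o: "opn Z (pre Z g U)" by (rule pre_opn[OF gm(1) U(1)])
    have "pre Z g U \<noteq> {}" "\<And>s. s \<in> carrier (sec Y U) \<Longrightarrow> \<zeta> (pre Z g U) (sh g U s) = \<delta> U s"
      using g U by (simp_all add: model_mor_def)
    moreover from this have "pre W m (pre Z g U) \<noteq> {}"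
      "\<And>s. s \<in> carrier (sec Z (pre Z g U)) \<Longrightarrow> \<omega> (pre W m (pre Z g U)) (sh m (pre Z g U) s) = \<zeta> (pre Z g U) s"
      using m o by (simp_all add: model_mor_def)
    ultimately show ?thesis
      using mor_closed[OF gm(1) U(1)] by (simp add: pre_comp[OF gm(2)] sh_comp[OF U(1)])
  qed
  ultimately show ?thesis by (simp add: model_mor_def)
qed

section \<open>Open subsets of the curve as models of its function field\<close>

context kcurve
begin

abbreviation "XO U \<equiv> open_sub X U"

lemma kcurve_XO:
  assumes "opn X U" "U \<noteq> {}"
  shows "kcurve F (U - {\<zero>}) ord k i" "XO U = curve_sch F ord i (U - {\<zero>})"
  using open_kcurve[OF assms] open_sub_curve[OF assms] by blast+

lemma Sm_XO: "opn X U \<Longrightarrow> U \<noteq> {} \<Longrightarrow> Sm k (XO U)"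
  using kcurve.Sm_X[OF kcurve_XO(1)] kcurve_XO(2) by simp

lemma zero_mem_opn: "opn X U \<Longrightarrow> U \<noteq> {} \<Longrightarrow> \<zero> \<in> U"
  by (simp add: opn_curve)

lemma opn_Int_ne: "opn X U \<Longrightarrow> U \<noteq> {} \<Longrightarrow> opn X V \<Longrightarrow> V \<noteq> {} \<Longrightarrow> opn X (U \<inter> V) \<and> U \<inter> V \<noteq> {}"
  using zero_mem_opn[of U] zero_mem_opn[of V] by (auto simp: openin_Int)

lemma XO_XO:
  assumes "opn X U" "opn X W" "W \<subseteq> U"
  shows "open_sub (XO U) W = XO W"
proof -
  have "subtopology (subtopology (sp X) U) W = subtopology (sp X) W"
    using assms(3) by (simp add: subtopology_subtopology inf.absorb2)
  then show ?thesis unfolding open_sub_def using assms pts_open_sub[OF assms(1)]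
    by (auto simp: open_sub_def fun_eq_iff)
qed

lemma mor_to_X_unique:
  assumes T: "ringed_space T" and m: "is_mor k T X m" "is_mor k T X m'"
    and "\<And>s. s \<in> reg F ord Cl \<Longrightarrow> sh m pt_set s = sh m' pt_set s"
  shows "m = m'"
  by (rule mor_eqI[OF T ringed_chart_X m])
    (use pre_pts[OF m(1)] pre_pts[OF m(2)] assms(4) in \<open>simp_all add: carrier_reg_ring\<close>)

lemma is_mor_incl_X: "opn X U \<Longrightarrow> is_mor k (XO U) X (incl X U)"
  by (rule is_mor_incl[OF ringed_space_curve _ str_X])

lemma model_mor_incl:
  assumes U: "opn X U" "U \<noteq> {}"
  shows "model_mor k (XO U) (\<lambda>_ s. s) X (\<lambda>_ s. s) (incl X U)"
  unfolding model_mor_def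
proof (intro conjI allI impI ballI; (elim conjE)?)
  show "is_mor k (XO U) X (incl X U)" by (rule is_mor_incl_X[OF U(1)])
  fix V assume V: "opn X V" "V \<noteq> {}"
  then show "pre (XO U) (incl X U) V \<noteq> {}" using pre_incl[OF U(1), of V] opn_Int_ne[OF U V] by simp
  fix s assume "s \<in> carrier (sec X V)"
  then show "sh (incl X U) V s = s" using sh_incl[OF V(1)] opn_Int_ne[OF U V] by simp
qed

lemma incl_incl:
  assumes U: "opn X U" "U \<noteq> {}" and W: "opn X W" "W \<noteq> {}" "W \<subseteq> U"
  shows "is_mor k (XO W) (XO U) (incl (XO U) W)"
    "model_mor k (XO W) (\<lambda>_ s. s) (XO U) (\<lambda>_ s. s) (incl (XO U) W)"
    "mor_comp (XO W) (XO U) X (incl X U) (incl (XO U) W) = incl X W"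
proof -
  note V = kcurve_XO[OF U]
  interpret V: kcurve F "U - {\<zero>}" ord k i by (rule V(1))
  have oW: "opn V.X W" using opn_open_sub[OF U(1)] W V(2) by simp
  have e: "V.XO W = XO W" using XO_XO[OF U(1) W(1,3)] V(2) by simp
  show M: "model_mor k (XO W) (\<lambda>_ s. s) (XO U) (\<lambda>_ s. s) (incl (XO U) W)"
    using V.model_mor_incl[OF oW W(2)] e V(2) by simp
  then show I: "is_mor k (XO W) (XO U) (incl (XO U) W)" by (simp add: model_mor_def)
  have "model_mor k (XO W) (\<lambda>_ s. s) X (\<lambda>_ s. s) (mor_comp (XO W) (XO U) X (incl X U) (incl (XO U) W))"
    by (rule model_mor_comp[OF Sm_XO[OF W(1,2)] Sm_XO[OF U] Sm_X model_mor_incl[OF U] M])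
  moreover have "model_mor k (XO W) (\<lambda>_ s. s) X (\<lambda>_ s. s) (incl X W)" by (rule model_mor_incl[OF W(1,2)])
  moreover have "opn X pt_set" "pt_set \<noteq> {}" using openin_topspace[of "sp X"] by auto
  ultimately show "mor_comp (XO W) (XO U) X (incl X U) (incl (XO U) W) = incl X W"
    by (intro mor_to_X_unique[OF SmD(1)[OF Sm_XO[OF W(1,2)]]]) (simp_all add: model_mor_def carrier_reg_ring)
qed

text \<open>A morphism of models acts on sections as the inclusion into the function field, and a
  morphism to the affine \<open>X\<close> is determined by its action on global sections.\<close>

lemma model_mor_to_X:
  assumes U: "opn X U" "U \<noteq> {}" and m: "model_mor k (XO U) (\<lambda>_ s. s) X (\<lambda>_ s. s) m"
  shows "m = incl X U"
proof -
  have "opn X pt_set" "pt_set \<noteq> {}" using openin_topspace[of "sp X"] by auto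
  then show ?thesis using m model_mor_incl[OF U]
    by (intro mor_to_X_unique[OF SmD(1)[OF Sm_XO[OF U]]]) (simp_all add: model_mor_def carrier_reg_ring)
qed

text \<open>Sections are elements of \<open>F\<close> already, so the structural family of this
  model consists of identities.\<close>

lemma field_model_X: "field_model k F i X (\<lambda>_ s. s)"
proof -
  have "irreducible_sch X" unfolding irreducible_sch_def using zero_mem_opn by auto
  moreover have "(\<lambda>s. s) \<in> ring_hom (reg_ring F ord U) F" if "U \<noteq> {}" for U
    using that reg_subset by (auto simp: ring_hom_def carrier_reg_ring)
  ultimately show ?thesis unfolding field_model_def using Sm_X by simp
qed

text \<open>Finitely many elements have finitely many poles, and these are removed.\<close>

lemma finite_set_regular:
  assumes "finite S" "S \<subseteq> carrier F"
  obtains U where "opn X U" "U \<noteq> {}" "S \<subseteq> reg F ord U"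
proof -
  let ?U = "insert \<zero> {p\<in>Cl. \<forall>s\<in>S - {\<zero>}. 0 \<le> ord p s}"
  have "Cl - ?U \<subseteq> (\<Union>s\<in>S - {\<zero>}. {p\<in>Cl. ord p s \<noteq> 0})" by force
  moreover have "finite (\<Union>s\<in>S - {\<zero>}. {p\<in>Cl. ord p s \<noteq> 0})"
    using assms ord_fin by (intro finite_UN_I) auto
  ultimately have "finite (Cl - ?U)" by (rule finite_subset)
  then have "opn X ?U" unfolding opn_curve by auto
  moreover have "S \<subseteq> reg F ord ?U" using assms(2) by (auto simp: reg_def)
  ultimately show ?thesis by (intro that[of ?U]) auto
qed

text \<open>Open subsets of the curve are cofinal among the models, by spreading out. The ring of an
  affine open \<open>V\<close> in \<open>Z\<close> has finitely many generators over
  \<open>k\<close>, whose images in \<open>F\<close> are regular on some \<open>U\<close>. So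
  \<zeta> maps this ring into the ring of \<open>U\<close>, which induces the morphism.\<close>

lemma ex_model_mor:
  assumes Z: "field_model k F i Z \<zeta>"
  obtains U m where "opn X U" "U \<noteq> {}" "model_mor k (XO U) (\<lambda>_ s. s) Z \<zeta> m"
proof -
  note Zm = field_modelD[OF Z]
  interpret Z: ringed Z using Zm(3) by unfold_locales
  obtain V where V: "opn Z V" "V \<noteq> {}" "affine_open Z V" "finite_type_hom k (sec Z V) (str (open_sub Z V))"
    using Zm(10) by blast
  obtain h where h: "chart Z V h" using affine_open_chart[OF V(3)] .
  interpret Zc: ringed_chart Z V h using h by unfold_locales
  interpret B: cring "sec Z V" by (rule Zc.B_cring)
  have Vp: "V \<subseteq> pts Z" using openin_subset[OF V(1)] .
  have zV: "\<zeta> V \<in> ring_hom (sec Z V) F" by (rule Zm(7)[OF V(1,2)])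
  have strV: "str (open_sub Z V) c = res Z (pts Z) V (str Z c)" for c by (simp add: open_sub_def)
  have zstr: "\<zeta> V (res Z (pts Z) V (str Z c)) = i c" if "c \<in> carrier k" for c
    using Zm(8)[OF openin_topspace V(1,2) Vp ring_hom_closed[OF Zm(4) that]] Zm(9)[OF that] by simp
  obtain S where S: "finite S" "S \<subseteq> carrier (sec Z V)"
    "generate_ring (sec Z V) (str (open_sub Z V) ` carrier k \<union> S) = carrier (sec Z V)"
    using V(4) by (auto simp: finite_type_hom_def)
  have "\<zeta> V ` S \<subseteq> carrier F" using S(2) ring_hom_closed[OF zV] by blast
  then obtain U where U: "opn X U" "U \<noteq> {}" "\<zeta> V ` S \<subseteq> reg F ord U"
    using finite_set_regular[of "\<zeta> V ` S"] S(1) by blast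
  note VV = kcurve_XO[OF U(1,2)]
  interpret V: kcurve F "U - {\<zero>}" ord k i by (rule VV(1))
  have Up: "U \<subseteq> pt_set" using U(1) by (auto simp: opn_curve)
  note sr = subringE[OF subring_reg[OF Up]]
  have ik: "i c \<in> reg F ord U" if "c \<in> carrier k" for c
    using ring_hom_closed[OF V.i_hom that] by simp
  interpret H: ring_hom_ring "sec Z V" F "\<zeta> V" by (rule ring_hom_ringI2[OF B.ring_axioms ring_axioms zV])
  have gen: "\<zeta> V b \<in> reg F ord U" if "b \<in> generate_ring (sec Z V) (str (open_sub Z V) ` carrier k \<union> S)" for b
    using that
  proof (induction rule: generate_ring.induct)
    case one
    then show ?case using sr(3) by simp
  next
    case (incl b)
    then show ?case using U(3) zstr ik strV by auto
  next
    case (a_inv b)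
    then have "b \<in> carrier (sec Z V)" using S(3) by simp
    then show ?case using sr(5)[OF a_inv(2)] by simp
  next
    case (eng_add a b)
    then have "a \<in> carrier (sec Z V)" "b \<in> carrier (sec Z V)" using S(3) by simp_all
    then show ?case using sr(7)[OF eng_add(3,4)] by simp
  next
    case (eng_mult a b)
    then have "a \<in> carrier (sec Z V)" "b \<in> carrier (sec Z V)" using S(3) by simp_all
    then show ?case using sr(6)[OF eng_mult(3,4)] by simp
  qed
  have \<phi>: "\<zeta> V \<in> ring_hom (sec Z V) (F\<lparr>carrier := reg F ord (U - {\<zero>})\<rparr>)"
    using zV gen S(3) by (auto simp: ring_hom_def)
  obtain m where m: "is_mor k V.X Z m" "pre V.X m V = insert \<zero> (U - {\<zero>})"
    "\<And>b. b \<in> carrier (sec Z V) \<Longrightarrow> sh m V b = \<zeta> V b" "h (pt m \<zero>) = {b \<in> carrier (sec Z V). \<zeta> V b = \<zero>}"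
    by (rule V.ex_mor[OF Zc.ringed_chart_axioms \<phi> Zm(4) zstr]) (assumption, rule that)
  have U0: "\<zero> \<in> U" using zero_mem_opn[OF U(1,2)] .
  have m0: "pt m \<zero> \<in> V" using m(2) by (auto simp: pre_def)
  interpret T: ringed V.X using V.ringed_space_curve by unfold_locales
  \<comment> \<open>Dominance: a nonempty open \<open>W\<close> contains a nonempty basic set on
    which \<open>b\<close> is a unit. Hence the image of \<open>b\<close> in \<open>F\<close> is not
    0, and the generic point is mapped into this basic set.\<close>
  have dom: "\<exists>b\<in>carrier (sec Z V). Zc.D b \<subseteq> W \<and> pt m \<zero> \<in> Zc.D b \<and> \<zeta> V b \<noteq> \<zero>" if W: "opn Z W" "W \<noteq> {}" for W
  proof -
    obtain y where y: "y \<in> W" "y \<in> V" using Zm(6)[OF W(1) V(1) W(2) V(2)] by blast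
    obtain b where b: "b \<in> carrier (sec Z V)" "y \<in> Zc.D b" "Zc.D b \<subseteq> W" using Zc.base[OF W(1) y] by blast
    have ne: "Zc.D b \<noteq> {}" using b(2) by blast
    have "\<zeta> (Zc.D b) (res Z V (Zc.D b) b) \<in> Units F"
      by (rule ring_hom_Units[OF Zm(7)[OF Zc.opn_D[OF b(1)] ne] Z.sec_cring[OF Zc.opn_D[OF b(1)]] is_cring Zc.res_D_unit[OF b(1)]])
    then have "\<zeta> V b \<noteq> \<zero>"
      using Zm(8)[OF V(1) Zc.opn_D[OF b(1)] ne Zc.D_sub b(1)] field_Units by simp
    moreover from this have "pt m \<zero> \<in> Zc.D b" using m(4) m0 by (simp add: Zc.D_def)
    ultimately show ?thesis using b by blast
  qed
  have "model_mor k V.X (\<lambda>_ s. s) Z \<zeta> m"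
    unfolding model_mor_def
  proof (intro conjI allI impI ballI; (elim conjE)?)
    show "is_mor k V.X Z m" by (rule m(1))
    fix W assume W: "opn Z W" "W \<noteq> {}"
    obtain f where f: "f \<in> carrier (sec Z V)" "Zc.D f \<subseteq> W" "pt m \<zero> \<in> Zc.D f" using dom[OF W] by blast
    let ?D = "Zc.D f"
    have D: "opn Z ?D" "?D \<noteq> {}" "?D \<subseteq> V" using Zc.opn_D[OF f(1)] f(3) Zc.D_sub by auto
    have pD: "\<zero> \<in> pre V.X m ?D" using f(3) by (simp add: mem_pre)
    then show "pre V.X m W \<noteq> {}" using pre_mono[OF f(2), of V.X m] by blast
    fix s assume s: "s \<in> carrier (sec Z W)"
    define r where "r = res Z W ?D s"
    have rc: "r \<in> carrier (sec Z ?D)" unfolding r_def by (rule Z.res_closed[OF W(1) D(1) f(2) s])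
    obtain a b where ab: "a \<in> carrier (sec Z V)" "b \<in> carrier (sec Z V)" "res Z V ?D b \<in> Units (sec Z ?D)"
      "r \<otimes>\<^bsub>sec Z ?D\<^esub> res Z V ?D b = res Z V ?D a"
      using Zc.local_fraction[OF f(1) rc] by metis
    have bc: "res Z V ?D b \<in> carrier (sec Z ?D)" by (rule Z.res_closed[OF V(1) D(1,3) ab(2)])
    have ne: "pre V.X m ?D \<noteq> {}" using pD by blast
    have "sh m ?D \<in> ring_hom (sec Z ?D) (F\<lparr>carrier := reg F ord (pre V.X m ?D)\<rparr>)"
      using mor_hom[OF m(1) D(1)] unfolding V.sec_curve V.reg_ring_ne[OF ne] .
    then have hD: "sh m ?D \<in> ring_hom (sec Z ?D) F"
      using reg_subset by (auto simp: ring_hom_def)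
    have zD: "\<zeta> ?D \<in> ring_hom (sec Z ?D) F" by (rule Zm(7)[OF D(1,2)])
    have same: "sh m ?D (res Z V ?D c) = \<zeta> ?D (res Z V ?D c)" if "c \<in> carrier (sec Z V)" for c
      using mor_res[OF m(1) V(1) D(1,3) that] m(3)[OF that] Zm(8)[OF V(1) D(1,2,3) that] pD by auto
    \<comment> \<open>On the basic set sections are fractions of sections over \<open>V\<close>,
      where the two maps agree by construction; the unit denominator cancels.\<close>
    have "sh m ?D r = \<zeta> ?D r"
    proof (rule Units_mult_cancel[OF is_cring])
      show "\<zeta> ?D (res Z V ?D b) \<in> Units F" by (rule ring_hom_Units[OF zD Z.sec_cring[OF D(1)] is_cring ab(3)])
      show "sh m ?D r \<in> carrier F" "\<zeta> ?D r \<in> carrier F" using ring_hom_closed[OF hD rc] ring_hom_closed[OF zD rc] .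
      show "sh m ?D r \<otimes> \<zeta> ?D (res Z V ?D b) = \<zeta> ?D r \<otimes> \<zeta> ?D (res Z V ?D b)"
        using ring_hom_mult[OF hD rc bc] ring_hom_mult[OF zD rc bc] same[OF ab(1)] same[OF ab(2)] ab(4) by simp
    qed
    moreover have "sh m ?D r = sh m W s"
      unfolding r_def using mor_res[OF m(1) W(1) D(1) f(2) s] pD by auto
    moreover have "\<zeta> ?D r = \<zeta> W s" unfolding r_def by (rule Zm(8)[OF W(1) D(1,2) f(2) s])
    ultimately show "sh m W s = \<zeta> W s" by simp
  qed
  then have "model_mor k (XO U) (\<lambda>_ s. s) Z \<zeta> m" using VV(2) by simp
  then show ?thesis by (rule that[OF U(1,2)])
qed

text \<open>All three morphisms induce \<delta> on sections over the affine \<open>V\<close>, and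
  morphisms into a chart are determined by that; so they agree where all of them land in
  \<open>V\<close>. Three are treated at once because a product involves two factors and a
  result.\<close>

lemma model_mors_agree:
  assumes Y: "field_model k F i Y \<delta>"
    and n: "\<And>j. j \<in> {1, 2, 3::nat} \<Longrightarrow> model_mor k X (\<lambda>_ s. s) Y \<delta> (n j)"
  obtains U where "opn X U" "U \<noteq> {}"
    "mor_comp (XO U) X Y (n 2) (incl X U) = mor_comp (XO U) X Y (n 1) (incl X U)"
    "mor_comp (XO U) X Y (n 3) (incl X U) = mor_comp (XO U) X Y (n 1) (incl X U)"
proof -
  note Ym = field_modelD[OF Y]
  interpret Y: ringed Y using Ym(3) by unfold_locales
  obtain V where V: "opn Y V" "V \<noteq> {}" "affine_open Y V" using Ym(10) by blast
  obtain h where h: "chart Y V h" using affine_open_chart[OF V(3)] .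
  have Yc: "ringed_chart Y V h" using h by unfold_locales
  have nm: "is_mor k X Y (n j)" "pre X (n j) V \<noteq> {}" "\<And>s. s \<in> carrier (sec Y V) \<Longrightarrow> sh (n j) V s = \<delta> V s"
    if "j \<in> {1, 2, 3}" for j
    using n[OF that] V(1,2) by (simp_all add: model_mor_def)
  have o: "opn X (pre X (n j) V)" if "j \<in> {1, 2, 3}" for j by (rule pre_opn[OF nm(1)[OF that] V(1)])
  define U where "U = pre X (n 1) V \<inter> (pre X (n 2) V \<inter> pre X (n 3) V)"
  have U: "opn X U" "U \<noteq> {}"
    using opn_Int_ne o nm(2) unfolding U_def by simp_all
  have eq: "mor_comp (XO U) X Y (n j) (incl X U) = mor_comp (XO U) X Y (n 1) (incl X U)" if j: "j \<in> {1, 2, 3}" for j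
  proof (rule mor_eqI[OF SmD(1)[OF Sm_XO[OF U]] Yc])
    have im: "is_mor k (XO U) Y (mor_comp (XO U) X Y (n j) (incl X U))" if "j \<in> {1, 2, 3}" for j
      by (rule is_mor_comp[OF SmD(1)[OF Sm_XO[OF U]] ringed_space_curve Ym(3) is_mor_incl_X[OF U(1)] nm(1)[OF that] Ym(4)])
    show "is_mor k (XO U) Y (mor_comp (XO U) X Y (n j) (incl X U))"
      "is_mor k (XO U) Y (mor_comp (XO U) X Y (n 1) (incl X U))" using im j by simp_all
    have pr: "pre (XO U) (mor_comp (XO U) X Y (n j) (incl X U)) V = pts (XO U)" if "j \<in> {1, 2, 3}" for j
      using pre_comp[OF is_mor_incl_X[OF U(1)], of Y "n j" V] pre_incl[OF U(1), of "pre X (n j) V"] pts_open_sub[OF U(1)] that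
      by (auto simp: U_def)
    show "pre (XO U) (mor_comp (XO U) X Y (n j) (incl X U)) V = pts (XO U)"
      "pre (XO U) (mor_comp (XO U) X Y (n 1) (incl X U)) V = pts (XO U)" using pr j by simp_all
    have sh: "sh (mor_comp (XO U) X Y (n j) (incl X U)) V b = \<delta> V b" if j: "j \<in> {1, 2, 3}" and b: "b \<in> carrier (sec Y V)" for j b
    proof -
      have "U \<inter> pre X (n j) V \<noteq> {}" using U j by (auto simp: U_def)
      then show ?thesis
        using sh_comp[OF V(1) b, of "XO U" X "n j" "incl X U"] sh_incl[OF o[OF j] mor_closed[OF nm(1)[OF j] V(1) b]]
          nm(3)[OF j b] by simp
    qed
    fix b assume "b \<in> carrier (sec Y V)"
    then show "sh (mor_comp (XO U) X Y (n j) (incl X U)) V b = sh (mor_comp (XO U) X Y (n 1) (incl X U)) V b"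
      using sh j by simp
  qed
  show ?thesis by (rule that[OF U eq eq]) simp_all
qed

end

section \<open>Equality of germs\<close>

lemma ab_sheafD:
  assumes "ab_sheaf k M"
  shows "\<And>X. Sm k X \<Longrightarrow> comm_group (grp M X)"
    and "\<And>X Y f. Sm k X \<Longrightarrow> Sm k Y \<Longrightarrow> is_mor k Y X f \<Longrightarrow> pull M X Y f \<in> hom (grp M X) (grp M Y)"
    and "\<And>X s. Sm k X \<Longrightarrow> s \<in> carrier (grp M X) \<Longrightarrow> pull M X X (mor_id X) s = s"
    and "\<And>X Y Z f g s. Sm k X \<Longrightarrow> Sm k Y \<Longrightarrow> Sm k Z \<Longrightarrow> is_mor k Y X f \<Longrightarrow> is_mor k Z Y g \<Longrightarrow>
      s \<in> carrier (grp M X) \<Longrightarrow> pull M X Z (mor_comp Z Y X f g) s = pull M Y Z g (pull M X Y f s)"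
    and "\<And>X Y f s. Sm k X \<Longrightarrow> Sm k Y \<Longrightarrow> is_mor k Y X f \<Longrightarrow> s \<in> carrier (grp M X) \<Longrightarrow> pull M X Y f s \<in> carrier (grp M Y)"
  using assms unfolding ab_sheaf_def nis_sheaf_def set_presheaf_def by simp_all

text \<open>The common model of the relation is replaced by an open subset of the curve mapping to
  it; the composite to \<open>X\<close> can only be the inclusion.\<close>

lemma (in kcurve) rel_on_open:
  assumes M: "ab_sheaf k M" and r: "((X, (\<lambda>_ s. s), s), (Y, \<delta>, t)) \<in> fsec_rel k M F i"
  obtains U n where "opn X U" "U \<noteq> {}" "model_mor k (XO U) (\<lambda>_ s. s) Y \<delta> n"
    "pull M X (XO U) (incl X U) s = pull M Y (XO U) n t"
proof -
  note Ms = ab_sheafD[OF M]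
  have s: "s \<in> carrier (grp M X)" and t: "t \<in> carrier (grp M Y)" and Y: "Sm k Y"
    using r by (auto simp: fsec_rel_def fsecs_def field_model_def)
  obtain Z \<zeta> f g where Z: "field_model k F i Z \<zeta>" and f: "model_mor k Z \<zeta> X (\<lambda>_ s. s) f"
    and g: "model_mor k Z \<zeta> Y \<delta> g" and eq: "pull M X Z f s = pull M Y Z g t"
    using r by (auto simp: fsec_rel_def)
  obtain U m where U: "opn X U" "U \<noteq> {}" and m: "model_mor k (XO U) (\<lambda>_ s. s) Z \<zeta> m"
    using ex_model_mor[OF Z] .
  have fgm: "is_mor k Z X f" "is_mor k Z Y g" "is_mor k (XO U) Z m" using f g m by (simp_all add: model_mor_def)
  note SZ = field_modelD(1)[OF Z] and SU = Sm_XO[OF U]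
  have "mor_comp (XO U) Z X f m = incl X U"
    by (rule model_mor_to_X[OF U model_mor_comp[OF SU SZ Sm_X f m]])
  then have "pull M X (XO U) (incl X U) s = pull M Z (XO U) m (pull M X Z f s)"
    using Ms(4)[OF Sm_X SZ SU fgm(1,3) s] by simp
  also have "\<dots> = pull M Y (XO U) (mor_comp (XO U) Z Y g m) t"
    unfolding eq using Ms(4)[OF Y SZ SU fgm(2,3) t] by simp
  finally show ?thesis using that[OF U model_mor_comp[OF SU SZ Y g m]] by blast
qed

lemma (in kcurve) pull_incl:
  assumes M: "ab_sheaf k M" and U: "opn X U" "U \<noteq> {}" and W: "opn X W" "W \<noteq> {}" "W \<subseteq> U"
    and s: "s \<in> carrier (grp M X)"
  shows "pull M X (XO W) (incl X W) s = pull M (XO U) (XO W) (incl (XO U) W) (pull M X (XO U) (incl X U) s)"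
  using ab_sheafD(4)[OF M Sm_X Sm_XO[OF U] Sm_XO[OF W(1,2)] is_mor_incl_X[OF U(1)] incl_incl(1)[OF U W] s]
    incl_incl(3)[OF U W] by simp

lemma (in kcurve) rel_restrict:
  assumes M: "ab_sheaf k M" and U: "opn X U" "U \<noteq> {}" and W: "opn X W" "W \<noteq> {}" "W \<subseteq> U"
    and s: "s \<in> carrier (grp M X)" and t: "t \<in> carrier (grp M Y)" and Y: "Sm k Y"
    and n: "model_mor k (XO U) (\<lambda>_ s. s) Y \<delta> n" "pull M X (XO U) (incl X U) s = pull M Y (XO U) n t"
  shows "model_mor k (XO W) (\<lambda>_ s. s) Y \<delta> (mor_comp (XO W) (XO U) Y n (incl (XO U) W))"
    "pull M X (XO W) (incl X W) s = pull M Y (XO W) (mor_comp (XO W) (XO U) Y n (incl (XO U) W)) t"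
proof -
  show "model_mor k (XO W) (\<lambda>_ s. s) Y \<delta> (mor_comp (XO W) (XO U) Y n (incl (XO U) W))"
    by (rule model_mor_comp[OF Sm_XO[OF W(1,2)] Sm_XO[OF U] Y n(1) incl_incl(2)[OF U W]])
  have "is_mor k (XO U) Y n" using n(1) by (simp add: model_mor_def)
  then show "pull M X (XO W) (incl X W) s = pull M Y (XO W) (mor_comp (XO W) (XO U) Y n (incl (XO U) W)) t"
    using pull_incl[OF M U W s] n(2) ab_sheafD(4)[OF M Y Sm_XO[OF U] Sm_XO[OF W(1,2)] _ incl_incl(1)[OF U W] t] by simp
qed

text \<open>The three relations come with three morphisms to \<open>Y\<close>, which may differ. On
  a small open set they coincide, and pullback along a single morphism is a homomorphism.\<close>

lemma (in kcurve) rel_mult: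
  assumes M: "ab_sheaf k M"
    and r: "((X, (\<lambda>_ s. s), s), (Y, \<delta>, t)) \<in> fsec_rel k M F i" "((X, (\<lambda>_ s. s), s'), (Y, \<delta>, t')) \<in> fsec_rel k M F i"
      "((X, (\<lambda>_ s. s), s''), (Y, \<delta>, t \<otimes>\<^bsub>grp M Y\<^esub> t')) \<in> fsec_rel k M F i"
  obtains U where "opn X U" "U \<noteq> {}"
    "pull M X (XO U) (incl X U) (s \<otimes>\<^bsub>grp M X\<^esub> s') = pull M X (XO U) (incl X U) s''"
proof -
  note Ms = ab_sheafD[OF M]
  have s: "s \<in> carrier (grp M X)" "s' \<in> carrier (grp M X)" "s'' \<in> carrier (grp M X)"
    and t: "t \<in> carrier (grp M Y)" "t' \<in> carrier (grp M Y)" "t \<otimes>\<^bsub>grp M Y\<^esub> t' \<in> carrier (grp M Y)"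
    and Ym: "field_model k F i Y \<delta>" using r by (auto simp: fsec_rel_def fsecs_def)
  have Y: "Sm k Y" by (rule field_modelD(1)[OF Ym])
  obtain U1 n1 where 1: "opn X U1" "U1 \<noteq> {}" "model_mor k (XO U1) (\<lambda>_ s. s) Y \<delta> n1"
    "pull M X (XO U1) (incl X U1) s = pull M Y (XO U1) n1 t" using rel_on_open[OF M r(1)] .
  obtain U2 n2 where 2: "opn X U2" "U2 \<noteq> {}" "model_mor k (XO U2) (\<lambda>_ s. s) Y \<delta> n2"
    "pull M X (XO U2) (incl X U2) s' = pull M Y (XO U2) n2 t'" using rel_on_open[OF M r(2)] .
  obtain U3 n3 where 3: "opn X U3" "U3 \<noteq> {}" "model_mor k (XO U3) (\<lambda>_ s. s) Y \<delta> n3"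
    "pull M X (XO U3) (incl X U3) s'' = pull M Y (XO U3) n3 (t \<otimes>\<^bsub>grp M Y\<^esub> t')" using rel_on_open[OF M r(3)] .
  define W where "W = U1 \<inter> (U2 \<inter> U3)"
  have W: "opn X W" "W \<noteq> {}" "W \<subseteq> U1" "W \<subseteq> U2" "W \<subseteq> U3"
    using opn_Int_ne[OF 1(1,2)] opn_Int_ne[OF 2(1,2) 3(1,2)] by (auto simp: W_def)
  note R1 = rel_restrict[OF M 1(1,2) W(1,2,3) s(1) t(1) Y 1(3,4)]
  note R2 = rel_restrict[OF M 2(1,2) W(1,2,4) s(2) t(2) Y 2(3,4)]
  note R3 = rel_restrict[OF M 3(1,2) W(1,2,5) s(3) t(3) Y 3(3,4)]
  define n where "n j = (if j = 1 then mor_comp (XO W) (XO U1) Y n1 (incl (XO U1) W)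
     else if j = 2 then mor_comp (XO W) (XO U2) Y n2 (incl (XO U2) W)
     else mor_comp (XO W) (XO U3) Y n3 (incl (XO U3) W))" for j :: nat
  note VV = kcurve_XO[OF W(1,2)]
  interpret V: kcurve F "W - {\<zero>}" ord k i by (rule VV(1))
  have nm: "model_mor k V.X (\<lambda>_ s. s) Y \<delta> (n j)" if "j \<in> {1, 2, 3}" for j
    using that R1(1) R2(1) R3(1) VV(2) by (auto simp: n_def)
  obtain U where U: "opn V.X U" "U \<noteq> {}"
    "mor_comp (V.XO U) V.X Y (n 2) (incl V.X U) = mor_comp (V.XO U) V.X Y (n 1) (incl V.X U)"
    "mor_comp (V.XO U) V.X Y (n 3) (incl V.X U) = mor_comp (V.XO U) V.X Y (n 1) (incl V.X U)"
    by (rule V.model_mors_agree[OF Ym nm]) (assumption, rule that)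
  have oU: "opn X U" "U \<subseteq> W" using U(1) opn_open_sub[OF W(1)] VV(2) by auto
  define N where "N = mor_comp (V.XO U) V.X Y (n 1) (incl V.X U)"
  have eX: "V.XO U = XO U" using XO_XO[OF W(1) oU] VV(2) by simp
  have nmor: "is_mor k V.X Y (n j)" if "j \<in> {1, 2, 3}" for j using nm[OF that] by (simp add: model_mor_def)
  have SU: "Sm k (XO U)" by (rule Sm_XO[OF oU(1) U(2)])
  have iU: "is_mor k (XO U) V.X (incl V.X U)" using V.is_mor_incl_X[OF U(1)] eX by simp
  have pl: "pull M X (XO U) (incl X U) x = pull M Y (XO U) N y"
    if j: "j \<in> {1, 2, 3}" and x: "x \<in> carrier (grp M X)" and y: "y \<in> carrier (grp M Y)"
      and e: "pull M X (XO W) (incl X W) x = pull M Y (XO W) (n j) y" for x y j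
  proof -
    have "pull M X (XO U) (incl X U) x = pull M V.X (XO U) (incl V.X U) (pull M Y V.X (n j) y)"
      using pull_incl[OF M W(1,2) oU(1) U(2) oU(2) x] e VV(2) by simp
    also have "\<dots> = pull M Y (XO U) (mor_comp (XO U) V.X Y (n j) (incl V.X U)) y"
      using Ms(4)[OF Y V.Sm_X SU nmor[OF j] iU y] by simp
    also have "mor_comp (XO U) V.X Y (n j) (incl V.X U) = N" using j U(3,4) eX by (auto simp: N_def)
    finally show ?thesis .
  qed
  have Nm: "is_mor k (XO U) Y N"
    unfolding N_def eX
    by (rule is_mor_comp[OF SmD(1)[OF SU] V.ringed_space_curve SmD(1)[OF Y] iU nmor SmD(2)[OF Y]]) simp
  note hX = Ms(2)[OF Sm_X SU is_mor_incl_X[OF oU(1)]] and hY = Ms(2)[OF Y SU Nm]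
  have "pull M X (XO U) (incl X U) (s \<otimes>\<^bsub>grp M X\<^esub> s') = pull M Y (XO U) N t \<otimes>\<^bsub>grp M (XO U)\<^esub> pull M Y (XO U) N t'"
    using hom_mult[OF hX s(1,2)] pl[of 1 s t] pl[of 2 s' t'] s t R1(2) R2(2) by (simp add: n_def)
  also have "\<dots> = pull M X (XO U) (incl X U) s''"
    using hom_mult[OF hY t(1,2)] pl[of 3 s'' "t \<otimes>\<^bsub>grp M Y\<^esub> t'"] s t R3(2) by (simp add: n_def)
  finally show ?thesis by (rule that[OF oU(1) U(2)])
qed

text \<open>The product in the colimit is only known on representatives over a common model; here all
  representatives are brought to an open subset of the curve.\<close>

lemma (in kcurve) eval_mult_eq:
  assumes M: "ab_sheaf k M" and s: "\<And>j. j \<in> {1, 2, 3, 4::nat} \<Longrightarrow> s j \<in> carrier (grp M X)"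
    and eq: "eval_class k M F i X (\<lambda>_ s. s) (s 1) \<otimes>\<^bsub>eval_fld k M F i\<^esub> eval_class k M F i X (\<lambda>_ s. s) (s 2) =
      eval_class k M F i X (\<lambda>_ s. s) (s 3) \<otimes>\<^bsub>eval_fld k M F i\<^esub> eval_class k M F i X (\<lambda>_ s. s) (s 4)"
  obtains U where "opn X U" "U \<noteq> {}"
    "pull M X (XO U) (incl X U) (s 1 \<otimes>\<^bsub>grp M X\<^esub> s 2) = pull M X (XO U) (incl X U) (s 3 \<otimes>\<^bsub>grp M X\<^esub> s 4)"
proof -
  note Ms = ab_sheafD[OF M]
  let ?id = "\<lambda>_ s. s"
  interpret G: comm_group "grp M X" by (rule Ms(1)[OF Sm_X])
  have pX: "opn X pt_set" using openin_topspace[of "sp X"] by simp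
  have mid: "model_mor k X ?id X ?id (mor_id X)"
    unfolding model_mor_def using is_mor_id[OF ringed_space_curve str_X]
    by (auto simp: pre_id) (simp add: mor_id_def)
  have refl: "((X, ?id, x), (X, ?id, x)) \<in> fsec_rel k M F i" if "x \<in> carrier (grp M X)" for x
    unfolding fsec_rel_def fsecs_def using field_model_X that mid by auto
  have c12: "s 1 \<otimes>\<^bsub>grp M X\<^esub> s 2 \<in> carrier (grp M X)" using s by simp
  \<comment> \<open>Products in the colimit are formed from representatives over one model;
    \<open>s 1\<close> and \<open>s 2\<close> both live on \<open>X\<close> and may be multiplied
    there.\<close>
  have "(X, ?id, s 1 \<otimes>\<^bsub>grp M X\<^esub> s 2) \<in>
      eval_class k M F i X ?id (s 1) \<otimes>\<^bsub>eval_fld k M F i\<^esub> eval_class k M F i X ?id (s 2)"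
    unfolding eval_fld_def eval_class_def monoid.simps
    using refl[OF s[of 1]] refl[OF s[of 2]] refl[OF c12] by blast
  then have "(X, ?id, s 1 \<otimes>\<^bsub>grp M X\<^esub> s 2) \<in>
      eval_class k M F i X ?id (s 3) \<otimes>\<^bsub>eval_fld k M F i\<^esub> eval_class k M F i X ?id (s 4)" using eq by simp
  then obtain Y \<delta> t t' where Y: "((X, ?id, s 3), (Y, \<delta>, t)) \<in> fsec_rel k M F i"
    "((X, ?id, s 4), (Y, \<delta>, t')) \<in> fsec_rel k M F i"
    "((Y, \<delta>, t \<otimes>\<^bsub>grp M Y\<^esub> t'), (X, ?id, s 1 \<otimes>\<^bsub>grp M X\<^esub> s 2)) \<in> fsec_rel k M F i"
    unfolding eval_fld_def eval_class_def monoid.simps by auto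
  \<comment> \<open>The relation is turned around by exchanging the two morphisms from the common
    model.\<close>
  have "((X, ?id, s 1 \<otimes>\<^bsub>grp M X\<^esub> s 2), (Y, \<delta>, t \<otimes>\<^bsub>grp M Y\<^esub> t')) \<in> fsec_rel k M F i"
  proof -
    obtain Z \<zeta> f g where "field_model k F i Z \<zeta>" "model_mor k Z \<zeta> Y \<delta> f" "model_mor k Z \<zeta> X ?id g"
      "pull M Y Z f (t \<otimes>\<^bsub>grp M Y\<^esub> t') = pull M X Z g (s 1 \<otimes>\<^bsub>grp M X\<^esub> s 2)"
      using Y(3) by (auto simp: fsec_rel_def)
    then have "\<exists>Z \<zeta> g f. field_model k F i Z \<zeta> \<and> model_mor k Z \<zeta> X ?id g \<and> model_mor k Z \<zeta> Y \<delta> f \<and>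
        pull M X Z g (s 1 \<otimes>\<^bsub>grp M X\<^esub> s 2) = pull M Y Z f (t \<otimes>\<^bsub>grp M Y\<^esub> t')" by metis
    then show ?thesis using Y(3) by (simp add: fsec_rel_def)
  qed
  then obtain U where U: "opn X U" "U \<noteq> {}"
    "pull M X (XO U) (incl X U) (s 3 \<otimes>\<^bsub>grp M X\<^esub> s 4) = pull M X (XO U) (incl X U) (s 1 \<otimes>\<^bsub>grp M X\<^esub> s 2)"
    by (rule rel_mult[OF M Y(1,2)])
  show ?thesis by (rule that[OF U(1,2) U(3)[symmetric]])
qed

section \<open>The pre-Bloch group\<close>

lemma (in field) one_minus_quotient:
  assumes "p \<in> carrier R" "q \<in> carrier R" "p \<noteq> \<zero>"
  shows "\<one> \<ominus> q \<otimes> inv p = (p \<ominus> q) \<otimes> inv p"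
proof -
  have "inv p \<in> carrier R" "p \<otimes> inv p = \<one>" using assms field_Units by auto
  then show ?thesis using assms(1,2) by (simp add: minus_eq l_distr l_minus)
qed

lemma (in field) one_minus_swap:
  assumes "x \<in> carrier R"
  shows "\<one> \<ominus> (\<one> \<ominus> x) = x"
  using assms by algebra

lemma (in field) cross_difference:
  assumes "x \<in> carrier R" "y \<in> carrier R"
  shows "x \<otimes> (\<one> \<ominus> y) \<ominus> y \<otimes> (\<one> \<ominus> x) = x \<ominus> y" "\<one> \<ominus> y \<ominus> (\<one> \<ominus> x) = x \<ominus> y"
  using assms by algebra+

lemma (in field) minus_nz: "x \<in> carrier R \<Longrightarrow> y \<in> carrier R \<Longrightarrow> x \<noteq> y \<Longrightarrow> x \<ominus> y \<in> carrier R - {\<zero>}"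
  using r_right_minus_eq by simp

lemma (in field) nz_times: "a \<in> carrier R - {\<zero>} \<Longrightarrow> b \<in> carrier R - {\<zero>} \<Longrightarrow> a \<otimes> b \<in> carrier R - {\<zero>}"
  using integral by auto

text \<open>For each of the three quotients \<open>z\<close> in the relation, \<open>1 - z\<close>
  is \<open>x - y\<close> divided by a nonzero element. So \<open>z\<close> is not 1 and the symbol
  \<open>{z}\<close> is indeed a generator.\<close>

lemma (in field) bloch_entries:
  assumes x: "x \<in> Units R - {\<one>}" and y: "y \<in> Units R - {\<one>}" and ne: "x \<noteq> y"
  shows "y \<otimes> inv x \<in> Units R - {\<one>}"
    "(\<one> \<ominus> x) \<otimes> inv (\<one> \<ominus> y) \<in> Units R - {\<one>}"
    "(y \<otimes> (\<one> \<ominus> x)) \<otimes> inv (x \<otimes> (\<one> \<ominus> y)) \<in> Units R - {\<one>}"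
    "\<one> \<ominus> y \<otimes> inv x = (x \<ominus> y) \<otimes> inv x"
    "\<one> \<ominus> (\<one> \<ominus> x) \<otimes> inv (\<one> \<ominus> y) = (x \<ominus> y) \<otimes> inv (\<one> \<ominus> y)"
    "\<one> \<ominus> (y \<otimes> (\<one> \<ominus> x)) \<otimes> inv (x \<otimes> (\<one> \<ominus> y)) = (x \<ominus> y) \<otimes> inv (x \<otimes> (\<one> \<ominus> y))"
proof -
  have c: "x \<in> carrier R - {\<zero>}" "y \<in> carrier R - {\<zero>}" using x y field_Units by auto
  then have c': "\<one> \<ominus> x \<in> carrier R - {\<zero>}" "\<one> \<ominus> y \<in> carrier R - {\<zero>}" "x \<ominus> y \<in> carrier R - {\<zero>}"
    using minus_nz[of \<one> x] minus_nz[of \<one> y] minus_nz[of x y] x y ne by auto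
  have p: "x \<otimes> (\<one> \<ominus> y) \<in> carrier R - {\<zero>}" "y \<otimes> (\<one> \<ominus> x) \<in> carrier R - {\<zero>}"
    using c c' nz_times by blast+
  show e: "\<one> \<ominus> y \<otimes> inv x = (x \<ominus> y) \<otimes> inv x"
    "\<one> \<ominus> (\<one> \<ominus> x) \<otimes> inv (\<one> \<ominus> y) = (x \<ominus> y) \<otimes> inv (\<one> \<ominus> y)"
    "\<one> \<ominus> (y \<otimes> (\<one> \<ominus> x)) \<otimes> inv (x \<otimes> (\<one> \<ominus> y)) = (x \<ominus> y) \<otimes> inv (x \<otimes> (\<one> \<ominus> y))"
    using one_minus_quotient[of x y] one_minus_quotient[of "\<one> \<ominus> y" "\<one> \<ominus> x"]
      one_minus_quotient[of "x \<otimes> (\<one> \<ominus> y)" "y \<otimes> (\<one> \<ominus> x)"] c c' p cross_difference[of x y] by auto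
  have *: "a \<otimes> inv b \<in> Units R - {\<one>}"
    if a: "a \<in> carrier R - {\<zero>}" and b: "b \<in> carrier R - {\<zero>}" and "\<one> \<ominus> a \<otimes> inv b = (x \<ominus> y) \<otimes> inv b" for a b
  proof -
    have bu: "b \<in> Units R" using b field_Units by simp
    then have i: "inv b \<in> Units R" "a \<in> Units R" "x \<ominus> y \<in> Units R" using a c'(3) Units_inv_Units[OF bu] field_Units by simp_all
    then have "\<one> \<ominus> a \<otimes> inv b \<in> Units R" unfolding that(3) by simp
    moreover have "\<one> \<ominus> \<one> \<notin> Units R" using field_Units by (simp add: minus_eq r_neg)
    ultimately have "a \<otimes> inv b \<noteq> \<one>" by metis
    then show ?thesis using Units_m_closed[OF i(2) Units_inv_Units[OF bu]] by simp
  qed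
  show "y \<otimes> inv x \<in> Units R - {\<one>}" "(\<one> \<ominus> x) \<otimes> inv (\<one> \<ominus> y) \<in> Units R - {\<one>}"
    "(y \<otimes> (\<one> \<ominus> x)) \<otimes> inv (x \<otimes> (\<one> \<ominus> y)) \<in> Units R - {\<one>}"
    using *[OF c(2,1) e(1)] *[OF c'(1,2) e(2)] *[OF p(2,1) e(3)] .
qed

locale bloch_field = field R for R :: "'u ring" (structure)

lemma (in bloch_field) bloch_rels_carrier: "bloch_rels R \<subseteq> carrier (bloch_free R)"
proof
  fix c assume "c \<in> bloch_rels R"
  then obtain x y where xy: "x \<in> Units R - {\<one>}" "y \<in> Units R - {\<one>}" "x \<noteq> y"
    "c = frag_of x - frag_of y + frag_of (y \<otimes> inv x)
        + frag_of ((\<one> \<ominus> x) \<otimes> inv (\<one> \<ominus> y)) - frag_of ((y \<otimes> (\<one> \<ominus> x)) \<otimes> inv (x \<otimes> (\<one> \<ominus> y)))"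
    by (auto simp: bloch_rels_def)
  note b = bloch_entries(1,2,3)[OF xy(1-3)]
  have add: "Poly_Mapping.keys (f + g) \<subseteq> S" if "Poly_Mapping.keys f \<subseteq> S" "Poly_Mapping.keys g \<subseteq> S"
    for f g :: "'u \<Rightarrow>\<^sub>0 int" and S using that keys_add[of f g] by blast
  have diff: "Poly_Mapping.keys (f - g) \<subseteq> S" if "Poly_Mapping.keys f \<subseteq> S" "Poly_Mapping.keys g \<subseteq> S"
    for f g :: "'u \<Rightarrow>\<^sub>0 int" and S using that keys_diff[of f g] by blast
  show "c \<in> carrier (bloch_free R)"
    unfolding xy(4) bloch_free_def carrier_free_Abelian_group_iff
    by (intro add diff) (use xy(1,2) b in simp_all)
qed

text \<open>The map \<open>{x} \<mapsto> v(x) w(1 - x) - w(x) v(1 - x)\<close> respects the five-term relation,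
  because for every entry \<open>z\<close> both \<open>z\<close> and \<open>1 - z\<close> are monomials in \<open>x, y, 1 - x, 1 - y, x - y\<close>.\<close>

lemma (in bloch_field) bloch_symbol_ne_one:
  fixes v w :: "'u \<Rightarrow> int"
  assumes v: "\<And>a b. a \<in> carrier R - {\<zero>} \<Longrightarrow> b \<in> carrier R - {\<zero>} \<Longrightarrow> v (a \<otimes> b) = v a + v b"
    and w: "\<And>a b. a \<in> carrier R - {\<zero>} \<Longrightarrow> b \<in> carrier R - {\<zero>} \<Longrightarrow> w (a \<otimes> b) = w a + w b"
    and z: "z \<noteq> \<one>" "v z * w (\<one> \<ominus> z) \<noteq> w z * v (\<one> \<ominus> z)"
  shows "bloch_symbol R z \<noteq> bloch_symbol R \<one>"
proof
  define \<psi> where "\<psi> x = v x * w (\<one> \<ominus> x) - w x * v (\<one> \<ominus> x)" for x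
  \<comment> \<open>The target is the free abelian group on one generator, a copy of the integers to
    which \<open>frag_extend\<close> applies.\<close>
  define \<Psi> where "\<Psi> = frag_extend (\<lambda>x. frag_cmul (\<psi> x) (frag_of ()))"
  have \<Psi>_of: "\<Psi> (frag_of x) = frag_cmul (\<psi> x) (frag_of ())" for x by (simp add: \<Psi>_def)
  have quot: "u (a \<otimes> inv b) = u a - u b" if "a \<in> carrier R - {\<zero>}" "b \<in> carrier R - {\<zero>}"
    and u: "\<forall>a\<in>carrier R - {\<zero>}. \<forall>b\<in>carrier R - {\<zero>}. u (a \<otimes> b) = u a + u b" for a b and u :: "'u \<Rightarrow> int"
  proof -
    have 1: "\<one> \<in> carrier R - {\<zero>}" and i: "inv b \<in> carrier R - {\<zero>}" "b \<otimes> inv b = \<one>"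
      using that(2) Units_inv_Units[of b] field_Units by auto
    have "u \<one> = 0" using bspec[OF bspec[OF u 1] 1] by simp
    then show ?thesis using bspec[OF bspec[OF u that(1)] i(1)] bspec[OF bspec[OF u that(2)] i(1)] i(2) by simp
  qed
  have rel: "\<Psi> c = 0" if "c \<in> bloch_rels R" for c
  proof -
    obtain x y where xy: "x \<in> Units R - {\<one>}" "y \<in> Units R - {\<one>}" "x \<noteq> y"
      "c = frag_of x - frag_of y + frag_of (y \<otimes> inv x)
        + frag_of ((\<one> \<ominus> x) \<otimes> inv (\<one> \<ominus> y)) - frag_of ((y \<otimes> (\<one> \<ominus> x)) \<otimes> inv (x \<otimes> (\<one> \<ominus> y)))"
      using \<open>c \<in> bloch_rels R\<close> by (auto simp: bloch_rels_def)
    have c: "x \<in> carrier R - {\<zero>}" "y \<in> carrier R - {\<zero>}" using xy(1,2) field_Units by auto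
    then have c': "\<one> \<ominus> x \<in> carrier R - {\<zero>}" "\<one> \<ominus> y \<in> carrier R - {\<zero>}" "x \<ominus> y \<in> carrier R - {\<zero>}"
      using minus_nz[of \<one> x] minus_nz[of \<one> y] minus_nz[of x y] xy(1-3) by auto
    have p: "x \<otimes> (\<one> \<ominus> y) \<in> carrier R - {\<zero>}" "y \<otimes> (\<one> \<ominus> x) \<in> carrier R - {\<zero>}"
      using c c' nz_times by blast+
    note e = bloch_entries(4-6)[OF xy(1-3)]
    have u: "u (y \<otimes> inv x) = u y - u x" "u ((\<one> \<ominus> x) \<otimes> inv (\<one> \<ominus> y)) = u (\<one> \<ominus> x) - u (\<one> \<ominus> y)"
      "u ((y \<otimes> (\<one> \<ominus> x)) \<otimes> inv (x \<otimes> (\<one> \<ominus> y))) = u y + u (\<one> \<ominus> x) - (u x + u (\<one> \<ominus> y))"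
      "u (\<one> \<ominus> y \<otimes> inv x) = u (x \<ominus> y) - u x"
      "u (\<one> \<ominus> (\<one> \<ominus> x) \<otimes> inv (\<one> \<ominus> y)) = u (x \<ominus> y) - u (\<one> \<ominus> y)"
      "u (\<one> \<ominus> (y \<otimes> (\<one> \<ominus> x)) \<otimes> inv (x \<otimes> (\<one> \<ominus> y))) = u (x \<ominus> y) - (u x + u (\<one> \<ominus> y))"
      if u: "\<forall>a\<in>carrier R - {\<zero>}. \<forall>b\<in>carrier R - {\<zero>}. u (a \<otimes> b) = u a + u b" for u :: "'u \<Rightarrow> int"
    proof -
      note m = bspec[OF bspec[OF u]]
      show "u (y \<otimes> inv x) = u y - u x" "u ((\<one> \<ominus> x) \<otimes> inv (\<one> \<ominus> y)) = u (\<one> \<ominus> x) - u (\<one> \<ominus> y)"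
        "u ((y \<otimes> (\<one> \<ominus> x)) \<otimes> inv (x \<otimes> (\<one> \<ominus> y))) = u y + u (\<one> \<ominus> x) - (u x + u (\<one> \<ominus> y))"
        using quot[OF c(2,1) u] quot[OF c'(1,2) u] quot[OF p(2,1) u] m[OF c(1) c'(2)] m[OF c(2) c'(1)] by simp_all
      show "u (\<one> \<ominus> y \<otimes> inv x) = u (x \<ominus> y) - u x"
        "u (\<one> \<ominus> (\<one> \<ominus> x) \<otimes> inv (\<one> \<ominus> y)) = u (x \<ominus> y) - u (\<one> \<ominus> y)"
        "u (\<one> \<ominus> (y \<otimes> (\<one> \<ominus> x)) \<otimes> inv (x \<otimes> (\<one> \<ominus> y))) = u (x \<ominus> y) - (u x + u (\<one> \<ominus> y))"
        unfolding e using quot[OF c'(3) c(1) u] quot[OF c'(3,2) u] quot[OF c'(3) p(1) u] m[OF c(1) c'(2)] by simp_all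
    qed
    have v': "\<forall>a\<in>carrier R - {\<zero>}. \<forall>b\<in>carrier R - {\<zero>}. v (a \<otimes> b) = v a + v b"
      and w': "\<forall>a\<in>carrier R - {\<zero>}. \<forall>b\<in>carrier R - {\<zero>}. w (a \<otimes> b) = w a + w b" using v w by blast+
    have "\<psi> x - \<psi> y + \<psi> (y \<otimes> inv x) + \<psi> ((\<one> \<ominus> x) \<otimes> inv (\<one> \<ominus> y)) - \<psi> ((y \<otimes> (\<one> \<ominus> x)) \<otimes> inv (x \<otimes> (\<one> \<ominus> y))) = 0"
      unfolding \<psi>_def u[OF v'] u[OF w'] by (simp add: algebra_simps)
    then show ?thesis unfolding xy(4)
      by (simp add: \<Psi>_def frag_extend_add frag_extend_diff flip: frag_cmul_distrib frag_cmul_diff_distrib)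
  qed
  have gen: "\<Psi> c = 0" if "c \<in> generate (bloch_free R) (bloch_rels R)" for c
    using that
  proof (induction rule: generate.induct)
    case (inv h)
    then have "h \<in> carrier (bloch_free R)" using bloch_rels_carrier by blast
    then show ?case using rel[OF inv] by (simp add: bloch_free_def \<Psi>_def frag_extend_minus)
  qed (simp_all add: rel, simp_all add: bloch_free_def \<Psi>_def frag_extend_add)
  assume "bloch_symbol R z = bloch_symbol R \<one>"
  then have "generate (bloch_free R) (bloch_rels R) #>\<^bsub>bloch_free R\<^esub> frag_of z = generate (bloch_free R) (bloch_rels R)"
    using z(1) by (simp add: bloch_symbol_def quot_class_def pre_bloch_def quot_by_def FactGroup_def)
  moreover have "frag_of z \<in> generate (bloch_free R) (bloch_rels R) #>\<^bsub>bloch_free R\<^esub> frag_of z"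
    using generate.one[of "bloch_free R" "bloch_rels R"] unfolding r_coset_def by (force simp: bloch_free_def)
  ultimately have "\<Psi> (frag_of z) = 0" using gen by blast
  then show False using z(2) by (simp add: \<Psi>_of \<psi>_def)
qed

lemma (in bloch_field) bloch_normal:
  "comm_group (bloch_free R)" "normal (generate (bloch_free R) (bloch_rels R)) (bloch_free R)"
proof -
  show c: "comm_group (bloch_free R)" by (simp add: bloch_free_def abelian_free_Abelian_group)
  then interpret G: comm_group "bloch_free R" .
  show "normal (generate (bloch_free R) (bloch_rels R)) (bloch_free R)"
    by (intro G.subgroup_imp_normal G.generate_is_subgroup bloch_rels_carrier)
qed

lemma (in bloch_field) bloch_symbol_closed:
  assumes "z \<in> Units R"
  shows "bloch_symbol R z \<in> carrier (fobj pre_bloch R)"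
proof -
  interpret N: normal "generate (bloch_free R) (bloch_rels R)" "bloch_free R" by (rule bloch_normal)
  have e: "fobj pre_bloch R = bloch_free R Mod generate (bloch_free R) (bloch_rels R)"
    by (simp add: pre_bloch_def quot_by_def)
  show ?thesis
  proof (cases "z = \<one>")
    case True
    then show ?thesis using monoid.one_closed[OF group.is_monoid[OF N.factorgroup_is_group]] e by (simp add: bloch_symbol_def)
  next
    case False
    then have "frag_of z \<in> carrier (bloch_free R)" using assms by (simp add: bloch_free_def)
    then show ?thesis using False e by (simp add: bloch_symbol_def quot_class_def carrier_FactGroup)
  qed
qed

text \<open>The relations attached to \<open>(x, y)\<close> and to \<open>(1 - y, 1 - x)\<close> share their last three terms.\<close>

lemma (in bloch_field) bloch_reflection:
  assumes x: "x \<in> Units R - {\<one>}" and y: "y \<in> Units R - {\<one>}" and ne: "x \<noteq> y"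
  shows "bloch_symbol R x \<otimes>\<^bsub>fobj pre_bloch R\<^esub> bloch_symbol R (\<one> \<ominus> x) =
    bloch_symbol R y \<otimes>\<^bsub>fobj pre_bloch R\<^esub> bloch_symbol R (\<one> \<ominus> y)"
proof -
  let ?G = "bloch_free R" and ?H = "generate (bloch_free R) (bloch_rels R)"
  interpret N: normal ?H ?G by (rule bloch_normal)
  have c: "x \<in> carrier R - {\<zero>}" "y \<in> carrier R - {\<zero>}" using x y field_Units by auto
  have u: "\<one> \<ominus> z \<in> Units R - {\<one>}" if "z \<in> Units R - {\<one>}" for z
  proof -
    have z: "z \<in> carrier R - {\<zero>}" using that field_Units by auto
    have "\<one> \<ominus> z \<in> carrier R - {\<zero>}" using minus_nz[of \<one> z] that z by auto
    moreover have "\<one> \<ominus> z \<noteq> \<one>" using one_minus_swap[of z] z by auto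
    ultimately show ?thesis using field_Units by auto
  qed
  have ne': "\<one> \<ominus> y \<noteq> \<one> \<ominus> x" using one_minus_swap[of x] one_minus_swap[of y] c ne by auto
  define r where "r x y = frag_of x - frag_of y + frag_of (y \<otimes> inv x)
        + frag_of ((\<one> \<ominus> x) \<otimes> inv (\<one> \<ominus> y)) - frag_of ((y \<otimes> (\<one> \<ominus> x)) \<otimes> inv (x \<otimes> (\<one> \<ominus> y)))" for x y
  have rel: "r a b \<in> ?H" if "a \<in> Units R - {\<one>}" "b \<in> Units R - {\<one>}" "a \<noteq> b" for a b
    unfolding r_def bloch_rels_def by (intro generate.incl CollectI exI[of _ a] exI[of _ b] conjI refl that)
  note r = rel[OF x y ne] rel[OF u[OF y] u[OF x] ne']
  have "r (\<one> \<ominus> y) (\<one> \<ominus> x) = frag_of (\<one> \<ominus> y) - frag_of (\<one> \<ominus> x) + frag_of ((\<one> \<ominus> x) \<otimes> inv (\<one> \<ominus> y))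
        + frag_of (y \<otimes> inv x) - frag_of ((y \<otimes> (\<one> \<ominus> x)) \<otimes> inv (x \<otimes> (\<one> \<ominus> y)))"
    unfolding r_def using one_minus_swap c u[OF x] u[OF y] by (simp add: m_comm)
  then have d: "r x y - r (\<one> \<ominus> y) (\<one> \<ominus> x) + (frag_of y + frag_of (\<one> \<ominus> y)) = frag_of x + frag_of (\<one> \<ominus> x)"
    by (simp add: r_def)
  have rc: "r (\<one> \<ominus> y) (\<one> \<ominus> x) \<in> carrier ?G" using r(2) by (rule N.mem_carrier)
  have h: "r x y - r (\<one> \<ominus> y) (\<one> \<ominus> x) \<in> ?H"
    using subgroup.m_closed[OF N.subgroup_axioms r(1) subgroup.m_inv_closed[OF N.subgroup_axioms r(2)]] rc by (simp add: bloch_free_def)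
  have fr: "frag_of z \<in> carrier ?G" if "z \<in> Units R - {\<one>}" for z using that by (simp add: bloch_free_def)
  have prod: "bloch_symbol R z \<otimes>\<^bsub>fobj pre_bloch R\<^esub> bloch_symbol R (\<one> \<ominus> z) = ?H #>\<^bsub>?G\<^esub> (frag_of z + frag_of (\<one> \<ominus> z))"
    if z: "z \<in> Units R - {\<one>}" for z
    using N.rcos_sum[OF fr[OF z] fr[OF u[OF z]]] z u[OF z]
    by (simp add: bloch_symbol_def quot_class_def pre_bloch_def quot_by_def FactGroup_def) (simp add: bloch_free_def)
  have yc: "frag_of y + frag_of (\<one> \<ominus> y) \<in> carrier ?G"
    using N.m_closed[OF fr[OF y] fr[OF u[OF y]]] by (simp add: bloch_free_def)
  have "?H #>\<^bsub>?G\<^esub> (frag_of x + frag_of (\<one> \<ominus> x)) = (?H #>\<^bsub>?G\<^esub> (r x y - r (\<one> \<ominus> y) (\<one> \<ominus> x))) #>\<^bsub>?G\<^esub> (frag_of y + frag_of (\<one> \<ominus> y))"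
    unfolding d[symmetric] using N.coset_mult_assoc[OF N.subset N.mem_carrier[OF h] yc] by (simp add: bloch_free_def)
  also have "?H #>\<^bsub>?G\<^esub> (r x y - r (\<one> \<ominus> y) (\<one> \<ominus> x)) = ?H" by (rule N.rcos_const[OF N.is_group h])
  finally show ?thesis using prod[OF x] prod[OF y] by simp
qed

section \<open>The class of the coordinate in the pre-Bloch group of k(t)\<close>

context affine_line
begin

text \<open>\<open>F\<close> is generated as a field by \<open>k\<close> and \<open>t\<close>, so
  every element lies in the generated subfield and is algebraic over it.\<close>

lemma fin_trdeg_line: "fin_trdeg_ext k F i"
proof -
  let ?B = "F\<lparr>carrier := reg F ord Cl\<rparr>" and ?S = "i ` carrier k \<union> {t}"
  let ?E = "generate_field F ?S"
  have sB: "subring (reg F ord Cl) F" by (rule subring_reg) blast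
  have sub: "?S \<subseteq> carrier F"
    using ring_hom_closed[OF i_hom] e_closed[OF T_closed] reg_subset[of Cl] by (auto simp: t_def)
  have E: "subfield ?E F" by (rule F.generate_field_is_subfield[OF sub])
  have 1: "x \<in> ?E" if "x \<in> generate_ring ?B ?S" for x
    using that
  proof (induction rule: generate_ring.induct)
    case (a_inv h)
    then have "h \<in> reg F ord Cl" using generate_line by simp
    then show ?case using F.a_inv_subring[OF sB] generate_field.a_inv[OF a_inv(2)] by simp
  qed (auto intro: generate_field.intros)
  have 2: "e a \<in> ?E" if "a \<in> carrier (UP k)" for a
    using 1[of "e a"] that unfolding generate_line by (simp add: reg_eq)
  have "x \<in> ?E" if x: "x \<in> carrier F" for x
  proof -
    obtain a b where ab: "a \<in> carrier (UP k)" "b \<in> carrier (UP k) - {\<zero>\<^bsub>UP k\<^esub>}" "x \<otimes>\<^bsub>F\<^esub> e b = e a"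
      using e_frac[OF x] by blast
    have nz: "e b \<in> carrier F - {\<zero>\<^bsub>F\<^esub>}" by (rule e_nz[OF ab(2)])
    then have "inv\<^bsub>F\<^esub> e b \<in> ?E" using 2 ab(2) by (intro generate_field.m_inv) auto
    then have "e a \<otimes>\<^bsub>F\<^esub> inv\<^bsub>F\<^esub> e b \<in> ?E" using 2[OF ab(1)] by (intro generate_field.eng_mult)
    moreover have "inv\<^bsub>F\<^esub> e b \<in> carrier F" "e b \<otimes>\<^bsub>F\<^esub> inv\<^bsub>F\<^esub> e b = \<one>\<^bsub>F\<^esub>" using nz_inv[OF nz] nz_r_inv[OF nz] by auto
    then have "e a \<otimes>\<^bsub>F\<^esub> inv\<^bsub>F\<^esub> e b = x" using x nz unfolding ab(3)[symmetric] by (simp add: F.m_assoc)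
    ultimately show ?thesis by simp
  qed
  then have "\<not> F.transcendental ?E x" if "x \<in> carrier F" for x
    using F.algebraic_self[OF subfieldE(1)[OF E]] that unfolding over_def by blast
  moreover have "i \<in> ring_hom k F" using i_hom reg_subset by (auto simp: ring_hom_def)
  ultimately show ?thesis unfolding fin_trdeg_ext_def
    using F.field_axioms e_closed[OF T_closed] by (intro conjI exI[of _ "{t}"]) (auto simp: t_def)
qed

text \<open>The names of the points \<open>t = 0\<close> and \<open>t = 1\<close>. The polynomials
  \<open>T\<close> and \<open>1 - T\<close> define these points but need not be the selected
  generators of their ideals.\<close>

definition "p0 = e (rp T)"
definition "p1 = e (rp (\<one>\<^bsub>UP k\<^esub> \<ominus>\<^bsub>UP k\<^esub> T))"

lemma ord_degree_one:
  assumes a: "a \<in> carrier (UP k) - {\<zero>\<^bsub>UP k\<^esub>}" "deg k a = 1"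
  shows "e (rp a) \<in> Cl" "\<And>p. p \<in> Cl \<Longrightarrow> ord p (e a) = (if p = e (rp a) then 1 else 0)"
proof -
  have pr: "primeideal (PIdl\<^bsub>UP k\<^esub> a) (UP k)" by (rule degree_one_prime[OF a])
  have r: "rp a \<in> Pr" by (rule rp_Pr[OF a(1) pr])
  then show "e (rp a) \<in> Cl" by (simp add: Cl_def)
  fix p assume "p \<in> Cl"
  then obtain q where q: "q \<in> Pr" "p = e q" by (auto simp: Cl_def)
  have "e q = e (rp a) \<longleftrightarrow> q = rp a" using inj_on_eq_iff[OF e_inj] Pr_carrier[OF q(1)] Pr_carrier[OF r] by auto
  then show "ord p (e a) = (if p = e (rp a) then 1 else 0)"
    using ord_e[OF q(1) a(1)] v_prime[OF a(1) pr q(1)] q(2) by simp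
qed

lemma T_facts:
  "T \<in> carrier (UP k) - {\<zero>\<^bsub>UP k\<^esub>}" "deg k T = 1"
  "\<one>\<^bsub>UP k\<^esub> \<ominus>\<^bsub>UP k\<^esub> T \<in> carrier (UP k) - {\<zero>\<^bsub>UP k\<^esub>}" "deg k (\<one>\<^bsub>UP k\<^esub> \<ominus>\<^bsub>UP k\<^esub> T) = 1"
proof -
  let ?A = "\<one>\<^bsub>UP k\<^esub> \<ominus>\<^bsub>UP k\<^esub> T"
  have "up_ring.coeff (UP k) T 1 \<noteq> up_ring.coeff (UP k) \<zero>\<^bsub>UP k\<^esub> 1" by simp
  then have "T \<noteq> \<zero>\<^bsub>UP k\<^esub>" by metis
  then show "T \<in> carrier (UP k) - {\<zero>\<^bsub>UP k\<^esub>}" by simp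
  show "deg k T = 1" by (simp add: P.deg_monom)
  have A: "?A \<in> carrier (UP k)" by simp
  have "up_ring.coeff (UP k) ?A 1 = \<ominus>\<^bsub>k\<^esub> \<one>\<^bsub>k\<^esub>" by (simp add: minus_eq)
  then have nz: "up_ring.coeff (UP k) ?A 1 \<noteq> \<zero>\<^bsub>k\<^esub>"
    using K.one_not_zero by (metis K.minus_minus K.minus_zero K.one_closed)
  then have "?A \<noteq> \<zero>\<^bsub>UP k\<^esub>" using P.coeff_zero by metis
  then show "?A \<in> carrier (UP k) - {\<zero>\<^bsub>UP k\<^esub>}" using A by blast
  show "deg k ?A = 1"
  proof (rule antisym)
    show "deg k ?A \<le> 1" by (rule P.deg_aboveI[OF _ A]) (simp add: minus_eq)
    show "1 \<le> deg k ?A" by (rule P.deg_belowI[OF nz A])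
  qed
qed

lemma e_one_minus: "e (\<one>\<^bsub>UP k\<^esub> \<ominus>\<^bsub>UP k\<^esub> T) = \<one>\<^bsub>F\<^esub> \<ominus>\<^bsub>F\<^esub> t"
proof -
  interpret H: ring_hom_ring "UP k" F e by (rule ring_hom_ringI2[OF ring_axioms F.ring_axioms e_hom])
  show ?thesis by (simp add: t_def minus_eq F.minus_eq)
qed

lemma t_nz: "t \<in> carrier F - {\<zero>\<^bsub>F\<^esub>}" "\<one>\<^bsub>F\<^esub> \<ominus>\<^bsub>F\<^esub> t \<in> carrier F - {\<zero>\<^bsub>F\<^esub>}"
  using e_nz[OF T_facts(1)] e_nz[OF T_facts(3)] unfolding e_one_minus by (simp_all add: t_def)

lemma points_Cl: "p0 \<in> Cl" "p1 \<in> Cl"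
  using ord_degree_one(1)[OF T_facts(1,2)] ord_degree_one(1)[OF T_facts(3,4)] by (simp_all add: p0_def p1_def)

lemma ord_t:
  assumes "p \<in> Cl"
  shows "ord p t = (if p = p0 then 1 else 0)" "ord p (\<one>\<^bsub>F\<^esub> \<ominus>\<^bsub>F\<^esub> t) = (if p = p1 then 1 else 0)"
  using ord_degree_one(2)[OF T_facts(1,2) assms] ord_degree_one(2)[OF T_facts(3,4) assms]
  unfolding e_one_minus by (simp_all add: p0_def p1_def t_def)

text \<open>Otherwise \<open>1 = t + (1 - t)\<close> would have positive order at the common
  point.\<close>

lemma p0_ne_p1: "p0 \<noteq> p1"
proof
  assume eq: "p0 = p1"
  have "t \<oplus>\<^bsub>F\<^esub> (\<one>\<^bsub>F\<^esub> \<ominus>\<^bsub>F\<^esub> t) = \<one>\<^bsub>F\<^esub>" using t_nz(1) by (simp add: F.minus_eq F.a_lcomm F.r_neg)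
  then have "1 \<le> ord p0 \<one>\<^bsub>F\<^esub>" using ord_add[OF points_Cl(1) t_nz, of 1] ord_t[OF points_Cl(1)] eq by simp
  then show False using ord_one[OF points_Cl(1)] by simp
qed

text \<open>A nonzero constant is invertible in the coordinate ring, so it has neither zeros nor
  poles.\<close>

lemma ord_const:
  assumes "c \<in> carrier k" "c \<noteq> \<zero>\<^bsub>k\<^esub>" "p \<in> Cl"
  shows "i c \<in> carrier F - {\<zero>\<^bsub>F\<^esub>}" "ord p (i c) = 0"
proof -
  have "c \<in> Units k" using K.field_Units assms by simp
  then have "i c \<in> Units (reg_ring F ord pt_set)"
    using ring_hom_Units[OF i_hom K.is_cring] domain.axioms(1)[OF reg_domain] by (simp add: reg_ring_ne)
  then show "i c \<in> carrier F - {\<zero>\<^bsub>F\<^esub>}" "ord p (i c) = 0"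
    using Units_reg[of pt_set] assms(3) zero_notin_Cl by auto
qed

lemma symbol_t_nontrivial: "bloch_symbol F t \<noteq> bloch_symbol F \<one>\<^bsub>F\<^esub>"
proof -
  interpret B: bloch_field F by unfold_locales
  show ?thesis
  proof (rule B.bloch_symbol_ne_one[of "ord p0" "ord p1"])
    show "t \<noteq> \<one>\<^bsub>F\<^esub>" using t_nz(2) t_nz(1) by (metis Diff_iff F.minus_eq F.one_closed F.r_neg singletonI)
    show "ord p0 t * ord p1 (\<one>\<^bsub>F\<^esub> \<ominus>\<^bsub>F\<^esub> t) \<noteq> ord p1 t * ord p0 (\<one>\<^bsub>F\<^esub> \<ominus>\<^bsub>F\<^esub> t)"
      using ord_t[OF points_Cl(1)] ord_t[OF points_Cl(2)] p0_ne_p1 by simp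
  qed (rule ord_mult[OF points_Cl(1)] ord_mult[OF points_Cl(2)]; assumption)+
qed

end

section \<open>Zariski gluing on the curve\<close>

context kcurve
begin

lemma XO_inj: "opn X U \<Longrightarrow> opn X V \<Longrightarrow> XO U = XO V \<Longrightarrow> U = V"
  using pts_open_sub by metis

lemma etale_incl_X:
  assumes U: "opn X U" "U \<noteq> {}"
  shows "etale k (XO U) X (incl X U)"
proof -
  interpret V: kcurve F "U - {\<zero>}" ord k i by (rule kcurve_XO(1)[OF U])
  have "insert \<zero> (U - {\<zero>}) = U" using zero_mem_opn[OF U] by blast
  then have "affine_open (XO U) U"
    using V.affine_open_curve[of i U] openin_topspace[of "sp V.X"] U(2) unfolding kcurve_XO(2)[OF U] by simp
  then show ?thesis by (rule etale_incl[OF ringed_space_curve affine_open_curve[OF U] _ str_X])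
qed

text \<open>A section on an open subset of \<open>U\<close> is also one on \<open>X\<close>, so it
  serves as its own approximation, with difference 0.\<close>

lemma residue_iso_incl:
  assumes U: "opn X U" "U \<noteq> {}" and x: "x \<in> U"
  shows "residue_iso (XO U) X (incl X U) x"
  unfolding residue_iso_def
proof (intro allI impI; elim conjE)
  fix W s assume W: "opn (XO U) W" "x \<in> W" and s: "s \<in> carrier (sec (XO U) W)"
  have oW: "opn X W" "W \<subseteq> U" using W(1) opn_open_sub[OF U(1)] by auto
  interpret X: ringed X using ringed_space_curve by unfold_locales
  have sX: "s \<in> carrier (sec X W)" using s unfolding sec_open_sub .
  interpret R: cring "sec X W" by (rule X.sec_cring[OF oW(1)])
  have p: "pre (XO U) (incl X U) W = W" using pre_incl[OF U(1), of W] oW(2) by auto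
  have sh: "sh (incl X U) W s = s" using sh_incl[OF oW(1) sX, of U] oW W(2) by auto
  have "s \<ominus>\<^bsub>sec X W\<^esub> s = \<zero>\<^bsub>sec X W\<^esub>" using R.r_neg[OF sX] unfolding R.minus_eq .
  then have z: "res (XO U) W W s \<ominus>\<^bsub>sec (XO U) W\<^esub> res (XO U) W W s = \<zero>"
    using W(2) by (auto simp: open_sub_def)
  have "vanishes (XO U) W \<zero> x"
    unfolding vanishes_def
  proof (intro allI impI notI; elim conjE)
    fix V assume V: "opn (XO U) V" "x \<in> V" "V \<subseteq> W" "res (XO U) W V \<zero> \<in> Units (sec (XO U) V)"
    have oV: "V \<subseteq> pt_set" using V(1) openin_subset[of "sp X" V] opn_open_sub[OF U(1)] by auto
    have "\<zero> \<in> Units (reg_ring F ord V)" using V(2,4) by (auto simp: open_sub_def)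
    then show False using Units_reg[OF oV] V(2) by auto
  qed
  then show "\<exists>V t. opn X V \<and> pt (incl X U) x \<in> V \<and> t \<in> carrier (sec X V) \<and>
      vanishes (XO U) (W \<inter> pre (XO U) (incl X U) V)
        (res (XO U) W (W \<inter> pre (XO U) (incl X U) V) s \<ominus>\<^bsub>sec (XO U) (W \<inter> pre (XO U) (incl X U) V)\<^esub>
          res (XO U) (pre (XO U) (incl X U) V) (W \<inter> pre (XO U) (incl X U) V) (sh (incl X U) V t)) x"
    using oW(1) W(2) sX p sh z x by (intro exI[of _ W] exI[of _ s]) (simp add: incl_def)
qed

lemma nis_cover_pair:
  assumes U: "opn X U" "U \<noteq> {}" and V: "opn X V" "V \<noteq> {}" and cov: "U \<union> V = pt_set"
  shows "nis_cover k X {(XO U, incl X U), (XO V, incl X V)}"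
  unfolding nis_cover_def
proof (intro conjI ballI)
  show "case p of (U, f) \<Rightarrow> Sm k U \<and> etale k U X f" if "p \<in> {(XO U, incl X U), (XO V, incl X V)}" for p
    using that Sm_XO[OF U] Sm_XO[OF V] etale_incl_X[OF U] etale_incl_X[OF V] by auto
  fix x assume x: "x \<in> pts X"
  have pt: "pt (incl X W) x = x" if "opn X W" "x \<in> W" for W
    using that by (simp add: incl_def)
  show "\<exists>(W, f)\<in>{(XO U, incl X U), (XO V, incl X V)}. \<exists>u\<in>pts W. pt f u = x \<and> residue_iso W X f u"
  proof (cases "x \<in> U")
    case True
    then show ?thesis using pt[OF U(1)] residue_iso_incl[OF U] pts_open_sub[OF U(1)] by auto
  next
    case False
    then have "x \<in> V" using x cov by auto
    then show ?thesis using pt[OF V(1)] residue_iso_incl[OF V] pts_open_sub[OF V(1)] by auto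
  qed
qed

text \<open>The intersection is the fibre product of the two open immersions. The common composite
  to \<open>X\<close> has its image in both sets, hence factors through the intersection, and the
  triangles commute because inclusions are monomorphisms.\<close>

lemma pair_factors:
  assumes U: "opn X U" "U \<noteq> {}" and V: "opn X V" "V \<noteq> {}" and Y: "ringed_space Y"
    and a: "is_mor k Y (XO U) a" and b: "is_mor k Y (XO V) b"
    and eq: "mor_comp Y (XO U) X (incl X U) a = mor_comp Y (XO V) X (incl X V) b"
  obtains m where "is_mor k Y (XO (U \<inter> V)) m"
    "mor_comp Y (XO (U \<inter> V)) (XO U) (incl (XO U) (U \<inter> V)) m = a"
    "mor_comp Y (XO (U \<inter> V)) (XO V) (incl (XO V) (U \<inter> V)) m = b"
proof -
  let ?D = "U \<inter> V" and ?c = "mor_comp Y (XO U) X (incl X U) a"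
  have D: "opn X ?D" "?D \<noteq> {}" using opn_Int_ne[OF U V] by auto
  have c: "is_mor k Y X ?c"
    by (rule is_mor_comp[OF Y SmD(1)[OF Sm_XO[OF U]] ringed_space_curve a is_mor_incl_X[OF U(1)] str_X])
  have "pre Y ?c ?D = pts Y"
  proof -
    have "pt ?c y \<in> ?D" if y: "y \<in> pts Y" for y
    proof -
      have "pt a y \<in> U" "pt b y \<in> V"
        using mor_pts[OF a y] mor_pts[OF b y] pts_open_sub[OF U(1)] pts_open_sub[OF V(1)] by auto
      moreover have "pt ?c y = pt a y" using y \<open>pt a y \<in> U\<close> by (simp add: pt_comp incl_def)
      moreover have "pt ?c y = pt b y" unfolding eq using y \<open>pt b y \<in> V\<close> by (simp add: pt_comp incl_def)
      ultimately show ?thesis by auto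
    qed
    then show ?thesis by (auto simp: pre_def)
  qed
  then obtain m where m: "is_mor k Y (XO ?D) m" "mor_comp Y (XO ?D) X (incl X ?D) m = ?c"
    by (rule corestrict[OF Y ringed_space_curve D(1) str_X c])
  have fac: "mor_comp Y (XO ?D) (XO W) (incl (XO W) ?D) m = n"
    if W: "opn X W" "W \<noteq> {}" "?D \<subseteq> W" and n: "is_mor k Y (XO W) n" "mor_comp Y (XO W) X (incl X W) n = ?c" for W n
  proof (rule incl_mono[OF ringed_space_curve W(1) _ n(1)])
    note I = incl_incl[OF W(1,2) D W(3)]
    note r = SmD[OF Sm_XO[OF W(1,2)]] and rD = SmD[OF Sm_XO[OF D]]
    show "is_mor k Y (XO W) (mor_comp Y (XO ?D) (XO W) (incl (XO W) ?D) m)"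
      by (rule is_mor_comp[OF Y rD(1) r(1) m(1) I(1) r(2)])
    show "mor_comp Y (XO W) X (incl X W) (mor_comp Y (XO ?D) (XO W) (incl (XO W) ?D) m) = mor_comp Y (XO W) X (incl X W) n"
      unfolding mor_comp_assoc[OF m(1) I(1) is_mor_incl_X[OF W(1)], symmetric] I(3) m(2) n(2) ..
  qed
  show ?thesis by (rule that[OF m(1) fac[OF U _ a refl] fac[OF V _ b eq[symmetric]]]) simp_all
qed

text \<open>The sheaf axiom asks for agreement on every \<open>Y\<close> mapping compatibly to two
  members of the cover. Over one member the two maps are equal; over two different members they
  factor through the intersection, where agreement is assumed.\<close>

lemma zariski_gluing:
  assumes M: "ab_sheaf k M" and U: "opn X U" "U \<noteq> {}" and V: "opn X V" "V \<noteq> {}"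
    and cov: "U \<union> V = pt_set" and ne: "U \<noteq> V"
    and a: "a \<in> carrier (grp M (XO U))" and b: "b \<in> carrier (grp M (XO V))"
    and eq: "pull M (XO U) (XO (U \<inter> V)) (incl (XO U) (U \<inter> V)) a =
      pull M (XO V) (XO (U \<inter> V)) (incl (XO V) (U \<inter> V)) b"
  obtains c where "c \<in> carrier (grp M X)" "pull M X (XO U) (incl X U) c = a"
proof -
  let ?C = "{(XO U, incl X U), (XO V, incl X V)}" and ?D = "U \<inter> V"
  have D: "opn X ?D" "?D \<noteq> {}" using opn_Int_ne[OF U V] by auto
  \<comment> \<open>The family is indexed by the members of the cover. Since \<open>U\<close> and
    \<open>V\<close> differ, so do their schemes, and the case distinction assigns \<open>b\<close>
    to \<open>V\<close>.\<close>
  define s where "s p = (if fst p = XO U then a else b)" for p :: "'a sch \<times> 'a mor"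
  have XV: "XO V \<noteq> XO U" using XO_inj[OF U(1) V(1)] ne by metis
  have s: "s (XO U, f) = a" "s (XO V, f) = b" for f using XV by (auto simp: s_def)
  note Ms = ab_sheafD[OF M]
  have same: "pull M (XO W) Y m x = pull M (XO W) Y n x"
    if "opn X W" "is_mor k Y (XO W) m" "is_mor k Y (XO W) n"
      "mor_comp Y (XO W) X (incl X W) m = mor_comp Y (XO W) X (incl X W) n" for W Y m n x
    using incl_mono[OF ringed_space_curve that] by simp
  have diff: "pull M (XO U) Y m a = pull M (XO V) Y n b"
    if Y: "Sm k Y" and mn: "is_mor k Y (XO U) m" "is_mor k Y (XO V) n"
      "mor_comp Y (XO U) X (incl X U) m = mor_comp Y (XO V) X (incl X V) n" for Y m n
  proof -
    obtain l where l: "is_mor k Y (XO ?D) l" "mor_comp Y (XO ?D) (XO U) (incl (XO U) ?D) l = m"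
      "mor_comp Y (XO ?D) (XO V) (incl (XO V) ?D) l = n"
      by (rule pair_factors[OF U V SmD(1)[OF Y] mn])
    show ?thesis
      unfolding l(2,3)[symmetric]
        Ms(4)[OF Sm_XO[OF U] Sm_XO[OF D] Y incl_incl(1)[OF U D Int_lower1] l(1) a]
        Ms(4)[OF Sm_XO[OF V] Sm_XO[OF D] Y incl_incl(1)[OF V D Int_lower2] l(1) b] eq ..
  qed
  have sheaf: "nis_sheaf k (\<lambda>X. carrier (grp M X)) (pull M)" using M by (simp add: ab_sheaf_def)
  have cd: "\<forall>(W, f)\<in>?C. s (W, f) \<in> carrier (grp M W)" using a b s by simp
  have cp: "\<forall>(W, f)\<in>?C. \<forall>(Z, g)\<in>?C. \<forall>Y m n.
      Sm k Y \<and> is_mor k Y W m \<and> is_mor k Y Z n \<and> mor_comp Y W X f m = mor_comp Y Z X g n \<longrightarrow>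
      pull M W Y m (s (W, f)) = pull M Z Y n (s (Z, g))"
    unfolding ball_simps prod.case s
  proof (intro conjI allI impI TrueI; elim conjE)
  qed (rule same[OF U(1)] same[OF V(1)] diff diff[symmetric]; (assumption | rule sym, assumption))+
  have "\<exists>!c. c \<in> carrier (grp M X) \<and> (\<forall>(W, f)\<in>?C. pull M X W f c = s (W, f))"
    by (rule sheaf[unfolded nis_sheaf_def, THEN conjunct2, THEN spec[where x = X], THEN spec[where x = ?C],
          THEN spec[where x = s], THEN mp]) (intro conjI Sm_X nis_cover_pair[OF U V cov] cd cp)
  then obtain c where "c \<in> carrier (grp M X)" "\<forall>(W, f)\<in>?C. pull M X W f c = s (W, f)" by (elim ex1E) blast
  then show ?thesis using s by (intro that[of c]) auto
qed

end

section \<open>The symbol of the coordinate is constant\<close>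

lemma symbolD:
  assumes "pointed_map k Gm M \<sigma>"
  shows "\<And>Y z. Sm k Y \<Longrightarrow> z \<in> Units (glob Y) \<Longrightarrow> \<sigma> Y z \<in> carrier (grp M Y)"
    and "\<And>Y. Sm k Y \<Longrightarrow> \<sigma> Y \<one>\<^bsub>glob Y\<^esub> = \<one>\<^bsub>grp M Y\<^esub>"
    and "\<And>Y Z f z. Sm k Y \<Longrightarrow> Sm k Z \<Longrightarrow> is_mor k Z Y f \<Longrightarrow> z \<in> Units (glob Y) \<Longrightarrow>
      \<sigma> Z (sh f (pts Y) z) = pull M Y Z f (\<sigma> Y z)"
proof -
  have 1: "\<sigma> Y \<in> Units (glob Y) \<rightarrow> carrier (grp M Y) \<and> \<sigma> Y \<one>\<^bsub>glob Y\<^esub> = \<one>\<^bsub>grp M Y\<^esub>" if "Sm k Y" for Y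
    using assms that unfolding pointed_map_def Gm_def pt_psh.simps by metis
  show "\<And>Y z. Sm k Y \<Longrightarrow> z \<in> Units (glob Y) \<Longrightarrow> \<sigma> Y z \<in> carrier (grp M Y)"
    "\<And>Y. Sm k Y \<Longrightarrow> \<sigma> Y \<one>\<^bsub>glob Y\<^esub> = \<one>\<^bsub>grp M Y\<^esub>"
    using 1 by blast+
  show "\<And>Y Z f z. Sm k Y \<Longrightarrow> Sm k Z \<Longrightarrow> is_mor k Z Y f \<Longrightarrow> z \<in> Units (glob Y) \<Longrightarrow>
      \<sigma> Z (sh f (pts Y) z) = pull M Y Z f (\<sigma> Y z)"
    using assms unfolding pointed_map_def Gm_def pt_psh.simps by metis
qed

section \<open>Symbols on open subsets, and the point as a terminal object\<close>

context kcurve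
begin

lemma glob_XO: "opn X U \<Longrightarrow> glob (XO U) = reg_ring F ord U"
  by (simp add: pts_open_sub)

lemma symbol_closed:
  assumes \<sigma>: "pointed_map k Gm M \<sigma>" and U: "opn X U" "U \<noteq> {}" and z: "z \<in> Units (reg_ring F ord U)"
  shows "\<sigma> (XO U) z \<in> carrier (grp M (XO U))"
  by (rule symbolD(1)[OF \<sigma> Sm_XO[OF U]]) (use z glob_XO[OF U(1)] in simp)

lemma symbol_restrict:
  assumes \<sigma>: "pointed_map k Gm M \<sigma>" and U: "opn X U" "U \<noteq> {}" and W: "opn X W" "W \<noteq> {}" "W \<subseteq> U"
    and z: "z \<in> Units (reg_ring F ord U)"
  shows "pull M (XO U) (XO W) (incl (XO U) W) (\<sigma> (XO U) z) = \<sigma> (XO W) z"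
proof -
  have "\<sigma> (XO W) (sh (incl (XO U) W) (pts (XO U)) z) = pull M (XO U) (XO W) (incl (XO U) W) (\<sigma> (XO U) z)"
    by (rule symbolD(3)[OF \<sigma> Sm_XO[OF U] Sm_XO[OF W(1,2)] incl_incl(1)[OF U W]]) (use z glob_XO[OF U(1)] in simp)
  moreover have "sh (incl (XO U) W) (pts (XO U)) z = z"
  proof -
    have "z \<in> carrier (reg_ring F ord U)" using z by (simp add: Units_def)
    moreover have "opn (XO U) U" using opn_open_sub[OF U(1)] U(1) by simp
    moreover have "W \<inter> U \<noteq> {}" using W(2,3) by blast
    ultimately show ?thesis using sh_incl[of "XO U" U z W] pts_open_sub[OF U(1)] W(2) by (simp add: open_sub_def)
  qed
  ultimately show ?thesis by simp
qed

text \<open>All functions on the point are constants, and morphisms over \<open>k\<close> are fixed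
  on constants.\<close>

lemma mor_to_point_unique:
  fixes S :: "'a sch"
  defines "S \<equiv> curve_sch k (\<lambda>_ _. 0) (\<lambda>c. c) {}"
  assumes "ringed_space T" "is_mor k T S m" "is_mor k T S m'"
  shows "m = m'"
proof -
  interpret O: kcurve k "{}" "\<lambda>_ _. 0" k "\<lambda>c. c" by (rule kcurve_point[OF k_field inf])
  show ?thesis
  proof (rule O.mor_to_X_unique[OF assms(2) assms(3,4)[unfolded S_def]])
    fix s assume "s \<in> reg k (\<lambda>_ _. 0) {}"
    then have "s \<in> carrier k" using O.reg_subset by blast
    then show "sh m (insert \<zero>\<^bsub>k\<^esub> {}) s = sh m' (insert \<zero>\<^bsub>k\<^esub> {}) s"
      using mor_str[OF assms(3), of s] mor_str[OF assms(4), of s] by (simp add: S_def)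
  qed
qed

lemma ex_mor_to_point:
  obtains q where "is_mor k X (curve_sch k (\<lambda>_ _. 0) (\<lambda>c. c) {}) q"
proof -
  interpret O: kcurve k "{}" "\<lambda>_ _. 0" k "\<lambda>c. c" by (rule kcurve_point[OF k_field inf])
  have reg: "carrier (sec O.X (insert \<zero>\<^bsub>k\<^esub> {})) = carrier k" by (simp add: O.carrier_reg_ring reg_def)
  have i': "i \<in> ring_hom (sec O.X (insert \<zero>\<^bsub>k\<^esub> {})) (F\<lparr>carrier := reg F ord Cl\<rparr>)"
    using i_hom reg by (simp add: ring_hom_def)
  obtain q where "is_mor k X O.X q"
    by (rule ex_mor[OF O.ringed_chart_X i' O.str_X]) (simp, rule that)
  then show ?thesis by (rule that)
qed

text \<open>The point is terminal, so the product with it is \<open>X\<close> itself. Invariance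
  over the base \<open>Spec k\<close> thereby becomes a statement about the pullback along the
  structure morphism of the line.\<close>

lemma is_product_point:
  assumes q: "is_mor k X (curve_sch k (\<lambda>_ _. 0) (\<lambda>c. c) {}) q"
  shows "is_product k X (curve_sch k (\<lambda>_ _. 0) (\<lambda>c. c) {}) X (mor_id X) q"
proof -
  interpret O: kcurve k "{}" "\<lambda>_ _. 0" k "\<lambda>c. c" by (rule kcurve_point[OF k_field inf])
  have "\<exists>!m. is_mor k T X m \<and> mor_comp T X X (mor_id X) m = a \<and> mor_comp T X O.X q m = b"
    if T: "kscheme k T" and ab: "is_mor k T X a" "is_mor k T O.X b" for T a b
  proof -
    have rT: "ringed_space T" using T by (simp add: kscheme_def)
    have "is_mor k T O.X (mor_comp T X O.X q a)"
      by (rule is_mor_comp[OF rT ringed_space_curve O.ringed_space_curve ab(1) q O.str_X])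
    then have "mor_comp T X O.X q a = b" using mor_to_point_unique[OF rT _ ab(2)] by blast
    then show ?thesis using ab(1) mor_comp_id_left by metis
  qed
  then show ?thesis unfolding is_product_def
    using kscheme_X is_mor_id[OF ringed_space_curve str_X] q by auto
qed

end

section \<open>The point t = 1 and the value of an extended symbol\<close>

context affine_line
begin

abbreviation "Spt \<equiv> curve_sch k (\<lambda>_ _. 0) (\<lambda>c. c) {}"
abbreviation "Gt \<equiv> pt_set - {p0}"

lemma t_reg: "t \<in> reg F ord Cl"
  by (simp add: t_def reg_eq)

lemma Gt: "opn X Gt" "Gt \<noteq> {}" "Gt = {x\<in>pt_set. t \<notin> max_at F ord Cl x}"
proof -
  have "finite (Cl - Gt)" by (rule finite_subset[of _ "{p0}"]) auto
  moreover have "p0 \<noteq> \<zero>\<^bsub>F\<^esub>" using points_Cl(1) zero_notin_Cl by metis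
  ultimately show "opn X Gt" "Gt \<noteq> {}" unfolding opn_curve by auto
  show "Gt = {x\<in>pt_set. t \<notin> max_at F ord Cl x}"
    using \<open>p0 \<noteq> \<zero>\<^bsub>F\<^esub>\<close> ord_t(1) t_reg t_nz(1) points_Cl(1) by (auto simp: max_at_def split: if_splits)
qed

text \<open>Evaluation at \<open>t = 1\<close> sends \<open>t\<close> to a unit, so it extends to
  the localization at \<open>t\<close>, the ring of the complement of \<open>t = 0\<close>.\<close>

lemma ex_unit_point:
  obtains e0 where "is_mor k Spt (XO Gt) e0" "sh e0 Gt t = \<one>\<^bsub>k\<^esub>"
proof -
  interpret O: kcurve k "{}" "\<lambda>_ _. 0" k "\<lambda>c. c" by (rule kcurve_point[OF K.field_axioms inf])
  note G = kcurve_XO[OF Gt(1,2)]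
  interpret G: kcurve F "Gt - {\<zero>\<^bsub>F\<^esub>}" ord k i by (rule G(1))
  have Gi: "insert \<zero>\<^bsub>F\<^esub> (Gt - {\<zero>\<^bsub>F\<^esub>}) = Gt" by (rule insert_Diff[OF zero_mem_opn[OF Gt(1,2)]])
  let ?B = "F\<lparr>carrier := reg F ord Cl\<rparr>" and ?G = "reg_ring F ord Gt"
  have regk: "k\<lparr>carrier := reg k (\<lambda>_ _. 0) {}\<rparr> = k" by (simp add: reg_def)
  have id: "(\<lambda>c. c) \<in> ring_hom k k" by (simp add: ring_hom_def)
  obtain \<psi> where \<psi>: "\<psi> \<in> ring_hom ?B k" "\<And>c. c \<in> carrier k \<Longrightarrow> \<psi> (i c) = c" "\<psi> t = \<one>\<^bsub>k\<^esub>"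
    by (rule eval_hom[OF K.is_cring id K.one_closed]) (rule that)
  have L: "is_localization ?B t ?G (\<lambda>x. x)"
    using localization_curve[OF t_reg] unfolding Gt(3)[symmetric] if_not_P[OF Gt(2)] .
  have cr: "cring ?B" "cring ?G" using domain.axioms(1)[OF reg_domain] reg_ring_cring[of Gt] by auto
  obtain \<psi>' where \<psi>': "\<psi>' \<in> ring_hom ?G k" "\<And>a. a \<in> carrier ?B \<Longrightarrow> \<psi>' a = \<psi> a"
    by (rule localization_extend[OF L cr K.is_cring \<psi>(1)]) (use t_reg \<psi>(3) in \<open>simp_all add: that\<close>)
  have h: "\<psi>' \<in> ring_hom (sec G.X (insert \<zero>\<^bsub>F\<^esub> (Gt - {\<zero>\<^bsub>F\<^esub>}))) (k\<lparr>carrier := reg k (\<lambda>_ _. 0) {}\<rparr>)"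
    unfolding Gi regk using \<psi>'(1) by simp
  have st: "\<psi>' (res G.X (pts G.X) (insert \<zero>\<^bsub>F\<^esub> (Gt - {\<zero>\<^bsub>F\<^esub>})) (str G.X c)) = c" if "c \<in> carrier k" for c
    using \<psi>'(2)[OF ring_hom_closed[OF i_hom that]] \<psi>(2)[OF that] by simp
  obtain e0 where e0: "is_mor k O.X G.X e0"
    "\<And>b. b \<in> carrier (sec G.X (insert \<zero>\<^bsub>F\<^esub> (Gt - {\<zero>\<^bsub>F\<^esub>}))) \<Longrightarrow> sh e0 (insert \<zero>\<^bsub>F\<^esub> (Gt - {\<zero>\<^bsub>F\<^esub>})) b = \<psi>' b"
    by (rule O.ex_mor[OF G.ringed_chart_X h G.str_X st]) (assumption, rule that)
  have "t \<in> carrier (sec G.X Gt)" using t_reg reg_mono[of Gt pt_set] Gt(2) by (auto simp: carrier_reg_ring)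
  then have "sh e0 Gt t = \<one>\<^bsub>k\<^esub>" using e0(2)[of t] \<psi>'(2)[of t] \<psi>(3) t_reg unfolding Gi by simp
  then show ?thesis using e0(1) G(2) by (intro that[of e0]) simp_all
qed

text \<open>A section over the affine line is constant, hence determined by its value at the point \<open>t = 1\<close>.\<close>

lemma extended_symbol_trivial:
  assumes M: "ab_sheaf k M" and A1: "strongly_A1_invariant k M" and \<sigma>: "pointed_map k Gm M \<sigma>"
    and c: "c \<in> carrier (grp M X)" "pull M X (XO Gt) (incl X Gt) c = \<sigma> (XO Gt) t"
    and u: "t \<in> Units (reg_ring F ord Gt)"
  shows "\<sigma> (XO Gt) t = \<one>\<^bsub>grp M (XO Gt)\<^esub>"
proof -
  interpret O: kcurve k "{}" "\<lambda>_ _. 0" k "\<lambda>c. c" by (rule kcurve_point[OF K.field_axioms inf])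
  note Ms = ab_sheafD[OF M] and SG = Sm_XO[OF Gt(1,2)]
  interpret MS: comm_group "grp M O.X" by (rule Ms(1)[OF O.Sm_X])
  interpret MX: comm_group "grp M X" by (rule Ms(1)[OF Sm_X])
  interpret MG: comm_group "grp M (XO Gt)" by (rule Ms(1)[OF SG])
  obtain q where q: "is_mor k X O.X q" using ex_mor_to_point .
  obtain e0 where e0: "is_mor k O.X (XO Gt) e0" "sh e0 Gt t = \<one>\<^bsub>k\<^esub>" using ex_unit_point .
  have "pull M O.X X q \<in> iso (grp M O.X) (grp M X)"
    using A1 O.Sm_X is_affine_line_X is_product_point[OF q] unfolding strongly_A1_invariant_def by blast
  then obtain c0 where c0: "c0 \<in> carrier (grp M O.X)" "c = pull M O.X X q c0"
    using c(1) by (auto simp: iso_def bij_betw_def)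
  have I: "is_mor k (XO Gt) X (incl X Gt)" by (rule is_mor_incl_X[OF Gt(1)])
  define w where "w = mor_comp O.X (XO Gt) X (incl X Gt) e0"
  have w: "is_mor k O.X X w"
    unfolding w_def by (rule is_mor_comp[OF O.ringed_space_curve SmD(1)[OF SG] ringed_space_curve e0(1) I str_X])
  \<comment> \<open>The point has only one endomorphism, so the rational point \<open>w\<close> is a
    section of the structure morphism, and pulling back along \<open>w\<close> recovers
    \<open>c0\<close> from \<open>c\<close>.\<close>
  have "mor_comp O.X X O.X q w = mor_id O.X"
    by (rule mor_to_point_unique[OF O.ringed_space_curve
          is_mor_comp[OF O.ringed_space_curve ringed_space_curve O.ringed_space_curve w q O.str_X]
          is_mor_id[OF O.ringed_space_curve O.str_X]])
  then have "c0 = pull M X O.X w c"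
    using Ms(3)[OF O.Sm_X c0(1)] Ms(4)[OF O.Sm_X Sm_X O.Sm_X q w c0(1)] c0(2) by simp
  also have "\<dots> = pull M (XO Gt) O.X e0 (\<sigma> (XO Gt) t)"
    unfolding w_def using Ms(4)[OF Sm_X SG O.Sm_X I e0(1) c(1)] c(2) by simp
  also have "\<dots> = \<sigma> O.X (sh e0 (pts (XO Gt)) t)"
    by (rule symbolD(3)[OF \<sigma> SG O.Sm_X e0(1), symmetric]) (use u glob_XO[OF Gt(1)] in simp)
  also have "sh e0 (pts (XO Gt)) t = \<one>\<^bsub>glob O.X\<^esub>" using e0(2) pts_open_sub[OF Gt(1)] by simp
  also have "\<sigma> O.X \<one>\<^bsub>glob O.X\<^esub> = \<one>\<^bsub>grp M O.X\<^esub>"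
    by (rule symbolD(2)[OF \<sigma> O.Sm_X])
  finally have "c = \<one>\<^bsub>grp M X\<^esub>"
    using hom_one[OF Ms(2)[OF O.Sm_X Sm_X q] MS.is_group MX.is_group] c0(2) by simp
  then show ?thesis using hom_one[OF Ms(2)[OF Sm_X SG I] MX.is_group MG.is_group] c(2) by simp
qed

end

section \<open>The relation near the generic point and its extension across t = 0\<close>

context affine_line
begin

lemma const_unit:
  assumes "c \<in> carrier k" "c \<noteq> \<zero>\<^bsub>k\<^esub>" "U \<subseteq> pt_set" "U \<noteq> {}"
  shows "i c \<in> Units (reg_ring F ord U)"
  unfolding Units_reg[OF assms(3,4)] using ord_const[OF assms(1,2)] assms(3) points_Cl(1) by blast

lemma one_minus_t_unit: "U \<subseteq> pt_set - {p1} \<Longrightarrow> U \<noteq> {} \<Longrightarrow> \<one>\<^bsub>F\<^esub> \<ominus>\<^bsub>F\<^esub> t \<in> Units (reg_ring F ord U)"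
proof -
  assume U: "U \<subseteq> pt_set - {p1}" "U \<noteq> {}"
  then have "U \<subseteq> pt_set" "\<forall>p\<in>U - {\<zero>\<^bsub>F\<^esub>}. p \<in> Cl \<and> p \<noteq> p1" by blast+
  then show ?thesis using Units_reg[OF _ U(2)] t_nz(2) ord_t(2) by simp
qed

lemma t_unit: "U \<subseteq> Gt \<Longrightarrow> U \<noteq> {} \<Longrightarrow> t \<in> Units (reg_ring F ord U)"
proof -
  assume U: "U \<subseteq> Gt" "U \<noteq> {}"
  then have "U \<subseteq> pt_set" "\<forall>p\<in>U - {\<zero>\<^bsub>F\<^esub>}. p \<in> Cl \<and> p \<noteq> p0" by blast+
  then show ?thesis using Units_reg[OF _ U(2)] t_nz(1) ord_t(1) by simp
qed

text \<open>As \<open>1 - 2 = -1\<close>, these constants form one of the sums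
  \<open>{x} + {1 - x}\<close>. If 2 is not 0 in \<open>k\<close>, both are units on every nonempty
  open set, so their symbols extend everywhere.\<close>

abbreviation "two \<equiv> i (\<one>\<^bsub>k\<^esub> \<oplus>\<^bsub>k\<^esub> \<one>\<^bsub>k\<^esub>)"
abbreviation "mone \<equiv> i (\<ominus>\<^bsub>k\<^esub> \<one>\<^bsub>k\<^esub>)"

text \<open>The reflection identity for \<open>t\<close> and 2 holds in the pre-Bloch group of
  \<open>F\<close>; \<alpha> transports it to the colimit, where equality means equality on some
  open \<open>D\<close>. With the points 0 and 1 removed all four arguments are units, so that the
  symbols are defined on one common curve.\<close>

lemma generic_relation:
  assumes M: "ab_sheaf k M" and rec: "recovers k M pre_bloch \<alpha>" and \<sigma>: "pointed_map k Gm M \<sigma>"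
    and sym: "\<forall>F i X \<epsilon> z. fin_trdeg_ext k F i \<and> field_model k F i X \<epsilon> \<and> z \<in> Units (glob X) \<longrightarrow>
       eval_class k M F i X \<epsilon> (\<sigma> X z) = \<alpha> F i (bloch_symbol F (\<epsilon> (pts X) z))"
    and two: "\<one>\<^bsub>k\<^esub> \<oplus>\<^bsub>k\<^esub> \<one>\<^bsub>k\<^esub> \<noteq> \<zero>\<^bsub>k\<^esub>"
  obtains D where "opn X D" "D \<noteq> {}" "D \<subseteq> pt_set - {p0, p1}"
    "\<sigma> (XO D) t \<otimes>\<^bsub>grp M (XO D)\<^esub> \<sigma> (XO D) (\<one>\<^bsub>F\<^esub> \<ominus>\<^bsub>F\<^esub> t) =
     \<sigma> (XO D) two \<otimes>\<^bsub>grp M (XO D)\<^esub> \<sigma> (XO D) mone"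
proof -
  interpret B: bloch_field F by unfold_locales
  note Ms = ab_sheafD[OF M]
  let ?U = "pt_set - {p0, p1}"
  have "finite (Cl - ?U)" by (rule finite_subset[of _ "{p0, p1}"]) auto
  moreover have "\<zero>\<^bsub>F\<^esub> \<in> ?U" using points_Cl zero_notin_Cl by auto
  ultimately have U: "opn X ?U" "?U \<noteq> {}" unfolding opn_curve by auto
  note VV = kcurve_XO[OF U]
  interpret V: kcurve F "?U - {\<zero>\<^bsub>F\<^esub>}" ord k i by (rule VV(1))
  have mo: "\<ominus>\<^bsub>k\<^esub> \<one>\<^bsub>k\<^esub> \<in> carrier k" "\<ominus>\<^bsub>k\<^esub> \<one>\<^bsub>k\<^esub> \<noteq> \<zero>\<^bsub>k\<^esub>"
    using K.one_not_zero by (metis K.a_inv_closed K.minus_minus K.minus_zero K.one_closed)+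
  have un: "t \<in> Units (reg_ring F ord W)" "\<one>\<^bsub>F\<^esub> \<ominus>\<^bsub>F\<^esub> t \<in> Units (reg_ring F ord W)"
    "two \<in> Units (reg_ring F ord W)" "mone \<in> Units (reg_ring F ord W)" if "W \<subseteq> ?U" "W \<noteq> {}" for W
    using that t_unit[of W] one_minus_t_unit[of W] const_unit[OF _ two, of W] const_unit[OF mo, of W] by auto
  interpret I: ring_hom_ring k F i
    by (rule ring_hom_ringI2[OF K.ring_axioms F.ring_axioms])
      (use i_hom reg_subset[of Cl] in \<open>auto simp: ring_hom_def\<close>)
  have eqs: "mone = \<one>\<^bsub>F\<^esub> \<ominus>\<^bsub>F\<^esub> two"
    by (simp add: F.minus_eq F.minus_add) (simp add: F.a_assoc[symmetric] F.r_neg)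
  have ne: "t \<noteq> two" "t \<in> Units F - {\<one>\<^bsub>F\<^esub>}" "two \<in> Units F - {\<one>\<^bsub>F\<^esub>}"
  proof -
    \<comment> \<open>\<open>t\<close> has order 1 at \<open>p0\<close>, whereas a nonzero constant
      has order 0.\<close>
    show "t \<noteq> two" using ord_t(1)[OF points_Cl(1)] ord_const(2)[OF _ two points_Cl(1)] by auto
    have "t \<noteq> \<one>\<^bsub>F\<^esub>" using ord_t(1)[OF points_Cl(1)] ord_one[OF points_Cl(1)] by auto
    then show "t \<in> Units F - {\<one>\<^bsub>F\<^esub>}" using t_nz(1) F.field_Units by auto
    have "mone \<noteq> \<zero>\<^bsub>F\<^esub>" using ord_const(1)[OF mo points_Cl(1)] by simp
    then have "two \<noteq> \<one>\<^bsub>F\<^esub>" unfolding eqs by (metis F.minus_eq F.one_closed F.r_neg)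
    then show "two \<in> Units F - {\<one>\<^bsub>F\<^esub>}" using ord_const(1)[OF _ two points_Cl(1)] F.field_Units by simp
  qed
  have U': "?U \<subseteq> ?U" by simp
  have ev: "eval_class k M F i V.X (\<lambda>_ s. s) (\<sigma> V.X z) = \<alpha> F i (bloch_symbol F z)"
    if "z \<in> Units (reg_ring F ord ?U)" for z
  proof -
    have "z \<in> Units (glob V.X)" using that glob_XO[OF U(1)] VV(2) by simp
    then show ?thesis using sym fin_trdeg_line V.field_model_X by blast
  qed
  have \<alpha>: "\<alpha> F i \<in> hom (fobj pre_bloch F) (eval_fld k M F i)"
    using rec fin_trdeg_line unfolding recovers_def iso_def by blast
  have bc: "bloch_symbol F z \<in> carrier (fobj pre_bloch F)" if "z \<in> Units (reg_ring F ord ?U)" for z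
    using that Units_reg[OF _ U(2)] F.field_Units by (intro B.bloch_symbol_closed) auto
  define s where "s j = \<sigma> V.X (if j = 1 then t else if j = 2 then \<one>\<^bsub>F\<^esub> \<ominus>\<^bsub>F\<^esub> t else if j = 3 then two else mone)" for j :: nat
  note u = un[OF U' U(2)]
  have sc: "s j \<in> carrier (grp M V.X)" if "j \<in> {1, 2, 3, 4}" for j
    unfolding s_def VV(2)[symmetric] by (rule symbol_closed[OF \<sigma> U]) (use u in simp)
  have E: "eval_class k M F i V.X (\<lambda>_ s. s) (s 1) \<otimes>\<^bsub>eval_fld k M F i\<^esub> eval_class k M F i V.X (\<lambda>_ s. s) (s 2) =
      eval_class k M F i V.X (\<lambda>_ s. s) (s 3) \<otimes>\<^bsub>eval_fld k M F i\<^esub> eval_class k M F i V.X (\<lambda>_ s. s) (s 4)"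
    using hom_mult[OF \<alpha> bc[OF u(1)] bc[OF u(2)]] hom_mult[OF \<alpha> bc[OF u(3)] bc[OF u(4)]]
      ev[OF u(1)] ev[OF u(2)] ev[OF u(3)] ev[OF u(4)] B.bloch_reflection[OF ne(2,3,1)]
    unfolding eqs[symmetric] by (simp add: s_def)
  obtain D where D: "opn V.X D" "D \<noteq> {}"
    "pull M V.X (V.XO D) (incl V.X D) (s 1 \<otimes>\<^bsub>grp M V.X\<^esub> s 2) = pull M V.X (V.XO D) (incl V.X D) (s 3 \<otimes>\<^bsub>grp M V.X\<^esub> s 4)"
    by (rule V.eval_mult_eq[where s = s, OF M _ E]) (rule sc, assumption, rule that)
  have oD: "opn X D" "D \<subseteq> ?U" using D(1) opn_open_sub[OF U(1)] VV(2) by auto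
  have eX: "V.XO D = XO D" using XO_XO[OF U(1) oD] VV(2) by simp
  have h: "pull M V.X (XO D) (incl V.X D) \<in> hom (grp M V.X) (grp M (XO D))"
    using Ms(2)[OF V.Sm_X V.Sm_XO[OF D(1,2)] V.is_mor_incl_X[OF D(1)]] eX by simp
  have r: "pull M V.X (XO D) (incl V.X D) (\<sigma> V.X z) = \<sigma> (XO D) z" if "z \<in> Units (reg_ring F ord ?U)" for z
    using symbol_restrict[OF \<sigma> U oD(1) D(2) oD(2) that] VV(2) by simp
  have "\<sigma> (XO D) t \<otimes>\<^bsub>grp M (XO D)\<^esub> \<sigma> (XO D) (\<one>\<^bsub>F\<^esub> \<ominus>\<^bsub>F\<^esub> t) = \<sigma> (XO D) two \<otimes>\<^bsub>grp M (XO D)\<^esub> \<sigma> (XO D) mone"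
    using D(3) hom_mult[OF h sc[of 1] sc[of 2]] hom_mult[OF h sc[of 3] sc[of 4]]
      r[OF u(1)] r[OF u(2)] r[OF u(3)] r[OF u(4)] eX by (simp add: s_def)
  then show ?thesis by (rule that[OF oD(1) D(2) oD(2)])
qed

text \<open>Solved for the symbol of \<open>t\<close>, the relation expresses it by symbols of
  \<open>1 - t\<close> and of constants, which are units at \<open>t = 0\<close> too. The expression
  is thus a section on \<open>D\<close> with \<open>p0\<close> added, ready to be glued with the
  symbol of \<open>t\<close> on \<open>Gt\<close>.\<close>

lemma symbol_extends:
  assumes M: "ab_sheaf k M" and \<sigma>: "pointed_map k Gm M \<sigma>"
    and two: "\<one>\<^bsub>k\<^esub> \<oplus>\<^bsub>k\<^esub> \<one>\<^bsub>k\<^esub> \<noteq> \<zero>\<^bsub>k\<^esub>"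
    and D: "opn X D" "D \<noteq> {}" "D \<subseteq> pt_set - {p0, p1}"
    and eq: "\<sigma> (XO D) t \<otimes>\<^bsub>grp M (XO D)\<^esub> \<sigma> (XO D) (\<one>\<^bsub>F\<^esub> \<ominus>\<^bsub>F\<^esub> t) =
     \<sigma> (XO D) two \<otimes>\<^bsub>grp M (XO D)\<^esub> \<sigma> (XO D) mone"
  obtains c where "c \<in> carrier (grp M X)" "pull M X (XO Gt) (incl X Gt) c = \<sigma> (XO Gt) t"
proof -
  let ?W = "insert p0 D"
  note Ms = ab_sheafD[OF M]
  have W: "opn X ?W" "?W \<noteq> {}" "D \<subseteq> ?W"
    using D(1,2) points_Cl(1) unfolding opn_curve by (auto intro: finite_subset[of _ "Cl - D"])
  have W1: "?W \<subseteq> pt_set - {p1}" "?W \<subseteq> pt_set" using D(3) points_Cl(1) p0_ne_p1 by auto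
  have mo: "\<ominus>\<^bsub>k\<^esub> \<one>\<^bsub>k\<^esub> \<in> carrier k" "\<ominus>\<^bsub>k\<^esub> \<one>\<^bsub>k\<^esub> \<noteq> \<zero>\<^bsub>k\<^esub>"
    using K.one_not_zero by (metis K.a_inv_closed K.minus_minus K.minus_zero K.one_closed)+
  have u: "\<one>\<^bsub>F\<^esub> \<ominus>\<^bsub>F\<^esub> t \<in> Units (reg_ring F ord ?W)" "two \<in> Units (reg_ring F ord ?W)" "mone \<in> Units (reg_ring F ord ?W)"
    using one_minus_t_unit[OF W1(1) W(2)] const_unit[OF _ two W1(2) W(2)] const_unit[OF mo W1(2) W(2)] by simp_all
  note tG = t_unit[OF subset_refl Gt(2)]
  interpret MW: comm_group "grp M (XO ?W)" by (rule Ms(1)[OF Sm_XO[OF W(1,2)]])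
  interpret MD: comm_group "grp M (XO D)" by (rule Ms(1)[OF Sm_XO[OF D(1,2)]])
  define b where "b = \<sigma> (XO ?W) two \<otimes>\<^bsub>grp M (XO ?W)\<^esub> \<sigma> (XO ?W) mone \<otimes>\<^bsub>grp M (XO ?W)\<^esub> inv\<^bsub>grp M (XO ?W)\<^esub> \<sigma> (XO ?W) (\<one>\<^bsub>F\<^esub> \<ominus>\<^bsub>F\<^esub> t)"
  note sW = symbol_closed[OF \<sigma> W(1,2) u(1)] symbol_closed[OF \<sigma> W(1,2) u(2)] symbol_closed[OF \<sigma> W(1,2) u(3)]
  \<comment> \<open>\<open>D\<close> omits \<open>p0\<close>, so the intersection is
    \<open>D\<close>; a point outside \<open>D\<close> other than \<open>p0\<close> belongs to
    \<open>Gt\<close>, so the union is the line.\<close>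
  have DG: "D \<subseteq> Gt" and GW: "Gt \<inter> ?W = D" and ne: "Gt \<noteq> ?W" and cov: "Gt \<union> ?W = pt_set"
    using D(3) points_Cl(1) by auto
  have uD: "t \<in> Units (reg_ring F ord D)" "\<one>\<^bsub>F\<^esub> \<ominus>\<^bsub>F\<^esub> t \<in> Units (reg_ring F ord D)"
    using t_unit[OF DG D(2)] one_minus_t_unit[of D] D(2,3) by auto
  note sD = symbol_closed[OF \<sigma> D(1,2) uD(1)] symbol_closed[OF \<sigma> D(1,2) uD(2)]
  have h: "group_hom (grp M (XO ?W)) (grp M (XO D)) (pull M (XO ?W) (XO D) (incl (XO ?W) D))"
    using Ms(2)[OF Sm_XO[OF W(1,2)] Sm_XO[OF D(1,2)] incl_incl(1)[OF W(1,2) D(1,2) W(3)]]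
    by (intro group_hom.intro group_hom_axioms.intro MW.is_group MD.is_group)
  then interpret h: group_hom "grp M (XO ?W)" "grp M (XO D)" "pull M (XO ?W) (XO D) (incl (XO ?W) D)" .
  have "pull M (XO ?W) (XO D) (incl (XO ?W) D) b =
      \<sigma> (XO D) two \<otimes>\<^bsub>grp M (XO D)\<^esub> \<sigma> (XO D) mone \<otimes>\<^bsub>grp M (XO D)\<^esub> inv\<^bsub>grp M (XO D)\<^esub> \<sigma> (XO D) (\<one>\<^bsub>F\<^esub> \<ominus>\<^bsub>F\<^esub> t)"
    unfolding b_def
    using symbol_restrict[OF \<sigma> W(1,2) D(1,2) W(3) u(1)] symbol_restrict[OF \<sigma> W(1,2) D(1,2) W(3) u(2)]
      symbol_restrict[OF \<sigma> W(1,2) D(1,2) W(3) u(3)] sW by (simp add: h.hom_inv)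
  also have "\<dots> = \<sigma> (XO D) t" unfolding eq[symmetric] using sD by (simp add: MD.m_assoc)
  also have "\<dots> = pull M (XO Gt) (XO D) (incl (XO Gt) D) (\<sigma> (XO Gt) t)"
    by (rule symbol_restrict[OF \<sigma> Gt(1,2) D(1,2) DG tG, symmetric])
  finally have agree: "pull M (XO Gt) (XO (Gt \<inter> ?W)) (incl (XO Gt) (Gt \<inter> ?W)) (\<sigma> (XO Gt) t) =
      pull M (XO ?W) (XO (Gt \<inter> ?W)) (incl (XO ?W) (Gt \<inter> ?W)) b" unfolding GW by (rule sym)
  have bc: "b \<in> carrier (grp M (XO ?W))" unfolding b_def using sW by simp
  show ?thesis
    by (rule zariski_gluing[OF M Gt(1,2) W(1,2) cov ne symbol_closed[OF \<sigma> Gt(1,2) tG] bc agree]) (rule that)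
qed

text \<open>The symbols of \<open>t\<close> and of 1 coincide on \<open>Gt\<close>, so by
  injectivity of \<alpha> the classes of \<open>t\<close> and of 1 in the pre-Bloch group coincide,
  which the orders at 0 and 1 exclude.\<close>

lemma no_symbol:
  assumes M: "ab_sheaf k M" and A1: "strongly_A1_invariant k M" and rec: "recovers k M pre_bloch \<alpha>"
    and \<sigma>: "pointed_map k Gm M \<sigma>"
    and sym: "\<forall>F i X \<epsilon> z. fin_trdeg_ext k F i \<and> field_model k F i X \<epsilon> \<and> z \<in> Units (glob X) \<longrightarrow>
       eval_class k M F i X \<epsilon> (\<sigma> X z) = \<alpha> F i (bloch_symbol F (\<epsilon> (pts X) z))"
    and two: "\<one>\<^bsub>k\<^esub> \<oplus>\<^bsub>k\<^esub> \<one>\<^bsub>k\<^esub> \<noteq> \<zero>\<^bsub>k\<^esub>"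
  shows False
proof -
  interpret B: bloch_field F by unfold_locales
  obtain D where D: "opn X D" "D \<noteq> {}" "D \<subseteq> pt_set - {p0, p1}"
    "\<sigma> (XO D) t \<otimes>\<^bsub>grp M (XO D)\<^esub> \<sigma> (XO D) (\<one>\<^bsub>F\<^esub> \<ominus>\<^bsub>F\<^esub> t) =
     \<sigma> (XO D) two \<otimes>\<^bsub>grp M (XO D)\<^esub> \<sigma> (XO D) mone"
    by (rule generic_relation[OF M rec \<sigma> sym two])
  obtain c where c: "c \<in> carrier (grp M X)" "pull M X (XO Gt) (incl X Gt) c = \<sigma> (XO Gt) t"
    by (rule symbol_extends[OF M \<sigma> two D])
  note tG = t_unit[OF subset_refl Gt(2)]
  have "\<sigma> (XO Gt) t = \<one>\<^bsub>grp M (XO Gt)\<^esub>" by (rule extended_symbol_trivial[OF M A1 \<sigma> c tG])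
  also have "\<dots> = \<sigma> (XO Gt) \<one>\<^bsub>glob (XO Gt)\<^esub>" by (rule symbolD(2)[OF \<sigma> Sm_XO[OF Gt(1,2)], symmetric])
  also have "\<one>\<^bsub>glob (XO Gt)\<^esub> = \<one>\<^bsub>F\<^esub>" unfolding glob_XO[OF Gt(1)] reg_ring_ne[OF Gt(2)] by simp
  finally have eq: "\<sigma> (XO Gt) t = \<sigma> (XO Gt) \<one>\<^bsub>F\<^esub>" .
  interpret G: kcurve F "Gt - {\<zero>\<^bsub>F\<^esub>}" ord k i by (rule kcurve_XO(1)[OF Gt(1,2)])
  have model: "field_model k F i (XO Gt) (\<lambda>_ s. s)" using G.field_model_X kcurve_XO(2)[OF Gt(1,2)] by simp
  have ev: "eval_class k M F i (XO Gt) (\<lambda>_ s. s) (\<sigma> (XO Gt) z) = \<alpha> F i (bloch_symbol F z)"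
    if "z \<in> Units (reg_ring F ord Gt)" for z
    using sym fin_trdeg_line model that unfolding glob_XO[OF Gt(1), symmetric] by blast
  have "\<one>\<^bsub>F\<^esub> \<in> Units (reg_ring F ord Gt)" using Units_reg[of Gt] Gt(2) ord_one by auto
  then have "\<alpha> F i (bloch_symbol F t) = \<alpha> F i (bloch_symbol F \<one>\<^bsub>F\<^esub>)" using ev[OF tG] ev eq by metis
  moreover have "inj_on (\<alpha> F i) (carrier (fobj pre_bloch F))"
    using rec fin_trdeg_line unfolding recovers_def iso_def bij_betw_def by blast
  moreover have "t \<in> Units F" "\<one>\<^bsub>F\<^esub> \<in> Units F" using t_nz(1) F.field_Units by simp_all
  ultimately have "bloch_symbol F t = bloch_symbol F \<one>\<^bsub>F\<^esub>"
    using B.bloch_symbol_closed by (metis inj_onD)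
  then show False using symbol_t_nontrivial by blast
qed

end

text \<open>The natural multiples of 1 are pairwise different, as the difference of two of them is a
  positive multiple.\<close>

lemma char_zero_infinite:
  fixes k :: "'u ring"
  assumes "field k" "char_zero k"
  shows "infinite (UNIV :: 'u set)"
proof -
  interpret K: field k by fact
  have "inj (\<lambda>n::nat. add_pow k n \<one>\<^bsub>k\<^esub>)"
  proof (rule linorder_injI)
    fix m n :: nat assume "m < n"
    then obtain d where d: "n = m + d" "0 < d" using less_imp_add_positive by blast
    have "add_pow k n \<one>\<^bsub>k\<^esub> = add_pow k m \<one>\<^bsub>k\<^esub> \<oplus>\<^bsub>k\<^esub> add_pow k d \<one>\<^bsub>k\<^esub>"
      unfolding d(1) by (rule K.add.nat_pow_mult[symmetric]) simp
    moreover have "add_pow k d \<one>\<^bsub>k\<^esub> \<noteq> \<zero>\<^bsub>k\<^esub>" using assms(2) d(2) by (simp add: char_zero_def)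
    moreover have c: "add_pow k m \<one>\<^bsub>k\<^esub> \<in> carrier k" "add_pow k d \<one>\<^bsub>k\<^esub> \<in> carrier k" by simp_all
    ultimately show "add_pow k m \<one>\<^bsub>k\<^esub> \<noteq> add_pow k n \<one>\<^bsub>k\<^esub>"
      using K.add.l_cancel[OF _ c(2) K.zero_closed c(1)] K.r_zero[OF c(1)] by metis
  qed
  then show ?thesis by (rule infinite_super[OF subset_UNIV range_inj_infinite])
qed

theorem theorem1p1:
  fixes k :: "'u ring"
  assumes "perfect_field k" and "char_zero k"
  shows "\<not> (\<exists>(P :: ('u, 'a) ab_psh) (A :: ('u, 'b) ab_psh) \<alpha> \<beta> \<sigma> \<tau>.
    ab_sheaf k P \<and> ab_sheaf k A \<and>
    strongly_A1_invariant k P \<and> strongly_A1_invariant k A \<and>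
    recovers k P pre_bloch \<alpha> \<and> recovers k A wedge2 \<beta> \<and>
    pointed_map k Gm P \<sigma> \<and> pointed_map k (Gm_smash 2) A \<tau> \<and>
    (\<forall>F i X \<epsilon> z. fin_trdeg_ext k F i \<and> field_model k F i X \<epsilon> \<and> z \<in> Units (glob X) \<longrightarrow>
       eval_class k P F i X \<epsilon> (\<sigma> X z) = \<alpha> F i (bloch_symbol F (\<epsilon> (pts X) z))) \<and>
    (\<forall>F i X \<epsilon> x y. fin_trdeg_ext k F i \<and> field_model k F i X \<epsilon> \<and>
       x \<in> Units (glob X) \<and> y \<in> Units (glob X) \<longrightarrow>
       eval_class k A F i X \<epsilon> (\<tau> X (smash_symbol X [x, y])) =
         \<beta> F i (wedge_symbol F (\<epsilon> (pts X) x) (\<epsilon> (pts X) y))))"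
proof -
  have k: "field k" using assms(1) by (simp add: perfect_field_def)
  interpret K: field k by (rule k)
  \<comment> \<open>The case \<open>n = 2\<close> of characteristic zero, which makes the constant 2
    a unit.\<close>
  have "add_pow k (Suc (Suc 0)) \<one>\<^bsub>k\<^esub> \<noteq> \<zero>\<^bsub>k\<^esub>" using assms(2) unfolding char_zero_def by blast
  then have two: "\<one>\<^bsub>k\<^esub> \<oplus>\<^bsub>k\<^esub> \<one>\<^bsub>k\<^esub> \<noteq> \<zero>\<^bsub>k\<^esub>" by (simp add: add_pow_def)
  obtain F e where "affine_line k F e" using ex_affine_line[OF k char_zero_infinite[OF k assms(2)]] .
  then interpret L: affine_line k F e .
  show ?thesis
    by (intro notI; elim exE conjE) (rule L.no_symbol[OF _ _ _ _ _ two]; assumption)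
qed

end
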